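(* Let $F_j$, $1\le j\le n$, be Bernstein functions and define $$F(z)=F_1(z^{\alpha_1})^{\beta_1}\cdots F_n(z^{\alpha_n})^{\beta_n},\qquad z\in\mathbb{C}_+,$$ where $0<\alpha_j\le1$, $0<\beta_j\le1$ and $\sum_{j=1}^n\alpha_j\beta_j\le1$. Let $A$ be a sectorial operator of angle $\omega$ on a complex Banach space, and assume that $A$ has dense range. 1. If $\omega\in[0,\pi/2)$, so that $-A$ generates a sectorially bounded holomorphic $C_0$-semigroup of angle $\pi/2-\omega$, then $-F(A)$ also generates a sectorially bounded holomorphic $C_0$-semigroup of angle $\pi/2-\omega$. 2. If $\alpha\in(1/2,1)$, $\omega\in(0,\pi/(2\alpha))$ and $G(z)=F(z^\alpha)$ for $z\in\Sigma_{\pi/(2\alpha)}$, then $-G(A)$ is the generator of a sectorially bounded holomorphic $C_0$-semigroup of angle $\pi/2-\alpha\omega$.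
   Context: $\mathbb{C}_+=\{\lambda\in\mathbb{C}:\operatorname{Re}\lambda>0\}$; $\Sigma_\theta=\{z\in\mathbb{C}: z\ne0,\ |\arg z|<\theta\}$ for $\theta\in(0,\pi]$ and $\Sigma_0=(0,\infty)$. Powers are principal branches. A Bernstein function is a smooth $f:(0,\infty)\to(0,\infty)$ with $(-1)^{n-1}f^{(n)}(t)\ge0$ for all $t>0$, $n\ge1$; equivalently $f(t)=a+bt+\int_{(0,\infty)}(1-e^{-ts})\,\mu(ds)$ (and $f\not\equiv0$) with $a,b\ge0$ and $\mu$ a positive measure on $(0,\infty)$ with $\int\frac{s}{1+s}\mu(ds)<\infty$. It is identified with its holomorphic extension $\mathbb{C}_+\to\mathbb{C}_+$ given by this formula. A linear operator $A$ on a complex Banach space $X$ is sectorial of angle $\omega\in[0,\pi)$ if it is closed and densely defined, $\sigma(A)\subset\overline{\Sigma}_\omega$, and for every $\omega'\in(\omega,\pi)$ one has $\sup_{z\in\Sigma_{\pi-\omega'}}\|z(A+z)^{-1}\|<\infty$. A sectorial operator with dense range is injective. A $C_0$-semigroup is a sectorially bounded holomorphic semigroup of angle $\theta\in(0,\pi/2]$ if it has a holomorphic extension $T$ to $\Sigma_\theta$ which is bounded in norm on $\Sigma_{\theta'}$ for every $\theta'\in(0,\theta)$. Holomorphic functional calculus: let $A$ be an injective sectorial operator of angle $\omega$, and let $f$ be holomorphic on $\Sigma_\theta$ for some $\theta\in(\omega,\pi]$, with $|f(z)|\le C_{\theta'}\max(|z|^k,|z|^{-k})$ on $\Sigma_{\theta'}$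 for some $k\geq 0$ and every $\theta'\in(\omega,\theta)$. Put $\tau(z)=z/(1+z)^2$. For an integer $n>k$ and $\omega'\in(\omega,\theta)$ let $(f\tau^n)(A)=\frac1{2\pi i}\int_{\partial\Sigma_{\omega'}}f(\lambda)\tau(\lambda)^n(\lambda-A)^{-1}\,d\lambda\in\mathcal{L}(X)$ (positively oriented boundary). The bounded operator $\tau^n(A)=(A(1+A)^{-2})^n$ is injective, and $f(A):=(\tau^n(A))^{-1}(f\tau^n)(A)$ with its natural domain; this is a closed operator independent of $n,\omega'$. *)

theory Defs
  imports "HOL-Analysis.Analysis"
begin

section \<open>Complex Banach spaces\<close>

class scaleC =
  fixes scaleC :: "complex \<Rightarrow> 'a \<Rightarrow> 'a" (infixr \<open>*\<^sub>C\<close> 75)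

class complex_normed_vector = real_normed_vector + scaleC +
  assumes scaleC_add_right: "c *\<^sub>C (x + y) = c *\<^sub>C x + c *\<^sub>C y"
    and scaleC_add_left: "(c + d) *\<^sub>C x = c *\<^sub>C x + d *\<^sub>C x"
    and scaleC_scaleC: "c *\<^sub>C d *\<^sub>C x = (c * d) *\<^sub>C x"
    and scaleC_of_real: "complex_of_real r *\<^sub>C x = r *\<^sub>R x"
    and norm_scaleC: "norm (c *\<^sub>C x) = cmod c * norm x"

class complex_banach = complex_normed_vector + banach

instantiation complex :: complex_banach
begin
definition "scaleC_complex (c :: complex) (x :: complex) = c * x"
instance
  by standard (auto simp: scaleC_complex_def algebra_simps scaleR_conv_of_real norm_mult)
end

lemma bounded_linear_scaleC: "bounded_linear (\<lambda>x :: 'a :: complex_normed_vector. c *\<^sub>C x)"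
proof (rule bounded_linear_intro[where K = "cmod c"])
  fix x :: 'a and r :: real
  show "c *\<^sub>C r *\<^sub>R x = r *\<^sub>R c *\<^sub>C x"
    by (simp add: scaleC_of_real[symmetric] scaleC_scaleC mult.commute)
qed (simp_all add: scaleC_add_right norm_scaleC mult.commute)

text \<open>
  The type \<open>'a \<Rightarrow>\<^sub>L 'b\<close> consists of the real-linear bounded operators. It is a complex normed space
  under pointwise multiplication, with \<open>\<L>(X)\<close> (see below) as a closed complex subspace.
\<close>

instantiation blinfun :: (real_normed_vector, complex_normed_vector) complex_normed_vector
begin

lift_definition scaleC_blinfun :: "complex \<Rightarrow> 'a \<Rightarrow>\<^sub>L 'b \<Rightarrow> 'a \<Rightarrow>\<^sub>L 'b" is "\<lambda>c T x. c *\<^sub>C T x"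
  by (rule bounded_linear_compose[OF bounded_linear_scaleC])

instance
proof
  fix c d :: complex and r :: real and S T :: "'a \<Rightarrow>\<^sub>L 'b"
  show "c *\<^sub>C (S + T) = c *\<^sub>C S + c *\<^sub>C T"
    by transfer (simp add: scaleC_add_right)
  show "(c + d) *\<^sub>C T = c *\<^sub>C T + d *\<^sub>C T"
    by transfer (simp add: scaleC_add_left)
  show "c *\<^sub>C d *\<^sub>C T = (c * d) *\<^sub>C T"
    by transfer (simp add: scaleC_scaleC)
  show "complex_of_real r *\<^sub>C T = r *\<^sub>R T"
    by transfer (simp add: scaleC_of_real)
  show "norm (c *\<^sub>C T) = cmod c * norm T"
  proof (rule antisym)
    have le: "norm (c' *\<^sub>C T') \<le> cmod c' * norm T'" for c' and T' :: "'a \<Rightarrow>\<^sub>L 'b"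
    proof (rule norm_blinfun_bound)
      fix x
      show "norm (blinfun_apply (c' *\<^sub>C T') x) \<le> cmod c' * norm T' * norm x"
        using mult_left_mono[OF norm_blinfun[of T' x], of "cmod c'"]
        by (simp add: scaleC_blinfun.rep_eq norm_scaleC mult.assoc)
    qed simp
    show "norm (c *\<^sub>C T) \<le> cmod c * norm T" by (rule le)
    show "cmod c * norm T \<le> norm (c *\<^sub>C T)"
    proof (cases "c = 0")
      case False
      have "inverse c *\<^sub>C c *\<^sub>C T = T"
      proof (rule blinfun_eqI)
        fix x
        show "blinfun_apply (inverse c *\<^sub>C c *\<^sub>C T) x = blinfun_apply T x"
          using False scaleC_of_real[of 1 "blinfun_apply T x"]
          by (simp add: scaleC_blinfun.rep_eq scaleC_scaleC)
      qed
      then have "norm T \<le> inverse (cmod c) * norm (c *\<^sub>C T)"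
        using le[of "inverse c" "c *\<^sub>C T"] by (simp add: norm_inverse)
      then show ?thesis using False by (simp add: field_simps)
    qed simp
  qed
qed

end


section \<open>Bounded and unbounded operators\<close>

text \<open>\<open>\<L>(X)\<close>: the bounded complex-linear operators on \<open>X\<close>.\<close>

definition bounded_ops :: "('a :: complex_banach \<Rightarrow>\<^sub>L 'a) set" where
  "bounded_ops = {T. \<forall>c x. blinfun_apply T (c *\<^sub>C x) = c *\<^sub>C blinfun_apply T x}"

text \<open>
  An operator with domain \<open>D(A) \<subseteq> X\<close> is represented by its graph \<open>{(x, A x) | x \<in> D(A)}\<close>. Hence
  \<^const>\<open>Domain\<close> and \<^const>\<open>Range\<close> are domain and range, \<open>A\<inverse>\<close> is the (graph of the) inverse,
  \<open>A O B\<close> is the composition ``first \<open>A\<close>, then \<open>B\<close>'' on its natural domain, \<open>A ^^ n\<close> is the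
  \<open>n\<close>-th power, and \<open>A\<close> is a closed operator iff \<open>A\<close> is a closed subset of \<open>X \<times> X\<close>.
\<close>

definition linear_operator :: "('a :: complex_banach) rel \<Rightarrow> bool" where
  "linear_operator A \<longleftrightarrow>
     single_valued A \<and> subspace A \<and> (\<forall>c x y. (x, y) \<in> A \<longrightarrow> (c *\<^sub>C x, c *\<^sub>C y) \<in> A)"

definition op_graph :: "('a :: complex_banach \<Rightarrow>\<^sub>L 'a) \<Rightarrow> 'a rel" where
  "op_graph T = {(x, blinfun_apply T x) | x. True}"

text \<open>The bounded operator with a given graph (if there is one).\<close>

definition bounded_op_of :: "('a :: complex_banach) rel \<Rightarrow> 'a \<Rightarrow>\<^sub>L 'a" where
  "bounded_op_of G = (THE T. op_graph T = G)"

text \<open>The operator \<open>a + b A\<close> with domain \<open>D(A)\<close>.\<close>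

definition affine_op :: "complex \<Rightarrow> complex \<Rightarrow> ('a :: complex_banach) rel \<Rightarrow> 'a rel" where
  "affine_op a b A = {(x, a *\<^sub>C x + b *\<^sub>C y) | x y. (x, y) \<in> A}"

definition resolvent_set :: "('a :: complex_banach) rel \<Rightarrow> complex set" where
  "resolvent_set A = {l. \<exists>R \<in> bounded_ops. (affine_op l (- 1) A)\<inverse> = op_graph R}"

definition resolvent :: "('a :: complex_banach) rel \<Rightarrow> complex \<Rightarrow> 'a \<Rightarrow>\<^sub>L 'a" where
  "resolvent A l = bounded_op_of ((affine_op l (- 1) A)\<inverse>)"

definition spectrum :: "('a :: complex_banach) rel \<Rightarrow> complex set" where
  "spectrum A = - resolvent_set A"


section \<open>Sectorial operators\<close>

definition sector :: "real \<Rightarrow> complex set" where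
  "sector \<theta> = (if \<theta> = 0 then of_real ` {0<..} else {z. z \<noteq> 0 \<and> \<bar>Arg z\<bar> < \<theta>})"

definition sectorial :: "real \<Rightarrow> ('a :: complex_banach) rel \<Rightarrow> bool" where
  "sectorial \<omega> A \<longleftrightarrow>
     0 \<le> \<omega> \<and> \<omega> < pi \<and>
     linear_operator A \<and> closed A \<and> closure (Domain A) = UNIV \<and>
     spectrum A \<subseteq> closure (sector \<omega>) \<and>
     (\<forall>\<omega>'. \<omega> < \<omega>' \<and> \<omega>' < pi \<longrightarrow>
        bdd_above ((\<lambda>z. norm (z *\<^sub>C bounded_op_of ((affine_op z 1 A)\<inverse>))) ` sector (pi - \<omega>')))"


section \<open>Holomorphic functional calculus\<close>

definition tau :: "complex \<Rightarrow> complex" where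
  "tau z = z / (1 + z)\<^sup>2"

text \<open>\<open>\<tau>(A) = A (1 + A)\<^sup>-\<^sup>2\<close>\<close>

definition tau_op :: "('a :: complex_banach) rel \<Rightarrow> 'a rel" where
  "tau_op A = ((affine_op 1 1 A)\<inverse> ^^ 2) O A"

text \<open>
  The integral \<open>\<integral> g(\<lambda>) (\<lambda> - A)\<inverse> d\<lambda>\<close> over the boundary of the sector of angle \<open>w\<close>, taken in the
  operator norm. The boundary is positively oriented (the sector lies to its left), so it comes in
  from infinity along the ray of argument \<open>w\<close> and goes out along the ray of argument \<open>- w\<close>.
\<close>

definition sector_boundary_integral ::
  "real \<Rightarrow> (complex \<Rightarrow> complex) \<Rightarrow> ('a :: complex_banach) rel \<Rightarrow> 'a \<Rightarrow>\<^sub>L 'a" where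
  "sector_boundary_integral w g A =
     (let h = (\<lambda>l. g l *\<^sub>C resolvent A l)
      in integral {0<..} (\<lambda>t. cis (- w) *\<^sub>C h (of_real t * cis (- w)))
       - integral {0<..} (\<lambda>t. cis w *\<^sub>C h (of_real t * cis w)))"

definition regularised_calculus ::
  "nat \<Rightarrow> real \<Rightarrow> (complex \<Rightarrow> complex) \<Rightarrow> ('a :: complex_banach) rel \<Rightarrow> 'a \<Rightarrow>\<^sub>L 'a" where
  "regularised_calculus n w f A =
     (1 / (2 * of_real pi * \<i>)) *\<^sub>C sector_boundary_integral w (\<lambda>l. f l * tau l ^ n) A"

definition calculus_admissible ::
  "real \<Rightarrow> real \<Rightarrow> (complex \<Rightarrow> complex) \<Rightarrow> nat \<Rightarrow> real \<Rightarrow> bool" where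
  "calculus_admissible \<omega> \<theta> f n w \<longleftrightarrow>
     \<omega> < \<theta> \<and> \<theta> \<le> pi \<and> f holomorphic_on sector \<theta> \<and> \<omega> < w \<and> w < \<theta> \<and>
     (\<exists>k :: real. 0 \<le> k \<and> k < real n \<and>
        (\<forall>\<theta>'. \<omega> < \<theta>' \<and> \<theta>' < \<theta> \<longrightarrow>
           (\<exists>C. \<forall>z \<in> sector \<theta>'. cmod (f z) \<le> C * max (cmod z powr k) (cmod z powr (- k)))))"

text \<open>
  \<open>f(A) = (\<tau>\<^sup>n(A))\<inverse> (f \<tau>\<^sup>n)(A)\<close> for \<open>A\<close> sectorial of angle \<open>\<omega>\<close> and \<open>f\<close> holomorphic on the sector of
  angle \<open>\<theta>\<close>. The result does not depend on the admissible \<open>n\<close> and \<open>w\<close>, so it is immaterial which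
  of them are chosen.
\<close>

definition hol_calculus ::
  "real \<Rightarrow> real \<Rightarrow> (complex \<Rightarrow> complex) \<Rightarrow> ('a :: complex_banach) rel \<Rightarrow> 'a rel" where
  "hol_calculus \<omega> \<theta> f A =
     (let (n, w) = (SOME (n, w). calculus_admissible \<omega> \<theta> f n w)
      in op_graph (regularised_calculus n w f A) O (tau_op A ^^ n)\<inverse>)"


section \<open>Bernstein functions\<close>

definition real_bernstein :: "(real \<Rightarrow> real) \<Rightarrow> bool" where
  "real_bernstein f \<longleftrightarrow>
     (\<forall>t > 0. f t > 0) \<and>
     (\<forall>m. \<forall>t > 0. (deriv ^^ m) f differentiable (at t)) \<and>
     (\<forall>m \<ge> 1. \<forall>t > 0. (- 1) ^ (m - 1) * (deriv ^^ m) f t \<ge> 0)"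

definition levy_measure :: "real measure \<Rightarrow> bool" where
  "levy_measure \<mu> \<longleftrightarrow>
     sets \<mu> = sets (restrict_space borel {0<..}) \<and>
     (\<integral>\<^sup>+ s. ennreal (s / (1 + s)) \<partial>\<mu>) < \<infinity>"

text \<open>
  A Bernstein function, identified with its holomorphic extension to the right half-plane given by
  the Levy-Khintchine formula. The values off the right half-plane are irrelevant.
\<close>

definition bernstein_function :: "(complex \<Rightarrow> complex) \<Rightarrow> bool" where
  "bernstein_function F \<longleftrightarrow>
     (\<exists>f. real_bernstein f \<and> (\<forall>t > 0. F (of_real t) = of_real (f t))) \<and>
     (\<exists>a b \<mu>. a \<ge> 0 \<and> b \<ge> 0 \<and> levy_measure \<mu> \<and>
        (\<forall>z. Re z > 0 \<longrightarrow>
           F z = of_real a + of_real b * z + (\<integral>s. 1 - exp (- (z * of_real s)) \<partial>\<mu>)))"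


section \<open>Semigroups\<close>

definition C0_semigroup :: "(real \<Rightarrow> 'a :: complex_banach \<Rightarrow>\<^sub>L 'a) \<Rightarrow> bool" where
  "C0_semigroup T \<longleftrightarrow>
     (\<forall>t \<ge> 0. T t \<in> bounded_ops) \<and>
     T 0 = id_blinfun \<and>
     (\<forall>s \<ge> 0. \<forall>t \<ge> 0. T (s + t) = T s o\<^sub>L T t) \<and>
     (\<forall>x. continuous_on {0..} (\<lambda>t. blinfun_apply (T t) x))"

definition generator :: "(real \<Rightarrow> 'a :: complex_banach \<Rightarrow>\<^sub>L 'a) \<Rightarrow> 'a rel" where
  "generator T =
     {(x, y). ((\<lambda>h. (1 / h) *\<^sub>R (blinfun_apply (T h) x - x)) \<longlongrightarrow> y) (at_right 0)}"

definition norm_holomorphic_on ::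
  "(complex \<Rightarrow> 'a :: complex_banach \<Rightarrow>\<^sub>L 'a) \<Rightarrow> complex set \<Rightarrow> bool" where
  "norm_holomorphic_on T S \<longleftrightarrow>
     (\<forall>z \<in> S. \<exists>D. (T has_derivative (\<lambda>h. h *\<^sub>C D)) (at z within S))"

definition sectorially_bounded_holomorphic_semigroup ::
  "real \<Rightarrow> (real \<Rightarrow> 'a :: complex_banach \<Rightarrow>\<^sub>L 'a) \<Rightarrow> bool" where
  "sectorially_bounded_holomorphic_semigroup \<theta> T \<longleftrightarrow>
     0 < \<theta> \<and> \<theta> \<le> pi / 2 \<and> C0_semigroup T \<and>
     (\<exists>U. (\<forall>z \<in> sector \<theta>. U z \<in> bounded_ops) \<and>
          (\<forall>t > 0. U (of_real t) = T t) \<and>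
          norm_holomorphic_on U (sector \<theta>) \<and>
          (\<forall>\<theta>'. 0 < \<theta>' \<and> \<theta>' < \<theta> \<longrightarrow> bdd_above ((\<lambda>z. norm (U z)) ` sector \<theta>')))"

definition generates_sectorially_bounded_holomorphic_semigroup ::
  "real \<Rightarrow> ('a :: complex_banach) rel \<Rightarrow> bool" where
  "generates_sectorially_bounded_holomorphic_semigroup \<theta> A \<longleftrightarrow>
     (\<exists>T. sectorially_bounded_holomorphic_semigroup \<theta> T \<and> generator T = A)"

end

theory Submission
  imports Defs "HOL-Complex_Analysis.Cauchy_Integral_Formula"
begin

text \<open>
  The semigroup is constructed directly, without resolvent estimates for \<open>F(A)\<close>. If \<open>g\<close> is bounded and
  holomorphic on a larger sector, and its variation along rays near the boundary is dominated uniformly in the angle,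
  then \<open>g(A)\<close> is bounded, with norm controlled by the bound on \<open>g\<close> and the variation. For \<open>f(z) = F(z\<^sup>a)\<close> a
  Bernstein function \<open>F\<^sub>j\<close> satisfies \<open>|F\<^sub>j'(z)| \<le> F\<^sub>j'(Re z)\<close> and \<open>F\<^sub>j(Re z) \<le> |F\<^sub>j(z)|\<close>, so along
  each ray both \<open>1 / |f|\<close> and \<open>|f'|\<close> are dominated in terms of a single increasing function \<open>p\<close> of the modulus,
  \<open>p \<le> |f|\<close> and \<open>|f'| \<le> C p'\<close>. Moreover \<open>|arg F\<^sub>j(z)| \<le> |arg z|\<close>, whence \<open>|arg f(z)| \<le> a |arg z|\<close>. Thus
  \<open>exp (- \<zeta> f)\<close>, whose derivative is at most \<open>C |\<zeta>| p' exp (- c |\<zeta>| p)\<close>, has bounded variation uniformly in \<open>\<zeta>\<close>,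
  and \<open>U \<zeta> = (exp (- \<zeta> f))(A)\<close> is the desired semigroup. Its generator is identified after multiplication with a
  power of the injective operator \<open>\<tau>(A)\<close>.
\<close>

section \<open>Improper integrals along rays\<close>

text \<open>A sectorial operator need not have a bounded H-infinity calculus, so the sup norm of
  exp(- \<zeta> f) alone gives no bound for exp(- \<zeta> f)(A). Variation along rays suffices
  because z R(z) is bounded off the sector: an integration by parts trades the non-integrable factor
  1/|z| of the resolvent for the derivative of the symbol. The bound must not depend on \<zeta>, and
  this comes from scaling: the variation is controlled by that of exp(- c |\<zeta>| p), a monotone
  function with values in [0, 1] whatever the size of \<zeta>. All of this needs room between
  \<omega> and the critical angle, so one works at an angle w > \<omega> with a w + |arg \<zeta>| <
  pi/2; that such w exist exactly for |arg \<zeta>| < pi/2 - a \<omega> explains the angle of the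
  semigroup. The condition on the sum of the \<alpha>_j \<beta>_j enters only through the bound for
  |arg f|, and part 1 is treated as the case a = 1.\<close>

hide_const (open) Polynomial.content

text \<open>Comparison for Banach-valued gauge integrals by Riemann sums alone: on a division fine
  for both gauges the sums of \<open>f\<close> and \<open>f1\<close> differ by at most a sum of
  \<open>g1\<close>, hence by less than 2e/5. The e/10 allowed for \<open>f1\<close> itself leaves
  e/2 per division, so two divisions differ by less than e.\<close>

lemma integrable_approx:
  fixes f :: "real \<Rightarrow> 'b::banach"
  assumes approx: "\<And>e. e > 0 \<Longrightarrow> \<exists>f1 g1. f1 integrable_on cbox a b \<and> g1 integrable_on cbox a b \<and>
     (\<forall>x\<in>cbox a b. norm (f x - f1 x) \<le> g1 x) \<and> integral (cbox a b) g1 < e"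
  shows "f integrable_on cbox a b"
  unfolding integrable_Cauchy
proof (intro allI impI)
  fix e :: real assume "e > 0"
  then have e5: "e / 5 > 0" by simp
  obtain f1 g1 where f1: "f1 integrable_on cbox a b" and g1: "g1 integrable_on cbox a b"
    and le: "\<And>x. x \<in> cbox a b \<Longrightarrow> norm (f x - f1 x) \<le> g1 x" and lt: "integral (cbox a b) g1 < e / 5"
    using approx[OF e5] by blast
  have e10: "e / 10 > 0" using \<open>e > 0\<close> by simp
  obtain \<gamma>1 where \<gamma>1: "gauge \<gamma>1" "\<And>\<D>. \<D> tagged_division_of cbox a b \<Longrightarrow> \<gamma>1 fine \<D> \<Longrightarrow>
      norm ((\<Sum>(x,K)\<in>\<D>. content K *\<^sub>R f1 x) - integral (cbox a b) f1) < e / 10"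
    using has_integralD[OF integrable_integral[OF f1] e10] by blast
  obtain \<gamma>2 where \<gamma>2: "gauge \<gamma>2" "\<And>\<D>. \<D> tagged_division_of cbox a b \<Longrightarrow> \<gamma>2 fine \<D> \<Longrightarrow>
      norm ((\<Sum>(x,K)\<in>\<D>. content K *\<^sub>R g1 x) - integral (cbox a b) g1) < e / 5"
    using has_integralD[OF integrable_integral[OF g1] e5] by blast
  have close: "norm ((\<Sum>(x,K)\<in>\<D>. content K *\<^sub>R f x) - integral (cbox a b) f1) < e / 2"
    if \<D>: "\<D> tagged_division_of cbox a b" and fine: "\<gamma>1 fine \<D>" "\<gamma>2 fine \<D>" for \<D>
  proof -
    have "norm ((\<Sum>(x,K)\<in>\<D>. content K *\<^sub>R f x) - (\<Sum>(x,K)\<in>\<D>. content K *\<^sub>R f1 x))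
        = norm (\<Sum>(x,K)\<in>\<D>. content K *\<^sub>R (f x - f1 x))"
      by (simp add: sum_subtractf[symmetric] split_def scaleR_diff_right)
    also have "\<dots> \<le> (\<Sum>(x,K)\<in>\<D>. content K *\<^sub>R g1 x)"
    proof (rule sum_norm_le, clarify)
      fix x K assume "(x, K) \<in> \<D>"
      then have "x \<in> cbox a b" using \<D> by (metis tag_in_interval)
      then show "norm (content K *\<^sub>R (f x - f1 x)) \<le> content K *\<^sub>R g1 x"
        using le[of x] by (simp add: mult_left_mono)
    qed
    also have "\<dots> < e / 5 + e / 5"
      using \<gamma>2(2)[OF \<D> fine(2)] lt unfolding real_norm_def by linarith
    finally have 1: "norm ((\<Sum>(x,K)\<in>\<D>. content K *\<^sub>R f x) - (\<Sum>(x,K)\<in>\<D>. content K *\<^sub>R f1 x)) < e / 5 + e / 5" .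
    show ?thesis
      using norm_diff_triangle_less[OF 1 \<gamma>1(2)[OF \<D> fine(1)]] by (rule less_le_trans) simp
  qed
  show "\<exists>\<gamma>. gauge \<gamma> \<and> (\<forall>\<D>1 \<D>2. \<D>1 tagged_division_of cbox a b \<and> \<gamma> fine \<D>1 \<and>
            \<D>2 tagged_division_of cbox a b \<and> \<gamma> fine \<D>2 \<longrightarrow>
            norm ((\<Sum>(x,K)\<in>\<D>1. content K *\<^sub>R f x) - (\<Sum>(x,K)\<in>\<D>2. content K *\<^sub>R f x)) < e)"
  proof (intro exI conjI allI impI)
    show "gauge (\<lambda>x. \<gamma>1 x \<inter> \<gamma>2 x)" using \<gamma>1(1) \<gamma>2(1) by (rule gauge_Int)
    fix \<D>1 \<D>2
    assume "\<D>1 tagged_division_of cbox a b \<and> (\<lambda>x. \<gamma>1 x \<inter> \<gamma>2 x) fine \<D>1 \<and>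
            \<D>2 tagged_division_of cbox a b \<and> (\<lambda>x. \<gamma>1 x \<inter> \<gamma>2 x) fine \<D>2"
    then have a: "\<D>1 tagged_division_of cbox a b" "\<gamma>1 fine \<D>1" "\<gamma>2 fine \<D>1"
      "\<D>2 tagged_division_of cbox a b" "\<gamma>1 fine \<D>2" "\<gamma>2 fine \<D>2"
      by (simp_all only: fine_Int)
    have 1: "norm ((\<Sum>(x,K)\<in>\<D>1. content K *\<^sub>R f x) - integral (cbox a b) f1) < e / 2"
      and 2: "norm (integral (cbox a b) f1 - (\<Sum>(x,K)\<in>\<D>2. content K *\<^sub>R f x)) < e / 2"
      unfolding norm_minus_commute[of "integral (cbox a b) f1"]
      by (rule close[OF a(1-3)], rule close[OF a(4-6)])
    show "norm ((\<Sum>(x,K)\<in>\<D>1. content K *\<^sub>R f x) - (\<Sum>(x,K)\<in>\<D>2. content K *\<^sub>R f x)) < e"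
      using norm_diff_triangle_less[OF 1 2] by (simp only: field_sum_of_halves)
  qed
qed

lemma integral_truncated_LIMSEQ:
  fixes g :: "real \<Rightarrow> 'b::euclidean_space"
  assumes "g absolutely_integrable_on {0<..}"
  shows "(\<lambda>k. integral {1 / real (Suc k)..real (Suc k)} g) \<longlonglongrightarrow> integral {0<..} g"
proof -
  let ?I = "\<lambda>k. {1 / real (Suc k)..real (Suc k)}"
  have g: "g integrable_on {0<..}" and ng: "(\<lambda>x. norm (g x)) integrable_on {0<..}"
    using assms by (auto simp: absolutely_integrable_on_def)
  have sub: "?I k \<inter> {0<..} = ?I k" for k
  proof (intro Int_absorb2 subsetI)
    fix x assume "x \<in> ?I k"
    moreover have "0 < 1 / real (Suc k)" by simp
    ultimately show "x \<in> {0<..}" unfolding atLeastAtMost_iff greaterThan_iff by linarith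
  qed
  have "(\<lambda>k. integral {0<..} (\<lambda>x. if x \<in> ?I k then g x else 0)) \<longlonglongrightarrow> integral {0<..} g"
  proof (rule dominated_convergence(2)[OF _ ng])
    fix k show "(\<lambda>x. if x \<in> ?I k then g x else 0) integrable_on {0<..}"
      unfolding integrable_restrict_Int sub
      by (rule integrable_on_subinterval[OF g]) (use sub in blast)
  next
    fix x :: real assume x: "x \<in> {0<..}"
    obtain N where N: "real N > max x (1 / x)" using reals_Archimedean2 by blast
    have *: "x \<in> ?I k" if "k \<ge> N" for k
    proof -
      have "real (Suc k) > x" "real (Suc k) > 1 / x" using N that by linarith+
      then show ?thesis using x by (simp add: field_simps del: of_nat_Suc)
    qed
    have "\<forall>\<^sub>F k in sequentially. (if x \<in> ?I k then g x else 0) = g x"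
      by (rule eventually_sequentiallyI[of N]) (simp only: * if_True)
    then show "(\<lambda>k. if x \<in> ?I k then g x else 0) \<longlonglongrightarrow> g x" by (rule tendsto_eventually)
  qed auto
  then show ?thesis unfolding integral_restrict_Int sub .
qed

text \<open>Domination settles the behaviour at infinity once \<phi> is integrable on compact
  intervals, where the only obstacle is the singularity at 0. Cutting \<phi> off below 1/(k+1)
  leaves a continuous function, and the discarded part is dominated by \<open>g\<close> near 0,
  whose integral there tends to 0 as k grows.\<close>

lemma dominated_integrable:
  fixes \<phi> :: "real \<Rightarrow> 'b::banach"
  assumes cont: "continuous_on {0<..} \<phi>" and le: "\<And>t. t > 0 \<Longrightarrow> norm (\<phi> t) \<le> g t"
    and g: "g integrable_on {0<..}"
  shows "\<phi> integrable_on {0<..}"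
proof (rule integrable_on_all_intervals_integrable_bound[OF _ _ g])
  show "norm (\<phi> t) \<le> g t" if "t \<in> {0<..}" for t using le that by simp
  fix a b :: real
  let ?\<phi> = "\<lambda>x. if x \<in> {0<..} then \<phi> x else 0"
  let ?g = "\<lambda>x. if x \<in> {0<..} then g x else 0"
  have gab: "?g integrable_on cbox a b" using g by (rule integrable_altD(1))
  have g0: "?g x \<ge> 0" for x using le[of x] order_trans[OF norm_ge_zero] by auto
  show "?\<phi> integrable_on cbox a b"
  proof (rule integrable_approx)
    fix e :: real assume e: "e > 0"
    let ?h = "\<lambda>k x. if x \<in> {1 / real (Suc k)..} then ?g x else 0"
    have hk: "?h k integrable_on cbox a b" for k
    proof -
      have "{1 / real (Suc k)..} \<inter> cbox a b = {max a (1 / real (Suc k))..b}" by auto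
      moreover have "?g integrable_on {max a (1 / real (Suc k))..b}"
        by (rule integrable_on_subinterval[OF gab]) auto
      ultimately show ?thesis by (subst integrable_restrict_Int) (simp only:)
    qed
    have "(\<lambda>k. integral (cbox a b) (?h k)) \<longlonglongrightarrow> integral (cbox a b) ?g"
    proof (rule dominated_convergence(2)[OF hk gab])
      fix k x show "norm (?h k x) \<le> ?g x" using g0[of x] by auto
    next
      fix x :: real
      show "(\<lambda>k. ?h k x) \<longlonglongrightarrow> ?g x"
      proof (cases "x > 0")
        case True
        obtain N where N: "real N > 1 / x" using reals_Archimedean2 by blast
        have *: "x \<in> {1 / real (Suc k)..}" if "k \<ge> N" for k
        proof -
          have "real (Suc k) > 1 / x" using N that by linarith
          then show ?thesis using True by (simp add: field_simps del: of_nat_Suc)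
        qed
        have "\<forall>\<^sub>F k in sequentially. ?h k x = ?g x"
          by (rule eventually_sequentiallyI[of N]) (simp only: * if_True)
        then show ?thesis by (rule tendsto_eventually)
      qed auto
    qed
    from LIMSEQ_D[OF this e] obtain k where k: "\<bar>integral (cbox a b) (?h k) - integral (cbox a b) ?g\<bar> < e"
      unfolding real_norm_def by blast
    define d where "d = 1 / real (Suc k)"
    have d: "d > 0" unfolding d_def by simp
    show "\<exists>f1 g1. f1 integrable_on cbox a b \<and> g1 integrable_on cbox a b \<and>
       (\<forall>x\<in>cbox a b. norm (?\<phi> x - f1 x) \<le> g1 x) \<and> integral (cbox a b) g1 < e"
    proof (intro exI conjI ballI)
      have "\<phi> integrable_on {max a d..b}"
        by (rule integrable_continuous_real) (rule continuous_on_subset[OF cont], use d in auto)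
      moreover have "{d..} \<inter> cbox a b = {max a d..b}" by auto
      ultimately show "(\<lambda>x. if x \<in> {d..} then \<phi> x else 0) integrable_on cbox a b"
        by (subst integrable_restrict_Int) (simp only:)
      show "(\<lambda>x. ?g x - ?h k x) integrable_on cbox a b"
        using gab hk by (rule integrable_diff)
      show "integral (cbox a b) (\<lambda>x. ?g x - ?h k x) < e"
        unfolding integral_diff[OF gab hk] using k by linarith
      fix x show "norm (?\<phi> x - (if x \<in> {d..} then \<phi> x else 0)) \<le> ?g x - ?h k x"
        using le[of x] d unfolding d_def[symmetric] by auto
    qed
  qed
qed

section \<open>Complex scalars, and derivatives along rays and arcs\<close>

lemma bounded_bilinear_scaleC: "bounded_bilinear (scaleC :: complex \<Rightarrow> 'b::complex_normed_vector \<Rightarrow> 'b)"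
proof
  fix r :: real and a :: complex and b :: 'b
  show "(r *\<^sub>R a) *\<^sub>C b = r *\<^sub>R a *\<^sub>C b"
    by (metis scaleC_of_real scaleC_scaleC scaleR_conv_of_real)
  show "a *\<^sub>C r *\<^sub>R b = r *\<^sub>R a *\<^sub>C b"
    by (simp add: scaleC_of_real[symmetric] scaleC_scaleC mult.commute)
  show "\<exists>K. \<forall>a (b::'b). norm (a *\<^sub>C b) \<le> norm a * norm b * K"
    by (rule exI[of _ 1]) (simp add: norm_scaleC)
qed (simp_all add: scaleC_add_left scaleC_add_right)

interpretation scaleC: bounded_bilinear "scaleC :: complex \<Rightarrow> 'b::complex_normed_vector \<Rightarrow> 'b"
  by (rule bounded_bilinear_scaleC)

lemma scaleC_one [simp]: "1 *\<^sub>C (x :: 'b::complex_normed_vector) = x"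
  using scaleC_of_real[of 1 x] by simp

declare scaleC.zero_left [simp] scaleC.zero_right [simp]

lemma has_vector_derivative_scaleC_chain:
  fixes h :: "complex \<Rightarrow> 'b::complex_normed_vector"
  assumes "(\<gamma> has_vector_derivative \<gamma>') (at x within S)"
    and "(h has_derivative (\<lambda>d. d *\<^sub>C H)) (at (\<gamma> x))"
  shows "((\<lambda>x. h (\<gamma> x)) has_vector_derivative \<gamma>' *\<^sub>C H) (at x within S)"
  using has_derivative_compose[OF assms(1)[unfolded has_vector_derivative_def] assms(2)]
  by (simp add: has_vector_derivative_def scaleC.scaleR_left)

lemma has_vector_derivative_ray:
  "((\<lambda>t. complex_of_real t * cis v) has_vector_derivative cis v) (at t within S)"
  unfolding has_vector_derivative_def scaleR_conv_of_real
  by (rule bounded_linear_imp_has_derivative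
      [OF bounded_linear_compose[OF bounded_linear_mult_left bounded_linear_of_real]])

lemma has_vector_derivative_arc:
  "((\<lambda>v. complex_of_real t * cis v) has_vector_derivative \<i> * (of_real t * cis v)) (at v within S)"
proof -
  have "(cis has_vector_derivative \<i> * cis v) (at v within S)"
    unfolding has_vector_derivative_def by (rule has_derivative_cis[OF has_derivative_ident])
  from has_vector_derivative_mult_right[OF this, of "of_real t"] show ?thesis by (simp only: mult.left_commute)
qed

text \<open>The first claim is quantitative because iterated integrals need it: the tail of \<phi>
  is at most the tail of \<open>g\<close>, at a rate that does not depend on \<phi>.\<close>

lemma dominated_truncated_LIMSEQ:
  fixes \<phi> :: "real \<Rightarrow> 'b::banach"
  assumes \<phi>: "\<phi> integrable_on {0<..}" and le: "\<And>t. t > 0 \<Longrightarrow> norm (\<phi> t) \<le> g t"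
    and g: "g integrable_on {0<..}"
  shows "norm (integral {0<..} \<phi> - integral {1 / real (Suc k)..real (Suc k)} \<phi>)
           \<le> integral {0<..} g - integral {1 / real (Suc k)..real (Suc k)} g" (is "?A k")
    and "(\<lambda>k. integral {1 / real (Suc k)..real (Suc k)} g) \<longlonglongrightarrow> integral {0<..} g" (is ?B)
    and "(\<lambda>k. integral {1 / real (Suc k)..real (Suc k)} \<phi>) \<longlonglongrightarrow> integral {0<..} \<phi>" (is ?C)
proof -
  let ?I = "\<lambda>k. {1 / real (Suc k)..real (Suc k)}"
  have sub: "?I k \<subseteq> {0<..}" for k
  proof
    fix x assume "x \<in> ?I k"
    moreover have "0 < 1 / real (Suc k)" by simp
    ultimately show "x \<in> {0<..}" unfolding atLeastAtMost_iff greaterThan_iff by linarith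
  qed
  have rest: "(\<lambda>x. if x \<in> ?I k then f x else 0) integrable_on {0<..}"
    "integral {0<..} (\<lambda>x. if x \<in> ?I k then f x else 0) = integral (?I k) f"
    if "f integrable_on {0<..}" for f :: "real \<Rightarrow> 'c::banach" and k
  proof -
    have "f integrable_on ?I k \<inter> {0<..}" and "?I k \<inter> {0<..} = ?I k"
      using integrable_on_subinterval[OF that sub] sub by (simp_all only: Int_absorb2)
    then show "(\<lambda>x. if x \<in> ?I k then f x else 0) integrable_on {0<..}"
      "integral {0<..} (\<lambda>x. if x \<in> ?I k then f x else 0) = integral (?I k) f"
      by (simp_all only: integrable_restrict_Int integral_restrict_Int)
  qed
  have *: "?A k" for k
  proof -
    have "norm (integral {0<..} (\<lambda>x. \<phi> x - (if x \<in> ?I k then \<phi> x else 0)))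
        \<le> integral {0<..} (\<lambda>x. g x - (if x \<in> ?I k then g x else 0))"
      by (rule integral_norm_bound_integral[OF integrable_diff[OF \<phi> rest(1)[OF \<phi>]] integrable_diff[OF g rest(1)[OF g]]])
        (use le in auto)
    then show ?thesis
      by (simp only: integral_diff[OF \<phi> rest(1)[OF \<phi>]] integral_diff[OF g rest(1)[OF g]] rest(2)[OF \<phi>] rest(2)[OF g])
  qed
  then show "?A k" .
  have "g absolutely_integrable_on {0<..}"
    using g le order_trans[OF norm_ge_zero] by (intro nonnegative_absolutely_integrable_1) auto
  then show B: ?B by (rule integral_truncated_LIMSEQ)
  have "(\<lambda>k. integral {0<..} g - integral (?I k) g) \<longlonglongrightarrow> integral {0<..} g - integral {0<..} g"
    by (intro tendsto_intros B)
  then have z: "(\<lambda>k. integral {0<..} g - integral (?I k) g) \<longlonglongrightarrow> 0" by (simp only: diff_self)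
  have "(\<lambda>k. integral {0<..} \<phi> - integral (?I k) \<phi>) \<longlonglongrightarrow> 0"
    by (rule Lim_null_comparison[OF always_eventually[OF allI[OF *]] z])
  then have "(\<lambda>k. integral {0<..} \<phi> - (integral {0<..} \<phi> - integral (?I k) \<phi>)) \<longlonglongrightarrow> integral {0<..} \<phi> - 0"
    by (intro tendsto_intros)
  then show ?C by (simp only: diff_diff_eq2 add_diff_cancel_left' diff_0_right)
qed

text \<open>The squares over [1/(k+1), k+1] exhaust the quadrant. By the product form of the bound,
  the error of the inner truncation at x is at most C g(x) r_k, where r_k is the tail of
  \<open>g\<close>; after the outer integration it is at most C G r_k.\<close>

lemma truncated_double_integral_LIMSEQ:
  fixes h :: "real \<Rightarrow> real \<Rightarrow> 'b::banach"
  assumes cont: "continuous_on ({0<..} \<times> {0<..}) (\<lambda>(x, y). h x y)"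
    and le: "\<And>x y. x > 0 \<Longrightarrow> y > 0 \<Longrightarrow> norm (h x y) \<le> C * (g x * g y)"
    and g: "g integrable_on {0<..}" and g0: "\<And>x. x > 0 \<Longrightarrow> g x \<ge> 0" and C: "C \<ge> 0"
    and a: "(\<lambda>x. integral {0<..} (h x)) integrable_on {0<..}"
  shows "(\<lambda>k. integral {1 / real (Suc k)..real (Suc k)} (\<lambda>x. integral {1 / real (Suc k)..real (Suc k)} (h x)))
     \<longlonglongrightarrow> integral {0<..} (\<lambda>x. integral {0<..} (h x))"
proof -
  let ?I = "\<lambda>k. {1 / real (Suc k)..real (Suc k)}"
  define a where "a x = integral {0<..} (h x)" for x
  define G where "G = integral {0<..} g"
  define r where "r k = G - integral (?I k) g" for k
  have pos: "x > 0" if "x \<in> ?I k" for x k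
  proof -
    have "0 < 1 / real (Suc k)" by simp
    then show ?thesis using that unfolding atLeastAtMost_iff by linarith
  qed
  have hx: "h x integrable_on {0<..}" if "x > 0" for x
  proof (rule dominated_integrable)
    have "continuous_on {0<..} (\<lambda>y. case (x, y) of (x, y) \<Rightarrow> h x y)"
      by (rule continuous_on_compose2[OF cont]) (use that in \<open>auto intro!: continuous_intros\<close>)
    then show "continuous_on {0<..} (h x)" by simp
    show "(\<lambda>y. (C * g x) * g y) integrable_on {0<..}"
      using integrable_cmul[OF g, of "C * g x"] by simp
    show "norm (h x t) \<le> C * g x * g t" if "t > 0" for t using le[OF \<open>x > 0\<close> that] by (simp add: mult.assoc)
  qed
  have gk: "integral (?I k) g \<le> G" for k
    unfolding G_def by (rule integral_subset_le) (use pos g g0 in \<open>auto intro: integrable_on_subinterval simp del: of_nat_Suc\<close>)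
  have G0: "G \<ge> 0" unfolding G_def using g g0 by (intro integral_nonneg) auto
  have inner: "norm (a x - integral (?I k) (h x)) \<le> C * g x * r k" if "x > 0" for x k
  proof -
    have "norm (a x - integral (?I k) (h x)) \<le> integral {0<..} (\<lambda>y. C * g x * g y) - integral (?I k) (\<lambda>y. C * g x * g y)"
      unfolding a_def
      by (rule dominated_truncated_LIMSEQ(1)[OF hx[OF that]])
        (use le that integrable_cmul[OF g, of "C * g x"] in \<open>auto simp: mult.assoc\<close>)
    then show ?thesis unfolding r_def G_def by (simp add: right_diff_distrib)
  qed
  have ai: "a integrable_on {0<..}" using a unfolding a_def .
  have ca: "norm (a x) \<le> C * G * g x" if "x > 0" for x
  proof -
    have "norm (a x) \<le> integral {0<..} (\<lambda>y. C * g x * g y)"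
      unfolding a_def
      by (rule integral_norm_bound_integral[OF hx[OF that]])
        (use le that integrable_cmul[OF g, of "C * g x"] in \<open>auto simp: mult.assoc\<close>)
    then show ?thesis unfolding G_def by (simp add: mult_ac)
  qed
  have "(\<lambda>k. integral (?I k) a) \<longlonglongrightarrow> integral {0<..} a"
    by (rule dominated_truncated_LIMSEQ(3)[OF ai ca])
      (use integrable_cmul[OF g, of "C * G"] in auto)
  moreover have "(\<lambda>k. integral (?I k) a - integral (?I k) (\<lambda>x. integral (?I k) (h x))) \<longlonglongrightarrow> 0"
  proof (rule Lim_null_comparison[OF always_eventually])
    have "(\<lambda>k. integral (?I k) g) \<longlonglongrightarrow> G" unfolding G_def
      by (rule integral_truncated_LIMSEQ) (use g g0 in \<open>auto intro!: nonnegative_absolutely_integrable_1\<close>)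
    then have "r \<longlonglongrightarrow> G - G" unfolding r_def by (intro tendsto_intros)
    then have "(\<lambda>k. C * G * r k) \<longlonglongrightarrow> C * G * (G - G)" by (intro tendsto_intros)
    then show "(\<lambda>k. C * G * r k) \<longlonglongrightarrow> 0" by simp
    show "\<forall>k. norm (integral (?I k) a - integral (?I k) (\<lambda>x. integral (?I k) (h x))) \<le> C * G * r k"
    proof
      fix k
      have aik: "a integrable_on ?I k"
        by (rule integrable_on_subinterval[OF ai]) (use pos in auto)
      have "continuous_on (?I k) (\<lambda>x. integral (cbox (1 / real (Suc k)) (real (Suc k))) (h x))"
        by (rule integral_continuous_on_param, rule continuous_on_subset[OF cont])
          (use pos in \<open>auto simp del: of_nat_Suc\<close>)
      then have tik: "(\<lambda>x. integral (?I k) (h x)) integrable_on ?I k"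
        by (intro integrable_continuous_real) (simp del: of_nat_Suc)
      have r0: "r k \<ge> 0" unfolding r_def using gk[of k] by simp
      have gik: "g integrable_on ?I k" by (rule integrable_on_subinterval[OF g]) (use pos in auto)
      have "norm (integral (?I k) (\<lambda>x. a x - integral (?I k) (h x))) \<le> integral (?I k) (\<lambda>x. (C * r k) * g x)"
        by (rule integral_norm_bound_integral)
          (use inner pos integrable_cmul[OF gik, of "C * r k"] in \<open>auto intro!: integrable_diff aik tik simp: mult_ac simp del: of_nat_Suc\<close>)
      also have "\<dots> = C * r k * integral (?I k) g" by simp
      also have "\<dots> \<le> C * r k * G" using gk C r0 by (intro mult_left_mono) auto
      finally show "norm (integral (?I k) a - integral (?I k) (\<lambda>x. integral (?I k) (h x))) \<le> C * G * r k"
        by (simp only: integral_diff[OF aik tik] mult_ac)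
    qed
  qed
  ultimately have "(\<lambda>k. integral (?I k) a - (integral (?I k) a - integral (?I k) (\<lambda>x. integral (?I k) (h x)))) \<longlonglongrightarrow> integral {0<..} a - 0"
    by (intro tendsto_diff)
  then show ?thesis unfolding a_def by (simp only: diff_diff_eq2 add_diff_cancel_left' diff_0_right)
qed

text \<open>On each truncated square the two orders agree by continuity, and both iterated integrals
  are limits over these squares.\<close>

lemma improper_fubini:
  fixes h :: "real \<Rightarrow> real \<Rightarrow> 'b::banach"
  assumes cont: "continuous_on ({0<..} \<times> {0<..}) (\<lambda>(x, y). h x y)"
    and le: "\<And>x y. x > 0 \<Longrightarrow> y > 0 \<Longrightarrow> norm (h x y) \<le> C * (g x * g y)"
    and g: "g integrable_on {0<..}" and g0: "\<And>x. x > 0 \<Longrightarrow> g x \<ge> 0" and C: "C \<ge> 0"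
    and a: "(\<lambda>x. integral {0<..} (h x)) integrable_on {0<..}"
    and b: "(\<lambda>y. integral {0<..} (\<lambda>x. h x y)) integrable_on {0<..}"
  shows "integral {0<..} (\<lambda>x. integral {0<..} (h x)) = integral {0<..} (\<lambda>y. integral {0<..} (\<lambda>x. h x y))"
proof -
  let ?I = "\<lambda>k. {1 / real (Suc k)..real (Suc k)}"
  have pos: "x > 0" if "x \<in> ?I k" for x k
  proof -
    have "0 < 1 / real (Suc k)" by simp
    then show ?thesis using that unfolding atLeastAtMost_iff by linarith
  qed
  have 1: "(\<lambda>k. integral (?I k) (\<lambda>x. integral (?I k) (h x))) \<longlonglongrightarrow> integral {0<..} (\<lambda>x. integral {0<..} (h x))"
    using truncated_double_integral_LIMSEQ[OF cont le g g0 C a] .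
  have cont': "continuous_on ({0<..} \<times> {0<..}) (\<lambda>(y, x). h x y)"
  proof -
    have "continuous_on ({0<..} \<times> {0<..}) (\<lambda>p. case (snd p, fst p) of (x, y) \<Rightarrow> h x y)"
      by (rule continuous_on_compose2[OF cont]) (auto intro!: continuous_intros)
    then show ?thesis by (simp add: case_prod_unfold)
  qed
  have le': "norm (h x y) \<le> C * (g y * g x)" if "y > 0" "x > 0" for x y
    using le[OF that(2,1)] by (simp add: mult_ac)
  have 2: "(\<lambda>k. integral (?I k) (\<lambda>y. integral (?I k) (\<lambda>x. h x y))) \<longlonglongrightarrow> integral {0<..} (\<lambda>y. integral {0<..} (\<lambda>x. h x y))"
    using truncated_double_integral_LIMSEQ[OF cont' le' g g0 C b] .
  have "integral (?I k) (\<lambda>x. integral (?I k) (h x)) = integral (?I k) (\<lambda>y. integral (?I k) (\<lambda>x. h x y))" for k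
  proof -
    have "continuous_on (cbox (1 / real (Suc k), 1 / real (Suc k)) (real (Suc k), real (Suc k))) (\<lambda>(x, y). h x y)"
      by (rule continuous_on_subset[OF cont]) (use pos in \<open>auto simp: cbox_Pair_eq simp del: of_nat_Suc\<close>)
    from integral_swap_continuous[OF this] show ?thesis by (simp only: cbox_interval)
  qed
  then have "(\<lambda>k. integral (?I k) (\<lambda>x. integral (?I k) (h x))) \<longlonglongrightarrow> integral {0<..} (\<lambda>y. integral {0<..} (\<lambda>x. h x y))"
    using 2 by (simp only:)
  with 1 show ?thesis by (rule LIMSEQ_unique)
qed

text \<open>For \<open>t > 0\<close> this is the minimum of \<open>t\<^sup>s\<close> and \<open>t\<^sup>-\<^sup>s\<close>; the exponential form makes it multiplicative in \<open>s\<close>.\<close>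

definition dk :: "real \<Rightarrow> real \<Rightarrow> real" where
  "dk s t = exp (- (s * \<bar>ln t\<bar>))"

lemma dk_pos: "dk s t > 0"
  by (simp add: dk_def)

lemma dk_add: "dk (s + s') t = dk s t * dk s' t"
  by (simp add: dk_def exp_add[symmetric] algebra_simps)

lemma dk_mono: "s \<le> s' \<Longrightarrow> dk s' t \<le> dk s t"
  by (simp add: dk_def mult_right_mono)

lemma dk_le_one: "s \<ge> 0 \<Longrightarrow> dk s t \<le> 1"
  by (simp add: dk_def)

lemma dk_inverse: "t > 0 \<Longrightarrow> dk s (1 / t) = dk s t"
  by (simp add: dk_def ln_div)

lemma dk_less_1: "0 < t \<Longrightarrow> t \<le> 1 \<Longrightarrow> dk s t = t powr s"
  by (simp add: dk_def powr_def)

lemma dk_ge_1: "1 \<le> t \<Longrightarrow> dk s t = t powr (- s)"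
  by (simp add: dk_def powr_def)

lemma continuous_on_dk: "continuous_on {0<..} (dk s)"
  unfolding dk_def by (intro continuous_intros) auto

lemma dk_integrable:
  assumes "s > 0"
  shows "(\<lambda>t. dk s t / t) integrable_on {0<..}"
proof -
  have "(\<lambda>t. t powr (s - 1)) integrable_on {0<..1}"
    using assms by (intro integrable_on_powr_from_0') auto
  then have 1: "(\<lambda>t. dk s t / t) integrable_on {0<..1}"
    by (rule integrable_eq) (auto simp: dk_less_1 powr_diff)
  have "(\<lambda>t. t powr (- s - 1)) integrable_on {1..}"
    using has_integral_powr_to_inf[of "- s - 1" 1] assms by (auto simp: integrable_on_def)
  then have 2: "(\<lambda>t. dk s t / t) integrable_on {1..}"
    by (rule integrable_eq) (auto simp: dk_ge_1 powr_diff)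
  have "{0<..1} \<inter> {1..} = {1::real}" "{0<..1} \<union> {1..} = {0::real<..}" by auto
  then show ?thesis using integrable_Un[OF _ 1 2] by simp
qed

lemma dk_Suc_LIMSEQ: "s > 0 \<Longrightarrow> (\<lambda>k. dk s (real (Suc k))) \<longlonglongrightarrow> 0"
proof -
  assume s: "s > 0"
  have "(\<lambda>k. real (Suc k) powr (- s)) \<longlonglongrightarrow> 0"
    using s filterlim_compose[OF filterlim_real_sequentially filterlim_Suc]
    by (intro tendsto_neg_powr) (auto simp: o_def)
  then show ?thesis by (simp add: dk_ge_1)
qed

text \<open>On the compact gap between a and b the quotient t |\<phi>(t)| / \<open>dk s t\<close> is
  continuous, hence bounded; if b < a there is no gap. Only the constant changes, the exponent s is
  kept.\<close>

lemma dk_bound_extend: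
  fixes \<phi> :: "real \<Rightarrow> 'b::real_normed_vector"
  assumes cont: "continuous_on {0<..} \<phi>" and a: "0 < a"
    and le: "\<And>t. t > 0 \<Longrightarrow> t < a \<or> b < t \<Longrightarrow> t * norm (\<phi> t) \<le> C * dk s t"
  obtains C' where "\<And>t. t > 0 \<Longrightarrow> t * norm (\<phi> t) \<le> C' * dk s t" "C' \<ge> 0"
proof -
  have "compact ((\<lambda>t. t * norm (\<phi> t) / dk s t) ` {a..b})"
    by (intro compact_continuous_image continuous_intros continuous_on_subset[OF cont]
        continuous_on_subset[OF continuous_on_dk])
      (use a dk_pos in \<open>auto simp: less_le\<close>)
  from compact_imp_bounded[OF this] obtain B
    where "\<forall>x\<in>(\<lambda>t. t * norm (\<phi> t) / dk s t) ` {a..b}. norm x \<le> B"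
    unfolding bounded_iff by blast
  then have B: "\<bar>t * norm (\<phi> t) / dk s t\<bar> \<le> B" if "t \<in> {a..b}" for t
    using that unfolding real_norm_def by blast
  have "t * norm (\<phi> t) \<le> max (max B C) 0 * dk s t" if "t > 0" for t
  proof (cases "t < a \<or> b < t")
    case True
    then have "t * norm (\<phi> t) \<le> C * dk s t" using le that by blast
    also have "\<dots> \<le> max (max B C) 0 * dk s t" using dk_pos[of s t] by (intro mult_right_mono) auto
    finally show ?thesis .
  next
    case False
    then have "t * norm (\<phi> t) / dk s t \<le> B"
      using abs_le_D1[OF B[of t]] unfolding atLeastAtMost_iff by linarith
    then have "t * norm (\<phi> t) \<le> B * dk s t" using dk_pos[of s t] by (simp add: pos_divide_le_eq)
    also have "\<dots> \<le> max (max B C) 0 * dk s t" using dk_pos[of s t] by (intro mult_right_mono) auto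
    finally show ?thesis .
  qed
  then show ?thesis by (intro that[of "max (max B C) 0"]) auto
qed

text \<open>The integral of h(z) dz along the ray of argument v, directed away from 0.\<close>

definition ray :: "real \<Rightarrow> (complex \<Rightarrow> 'b::{complex_normed_vector,banach}) \<Rightarrow> 'b" where
  "ray v h = integral {0<..} (\<lambda>t. cis v *\<^sub>C h (of_real t * cis v))"

text \<open>The natural measure on a ray is dt/t, for which \<open>dk s\<close> is integrable at
  both ends; hence the factor t in the hypothesis.\<close>

lemma ray_integrable:
  fixes h :: "complex \<Rightarrow> 'b::{complex_normed_vector,banach}"
  assumes cont: "continuous_on {0<..} (\<lambda>t. h (of_real t * cis v))" and s: "s > 0"
    and le: "\<And>t. t > 0 \<Longrightarrow> t * norm (h (of_real t * cis v)) \<le> C * dk s t"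
  shows "(\<lambda>t. cis v *\<^sub>C h (of_real t * cis v)) integrable_on {0<..}" (is ?A)
    and "norm (ray v h) \<le> C * integral {0<..} (\<lambda>t. dk s t / t)" (is ?B)
    and "(\<lambda>k. integral {1 / real (Suc k)..real (Suc k)} (\<lambda>t. cis v *\<^sub>C h (of_real t * cis v))) \<longlonglongrightarrow> ray v h" (is ?C)
proof -
  have le': "norm (cis v *\<^sub>C h (of_real t * cis v)) \<le> C * (dk s t / t)" if "t > 0" for t
    using le[OF that] that by (simp add: norm_scaleC field_simps)
  have i: "(\<lambda>t. C * (dk s t / t)) integrable_on {0<..}"
    using integrable_cmul[OF dk_integrable[OF s], of C] by simp
  show ?A
    by (rule dominated_integrable[OF _ le' i]) (intro scaleC.continuous_on continuous_intros cont)
  then show ?C unfolding ray_def by (rule dominated_truncated_LIMSEQ(3)[OF _ le' i])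
  show ?B unfolding ray_def
    using integral_norm_bound_integral[OF \<open>?A\<close> i] le' by (simp only: integral_mult_right greaterThan_iff)
qed

text \<open>
  Cauchy's theorem on a sector: with \<open>D = h + z h'\<close> one has
  \<open>d/dt (z h) = e\<^sup>i\<^sup>v D\<close> and \<open>d/dv (e\<^sup>i\<^sup>v h) = i e\<^sup>i\<^sup>v D\<close> at \<open>z = t e\<^sup>i\<^sup>v\<close>, so the two ray integrals differ by
  the contributions of the arcs.
\<close>

lemma ray_rotate:
  fixes h :: "complex \<Rightarrow> 'b::{complex_normed_vector,banach}"
  assumes v: "v1 \<le> v2"
    and der: "\<And>t v. t > 0 \<Longrightarrow> v \<in> {v1..v2} \<Longrightarrow>
       (h has_derivative (\<lambda>d. d *\<^sub>C h' (of_real t * cis v))) (at (of_real t * cis v))"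
    and cont: "\<And>t v. t > 0 \<Longrightarrow> v \<in> {v1..v2} \<Longrightarrow> isCont h' (of_real t * cis v)"
    and s: "s > 0" and a: "a > 0"
    and le: "\<And>t v. t > 0 \<Longrightarrow> v \<in> {v1..v2} \<Longrightarrow> t < a \<or> b < t \<Longrightarrow> t * norm (h (of_real t * cis v)) \<le> C * dk s t"
  shows "ray v1 h = ray v2 h"
proof -
  define P where "P = (\<lambda>p. complex_of_real (fst p) * cis (snd p)) ` ({0<..} \<times> {v1..v2})"
  have inP: "of_real t * cis v \<in> P" if "t > 0" "v \<in> {v1..v2}" for t v
    unfolding P_def by (rule image_eqI[of _ _ "(t, v)"]) (use that in auto)
  have contP: "continuous_on P h'" "continuous_on P h"
    unfolding P_def using cont has_derivative_continuous[OF der]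
    by (auto intro!: continuous_at_imp_continuous_on)
  define D where "D t v = cis v *\<^sub>C (h (of_real t * cis v) + (of_real t * cis v) *\<^sub>C h' (of_real t * cis v))" for t v
  have sub: "\<And>c d. 0 < c \<Longrightarrow> (\<lambda>p. complex_of_real (fst p) * cis (snd p)) ` ({c..d} \<times> {v1..v2}) \<subseteq> P"
    unfolding P_def by (intro image_mono) auto
  have ci: "continuous_on S (\<lambda>p. complex_of_real (fst p) * cis (snd p))" for S
    by (intro continuous_intros)
  \<comment> \<open>With c < a and d > b both arcs lie where the decay bound holds. The truncated
    rays differ by the contributions of the two arcs, each at most the angle v2 - v1 times C times
    the value of \<open>dk s\<close> at its radius.\<close>
  have arc: "norm (integral {c..d} (\<lambda>t. cis v2 *\<^sub>C h (of_real t * cis v2)) - integral {c..d} (\<lambda>t. cis v1 *\<^sub>C h (of_real t * cis v1)))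
     \<le> (C * dk s d + C * dk s c) * (v2 - v1)" if c: "0 < c" "c < a" and d: "b < d" "c \<le> d" for c d
  proof -
    have contD: "continuous_on ({c..d} \<times> {v1..v2}) (\<lambda>(t, v). D t v)"
      unfolding D_def case_prod_unfold
      by (intro scaleC.continuous_on continuous_intros continuous_on_compose2[OF contP(1) ci sub[OF c(1)]]
          continuous_on_compose2[OF contP(2) ci sub[OF c(1)]])
    have contray: "continuous_on {c..d} (\<lambda>t. cis v *\<^sub>C h (of_real t * cis v))" if "v \<in> {v1..v2}" for v
      by (intro scaleC.continuous_on continuous_intros continuous_on_compose2[OF contP(2)])
        (use that c in \<open>auto intro: inP\<close>)
    have dv: "((\<lambda>v. \<i> *\<^sub>C D t v) has_integral (cis v2 *\<^sub>C h (of_real t * cis v2) - cis v1 *\<^sub>C h (of_real t * cis v1))) {v1..v2}"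
      if t: "t > 0" for t
    proof (rule fundamental_theorem_of_calculus[OF v])
      fix x assume x: "x \<in> {v1..v2}"
      have c1: "(cis has_vector_derivative \<i> * cis x) (at x within {v1..v2})"
        unfolding has_vector_derivative_def by (rule has_derivative_cis[OF has_derivative_ident])
      show "((\<lambda>v. cis v *\<^sub>C h (of_real t * cis v)) has_vector_derivative \<i> *\<^sub>C D t x) (at x within {v1..v2})"
        using scaleC.has_vector_derivative[OF c1 has_vector_derivative_scaleC_chain[OF has_vector_derivative_arc der[OF t x]]]
        by (simp add: D_def scaleC_scaleC scaleC_add_right mult_ac add.commute)
    qed
    have dt: "((\<lambda>t. \<i> *\<^sub>C D t v) has_integral (\<i> *\<^sub>C ((of_real d * cis v) *\<^sub>C h (of_real d * cis v)) - \<i> *\<^sub>C ((of_real c * cis v) *\<^sub>C h (of_real c * cis v)))) {c..d}"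
      if v: "v \<in> {v1..v2}" for v
    proof (rule fundamental_theorem_of_calculus[OF d(2)])
      fix x assume x: "x \<in> {c..d}"
      then have x0: "x > 0" using c by auto
      have c1: "((\<lambda>x. complex_of_real x * cis v) has_vector_derivative cis v) (at x within {c..d})"
        by (rule has_vector_derivative_ray)
      show "((\<lambda>t. \<i> *\<^sub>C ((of_real t * cis v) *\<^sub>C h (of_real t * cis v))) has_vector_derivative \<i> *\<^sub>C D x v) (at x within {c..d})"
        using bounded_linear.has_vector_derivative[OF bounded_linear_scaleC
            scaleC.has_vector_derivative[OF c1 has_vector_derivative_scaleC_chain[OF c1 der[OF x0 v]]], of \<i>]
        by (simp add: D_def scaleC_scaleC scaleC_add_right mult_ac add.commute)
    qed
    have "integral {c..d} (\<lambda>t. cis v2 *\<^sub>C h (of_real t * cis v2)) - integral {c..d} (\<lambda>t. cis v1 *\<^sub>C h (of_real t * cis v1))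
       = integral {c..d} (\<lambda>t. cis v2 *\<^sub>C h (of_real t * cis v2) - cis v1 *\<^sub>C h (of_real t * cis v1))"
      using v by (intro integral_diff[symmetric] integrable_continuous_real contray) auto
    also have "\<dots> = integral {c..d} (\<lambda>t. integral {v1..v2} (\<lambda>v. \<i> *\<^sub>C D t v))"
      using c by (intro integral_cong) (auto simp: integral_unique[OF dv])
    also have "\<dots> = integral {v1..v2} (\<lambda>v. integral {c..d} (\<lambda>t. \<i> *\<^sub>C D t v))"
    proof -
      have "continuous_on (cbox (c, v1) (d, v2)) (\<lambda>(t, v). \<i> *\<^sub>C D t v)"
        using scaleC.continuous_on[OF continuous_on_const contD, of \<i>]
        by (simp add: cbox_Pair_eq case_prod_unfold)
      from integral_swap_continuous[OF this] show ?thesis by simp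
    qed
    also have "norm \<dots> \<le> (C * dk s d + C * dk s c) * (v2 - v1)"
    proof (rule integral_bound[OF v])
      have "continuous_on {v1..v2} (\<lambda>v. \<i> *\<^sub>C ((of_real d * cis v) *\<^sub>C h (of_real d * cis v)) - \<i> *\<^sub>C ((of_real c * cis v) *\<^sub>C h (of_real c * cis v)))"
        by (intro scaleC.continuous_on continuous_intros continuous_on_compose2[OF contP(2)])
          (use c d in \<open>auto intro: inP\<close>)
      then show "continuous_on {v1..v2} (\<lambda>v. integral {c..d} (\<lambda>t. \<i> *\<^sub>C D t v))"
        by (rule continuous_on_eq) (simp add: integral_unique[OF dt])
      fix x assume x: "x \<in> {v1..v2}"
      have "norm (integral {c..d} (\<lambda>t. \<i> *\<^sub>C D t x)) \<le> norm (\<i> *\<^sub>C ((of_real d * cis x) *\<^sub>C h (of_real d * cis x)))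
         + norm (\<i> *\<^sub>C ((of_real c * cis x) *\<^sub>C h (of_real c * cis x)))"
        unfolding integral_unique[OF dt[OF x]] by (rule norm_triangle_ineq4)
      also have "\<dots> \<le> C * dk s d + C * dk s c"
        using le[of d x] le[of c x] x c d by (auto simp: norm_scaleC norm_mult intro!: add_mono)
      finally show "norm (integral {c..d} (\<lambda>t. \<i> *\<^sub>C D t x)) \<le> C * dk s d + C * dk s c" .
    qed
    finally show ?thesis .
  qed
  have lim: "(\<lambda>k. integral {1 / real (Suc k)..real (Suc k)} (\<lambda>t. cis v *\<^sub>C h (of_real t * cis v))) \<longlonglongrightarrow> ray v h"
    if v: "v \<in> {v1..v2}" for v
  proof -
    have ch: "continuous_on {0<..} (\<lambda>t. h (of_real t * cis v))"
      by (intro continuous_intros continuous_on_compose2[OF contP(2)])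
        (use v in \<open>auto intro: inP\<close>)
    obtain C' where "\<And>t. t > 0 \<Longrightarrow> t * norm (h (of_real t * cis v)) \<le> C' * dk s t"
      using dk_bound_extend[OF ch a] le[OF _ v] by metis
    then show ?thesis using ray_integrable(3)[OF ch s] by blast
  qed
  have "(\<lambda>k. integral {1 / real (Suc k)..real (Suc k)} (\<lambda>t. cis v2 *\<^sub>C h (of_real t * cis v2)) - integral {1 / real (Suc k)..real (Suc k)} (\<lambda>t. cis v1 *\<^sub>C h (of_real t * cis v1))) \<longlonglongrightarrow> 0"
  proof (rule Lim_null_comparison)
    have "(\<lambda>k. (C * dk s (real (Suc k)) + C * dk s (real (Suc k))) * (v2 - v1)) \<longlonglongrightarrow> (C * 0 + C * 0) * (v2 - v1)"
      by (intro tendsto_intros dk_Suc_LIMSEQ s)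
    then show "(\<lambda>k. (C * dk s (real (Suc k)) + C * dk s (real (Suc k))) * (v2 - v1)) \<longlonglongrightarrow> 0" by simp
    \<comment> \<open>From this index on the inner radius is below a and the outer one above b;
      \<open>dk s\<close> takes the same value at both, by inversion.\<close>
    obtain N where N: "real N > max b (1 / a)" using reals_Archimedean2 by blast
    show "\<forall>\<^sub>F k in sequentially. norm (integral {1 / real (Suc k)..real (Suc k)} (\<lambda>t. cis v2 *\<^sub>C h (of_real t * cis v2)) - integral {1 / real (Suc k)..real (Suc k)} (\<lambda>t. cis v1 *\<^sub>C h (of_real t * cis v1)))
      \<le> (C * dk s (real (Suc k)) + C * dk s (real (Suc k))) * (v2 - v1)"
    proof (rule eventually_sequentiallyI[of N])
      fix k assume "N \<le> k"
      then have k: "real (Suc k) > b" "real (Suc k) > 1 / a" "real (Suc k) \<ge> 1" using N by auto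
      have k1: "1 / real (Suc k) < a" using k(2) a by (simp add: field_simps)
      have k2: "1 / real (Suc k) \<le> real (Suc k)"
        using k(3) by (meson divide_le_eq_1_pos le_trans less_le_trans order_trans zero_less_one)
      show "norm (integral {1 / real (Suc k)..real (Suc k)} (\<lambda>t. cis v2 *\<^sub>C h (of_real t * cis v2)) - integral {1 / real (Suc k)..real (Suc k)} (\<lambda>t. cis v1 *\<^sub>C h (of_real t * cis v1)))
      \<le> (C * dk s (real (Suc k)) + C * dk s (real (Suc k))) * (v2 - v1)"
        using arc[of "1 / real (Suc k)" "real (Suc k)"] k k1 k2 dk_inverse[of "real (Suc k)" s]
        by (simp del: of_nat_Suc)
    qed
  qed
  moreover have "(\<lambda>k. integral {1 / real (Suc k)..real (Suc k)} (\<lambda>t. cis v2 *\<^sub>C h (of_real t * cis v2)) - integral {1 / real (Suc k)..real (Suc k)} (\<lambda>t. cis v1 *\<^sub>C h (of_real t * cis v1))) \<longlonglongrightarrow> ray v2 h - ray v1 h"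
    using v by (intro tendsto_diff lim) auto
  ultimately have "ray v2 h - ray v1 h = 0" by (rule LIMSEQ_unique[rotated])
  then show ?thesis by simp
qed

section \<open>Contour integrals over the boundary of a sector\<close>

lemma Re_eq_cmod_cos_Arg: "Re z = cmod z * cos (Arg z)"
  using rcis_cmod_Arg[of z] by (metis Re_rcis)

text \<open>Passing from the argument to its cosine turns membership into a strict inequality of
  continuous functions. This gives openness, and it also decides about points t e^(iv) with v
  outside the range of \<open>Arg\<close>.\<close>

lemma sector_iff:
  assumes "0 < \<theta>" "\<theta> \<le> pi"
  shows "z \<in> sector \<theta> \<longleftrightarrow> z \<noteq> 0 \<and> cmod z * cos \<theta> < Re z"
proof (cases "z = 0")
  case False
  have "cmod z * cos \<theta> < Re z \<longleftrightarrow> cos \<theta> < cos \<bar>Arg z\<bar>"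
    using False by (simp add: Re_eq_cmod_cos_Arg)
  also have "\<dots> \<longleftrightarrow> \<bar>Arg z\<bar> < \<theta>"
    using assms Arg_bounded[of z] by (intro cos_mono_less_eq) auto
  finally show ?thesis using False assms by (auto simp: sector_def)
qed (use assms in \<open>auto simp: sector_def\<close>)

lemma cis_in_sector:
  assumes "t > 0" "\<bar>v\<bar> < \<theta>" "\<theta> \<le> pi"
  shows "of_real t * cis v \<in> sector \<theta>"
proof -
  have "cos \<theta> < cos \<bar>v\<bar>" using assms by (intro cos_monotone_0_pi) auto
  then show ?thesis using assms by (subst sector_iff) (auto simp: norm_mult)
qed

lemma sector_mono: "0 < \<theta> \<Longrightarrow> \<theta> \<le> \<theta>' \<Longrightarrow> sector \<theta> \<subseteq> sector \<theta>'"
  by (auto simp: sector_def)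

lemma open_sector: "0 < \<theta> \<Longrightarrow> \<theta> \<le> pi \<Longrightarrow> open (sector \<theta>)"
proof -
  assume a: "0 < \<theta>" "\<theta> \<le> pi"
  have "sector \<theta> = {z. z \<noteq> 0} \<inter> {z. cmod z * cos \<theta> < Re z}" using sector_iff[OF a] by auto
  moreover have "open {z. cmod z * cos \<theta> < Re z}" by (intro open_Collect_less continuous_intros)
  ultimately show ?thesis by (auto intro!: open_Int open_Collect_neq continuous_intros)
qed

lemma closure_sector_subset:
  assumes "0 \<le> \<omega>" "\<omega> \<le> pi"
  shows "closure (sector \<omega>) \<subseteq> {z. cmod z * cos \<omega> \<le> Re z}"
proof (rule closure_minimal)
  show "sector \<omega> \<subseteq> {z. cmod z * cos \<omega> \<le> Re z}"
  proof (cases "\<omega> = 0")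
    case True
    show ?thesis unfolding True sector_def by auto
  next
    case False
    then have "0 < \<omega>" using assms by simp
    from sector_iff[OF this assms(2)] show ?thesis by (auto intro: less_imp_le)
  qed
  show "closed {z. cmod z * cos \<omega> \<le> Re z}" by (intro closed_Collect_le continuous_intros)
qed

text \<open>The angles from w to 2 pi - w are those of the rays in the complement of the open
  sector. Beyond pi, the reflection of v to 2 pi - v leads back to the range where the cosine
  decreases.\<close>

lemma cos_le_cos_outside:
  assumes "0 \<le> w" "w \<le> v" "v \<le> 2 * pi - w"
  shows "cos v \<le> cos w"
proof (cases "v \<le> pi")
  case True
  then show ?thesis using assms by (intro cos_monotone_0_pi_le) auto
next
  case False
  have "cos v = cos (2 * pi - v)" by (simp add: cos_diff)
  also have "\<dots> \<le> cos w" using assms False by (intro cos_monotone_0_pi_le) auto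
  finally show ?thesis .
qed

text \<open>The bound is required only near 0 and infinity, so that poles at intermediate moduli are
  allowed. It is uniform over the angles in V, as is needed to turn a ray from one angle to
  another.\<close>

definition decays :: "(complex \<Rightarrow> 'b::real_normed_vector) \<Rightarrow> real set \<Rightarrow> bool" where
  "decays h V \<longleftrightarrow> (\<exists>s>0. \<exists>a>0. \<exists>b C. \<forall>t>0. \<forall>v\<in>V. t < a \<or> b < t \<longrightarrow>
      t * norm (h (of_real t * cis v)) \<le> C * dk s t)"

lemma decaysI:
  assumes "s > 0" "a > 0" "\<And>t v. t > 0 \<Longrightarrow> v \<in> V \<Longrightarrow> t < a \<or> b < t \<Longrightarrow>
      t * norm (h (of_real t * cis v)) \<le> C * dk s t"
  shows "decays h V"
  unfolding decays_def using assms(1,2)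
  by (intro exI[of _ s] exI[of _ a] exI[of _ b] exI[of _ C] conjI allI ballI impI assms(3))

lemma decaysE:
  assumes "decays h V"
  obtains s a b C where "s > 0" "a > 0" "\<And>t v. t > 0 \<Longrightarrow> v \<in> V \<Longrightarrow> t < a \<or> b < t \<Longrightarrow>
      t * norm (h (of_real t * cis v)) \<le> C * dk s t"
proof -
  obtain s a b C where *: "s > 0" "a > 0" "\<forall>t>0. \<forall>v\<in>V. t < a \<or> b < t \<longrightarrow>
      t * norm (h (of_real t * cis v)) \<le> C * dk s t"
    using assms unfolding decays_def by blast
  show ?thesis by (rule that[OF *(1,2)]) (use *(3) in blast)
qed

lemma decays_subset:
  assumes "decays h V" "V' \<subseteq> V"
  shows "decays h V'"
proof (rule decaysE[OF assms(1)])
  fix s a b C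
  assume h: "s > 0" "a > 0" "\<And>t v. t > 0 \<Longrightarrow> v \<in> V \<Longrightarrow> t < a \<or> b < t \<Longrightarrow>
      t * norm (h (of_real t * cis v)) \<le> C * dk s t"
  show ?thesis by (rule decaysI[OF h(1,2)], rule h(3)) (use assms(2) in auto)
qed

lemma decays_add:
  assumes "decays h V" "decays k V"
  shows "decays (\<lambda>z. h z + k z) V"
proof -
  obtain s a b C where h: "s > 0" "a > 0" "\<And>t v. t > 0 \<Longrightarrow> v \<in> V \<Longrightarrow> t < a \<or> b < t \<Longrightarrow>
      t * norm (h (of_real t * cis v)) \<le> C * dk s t" by (rule decaysE[OF assms(1)]) blast
  obtain s' a' b' C' where k: "s' > 0" "a' > 0" "\<And>t v. t > 0 \<Longrightarrow> v \<in> V \<Longrightarrow> t < a' \<or> b' < t \<Longrightarrow>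
      t * norm (k (of_real t * cis v)) \<le> C' * dk s' t" by (rule decaysE[OF assms(2)]) blast
  show ?thesis
  proof (rule decaysI[of "min s s'" "min a a'" V "max b b'" _ "\<bar>C\<bar> + \<bar>C'\<bar>"])
    fix t v :: real assume t: "t > 0" "v \<in> V" "t < min a a' \<or> max b b' < t"
    have "t * norm (h (of_real t * cis v)) \<le> C * dk s t" using h(3)[of t v] t by auto
    also have "\<dots> \<le> \<bar>C\<bar> * dk (min s s') t"
      by (rule mult_mono) (auto simp: dk_mono less_imp_le[OF dk_pos])
    finally have 1: "t * norm (h (of_real t * cis v)) \<le> \<bar>C\<bar> * dk (min s s') t" .
    have "t * norm (k (of_real t * cis v)) \<le> C' * dk s' t" using k(3)[of t v] t by auto
    also have "\<dots> \<le> \<bar>C'\<bar> * dk (min s s') t"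
      by (rule mult_mono) (auto simp: dk_mono less_imp_le[OF dk_pos])
    finally have 2: "t * norm (k (of_real t * cis v)) \<le> \<bar>C'\<bar> * dk (min s s') t" .
    have "t * norm (h (of_real t * cis v) + k (of_real t * cis v)) \<le> t * (norm (h (of_real t * cis v)) + norm (k (of_real t * cis v)))"
      using t by (intro mult_left_mono norm_triangle_ineq) auto
    then show "t * norm (h (of_real t * cis v) + k (of_real t * cis v)) \<le> (\<bar>C\<bar> + \<bar>C'\<bar>) * dk (min s s') t"
      using 1 2 by (simp add: distrib_left distrib_right)
  qed (use h k in auto)
qed

lemma decays_bounded_linear:
  assumes "decays h V" "bounded_linear T"
  shows "decays (\<lambda>z. T (h z)) V"
proof -
  obtain s a b C where h: "s > 0" "a > 0" "\<And>t v. t > 0 \<Longrightarrow> v \<in> V \<Longrightarrow> t < a \<or> b < t \<Longrightarrow>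
      t * norm (h (of_real t * cis v)) \<le> C * dk s t" by (rule decaysE[OF assms(1)]) blast
  obtain K where K: "K > 0" "\<And>x. norm (T x) \<le> norm x * K" using bounded_linear.pos_bounded[OF assms(2)] by blast
  show ?thesis
  proof (rule decaysI[OF h(1,2)])
    fix t v :: real assume t: "t > 0" "v \<in> V" "t < a \<or> b < t"
    have "t * norm (T (h (of_real t * cis v))) \<le> t * (norm (h (of_real t * cis v)) * K)"
      using t K by (intro mult_left_mono) auto
    also have "\<dots> \<le> (C * dk s t) * K" using h(3)[OF t] K by (simp add: mult.assoc[symmetric] mult_right_mono)
    finally show "t * norm (T (h (of_real t * cis v))) \<le> (C * K) * dk s t" by (simp add: mult_ac)
  qed
qed

text \<open>Near 0 the function is bounded and t is \<open>dk 1 t\<close>; near infinity it is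
  O(1/t^2), and t times this is O(\<open>dk 1 t\<close>). The thresholds keep z at distance at least
  |p|/2 or t/2 from p, and likewise for q.\<close>

lemma decays_rational:
  assumes "p \<noteq> 0" "q \<noteq> 0"
  shows "decays (\<lambda>z. c / ((z - p) * (z - q)) :: complex) V"
proof (rule decaysI[of 1 "min 1 (min (cmod p) (cmod q) / 2)" V "max 1 (2 * max (cmod p) (cmod q))" _
      "cmod c * 4 / (cmod p * cmod q) + 4 * cmod c"])
  fix t v :: real
  assume t: "t > 0" "v \<in> V" and "t < min 1 (min (cmod p) (cmod q) / 2) \<or> max 1 (2 * max (cmod p) (cmod q)) < t"
  then consider "t < 1" "t < cmod p / 2" "t < cmod q / 2" | "t > 1" "t > 2 * cmod p" "t > 2 * cmod q" by linarith
  then show "t * norm (c / ((of_real t * cis v - p) * (of_real t * cis v - q)))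
      \<le> (cmod c * 4 / (cmod p * cmod q) + 4 * cmod c) * dk 1 t"
  proof cases
    case 1
    have "cmod r / 2 \<le> cmod (of_real t * cis v - r)" if "t < cmod r / 2" for r
      using norm_triangle_ineq2[of r "of_real t * cis v"] that t by (simp add: norm_mult norm_minus_commute)
    then have l: "cmod p / 2 \<le> cmod (of_real t * cis v - p)" "cmod q / 2 \<le> cmod (of_real t * cis v - q)"
      using 1 by auto
    moreover have "0 < cmod p / 2" "0 < cmod q / 2" using assms by auto
    ultimately have pos: "0 < cmod (of_real t * cis v - p)" "0 < cmod (of_real t * cis v - q)" by linarith+
    from l have "(cmod p / 2) * (cmod q / 2) \<le> cmod (of_real t * cis v - p) * cmod (of_real t * cis v - q)"
      by (intro mult_mono) auto
    then have "cmod c / (cmod (of_real t * cis v - p) * cmod (of_real t * cis v - q)) \<le> cmod c / ((cmod p / 2) * (cmod q / 2))"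
      using assms pos by (intro divide_left_mono mult_pos_pos) auto
    then have "t * norm (c / ((of_real t * cis v - p) * (of_real t * cis v - q))) \<le> t * (cmod c * 4 / (cmod p * cmod q))"
      using t by (intro mult_left_mono) (auto simp: norm_mult norm_divide)
    also have "\<dots> \<le> (cmod c * 4 / (cmod p * cmod q) + 4 * cmod c) * t"
      using t by (subst mult.commute) (intro mult_right_mono; simp)
    finally show ?thesis using 1 t by (simp add: dk_less_1)
  next
    case 2
    have *: "t / 2 \<le> cmod (of_real t * cis v - r)" if "t > 2 * cmod r" for r
      using norm_triangle_ineq2[of "of_real t * cis v" r] that t by (simp add: norm_mult)
    have "(t / 2) * (t / 2) \<le> cmod (of_real t * cis v - p) * cmod (of_real t * cis v - q)"
      using 2 t * by (intro mult_mono) auto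
    then have "cmod c / (cmod (of_real t * cis v - p) * cmod (of_real t * cis v - q)) \<le> cmod c / ((t / 2) * (t / 2))"
      using t *[of p] *[of q] 2 by (intro divide_left_mono mult_pos_pos) auto
    then have "t * norm (c / ((of_real t * cis v - p) * (of_real t * cis v - q))) \<le> t * (cmod c / ((t / 2) * (t / 2)))"
      using t by (intro mult_left_mono) (auto simp: norm_mult norm_divide)
    also have "\<dots> = 4 * cmod c / t" using t by (simp add: field_simps)
    also have "\<dots> \<le> (cmod c * 4 / (cmod p * cmod q) + 4 * cmod c) / t"
      using t by (intro divide_right_mono) auto
    finally show ?thesis using 2 t by (simp add: dk_ge_1 powr_minus_divide)
  qed
qed (use assms in auto)

text \<open>Away from the circle |z| = |p| the factor t / |z - p| is bounded, by 2 when t > 2 |p|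
  and by 2 / |p| when t is below both 1 and |p|/2. The decay thus comes from g alone.\<close>

lemma decays_quotient:
  fixes g :: "complex \<Rightarrow> complex"
  assumes p: "p \<noteq> 0" and s: "s > 0"
    and le: "\<And>t v. t > 0 \<Longrightarrow> v \<in> V \<Longrightarrow> cmod (g (of_real t * cis v)) \<le> C * dk s t"
  shows "decays (\<lambda>z. g z / (z - p)) V"
proof (rule decaysI[of s "min 1 (cmod p / 2)" V "2 * cmod p" _ "2 * \<bar>C\<bar> / cmod p + 2 * \<bar>C\<bar>"])
  fix t v :: real
  assume t: "t > 0" "v \<in> V" "t < min 1 (cmod p / 2) \<or> 2 * cmod p < t"
  let ?z = "of_real t * cis v"
  have g: "cmod (g ?z) \<le> \<bar>C\<bar> * dk s t"
    using le[OF t(1,2)] by (rule order_trans) (auto intro!: mult_right_mono less_imp_le[OF dk_pos])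
  have n: "cmod ?z = t" using t by (simp add: norm_mult)
  have "t / cmod (?z - p) \<le> 2 / cmod p + 2"
  proof (cases "2 * cmod p < t")
    case True
    then have "t / 2 \<le> cmod (?z - p)" using norm_triangle_ineq2[of ?z p] n by linarith
    then have "t / cmod (?z - p) \<le> t / (t / 2)" using t by (intro divide_left_mono mult_pos_pos) auto
    then show ?thesis using t by (simp add: add_increasing)
  next
    case False
    then have "cmod p / 2 \<le> cmod (?z - p)" using norm_triangle_ineq2[of p ?z] n t by (simp add: norm_minus_commute)
    then have "t / cmod (?z - p) \<le> t / (cmod p / 2)" using t p by (intro divide_left_mono mult_pos_pos) auto
    also have "\<dots> \<le> 1 / (cmod p / 2)" using t p False by (intro divide_right_mono) auto
    finally show ?thesis by simp
  qed
  then have "t / cmod (?z - p) * cmod (g ?z) \<le> (2 / cmod p + 2) * (\<bar>C\<bar> * dk s t)"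
    using g t by (intro mult_mono) auto
  then show "t * norm (g ?z / (?z - p)) \<le> (2 * \<bar>C\<bar> / cmod p + 2 * \<bar>C\<bar>) * dk s t"
    by (simp add: norm_divide algebra_simps)
qed (use s p in auto)

lemma ray_integrable_decays:
  fixes h :: "complex \<Rightarrow> 'b::{complex_normed_vector,banach}"
  assumes cont: "continuous_on {0<..} (\<lambda>t. h (of_real t * cis v))" and d: "decays h V" and v: "v \<in> V"
  shows "(\<lambda>t. cis v *\<^sub>C h (of_real t * cis v)) integrable_on {0<..}"
    and "(\<lambda>k. integral {1 / real (Suc k)..real (Suc k)} (\<lambda>t. cis v *\<^sub>C h (of_real t * cis v))) \<longlonglongrightarrow> ray v h"
proof -
  obtain s a b C where h: "s > 0" "a > 0" "\<And>t. t > 0 \<Longrightarrow> t < a \<or> b < t \<Longrightarrow>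
      t * norm (h (of_real t * cis v)) \<le> C * dk s t" using v by (rule_tac decaysE[OF d]) blast
  obtain C' where C': "\<And>t. t > 0 \<Longrightarrow> t * norm (h (of_real t * cis v)) \<le> C' * dk s t"
    using dk_bound_extend[OF cont h(2,3)] by blast
  show "(\<lambda>t. cis v *\<^sub>C h (of_real t * cis v)) integrable_on {0<..}"
    by (rule ray_integrable(1)[OF cont h(1) C'])
  show "(\<lambda>k. integral {1 / real (Suc k)..real (Suc k)} (\<lambda>t. cis v *\<^sub>C h (of_real t * cis v))) \<longlonglongrightarrow> ray v h"
    by (rule ray_integrable(3)[OF cont h(1) C'])
qed

lemma ray_rotate_decays:
  fixes h :: "complex \<Rightarrow> 'b::{complex_normed_vector,banach}"
  assumes v: "v1 \<le> v2"
    and der: "\<And>t v. t > 0 \<Longrightarrow> v \<in> {v1..v2} \<Longrightarrow>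
       (h has_derivative (\<lambda>d. d *\<^sub>C h' (of_real t * cis v))) (at (of_real t * cis v))"
    and cont: "\<And>t v. t > 0 \<Longrightarrow> v \<in> {v1..v2} \<Longrightarrow> isCont h' (of_real t * cis v)"
    and d: "decays h {v1..v2}"
  shows "ray v1 h = ray v2 h"
proof -
  obtain s a b C where h: "s > 0" "a > 0" "\<And>t v. t > 0 \<Longrightarrow> v \<in> {v1..v2} \<Longrightarrow> t < a \<or> b < t \<Longrightarrow>
      t * norm (h (of_real t * cis v)) \<le> C * dk s t" by (rule decaysE[OF d]) blast
  show ?thesis by (rule ray_rotate[OF v der cont h])
qed

lemma holomorphic_has_derivative_scaleC:
  fixes h :: "complex \<Rightarrow> complex"
  assumes "h holomorphic_on S" "open S" "z \<in> S"
  shows "(h has_derivative (\<lambda>d. d *\<^sub>C deriv h z)) (at z)" and "isCont (deriv h) z"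
proof -
  have "(h has_field_derivative deriv h z) (at z)" using assms by (rule holomorphic_derivI)
  then show "(h has_derivative (\<lambda>d. d *\<^sub>C deriv h z)) (at z)"
    by (simp add: has_field_derivative_def scaleC_complex_def mult_commute_abs)
  have "continuous_on S (deriv h)"
    using holomorphic_deriv[OF assms(1,2)] by (rule holomorphic_on_imp_continuous_on)
  then show "isCont (deriv h) z" using assms by (simp add: continuous_on_eq_continuous_at)
qed

lemma ray_rotate_holomorphic:
  fixes h :: "complex \<Rightarrow> complex"
  assumes "v1 \<le> v2" "h holomorphic_on S" "open S"
    and "\<And>t v. t > 0 \<Longrightarrow> v \<in> {v1..v2} \<Longrightarrow> of_real t * cis v \<in> S" "decays h {v1..v2}"
  shows "ray v1 h = ray v2 h"
  by (rule ray_rotate_decays[OF assms(1) holomorphic_has_derivative_scaleC(1)[OF assms(2,3)]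
        holomorphic_has_derivative_scaleC(2)[OF assms(2,3)] assms(5)]) (use assms(4) in auto)

lemma continuous_on_ray:
  assumes "continuous_on S h" "\<And>t. t > 0 \<Longrightarrow> of_real t * cis v \<in> S"
  shows "continuous_on {0<..} (\<lambda>t. h (of_real t * cis v))"
  by (rule continuous_on_compose2[OF assms(1)]) (use assms(2) in \<open>auto intro!: continuous_intros\<close>)

section \<open>Algebra of ray integrals, and a kernel with residue 1\<close>

lemma ray_add:
  fixes h k :: "complex \<Rightarrow> 'b::{complex_normed_vector,banach}"
  assumes "(\<lambda>t. cis v *\<^sub>C h (of_real t * cis v)) integrable_on {0<..}"
    "(\<lambda>t. cis v *\<^sub>C k (of_real t * cis v)) integrable_on {0<..}"
  shows "ray v (\<lambda>z. h z + k z) = ray v h + ray v k"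
  unfolding ray_def scaleC_add_right by (rule integral_add[OF assms])

lemma ray_cong: "(\<And>t. t > 0 \<Longrightarrow> h (of_real t * cis v) = k (of_real t * cis v)) \<Longrightarrow> ray v h = ray v k"
  unfolding ray_def by (intro integral_cong) auto

lemma ray_linear:
  fixes h :: "complex \<Rightarrow> 'b::{complex_normed_vector,banach}" and T :: "'b \<Rightarrow> 'c::{complex_normed_vector,banach}"
  assumes "(\<lambda>t. cis v *\<^sub>C h (of_real t * cis v)) integrable_on {0<..}" "bounded_linear T" "\<And>c x. T (c *\<^sub>C x) = c *\<^sub>C T x"
  shows "ray v (\<lambda>z. T (h z)) = T (ray v h)" "(\<lambda>t. cis v *\<^sub>C T (h (of_real t * cis v))) integrable_on {0<..}"
  using integral_linear[OF assms(1,2)] integrable_linear[OF assms(1,2)] by (simp_all add: ray_def o_def assms(3))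

text \<open>The lower boundary ray has the two angles - w and 2 pi - w: the first is reached from w
  through the sector, the second through its complement.\<close>

lemma ray_periodic: "ray (2 * pi - w) h = ray (- w) h"
proof -
  have "cis (2 * pi - w) = cis (- w)" by (simp add: complex_eq_iff cos_diff sin_diff)
  then show ?thesis by (simp add: ray_def)
qed

text \<open>This is 1/(z - p) - 1/(z + 1): it has residue 1 at p, and its decay of order 2 at
  infinity makes the ray integrals converge, which those of 1/(z - p) do not.\<close>

abbreviation kappa :: "complex \<Rightarrow> complex \<Rightarrow> complex" where
  "kappa p z \<equiv> (p + 1) / ((z - p) * (z - - 1))"

text \<open>The hypothesis puts the ray on the imaginary axis. There z^2 = - t^2, so the kernel is -
  2/(1 + t^2), with an arctangent as primitive.\<close>

lemma ray_kappa_perpendicular: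
  assumes c: "cis v * cis v = - 1"
  shows "ray v (kappa 1) = - (of_real pi * cis v)"
proof -
  have eq: "kappa 1 (of_real t * cis v) = - of_real (2 / (1 + t\<^sup>2))" for t :: real
  proof -
    have "(of_real t * cis v - 1) * (of_real t * cis v - - 1) = of_real t * of_real t * (cis v * cis v) - 1"
      by (simp add: algebra_simps)
    also have "\<dots> = - of_real (1 + t\<^sup>2)" unfolding c by (simp add: power2_eq_square)
    finally have prod: "(of_real t * cis v - 1) * (of_real t * cis v - - 1) = - complex_of_real (1 + t\<^sup>2)" .
    show ?thesis by (simp only: prod one_add_one of_real_divide of_real_numeral minus_divide_right)
  qed
  have d: "decays (kappa 1) UNIV" by (rule decays_rational) auto
  have "continuous_on {0<..} (\<lambda>t. kappa 1 (of_real t * cis v))"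
    unfolding eq by (intro continuous_intros) (auto simp: add_nonneg_eq_0_iff)
  from ray_integrable_decays(2)[OF this d UNIV_I]
  have 1: "(\<lambda>k. integral {1 / real (Suc k)..real (Suc k)} (\<lambda>t. cis v *\<^sub>C - of_real (2 / (1 + t\<^sup>2)))) \<longlonglongrightarrow> ray v (kappa 1)"
    by (simp only: eq)
  have 2: "integral {1 / real (Suc k)..real (Suc k)} (\<lambda>t. cis v *\<^sub>C - of_real (2 / (1 + t\<^sup>2)))
     = - (2 * cis v) * of_real (arctan (real (Suc k))) - - (2 * cis v) * of_real (arctan (1 / real (Suc k)))" for k
  proof (rule integral_unique, rule fundamental_theorem_of_calculus)
    show "1 / real (Suc k) \<le> real (Suc k)" by (simp add: field_simps)
    fix x :: real
    have "(arctan has_vector_derivative inverse (1 + x\<^sup>2)) (at x within S)" for S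
      using DERIV_arctan by (simp add: has_real_derivative_iff_has_vector_derivative[symmetric] has_field_derivative_at_within)
    from has_vector_derivative_mult_right[OF bounded_linear.has_vector_derivative[OF bounded_linear_of_real this], of "- (2 * cis v)"]
    show "((\<lambda>x. - (2 * cis v) * complex_of_real (arctan x)) has_vector_derivative
          cis v *\<^sub>C - complex_of_real (2 / (1 + x\<^sup>2))) (at x within {1 / real (Suc k)..real (Suc k)})"
      by (simp add: scaleC_complex_def divide_inverse mult_ac del: of_nat_Suc)
  qed
  have l1: "(\<lambda>k. arctan (real (Suc k))) \<longlonglongrightarrow> pi / 2"
    by (rule filterlim_compose[OF tendsto_arctan_at_top filterlim_compose[OF filterlim_real_sequentially filterlim_Suc]])
  have l2: "(\<lambda>k. 1 / real (Suc k)) \<longlonglongrightarrow> 0"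
    by (rule LIMSEQ_inverse_real_of_nat[unfolded inverse_eq_divide])
  have 3: "(\<lambda>k. - (2 * cis v) * complex_of_real (arctan (real (Suc k))) - - (2 * cis v) * of_real (arctan (1 / real (Suc k))))
     \<longlonglongrightarrow> - (2 * cis v) * of_real (pi / 2) - - (2 * cis v) * of_real (arctan 0)"
    by (intro tendsto_diff tendsto_mult tendsto_const tendsto_of_real l1 tendsto_arctan l2)
  show ?thesis using LIMSEQ_unique[OF 1[unfolded 2] 3] by simp
qed

text \<open>Both poles 1 and - 1 are real, so each boundary ray can be turned to the imaginary axis
  inside its open half-plane.\<close>

lemma ray_kappa_one:
  assumes w: "0 < w" "w < pi"
  shows "ray (- w) (kappa 1) - ray w (kappa 1) = 2 * of_real pi * \<i>"
proof -
  have rot: "ray v1 (kappa 1) = ray v2 (kappa 1)"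
    if "v1 \<le> v2" and ne: "\<And>v. v \<in> {v1..v2} \<Longrightarrow> sin v \<noteq> 0" for v1 v2
  proof (rule ray_rotate_holomorphic[OF that(1), of _ "{z. Im z \<noteq> 0}"])
    have "z - 1 \<noteq> 0" "z + 1 \<noteq> 0" if "Im z \<noteq> 0" for z using that by (auto simp: complex_eq_iff)
    then show "kappa 1 holomorphic_on {z. Im z \<noteq> 0}" by (intro holomorphic_intros) simp
    show "open {z. Im z \<noteq> 0}" by (intro open_Collect_neq continuous_intros)
    show "decays (kappa 1) {v1..v2}" by (rule decays_rational) auto
  qed (use ne in auto)
  have s: "sin v \<noteq> 0" if "0 < v" "v < pi" for v using sin_gt_zero[OF that] by simp
  have "ray w (kappa 1) = ray (pi / 2) (kappa 1)"
  proof (cases "w \<le> pi / 2")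
    case True
    then show ?thesis using w by (intro rot s) auto
  next
    case False
    then show ?thesis using w by (intro rot[symmetric] s) auto
  qed
  moreover have s': "sin v \<noteq> 0" if "- pi < v" "v < 0" for v
    using s[of "- v"] that by simp
  have "ray (- w) (kappa 1) = ray (- (pi / 2)) (kappa 1)"
  proof (cases "w \<le> pi / 2")
    case True
    then show ?thesis using w by (intro rot[symmetric] s') auto
  next
    case False
    then show ?thesis using w by (intro rot s') auto
  qed
  moreover have "ray (pi / 2) (kappa 1) = - (of_real pi * \<i>)"
    using ray_kappa_perpendicular[of "pi / 2"] by (simp add: cis_mult)
  moreover have "ray (- (pi / 2)) (kappa 1) = of_real pi * \<i>"
    using ray_kappa_perpendicular[of "- (pi / 2)"] by (simp add: cis_mult cis_inverse[symmetric] del: cis_inverse) 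
  ultimately show ?thesis by simp
qed

section \<open>Cauchy's formula on a sector\<close>

lemma ray_notin_sector:
  assumes "t > 0" "0 < w" "w \<le> v" "v \<le> 2 * pi - w" "w < pi"
  shows "of_real t * cis v \<notin> sector w"
  using cos_le_cos_outside[of w v] assms by (subst sector_iff) (auto simp: norm_mult)

lemma ray_neg_notin_sector: "t > 0 \<Longrightarrow> 0 < w \<Longrightarrow> w < pi \<Longrightarrow> of_real t * cis (- w) \<notin> sector w"
  by (subst sector_iff) (auto simp: norm_mult)

lemma kappa_split:
  assumes "z \<noteq> p" "z \<noteq> 1" "z \<noteq> - 1"
  shows "kappa p z = kappa 1 z + (p - 1) / ((z - p) * (z - 1))"
proof -
  have "z + 1 \<noteq> 0" using assms(3) by (metis add_eq_0_iff2)
  then show ?thesis using assms by (simp add: divide_simps) (simp add: algebra_simps)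
qed

text \<open>The difference from \<open>kappa 1\<close> has both its poles p and 1 inside the sector
  and decays to second order. Its ray at w can therefore be turned through the complement to 2 pi -
  w, that is, to - w, and it contributes nothing.\<close>

lemma ray_kappa:
  assumes w: "0 < w" "w < pi" and p: "p \<in> sector w"
  shows "ray (- w) (kappa p) - ray w (kappa p) = 2 * of_real pi * \<i>"
    and "v \<in> {- w, w} \<Longrightarrow> (\<lambda>t. cis v *\<^sub>C kappa p (of_real t * cis v)) integrable_on {0<..}"
proof -
  have one: "1 \<in> sector w" using w sector_iff[of w 1] cos_monotone_0_pi[of 0 w] by simp
  have mone: "- 1 \<notin> sector w" using w sector_iff[of w "- 1"] cos_monotone_0_pi[of w pi] by simp
  have p0: "p \<noteq> 0" using p w by (auto simp: sector_iff)
  define S where "S = - {p, 1, - 1}"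
  have oS: "open S" unfolding S_def by (intro open_Compl finite_imp_closed) auto
  have inS: "of_real t * cis v \<in> S" if "t > 0" "v \<in> {- w, w}" for t v
  proof -
    have "of_real t * cis v \<notin> sector w"
      using ray_notin_sector[of t w v] ray_neg_notin_sector[of t w] that w by auto
    moreover have "of_real t * cis v \<noteq> - 1"
    proof
      assume "of_real t * cis v = - 1"
      then have "Im (of_real t * cis v) = 0" by simp
      then have "sin v = 0" using that by simp
      then show False using that w sin_gt_zero[of w] by auto
    qed
    ultimately show ?thesis using p one unfolding S_def by auto
  qed
  have int: "(\<lambda>t. cis v *\<^sub>C h (of_real t * cis v)) integrable_on {0<..}"
    if "h holomorphic_on S" "decays h UNIV" "v \<in> {- w, w}" for v and h :: "complex \<Rightarrow> complex"
    by (rule ray_integrable_decays(1)[OF continuous_on_ray that(2)])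
      (use that inS holomorphic_on_imp_continuous_on in auto)
  have k: "kappa p holomorphic_on S" "decays (kappa p) UNIV" if "p \<in> - S" "p \<noteq> 0" for p
    using that by (intro holomorphic_intros; auto simp: S_def eq_neg_iff_add_eq_0) (rule decays_rational; simp add: that)
  then show "v \<in> {- w, w} \<Longrightarrow> (\<lambda>t. cis v *\<^sub>C kappa p (of_real t * cis v)) integrable_on {0<..}"
    using p0 by (intro int) (auto simp: S_def)
  define \<eta> where "\<eta> z = (p - 1) / ((z - p) * (z - 1))" for z
  have \<eta>: "\<eta> holomorphic_on - {p, 1}" "decays \<eta> UNIV" unfolding \<eta>_def
    using p0 by (intro holomorphic_intros decays_rational; auto)+
  have "ray w \<eta> = ray (2 * pi - w) \<eta>"
  proof (rule ray_rotate_holomorphic[OF _ \<eta>(1)])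
    show "open (- {p, 1})" by (intro open_Compl finite_imp_closed) auto
    show "decays \<eta> {w..2 * pi - w}" using \<eta>(2) by (rule decays_subset) simp
    show "of_real t * cis v \<in> - {p, 1}" if "0 < t" "v \<in> {w..2 * pi - w}" for t v
      using ray_notin_sector[of t w v] that w p one by auto
  qed (use w in auto)
  then have r\<eta>: "ray w \<eta> = ray (- w) \<eta>" by (simp add: ray_periodic)
  have split: "ray v (kappa p) = ray v (kappa 1) + ray v \<eta>" if v: "v \<in> {- w, w}" for v
  proof -
    have "ray v (kappa p) = ray v (\<lambda>z. kappa 1 z + \<eta> z)"
    proof (rule ray_cong)
      fix t :: real assume "t > 0"
      then have "of_real t * cis v \<in> S" using inS v by blast
      then show "kappa p (of_real t * cis v) = kappa 1 (of_real t * cis v) + \<eta> (of_real t * cis v)"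
        unfolding S_def \<eta>_def by (intro kappa_split) auto
    qed
    also have "\<dots> = ray v (kappa 1) + ray v \<eta>"
      by (intro ray_add int k v \<eta> holomorphic_on_subset[OF \<eta>(1)]) (auto simp: S_def)
    finally show ?thesis .
  qed
  show "ray (- w) (kappa p) - ray w (kappa p) = 2 * of_real pi * \<i>"
    using ray_kappa_one[OF w] split[of w] split[of "- w"] r\<eta> by simp
qed

text \<open>The functions g for which the Cauchy integral of g(z) (z - A)^-1 converges absolutely.
  The resolvent contributes the factor 1/|z|, so unlike in \<open>decays\<close> there is no factor
  |z| in the bound.\<close>

definition decaying :: "real \<Rightarrow> (complex \<Rightarrow> complex) \<Rightarrow> bool" where
  "decaying \<theta> g \<longleftrightarrow> g holomorphic_on sector \<theta> \<and>
     (\<exists>s>0. \<exists>C\<ge>0. \<forall>z\<in>sector \<theta>. cmod (g z) \<le> C * dk s (cmod z))"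

lemma decayingE:
  assumes "decaying \<theta> g"
  obtains s C where "s > 0" "C \<ge> 0" "\<And>z. z \<in> sector \<theta> \<Longrightarrow> cmod (g z) \<le> C * dk s (cmod z)"
  using assms unfolding decaying_def by blast

text \<open>The pole p lies outside the closed sector of angle w, so the ray can be turned from - w
  to w through the interior.\<close>

lemma ray_quotient_outside:
  assumes g: "decaying \<theta> g" and w: "0 < w" "w < \<theta>" "\<theta> \<le> pi"
    and p: "p \<noteq> 0" "Re p < cmod p * cos w"
  shows "ray (- w) (\<lambda>z. g z / (z - p)) = ray w (\<lambda>z. g z / (z - p))"
proof (rule ray_rotate_holomorphic[of "- w" w _ "sector \<theta> - {p}"])
  obtain s C where s: "s > 0" "C \<ge> 0" "\<And>z. z \<in> sector \<theta> \<Longrightarrow> cmod (g z) \<le> C * dk s (cmod z)"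
    by (rule decayingE[OF g]) blast
  show "(\<lambda>z. g z / (z - p)) holomorphic_on sector \<theta> - {p}"
    using g unfolding decaying_def by (intro holomorphic_intros) (auto intro: holomorphic_on_subset)
  show "open (sector \<theta> - {p})" using w by (intro open_delete open_sector) auto
  show "decays (\<lambda>z. g z / (z - p)) {- w..w}"
    by (rule decays_quotient[OF p(1) s(1), of _ _ C])
      (use s(3)[OF cis_in_sector] w in \<open>auto simp: norm_mult\<close>)
  fix t v :: real assume t: "t > 0" "v \<in> {- w..w}"
  have "cos w \<le> cos \<bar>v\<bar>" using t w by (intro cos_monotone_0_pi_le) auto
  then have "t * cos w \<le> Re (of_real t * cis v)" using t by simp
  then have "of_real t * cis v \<noteq> p" using p(2) t by (auto simp: norm_mult)
  then show "of_real t * cis v \<in> sector \<theta> - {p}" using cis_in_sector[of t v \<theta>] t w by auto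
qed (use w in auto)

lemma decaying_continuous_on_ray:
  assumes "decaying \<theta> g" "\<theta> \<le> pi" "\<bar>v\<bar> < \<theta>"
  shows "continuous_on {0<..} (\<lambda>t. g (of_real t * cis v))"
  by (rule continuous_on_ray[of "sector \<theta>"])
    (use assms in \<open>auto simp: decaying_def cis_in_sector holomorphic_on_imp_continuous_on\<close>)

text \<open>Subtracting g(p) times \<open>kappa p\<close> removes the pole. The remainder is
  holomorphic on the whole sector and contributes nothing, so the residue of the kernel is all that
  is left.\<close>

lemma ray_quotient_inside:
  assumes g: "decaying \<theta> g" and w: "0 < w" "w < \<theta>" "\<theta> \<le> pi" and p: "p \<in> sector w"
  shows "ray (- w) (\<lambda>z. g z / (z - p)) - ray w (\<lambda>z. g z / (z - p)) = 2 * of_real pi * \<i> * g p"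
proof -
  have wpi: "w < pi" using w by simp
  have p0: "p \<noteq> 0" using p w by (auto simp: sector_iff)
  have p\<theta>: "p \<in> sector \<theta>" using p sector_mono[of w \<theta>] w by auto
  have m1: "- 1 \<notin> sector \<theta>" using w sector_iff[of \<theta> "- 1"] cos_ge_minus_one[of \<theta>] by auto
  have m1': "z - - 1 \<noteq> 0" if "z \<in> sector \<theta>" for z using m1 that by (auto simp: add_eq_0_iff2)
  have hol: "g holomorphic_on sector \<theta>" using g by (simp add: decaying_def)
  have op: "open (sector \<theta>)" using w by (intro open_sector) auto
  obtain s C where s: "s > 0" "C \<ge> 0" "\<And>z. z \<in> sector \<theta> \<Longrightarrow> cmod (g z) \<le> C * dk s (cmod z)"
    by (rule decayingE[OF g]) blast
  have dq: "decays (\<lambda>z. g z / (z - p)) {- w..w}"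
    by (rule decays_quotient[OF p0 s(1), of _ _ C])
      (use s(3)[OF cis_in_sector] w in \<open>auto simp: norm_mult\<close>)
  \<comment> \<open>This is g/(z - p) - g(p) \<open>kappa p\<close> with the singularity at p filled
    in. The term g(p)/(z + 1) cancels the behaviour - g(p)/z at infinity of the difference quotient;
    its pole - 1 is outside the sector.\<close>
  define q where "q z = (if z = p then deriv g p else (g z - g p) / (z - p)) + g p / (z - - 1)" for z
  have qhol: "q holomorphic_on sector \<theta>"
    unfolding q_def by (intro holomorphic_intros pole_lemma_open hol op) (use m1' in auto)
  have qeq: "q z = g z / (z - p) + (- g p) * kappa p z" if "z \<noteq> p" "z \<noteq> - 1" for z
  proof -
    have "z + 1 \<noteq> 0" using that(2) by (metis add_eq_0_iff2)
    then show ?thesis using that(1) by (simp add: q_def divide_simps) (simp add: algebra_simps)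
  qed
  have dk': "decays (\<lambda>z. (- g p) * kappa p z) {- w..w}"
    by (rule decays_bounded_linear[OF decays_rational bounded_linear_mult_right]) (use p0 in auto)
  have "decays q {- w..w}"
  proof -
    from decays_add[OF dq dk'] obtain s a b C where h: "s > 0" "a > 0" "\<And>t v. t > 0 \<Longrightarrow> v \<in> {- w..w} \<Longrightarrow> t < a \<or> b < t \<Longrightarrow>
      t * norm (g (of_real t * cis v) / (of_real t * cis v - p) + (- g p) * kappa p (of_real t * cis v)) \<le> C * dk s t"
      by (rule decaysE) blast
    show ?thesis
    \<comment> \<open>Moving the thresholds to |p| excludes z = p, where the quotient formula for
      \<open>q\<close> does not apply.\<close>
    proof (rule decaysI[of s "min a (cmod p)" _ "max b (cmod p)" _ C])
      fix t v :: real assume t: "t > 0" "v \<in> {- w..w}" "t < min a (cmod p) \<or> max b (cmod p) < t"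
      then have ab: "t < a \<or> b < t" by auto
      have "of_real t * cis v \<noteq> p" using t by (auto simp: norm_mult)
      moreover have "\<bar>v\<bar> < \<theta>" using t(2) w unfolding atLeastAtMost_iff by linarith
      then have "of_real t * cis v \<noteq> - 1" using cis_in_sector[of t v \<theta>] t w m1 by auto
      ultimately show "t * norm (q (of_real t * cis v)) \<le> C * dk s t"
        using h(3)[OF t(1,2) ab] by (simp only: qeq simp_thms)
    qed (use h p0 in auto)
  qed
  then have rq: "ray (- w) q = ray w q"
    by (intro ray_rotate_holomorphic[OF _ qhol op]) (use w in \<open>auto intro!: cis_in_sector\<close>)
  have split: "ray v (\<lambda>z. g z / (z - p)) = ray v q + g p * ray v (kappa p)" if v: "v \<in> {- w, w}" for v
  proof -
    have ne: "of_real t * cis v \<noteq> p" "of_real t * cis v \<noteq> - 1" if t: "t > 0" for t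
    proof -
      have "of_real t * cis v \<notin> sector w"
        using ray_notin_sector[of t w v] ray_neg_notin_sector[of t w] v t w by auto
      then show "of_real t * cis v \<noteq> p" using p by auto
      show "of_real t * cis v \<noteq> - 1" using cis_in_sector[of t v \<theta>] t v w m1 by auto
    qed
    have qi: "(\<lambda>t. cis v *\<^sub>C q (of_real t * cis v)) integrable_on {0<..}"
      by (rule ray_integrable_decays(1)[OF continuous_on_ray[OF holomorphic_on_imp_continuous_on[OF qhol]] \<open>decays q {- w..w}\<close>])
        (use v w in \<open>auto intro!: cis_in_sector\<close>)
    have ki: "(\<lambda>t. cis v *\<^sub>C kappa p (of_real t * cis v)) integrable_on {0<..}"
      by (rule ray_kappa(2)[OF w(1) wpi p v])
    have lin: "ray v (\<lambda>z. g p * kappa p z) = g p * ray v (kappa p)"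
      "(\<lambda>t. cis v *\<^sub>C (g p * kappa p (of_real t * cis v))) integrable_on {0<..}"
      using ray_linear[OF ki bounded_linear_mult_right, of "g p"] by (simp_all add: scaleC_complex_def mult_ac)
    have "ray v (\<lambda>z. g z / (z - p)) = ray v (\<lambda>z. q z + g p * kappa p z)"
      by (rule ray_cong) (simp add: qeq ne)
    also have "\<dots> = ray v q + g p * ray v (kappa p)"
      using ray_add[OF qi lin(2)] lin(1) by simp
    finally show ?thesis .
  qed
  have "ray (- w) (\<lambda>z. g z / (z - p)) - ray w (\<lambda>z. g z / (z - p)) = g p * (ray (- w) (kappa p) - ray w (kappa p))"
    using split[of w] split[of "- w"] rq by (simp add: algebra_simps)
  then show ?thesis using ray_kappa(1)[OF w(1) wpi p] by simp
qed

section \<open>The calculus for decaying functions\<close>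

text \<open>The inner integral is continuous in x, as a locally uniform limit of its truncations: on
  compact sets \<open>g\<close> is bounded, which makes the tail estimate C g(x) r_k uniform.
  Continuity and the bound C G g(x) then give integrability.\<close>

lemma parameter_integral_integrable:
  fixes h :: "real \<Rightarrow> real \<Rightarrow> 'b::banach"
  assumes cont: "continuous_on ({0<..} \<times> {0<..}) (\<lambda>(x, y). h x y)"
    and le: "\<And>x y. x > 0 \<Longrightarrow> y > 0 \<Longrightarrow> norm (h x y) \<le> C * (g x * g y)"
    and g: "g integrable_on {0<..}" and g0: "\<And>x. x > 0 \<Longrightarrow> g x \<ge> 0" and C: "C \<ge> 0"
    and contg: "continuous_on {0<..} g"
  shows "(\<lambda>x. integral {0<..} (h x)) integrable_on {0<..}"
proof -
  let ?I = "\<lambda>k. {1 / real (Suc k)..real (Suc k)}"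
  define a where "a x = integral {0<..} (h x)" for x
  define G where "G = integral {0<..} g"
  define r where "r k = G - integral (?I k) g" for k
  have pos: "x > 0" if "x \<in> ?I k" for x k
  proof -
    have "0 < 1 / real (Suc k)" by simp
    then show ?thesis using that unfolding atLeastAtMost_iff by linarith
  qed
  have gi: "(\<lambda>y. (C * g x) * g y) integrable_on {0<..}" for x
    using integrable_cmul[OF g, of "C * g x"] by simp
  have le': "norm (h x y) \<le> (C * g x) * g y" if "x > 0" "y > 0" for x y
    using le[OF that] by (simp add: mult.assoc)
  have hx: "h x integrable_on {0<..}" if "x > 0" for x
  proof (rule dominated_integrable[OF _ le'[OF that] gi])
    have "continuous_on {0<..} (\<lambda>y. case (x, y) of (x, y) \<Rightarrow> h x y)"
      by (rule continuous_on_compose2[OF cont]) (use that in \<open>auto intro!: continuous_intros\<close>)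
    then show "continuous_on {0<..} (h x)" by simp
  qed
  have inner: "norm (a x - integral (?I k) (h x)) \<le> C * g x * r k" if "x > 0" for x k
    using dominated_truncated_LIMSEQ(1)[OF hx[OF that] le'[OF that] gi, of k]
    unfolding a_def r_def G_def by (simp add: right_diff_distrib del: of_nat_Suc)
  have ca: "norm (a x) \<le> C * G * g x" if "x > 0" for x
    using integral_norm_bound_integral[OF hx[OF that] gi] le'[OF that]
    unfolding a_def G_def by (simp add: mult_ac)
  have g1: "g absolutely_integrable_on {0<..}"
    using g g0 by (intro nonnegative_absolutely_integrable_1) auto
  have "(\<lambda>k. integral (?I k) g) \<longlonglongrightarrow> G" unfolding G_def by (rule integral_truncated_LIMSEQ[OF g1])
  then have r: "r \<longlonglongrightarrow> G - G" unfolding r_def by (intro tendsto_intros)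
  have gk: "integral (?I k) g \<le> G" for k
    unfolding G_def
    by (rule integral_subset_le[OF _ integrable_on_subinterval[OF g] g]) (use pos g0 in auto)
  have conta: "continuous_on {c..d} a" if c: "0 < c" for c d
  proof (rule uniform_limit_theorem)
    show "\<forall>\<^sub>F k in sequentially. continuous_on {c..d} (\<lambda>x. integral (cbox (1 / real (Suc k)) (real (Suc k))) (h x))"
      by (rule always_eventually, rule allI, rule integral_continuous_on_param, rule continuous_on_subset[OF cont])
        (use pos c in \<open>auto simp del: of_nat_Suc\<close>)
    obtain B where B: "\<And>x. x \<in> {c..d} \<Longrightarrow> \<bar>g x\<bar> \<le> B"
    proof -
      have "compact (g ` {c..d})"
        by (intro compact_continuous_image continuous_on_subset[OF contg]) (use c in auto)
      from compact_imp_bounded[OF this] obtain B where "\<forall>y\<in>g ` {c..d}. norm y \<le> B"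
        unfolding bounded_iff by blast
      then show ?thesis by (intro that[of B]) auto
    qed
    show "uniform_limit {c..d} (\<lambda>k x. integral (cbox (1 / real (Suc k)) (real (Suc k))) (h x)) a sequentially"
    proof (rule uniform_limitI)
      fix e :: real assume e: "e > 0"
      have "(\<lambda>k. C * B * r k) \<longlonglongrightarrow> C * B * (G - G)" by (intro tendsto_intros r)
      then have "\<forall>\<^sub>F k in sequentially. C * B * r k < e" by (rule order_tendstoD) (use e in simp)
      then show "\<forall>\<^sub>F k in sequentially. \<forall>x\<in>{c..d}. dist (integral (cbox (1 / real (Suc k)) (real (Suc k))) (h x)) (a x) < e"
      proof eventually_elim
        case (elim k)
        show ?case
        proof
          fix x assume x: "x \<in> {c..d}"
          then have x0: "x > 0" using c by auto
          have "dist (integral (cbox (1 / real (Suc k)) (real (Suc k))) (h x)) (a x) \<le> C * g x * r k"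
            using inner[OF x0, of k] by (simp add: dist_norm norm_minus_commute del: of_nat_Suc)
          also have "\<dots> \<le> C * B * r k"
            using B[OF x] gk[of k] C unfolding r_def by (intro mult_right_mono mult_left_mono) auto
          finally show "dist (integral (cbox (1 / real (Suc k)) (real (Suc k))) (h x)) (a x) < e" using elim by simp
        qed
      qed
    qed
  qed simp
  have "isCont a x" if "x > 0" for x
    using continuous_on_interior[OF conta[of "x / 2" "2 * x"], of x] that by simp
  then have "continuous_on {0<..} a" by (simp add: continuous_on_eq_continuous_at)
  moreover have "(\<lambda>x. C * G * g x) integrable_on {0<..}" using integrable_cmul[OF g, of "C * G"] by simp
  ultimately have "a integrable_on {0<..}" using ca by (rule_tac dominated_integrable)
  then show ?thesis unfolding a_def .
qed

section \<open>Bounded complex-linear operators and their graphs\<close>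

lemma op_graph_inject: "op_graph S = op_graph T \<longleftrightarrow> S = T"
  unfolding op_graph_def by (auto simp: set_eq_iff intro: blinfun_eqI)

lemma bounded_op_of_op_graph: "bounded_op_of (op_graph T) = T"
  unfolding bounded_op_of_def by (simp add: op_graph_inject)

lemma bounded_opsD: "T \<in> bounded_ops \<Longrightarrow> blinfun_apply T (c *\<^sub>C x) = c *\<^sub>C blinfun_apply T x"
  by (simp add: bounded_ops_def)

lemma bounded_ops_intros:
  "S \<in> bounded_ops \<Longrightarrow> T \<in> bounded_ops \<Longrightarrow> S + T \<in> bounded_ops"
  "S \<in> bounded_ops \<Longrightarrow> T \<in> bounded_ops \<Longrightarrow> S - T \<in> bounded_ops"
  "S \<in> bounded_ops \<Longrightarrow> - S \<in> bounded_ops"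
  "S \<in> bounded_ops \<Longrightarrow> T \<in> bounded_ops \<Longrightarrow> S o\<^sub>L T \<in> bounded_ops"
  "S \<in> bounded_ops \<Longrightarrow> c *\<^sub>C S \<in> bounded_ops"
  "id_blinfun \<in> bounded_ops"
  by (auto simp: bounded_ops_def blinfun.add_left blinfun.diff_left blinfun.minus_left
      scaleC_add_right scaleC.diff_right scaleC.minus_right scaleC_blinfun.rep_eq scaleC_scaleC mult.commute)

lemma scaleC_compose_left: "(c *\<^sub>C S) o\<^sub>L T = c *\<^sub>C (S o\<^sub>L T)"
  by (rule blinfun_eqI) (simp add: scaleC_blinfun.rep_eq)

lemma scaleC_compose_right: "S \<in> bounded_ops \<Longrightarrow> S o\<^sub>L (c *\<^sub>C T) = c *\<^sub>C (S o\<^sub>L T)"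
  by (rule blinfun_eqI) (simp add: scaleC_blinfun.rep_eq bounded_opsD)

interpretation compose: bounded_bilinear "(o\<^sub>L)"
  by (rule bounded_bilinear_blinfun_compose)

text \<open>Elements of the function type are real-linear only, so complex linearity has to be
  carried through the integral, by evaluating at c x and at x under the integral sign.\<close>

lemma ray_bounded_ops:
  fixes h :: "complex \<Rightarrow> ('a::complex_banach \<Rightarrow>\<^sub>L 'a)"
  assumes i: "(\<lambda>t. cis v *\<^sub>C h (of_real t * cis v)) integrable_on {0<..}"
    and h: "\<And>t. t > 0 \<Longrightarrow> h (of_real t * cis v) \<in> bounded_ops"
  shows "ray v h \<in> bounded_ops"
  unfolding bounded_ops_def
proof (intro CollectI allI)
  fix c :: complex and x :: 'a
  have l: "bounded_linear (\<lambda>T. blinfun_apply T (c *\<^sub>C x) :: 'a)" "bounded_linear (\<lambda>T. c *\<^sub>C blinfun_apply T x :: 'a)"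
    by (intro bounded_linear_intros bounded_linear_compose[OF bounded_linear_scaleC])+
  have "blinfun_apply (ray v h) (c *\<^sub>C x) = integral {0<..} (\<lambda>t. blinfun_apply (cis v *\<^sub>C h (of_real t * cis v)) (c *\<^sub>C x))"
    unfolding ray_def using integral_linear[OF i l(1)] by (simp add: o_def)
  also have "\<dots> = integral {0<..} (\<lambda>t. c *\<^sub>C blinfun_apply (cis v *\<^sub>C h (of_real t * cis v)) x)"
    by (rule integral_cong) (auto intro!: bounded_opsD bounded_ops_intros h)
  also have "\<dots> = c *\<^sub>C blinfun_apply (ray v h) x"
    unfolding ray_def using integral_linear[OF i l(2)] by (simp add: o_def)
  finally show "blinfun_apply (ray v h) (c *\<^sub>C x) = c *\<^sub>C blinfun_apply (ray v h) x" .
qed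

text \<open>Caratheodory's form of the derivative, in which the resolvent identity is already a
  proof of differentiability.\<close>

lemma has_derivative_scaleC_Caratheodory:
  fixes h Q :: "complex \<Rightarrow> 'b::complex_normed_vector"
  assumes eq: "\<And>y. y \<in> S \<Longrightarrow> h y = h z + (y - z) *\<^sub>C Q y" and S: "open S" "z \<in> S" and Q: "isCont Q z"
  shows "(h has_derivative (\<lambda>d. d *\<^sub>C Q z)) (at z)"
  unfolding has_derivative_at
proof (intro conjI)
  show "bounded_linear (\<lambda>d. d *\<^sub>C Q z)" by (rule scaleC.bounded_linear_left)
  have "(\<lambda>d. norm (Q (z + d) - Q z)) \<midarrow>0\<rightarrow> norm (Q z - Q z)"
    using Q by (intro tendsto_intros) (simp add: isCont_iff)
  then have lim: "(\<lambda>d. norm (Q (z + d) - Q z)) \<midarrow>0\<rightarrow> 0" by simp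
  have "\<forall>\<^sub>F y in at z. y \<in> S" using S by (rule eventually_at_in_open')
  then have ev: "\<forall>\<^sub>F d in at 0. z + d \<in> S"
    by (subst (asm) at_to_0) (simp add: eventually_filtermap add.commute)
  show "(\<lambda>d. norm (h (z + d) - h z - d *\<^sub>C Q z) / norm d) \<midarrow>0\<rightarrow> 0"
  proof (rule Lim_transform_eventually[OF lim])
    show "\<forall>\<^sub>F d in at 0. norm (Q (z + d) - Q z) = norm (h (z + d) - h z - d *\<^sub>C Q z) / norm d"
      using ev eventually_at_ball'[OF zero_less_one, of 0 UNIV]
    proof eventually_elim
      case (elim d)
      have "h (z + d) - h z - d *\<^sub>C Q z = d *\<^sub>C (Q (z + d) - Q z)"
        using eq[OF elim(1)] by (simp add: scaleC.diff_right)
      then show ?case using elim(2) by (simp add: norm_scaleC)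
    qed
  qed
qed

section \<open>Resolvents off the sector and the Cauchy integral\<close>

locale sectorial_operator =
  fixes A :: "('a::complex_banach) rel" and \<omega> :: real
  assumes sectorial: "sectorial \<omega> A" and dense_range: "closure (Range A) = UNIV"
begin

abbreviation R :: "complex \<Rightarrow> 'a \<Rightarrow>\<^sub>L 'a" where
  "R \<equiv> resolvent A"

lemma angle: "0 \<le> \<omega>" "\<omega> < pi"
  using sectorial by (auto simp: sectorial_def)

lemma linear: "linear_operator A"
  using sectorial by (auto simp: sectorial_def)

lemma outside_resolvent:
  assumes "Re z < cmod z * cos \<omega>"
  shows "R z \<in> bounded_ops" "(affine_op z (- 1) A)\<inverse> = op_graph (R z)"
proof -
  have "z \<notin> closure (sector \<omega>)" using closure_sector_subset[of \<omega>] angle assms by auto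
  then have "z \<in> resolvent_set A" using sectorial by (auto simp: sectorial_def spectrum_def)
  then obtain T where T: "T \<in> bounded_ops" "(affine_op z (- 1) A)\<inverse> = op_graph T"
    by (auto simp: resolvent_set_def)
  then have "R z = T" by (simp add: resolvent_def bounded_op_of_op_graph)
  with T show "R z \<in> bounded_ops" "(affine_op z (- 1) A)\<inverse> = op_graph (R z)" by auto
qed

lemma resolvent_in_graph:
  assumes "Re z < cmod z * cos \<omega>"
  shows "(blinfun_apply (R z) x, z *\<^sub>C blinfun_apply (R z) x - x) \<in> A"
proof -
  have "(x, blinfun_apply (R z) x) \<in> (affine_op z (- 1) A)\<inverse>"
    unfolding outside_resolvent(2)[OF assms] by (auto simp: op_graph_def)
  then obtain y where "(blinfun_apply (R z) x, y) \<in> A" "x = z *\<^sub>C blinfun_apply (R z) x + (- 1) *\<^sub>C y"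
    by (auto simp: affine_op_def)
  moreover from this(2) have "y = z *\<^sub>C blinfun_apply (R z) x - x" 
    by (simp add: scaleC.minus_left eq_diff_eq add.commute)
  ultimately show ?thesis by simp
qed

lemma resolvent_left_inverse:
  assumes "Re z < cmod z * cos \<omega>" "(x, y) \<in> A"
  shows "blinfun_apply (R z) (z *\<^sub>C x - y) = x"
proof -
  have "(z *\<^sub>C x + (- 1) *\<^sub>C y, x) \<in> (affine_op z (- 1) A)\<inverse>"
    using assms(2) by (auto simp: affine_op_def)
  then show ?thesis
    unfolding outside_resolvent(2)[OF assms(1)] by (auto simp: op_graph_def scaleC.minus_left)
qed

lemma resolvent_identity:
  assumes "Re z < cmod z * cos \<omega>" "Re z' < cmod z' * cos \<omega>"
  shows "R z - R z' = (z' - z) *\<^sub>C (R z o\<^sub>L R z')"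
proof (rule blinfun_eqI)
  fix x
  let ?u = "blinfun_apply (R z') x"
  have "blinfun_apply (R z) (z *\<^sub>C ?u - (z' *\<^sub>C ?u - x)) = ?u"
    by (rule resolvent_left_inverse[OF assms(1) resolvent_in_graph[OF assms(2)]])
  moreover have "z *\<^sub>C ?u - (z' *\<^sub>C ?u - x) = (z - z') *\<^sub>C ?u + x" by (simp add: scaleC.diff_left)
  ultimately have "(z - z') *\<^sub>C blinfun_apply (R z) ?u + blinfun_apply (R z) x = ?u"
    by (simp add: blinfun.add_right bounded_opsD[OF outside_resolvent(1)[OF assms(1)]])
  then show "blinfun_apply (R z - R z') x = blinfun_apply ((z' - z) *\<^sub>C (R z o\<^sub>L R z')) x"
    by (simp add: blinfun.diff_left scaleC_blinfun.rep_eq scaleC.diff_left algebra_simps)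
qed

lemma affine_inverse:
  assumes out: "Re z < cmod z * cos \<omega>"
  shows "(affine_op (- z) 1 A)\<inverse> = op_graph (- R z)"
proof -
      have "(affine_op (- z) 1 A)\<inverse> = {(- p, q) | p q. (p, q) \<in> (affine_op z (- 1) A)\<inverse>}"
        unfolding affine_op_def by (auto simp: scaleC.minus_left) (metis add_uminus_conv_diff minus_diff_eq)
      also have "\<dots> = op_graph (- R z)"
        unfolding outside_resolvent(2)[OF out] op_graph_def
        by (auto simp: blinfun.minus_left blinfun.minus_right) (metis minus_minus blinfun.minus_right)
      finally show ?thesis .
qed

lemma outside_mono:
  assumes "\<omega> < w" "w \<le> pi" "z \<noteq> 0" "Re z \<le> cmod z * cos w"
  shows "Re z < cmod z * cos \<omega>"
proof -
  have "cos w < cos \<omega>" using assms angle by (intro cos_monotone_0_pi) auto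
  then show ?thesis using assms by (auto intro: le_less_trans mult_strict_left_mono)
qed

lemma resolvent_bound:
  assumes "\<omega> < w" "w < pi"
  obtains M where "M > 0" "\<And>z. z \<noteq> 0 \<Longrightarrow> Re z \<le> cmod z * cos w \<Longrightarrow> norm (R z) \<le> M / cmod z"
proof -
  \<comment> \<open>The region in the claim contains the boundary rays of angle w, whereas
    sectoriality gives bounds on open sectors; an angle strictly between \<omega> and w bridges the
    two.\<close>
  define u where "u = (\<omega> + w) / 2"
  have u: "\<omega> < u" "u < w" "u < pi" using assms unfolding u_def by auto
  then have "bdd_above ((\<lambda>z. norm (z *\<^sub>C bounded_op_of ((affine_op z 1 A)\<inverse>))) ` sector (pi - u))"
    using sectorial by (auto simp: sectorial_def)
  then obtain M where M: "\<And>z. z \<in> sector (pi - u) \<Longrightarrow> norm (z *\<^sub>C bounded_op_of ((affine_op z 1 A)\<inverse>)) \<le> M"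
    unfolding bdd_above_def by auto
  show ?thesis
  proof (rule that[of "\<bar>M\<bar> + 1"])
    fix z assume z: "z \<noteq> 0" "Re z \<le> cmod z * cos w"
    have "cos w < cos u" using u assms angle by (intro cos_monotone_0_pi) auto
    then have "Re z < cmod z * cos u" using z by (auto intro: le_less_trans mult_strict_left_mono)
    then have "- z \<in> sector (pi - u)" using z u angle by (subst sector_iff) (auto simp: cos_diff)
    from M[OF this] have 1: "norm ((- z) *\<^sub>C bounded_op_of ((affine_op (- z) 1 A)\<inverse>)) \<le> M" .
    have out: "Re z < cmod z * cos \<omega>" using outside_mono[of w z] assms z by auto
    note affine_inverse[OF out]
    with 1 have "norm ((- z) *\<^sub>C (- R z)) \<le> M" by (simp add: bounded_op_of_op_graph)
    then have "cmod z * norm (R z) \<le> M" by (simp add: norm_scaleC)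
    then show "norm (R z) \<le> (\<bar>M\<bar> + 1) / cmod z" using z by (simp add: field_simps)
  qed simp
qed

lemma resolvent_isCont:
  assumes "Re z < cmod z * cos \<omega>"
  shows "isCont R z"
proof -
  have z0: "z \<noteq> 0" using assms by auto
  have "cos \<bar>Arg z\<bar> < cos \<omega>" using assms z0 by (simp add: Re_eq_cmod_cos_Arg)
  then have A: "\<omega> < \<bar>Arg z\<bar>" using Arg_bounded[of z] angle by (subst (asm) cos_mono_less_eq) auto
  \<comment> \<open>An angle between \<omega> and |Arg z| makes z an interior point of a region with
    a uniform resolvent bound. With the resolvent identity this bounds the increment of
    \<open>R\<close> at z by a multiple of |y - z|.\<close>
  define w where "w = (\<omega> + \<bar>Arg z\<bar>) / 2"
  have w: "\<omega> < w" "w < \<bar>Arg z\<bar>" "w < pi" using A Arg_bounded[of z] unfolding w_def by auto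
  have "cos \<bar>Arg z\<bar> < cos w" using w angle Arg_bounded[of z] by (intro cos_monotone_0_pi) auto
  then have zw: "Re z < cmod z * cos w" using z0 by (simp add: Re_eq_cmod_cos_Arg)
  obtain M where M: "M > 0" "\<And>z. z \<noteq> 0 \<Longrightarrow> Re z \<le> cmod z * cos w \<Longrightarrow> norm (R z) \<le> M / cmod z"
    using resolvent_bound[OF w(1,3)] by blast
  define S where "S = {y. Re y < cmod y * cos w} \<inter> {y. cmod z / 2 < cmod y}"
  have S: "open S" unfolding S_def by (intro open_Int open_Collect_less continuous_intros)
  have zS: "z \<in> S" using zw z0 unfolding S_def by simp
  have bound: "norm (R y - R z) \<le> cmod (y - z) * (2 * M / cmod z * norm (R z))" if "y \<in> S" for y
  proof -
    have y: "y \<noteq> 0" "Re y \<le> cmod y * cos w" "cmod z / 2 < cmod y" using that z0 unfolding S_def by auto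
    have "norm (R y) \<le> M / cmod y" by (rule M(2)[OF y(1,2)])
    also have "\<dots> \<le> M / (cmod z / 2)" using y M z0 by (intro divide_left_mono mult_pos_pos) auto
    finally have Ry: "norm (R y) \<le> 2 * M / cmod z" by (simp add: mult.commute)
    have "R y - R z = (z - y) *\<^sub>C (R y o\<^sub>L R z)"
      by (rule resolvent_identity[OF outside_mono[OF w(1) less_imp_le[OF w(3)] y(1,2)] assms])
    then have "norm (R y - R z) \<le> cmod (y - z) * (norm (R y) * norm (R z))"
      by (simp add: norm_scaleC norm_minus_commute mult_left_mono norm_blinfun_compose)
    also have "\<dots> \<le> cmod (y - z) * (2 * M / cmod z * norm (R z))"
      using Ry by (intro mult_left_mono mult_right_mono) auto
    finally show ?thesis .
  qed
  have "((\<lambda>y. R y - R z) \<longlongrightarrow> 0) (at z)"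
  proof (rule Lim_null_comparison)
    show "\<forall>\<^sub>F y in at z. norm (R y - R z) \<le> cmod (y - z) * (2 * M / cmod z * norm (R z))"
      using eventually_at_in_open'[OF S zS] bound by (auto elim: eventually_mono)
    have "((\<lambda>y. cmod (y - z) * (2 * M / cmod z * norm (R z))) \<longlongrightarrow> cmod (z - z) * (2 * M / cmod z * norm (R z))) (at z)"
      by (intro tendsto_intros)
    then show "((\<lambda>y. cmod (y - z) * (2 * M / cmod z * norm (R z))) \<longlongrightarrow> 0) (at z)" by simp
  qed
  then show ?thesis unfolding isCont_def by (rule LIM_zero_cancel)
qed

lemma resolvent_has_derivative:
  assumes "Re z < cmod z * cos \<omega>"
  shows "(R has_derivative (\<lambda>d. d *\<^sub>C (- (R z o\<^sub>L R z)))) (at z)" and "isCont (\<lambda>z. - (R z o\<^sub>L R z)) z"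
proof -
  show "isCont (\<lambda>z. - (R z o\<^sub>L R z)) z"
    by (intro isCont_minus compose.isCont resolvent_isCont assms)
  define S where "S = {y. Re y < cmod y * cos \<omega>}"
  have S: "open S" "z \<in> S" unfolding S_def using assms by (auto intro!: open_Collect_less continuous_intros)
  show "(R has_derivative (\<lambda>d. d *\<^sub>C (- (R z o\<^sub>L R z)))) (at z)"
  proof (rule has_derivative_scaleC_Caratheodory[OF _ S, of R "\<lambda>y. - (R y o\<^sub>L R z)"])
    show "isCont (\<lambda>y. - (R y o\<^sub>L R z)) z"
      by (intro isCont_minus compose.isCont resolvent_isCont assms) simp
    fix y assume "y \<in> S"
    then have "R y - R z = (z - y) *\<^sub>C (R y o\<^sub>L R z)"
      unfolding S_def using assms by (intro resolvent_identity) auto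
    moreover have "(z - y) *\<^sub>C (R y o\<^sub>L R z) = (y - z) *\<^sub>C (- (R y o\<^sub>L R z))"
      by (simp add: scaleC.minus_right scaleC.minus_left[symmetric])
    ultimately show "R y = R z + (y - z) *\<^sub>C (- (R y o\<^sub>L R z))" by (simp add: algebra_simps)
  qed
qed

lemma outside_ray:
  assumes "\<omega> < w" "w < pi" "t > 0" "cos v \<le> cos w"
  shows "Re (of_real t * cis v) < cmod (of_real t * cis v) * cos \<omega>"
    and "Re (of_real t * cis v) \<le> cmod (of_real t * cis v) * cos w"
  using outside_mono[of w "of_real t * cis v"] assms by (auto simp: norm_mult)

lemma resolvent_continuous_on_ray:
  assumes "\<omega> < w" "w < pi" "cos v \<le> cos w"
  shows "continuous_on {0<..} (\<lambda>t. R (of_real t * cis v))"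
  by (rule continuous_on_ray[of "{z. Re z < cmod z * cos \<omega>}"])
    (use outside_ray(1)[OF assms(1,2) _ assms(3)] in \<open>auto intro!: continuous_at_imp_continuous_on resolvent_isCont\<close>)

text \<open>The Cauchy integral for g(A), with the boundary oriented as in
  \<open>sector_boundary_integral\<close>.\<close>

definition Psi :: "real \<Rightarrow> (complex \<Rightarrow> complex) \<Rightarrow> 'a \<Rightarrow>\<^sub>L 'a" where
  "Psi w g = (1 / (2 * of_real pi * \<i>)) *\<^sub>C
     (ray (- w) (\<lambda>z. g z *\<^sub>C R z) - ray w (\<lambda>z. g z *\<^sub>C R z))"

lemma regularised_calculus_eq: "regularised_calculus n w f A = Psi w (\<lambda>z. f z * tau z ^ n)"
  by (simp add: regularised_calculus_def sector_boundary_integral_def Psi_def ray_def Let_def)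

lemma ray_resolvent:
  assumes w: "\<omega> < w" "w < \<theta>" "\<theta> \<le> pi" and v: "v \<in> {- w, w}" and g: "decaying \<theta> g"
  shows "(\<lambda>t. cis v *\<^sub>C (g (of_real t * cis v) *\<^sub>C R (of_real t * cis v))) integrable_on {0<..}"
    and "ray v (\<lambda>z. g z *\<^sub>C R z) \<in> bounded_ops"
    and "(\<lambda>k. integral {1 / real (Suc k)..real (Suc k)} (\<lambda>t. cis v *\<^sub>C (g (of_real t * cis v) *\<^sub>C R (of_real t * cis v))))
      \<longlonglongrightarrow> ray v (\<lambda>z. g z *\<^sub>C R z)"
proof -
  have wpi: "w < pi" and w0: "0 < w" using w angle by auto
  have cv: "cos v \<le> cos w" using v by auto
  obtain s C where s: "s > 0" "C \<ge> 0" "\<And>z. z \<in> sector \<theta> \<Longrightarrow> cmod (g z) \<le> C * dk s (cmod z)"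
    by (rule decayingE[OF g]) blast
  obtain M where M: "M > 0" "\<And>z. z \<noteq> 0 \<Longrightarrow> Re z \<le> cmod z * cos w \<Longrightarrow> norm (R z) \<le> M / cmod z"
    using resolvent_bound[OF w(1) wpi] by blast
  have cont: "continuous_on {0<..} (\<lambda>t. g (of_real t * cis v) *\<^sub>C R (of_real t * cis v))"
    by (intro scaleC.continuous_on resolvent_continuous_on_ray[OF w(1) wpi cv] decaying_continuous_on_ray[OF g w(3)])
      (use v w w0 in auto)
  have le: "t * norm (g (of_real t * cis v) *\<^sub>C R (of_real t * cis v)) \<le> (C * M) * dk s t" if t: "t > 0" for t
  proof -
    have "cmod (g (of_real t * cis v)) \<le> C * dk s t"
      using s(3)[OF cis_in_sector[of t v \<theta>]] t v w w0 by (auto simp: norm_mult)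
    moreover have "t * norm (R (of_real t * cis v)) \<le> M"
      using M(2)[of "of_real t * cis v"] outside_ray(2)[OF w(1) wpi t cv] t by (simp add: norm_mult field_simps)
    ultimately have "cmod (g (of_real t * cis v)) * (t * norm (R (of_real t * cis v))) \<le> (C * dk s t) * M"
      using t s(2) less_imp_le[OF dk_pos[of s t]] by (intro mult_mono) auto
    then show ?thesis by (simp add: norm_scaleC mult_ac)
  qed
  show i: "(\<lambda>t. cis v *\<^sub>C (g (of_real t * cis v) *\<^sub>C R (of_real t * cis v))) integrable_on {0<..}"
    by (rule ray_integrable(1)[OF cont s(1) le])
  show "(\<lambda>k. integral {1 / real (Suc k)..real (Suc k)} (\<lambda>t. cis v *\<^sub>C (g (of_real t * cis v) *\<^sub>C R (of_real t * cis v))))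
      \<longlonglongrightarrow> ray v (\<lambda>z. g z *\<^sub>C R z)"
    by (rule ray_integrable(3)[OF cont s(1) le])
  show "ray v (\<lambda>z. g z *\<^sub>C R z) \<in> bounded_ops"
    by (rule ray_bounded_ops[OF i])
      (use outside_resolvent(1)[OF outside_ray(1)[OF w(1) wpi _ cv]] in \<open>auto intro: bounded_ops_intros\<close>)
qed

lemma Psi_bounded_ops:
  assumes "\<omega> < w" "w < \<theta>" "\<theta> \<le> pi" "decaying \<theta> g"
  shows "Psi w g \<in> bounded_ops"
  unfolding Psi_def using ray_resolvent(2)[OF assms(1-3) _ assms(4)] by (intro bounded_ops_intros) auto

text \<open>The constant depends on w and s only, so a pointwise estimate for a family of symbols
  becomes a norm estimate for the family of operators.\<close>

lemma Psi_bound: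
  assumes w: "\<omega> < w" "w < pi" and s: "s > 0"
  obtains K where "K \<ge> 0"
    "\<And>\<theta> g C. w < \<theta> \<Longrightarrow> \<theta> \<le> pi \<Longrightarrow> g holomorphic_on sector \<theta> \<Longrightarrow> C \<ge> 0 \<Longrightarrow>
       (\<And>z. z \<in> sector \<theta> \<Longrightarrow> cmod (g z) \<le> C * dk s (cmod z)) \<Longrightarrow> norm (Psi w g) \<le> K * C"
proof -
  obtain M where M: "M > 0" "\<And>z. z \<noteq> 0 \<Longrightarrow> Re z \<le> cmod z * cos w \<Longrightarrow> norm (R z) \<le> M / cmod z"
    using resolvent_bound[OF w] by blast
  define J where "J = integral {0<..} (\<lambda>t. dk s t / t)"
  have J: "J \<ge> 0" unfolding J_def
    by (intro integral_nonneg dk_integrable s) (auto intro!: divide_nonneg_pos less_imp_le[OF dk_pos])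
  show ?thesis
  proof (rule that[of "M * J / pi"])
    fix \<theta> g C assume \<theta>: "w < \<theta>" "\<theta> \<le> pi" and hol: "g holomorphic_on sector \<theta>" and C: "C \<ge> 0"
      and le: "\<And>z. z \<in> sector \<theta> \<Longrightarrow> cmod (g z) \<le> C * dk s (cmod z)"
    have g: "decaying \<theta> g" unfolding decaying_def using hol s C le by blast
    have ray: "norm (ray v (\<lambda>z. g z *\<^sub>C R z)) \<le> C * M * J" if v: "v \<in> {- w, w}" for v
    proof -
      have cv: "cos v \<le> cos w" and av: "\<bar>v\<bar> < \<theta>" using v w angle \<theta> by auto
      have cont: "continuous_on {0<..} (\<lambda>t. g (of_real t * cis v) *\<^sub>C R (of_real t * cis v))"
        by (intro scaleC.continuous_on resolvent_continuous_on_ray[OF w cv] decaying_continuous_on_ray[OF g \<theta>(2) av])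
      have le: "t * norm (g (of_real t * cis v) *\<^sub>C R (of_real t * cis v)) \<le> (C * M) * dk s t" if t: "t > 0" for t
      proof -
        have "cmod (g (of_real t * cis v)) \<le> C * dk s t"
          using le[OF cis_in_sector[OF t av \<theta>(2)]] t by (auto simp: norm_mult)
        moreover have "t * norm (R (of_real t * cis v)) \<le> M"
          using M(2)[of "of_real t * cis v"] outside_ray(2)[OF w t cv] t by (simp add: norm_mult field_simps)
        ultimately have "cmod (g (of_real t * cis v)) * (t * norm (R (of_real t * cis v))) \<le> (C * dk s t) * M"
          using t C less_imp_le[OF dk_pos[of s t]] by (intro mult_mono) auto
        then show ?thesis by (simp add: norm_scaleC mult_ac)
      qed
      show ?thesis unfolding J_def by (rule ray_integrable(2)[OF cont s le])
    qed
    have "norm (Psi w g) = norm (ray (- w) (\<lambda>z. g z *\<^sub>C R z) - ray w (\<lambda>z. g z *\<^sub>C R z)) / (2 * pi)"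
      by (simp add: Psi_def norm_scaleC norm_mult norm_divide)
    also have "\<dots> \<le> (C * M * J + C * M * J) / (2 * pi)"
      by (intro divide_right_mono order_trans[OF norm_triangle_ineq4] add_mono ray) auto
    also have "\<dots> = M * J / pi * C" by (simp add: field_simps)
    finally show "norm (Psi w g) \<le> M * J / pi * C" .
  qed (use J M in auto)
qed

lemma Psi_add:
  assumes "\<omega> < w" "w < \<theta>" "\<theta> \<le> pi" "decaying \<theta> g" "decaying \<theta> h"
  shows "Psi w (\<lambda>z. g z + h z) = Psi w g + Psi w h"
proof -
  have "ray v (\<lambda>z. (g z + h z) *\<^sub>C R z) = ray v (\<lambda>z. g z *\<^sub>C R z) + ray v (\<lambda>z. h z *\<^sub>C R z)" if "v \<in> {- w, w}" for v
    unfolding scaleC_add_left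
    by (rule ray_add[OF ray_resolvent(1)[OF assms(1-3) that assms(4)] ray_resolvent(1)[OF assms(1-3) that assms(5)]])
  then show ?thesis unfolding Psi_def by (simp add: scaleC_add_right[symmetric] add_diff_add)
qed

lemma Psi_mult_const:
  assumes "\<omega> < w" "w < \<theta>" "\<theta> \<le> pi" "decaying \<theta> g"
  shows "Psi w (\<lambda>z. c * g z) = c *\<^sub>C Psi w g"
proof -
  have "ray v (\<lambda>z. (c * g z) *\<^sub>C R z) = c *\<^sub>C ray v (\<lambda>z. g z *\<^sub>C R z)" if "v \<in> {- w, w}" for v
    using ray_linear(1)[OF ray_resolvent(1)[OF assms(1-3) that assms(4)] bounded_linear_scaleC, of c]
    by (simp add: scaleC_scaleC mult.commute)
  then show ?thesis unfolding Psi_def by (simp add: scaleC.diff_right scaleC_scaleC mult.commute)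
qed

lemma Psi_cong:
  assumes "0 < w" "w < \<theta>" "\<theta> \<le> pi" "\<And>z. z \<in> sector \<theta> \<Longrightarrow> g z = h z"
  shows "Psi w g = Psi w h"
proof -
  have "ray v (\<lambda>z. g z *\<^sub>C R z) = ray v (\<lambda>z. h z *\<^sub>C R z)" if "v \<in> {- w, w}" for v
    by (rule ray_cong) (use assms that cis_in_sector[of _ v \<theta>] in auto)
  then show ?thesis unfolding Psi_def by simp
qed

text \<open>Between the angles w and w' both factors are holomorphic, g because w' < \<theta> and
  the resolvent because cos v \<le> cos w. Hence each boundary ray can be turned on its own.\<close>

lemma Psi_angle:
  assumes w: "\<omega> < w" "w \<le> w'" "w' < \<theta>" "\<theta> \<le> pi" and g: "decaying \<theta> g"
  shows "Psi w g = Psi w' g"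
proof -
  have wpi: "w < pi" and w0: "0 < w" using w angle by auto
  have hol: "g holomorphic_on sector \<theta>" and op: "open (sector \<theta>)"
    using g open_sector[of \<theta>] w w0 by (auto simp: decaying_def)
  obtain s C where s: "s > 0" "C \<ge> 0" "\<And>z. z \<in> sector \<theta> \<Longrightarrow> cmod (g z) \<le> C * dk s (cmod z)"
    by (rule decayingE[OF g]) blast
  obtain M where M: "M > 0" "\<And>z. z \<noteq> 0 \<Longrightarrow> Re z \<le> cmod z * cos w \<Longrightarrow> norm (R z) \<le> M / cmod z"
    using resolvent_bound[OF w(1) wpi] by blast
  have rot: "ray v1 (\<lambda>z. g z *\<^sub>C R z) = ray v2 (\<lambda>z. g z *\<^sub>C R z)"
    if v12: "v1 \<le> v2" and v: "\<And>v. v \<in> {v1..v2} \<Longrightarrow> \<bar>v\<bar> < \<theta> \<and> cos v \<le> cos w" for v1 v2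
  proof (rule ray_rotate[OF v12, where a = 1 and b = 1 and s = s and C = "C * M"
        and h' = "\<lambda>z. g z *\<^sub>C (- (R z o\<^sub>L R z)) + deriv g z *\<^sub>C R z"])
    fix t v :: real assume t: "t > 0" and vv: "v \<in> {v1..v2}"
    have zs: "of_real t * cis v \<in> sector \<theta>" using v[OF vv] t w by (intro cis_in_sector) auto
    have out: "Re (of_real t * cis v) < cmod (of_real t * cis v) * cos \<omega>"
      "Re (of_real t * cis v) \<le> cmod (of_real t * cis v) * cos w"
      using outside_ray[OF w(1) wpi t] v[OF vv] by auto
    show "((\<lambda>z. g z *\<^sub>C R z) has_derivative (\<lambda>d. d *\<^sub>C (g (of_real t * cis v) *\<^sub>C (- (R (of_real t * cis v) o\<^sub>L R (of_real t * cis v))) + deriv g (of_real t * cis v) *\<^sub>C R (of_real t * cis v)))) (at (of_real t * cis v))"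
      using scaleC.FDERIV[OF holomorphic_has_derivative_scaleC(1)[OF hol op zs] resolvent_has_derivative(1)[OF out(1)]]
      by (simp add: scaleC_complex_def scaleC_scaleC scaleC_add_right mult.commute)
    show "isCont (\<lambda>z. g z *\<^sub>C (- (R z o\<^sub>L R z)) + deriv g z *\<^sub>C R z) (of_real t * cis v)"
      using holomorphic_on_imp_continuous_on[OF hol] zs op
      by (intro isCont_add scaleC.isCont resolvent_has_derivative(2)[OF out(1)] resolvent_isCont[OF out(1)]
          holomorphic_has_derivative_scaleC(2)[OF hol op zs]) (simp add: continuous_on_eq_continuous_at)
    have "cmod (g (of_real t * cis v)) \<le> C * dk s t"
      using s(3)[OF zs] t by (auto simp: norm_mult)
    moreover have "t * norm (R (of_real t * cis v)) \<le> M"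
      using M(2)[of "of_real t * cis v"] out(2) t by (simp add: norm_mult field_simps)
    ultimately have "cmod (g (of_real t * cis v)) * (t * norm (R (of_real t * cis v))) \<le> (C * dk s t) * M"
      using t s(2) less_imp_le[OF dk_pos[of s t]] by (intro mult_mono) auto
    then show "t * norm (g (of_real t * cis v) *\<^sub>C R (of_real t * cis v)) \<le> (C * M) * dk s t"
      by (simp add: norm_scaleC mult_ac)
  qed (use s in auto)
  have "cos v \<le> cos w" if "w \<le> v" "v \<le> w'" for v
    using that w w0 by (intro cos_monotone_0_pi_le) auto
  moreover have "cos v \<le> cos w" if "- w' \<le> v" "v \<le> - w" for v
    using cos_monotone_0_pi_le[of w "- v"] that w w0 by auto
  ultimately have "ray w (\<lambda>z. g z *\<^sub>C R z) = ray w' (\<lambda>z. g z *\<^sub>C R z)"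
    "ray (- w') (\<lambda>z. g z *\<^sub>C R z) = ray (- w) (\<lambda>z. g z *\<^sub>C R z)"
    using w w0 by (intro rot; force)+
  then show ?thesis unfolding Psi_def by simp
qed

end

section \<open>Lower bounds for |z + r|, and the decay of tau\<close>

lemma blinfun_compose_assoc: "(S o\<^sub>L T) o\<^sub>L U = S o\<^sub>L (T o\<^sub>L U)"
  by (rule blinfun_eqI) simp

text \<open>With c = (1 + cos \<theta>)/2, which is the square of cos (\<theta>/2), one has c (|z| +
  r)^2 = |z|^2 + r^2 + 2 r |z| cos \<theta> - (1 - c) (|z| - r)^2. This gives the constant sqrt c,
  and c \<le> 1 permits the simpler c.\<close>

lemma cmod_add_real_ge:
  assumes "cmod z * cos \<theta> \<le> Re z" "r \<ge> 0"
  shows "(1 + cos \<theta>) / 2 * (cmod z + r) \<le> cmod (z + of_real r)"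
proof (rule power2_le_imp_le)
  define c where "c = (1 + cos \<theta>) / 2"
  have "- 1 \<le> cos \<theta>" "cos \<theta> \<le> 1" by simp_all
  then have "0 \<le> 1 + cos \<theta>" "1 + cos \<theta> \<le> 2" by linarith+
  then have c: "0 \<le> c" "c \<le> 1" unfolding c_def by (simp_all only: zero_le_divide_iff divide_le_eq_1) auto
  have cth: "cos \<theta> = 2 * c - 1" unfolding c_def by (simp add: add_divide_distrib)
  have "(c * (cmod z + r))\<^sup>2 \<le> c * (cmod z + r)\<^sup>2"
  proof -
    have "c * (c * (cmod z + r)\<^sup>2) \<le> c * (1 * (cmod z + r)\<^sup>2)"
      using c by (intro mult_left_mono mult_right_mono) auto
    then show ?thesis by (simp add: power2_eq_square mult_ac)
  qed
  also have "\<dots> = (cmod z)\<^sup>2 + r\<^sup>2 + 2 * r * (cmod z * cos \<theta>) - (1 - c) * (cmod z - r)\<^sup>2"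
    unfolding cth by (simp add: power2_eq_square algebra_simps)
  also have "\<dots> \<le> (cmod z)\<^sup>2 + r\<^sup>2 + 2 * r * Re z"
  proof -
    have "2 * r * (cmod z * cos \<theta>) \<le> 2 * r * Re z" using assms by (intro mult_left_mono) auto
    moreover have "0 \<le> (1 - c) * (cmod z - r)\<^sup>2" using c by simp
    ultimately show ?thesis by linarith
  qed
  also have "\<dots> = (cmod (z + of_real r))\<^sup>2"
    unfolding cmod_power2 by (simp add: power2_eq_square algebra_simps)
  finally show "((1 + cos \<theta>) / 2 * (cmod z + r))\<^sup>2 \<le> (cmod (z + of_real r))\<^sup>2" unfolding c_def .
qed simp

lemma tau_bound:
  assumes "0 < \<theta>" "\<theta> < pi"
  obtains K where "K > 0" "\<And>z. z \<in> sector \<theta> \<Longrightarrow> cmod (tau z) \<le> K * dk 1 (cmod z)"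
proof -
  define c where "c = (1 + cos \<theta>) / 2"
  have c: "c > 0" using cos_monotone_0_pi[of \<theta> pi] assms unfolding c_def by simp
  show ?thesis
  proof (rule that[of "1 / c\<^sup>2"])
    fix z assume z: "z \<in> sector \<theta>"
    define t where "t = cmod z"
    have z0: "z \<noteq> 0" "cmod z * cos \<theta> \<le> Re z" using z sector_iff[of \<theta> z] assms by auto
    have t: "t > 0" using z0 unfolding t_def by simp
    have le: "c * (t + 1) \<le> cmod (1 + z)"
      using cmod_add_real_ge[OF z0(2), of 1] unfolding c_def t_def by (simp add: add.commute)
    have "0 < c * (t + 1)" using c t by simp
    from less_le_trans[OF this le] have pos: "0 < cmod (1 + z)" .
    from le have "(c * (t + 1))\<^sup>2 \<le> (cmod (1 + z))\<^sup>2" using c t by (intro power_mono) (auto simp: add.commute)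
    then have "t / (cmod (1 + z))\<^sup>2 \<le> t / (c * (t + 1))\<^sup>2"
      using c t pos by (intro divide_left_mono mult_pos_pos zero_less_power) auto
    moreover have "cmod (tau z) = t / (cmod (1 + z))\<^sup>2" by (simp add: tau_def norm_divide norm_power t_def)
    moreover have "t / (c * (t + 1))\<^sup>2 = 1 / c\<^sup>2 * (t / (t + 1)\<^sup>2)" by (simp add: power_mult_distrib)
    moreover have "t / (t + 1)\<^sup>2 \<le> dk 1 t"
    proof (cases "t \<le> 1")
      case True
      have "t / (t + 1)\<^sup>2 \<le> t / 1" using t by (intro divide_left_mono) auto
      then show ?thesis using True t by (simp add: dk_less_1)
    next
      case False
      have "t / (t + 1)\<^sup>2 \<le> t / t\<^sup>2" using t by (intro divide_left_mono power_mono) auto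
      also have "\<dots> = 1 / t" using t by (simp add: power2_eq_square)
      finally show ?thesis using False t by (simp add: dk_ge_1 powr_minus_divide)
    qed
    ultimately show "cmod (tau z) \<le> 1 / c\<^sup>2 * dk 1 (cmod z)"
      using c unfolding t_def by (metis divide_nonneg_nonneg mult_left_mono order_trans zero_le_one zero_le_power2)
  qed (use c in auto)
qed

lemma tau_holomorphic: "0 < \<theta> \<Longrightarrow> \<theta> \<le> pi \<Longrightarrow> tau holomorphic_on sector \<theta>"
proof -
  assume t: "0 < \<theta>" "\<theta> \<le> pi"
  have "1 + z \<noteq> 0" if "z \<in> sector \<theta>" for z
  proof
    assume "1 + z = 0"
    then have "z = - 1" by (metis add_eq_0_iff)
    then show False using that sector_iff[OF t, of z] cos_ge_minus_one[of \<theta>] by simp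
  qed
  then show ?thesis unfolding tau_def by (intro holomorphic_intros) auto
qed

lemma decaying_tau: "0 < \<theta> \<Longrightarrow> \<theta> < pi \<Longrightarrow> decaying \<theta> tau"
proof -
  assume t: "0 < \<theta>" "\<theta> < pi"
  obtain K where "K > 0" "\<And>z. z \<in> sector \<theta> \<Longrightarrow> cmod (tau z) \<le> K * dk 1 (cmod z)"
    using tau_bound[OF t] by blast
  then show ?thesis unfolding decaying_def using tau_holomorphic[of \<theta>] t
    by (intro conjI exI[of _ 1] exI[of _ K]) auto
qed

lemma decaying_mult_bounded:
  assumes f: "decaying \<theta> f" and h: "h holomorphic_on sector \<theta>" "\<And>z. z \<in> sector \<theta> \<Longrightarrow> cmod (h z) \<le> B"
  shows "decaying \<theta> (\<lambda>z. h z * f z)" "decaying \<theta> (\<lambda>z. f z * h z)"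
proof -
  obtain s C where s: "s > 0" "C \<ge> 0" "\<And>z. z \<in> sector \<theta> \<Longrightarrow> cmod (f z) \<le> C * dk s (cmod z)"
    by (rule decayingE[OF f]) blast
  have "cmod (h z * f z) \<le> (\<bar>B\<bar> * C) * dk s (cmod z)" if "z \<in> sector \<theta>" for z
  proof -
    have "cmod (h z) * cmod (f z) \<le> \<bar>B\<bar> * (C * dk s (cmod z))"
      using h(2)[OF that] s(3)[OF that] by (intro mult_mono) auto
    then show ?thesis by (simp add: norm_mult mult_ac)
  qed
  moreover have "(\<lambda>z. h z * f z) holomorphic_on sector \<theta>"
    using f h by (auto simp: decaying_def intro: holomorphic_intros)
  ultimately show 1: "decaying \<theta> (\<lambda>z. h z * f z)"
    unfolding decaying_def using s by (intro conjI exI[of _ s] exI[of _ "\<bar>B\<bar> * C"]) auto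
  then show "decaying \<theta> (\<lambda>z. f z * h z)" by (simp add: mult.commute)
qed

lemma decaying_bounded:
  assumes "decaying \<theta> f"
  obtains B where "B \<ge> 0" "\<And>z. z \<in> sector \<theta> \<Longrightarrow> cmod (f z) \<le> B"
proof -
  obtain s C where s: "s > 0" "C \<ge> 0" "\<And>z. z \<in> sector \<theta> \<Longrightarrow> cmod (f z) \<le> C * dk s (cmod z)"
    by (rule decayingE[OF assms]) blast
  have "cmod (f z) \<le> C" if "z \<in> sector \<theta>" for z
    using s(3)[OF that] mult_left_mono[OF dk_le_one[of s "cmod z"] s(2)] s(1) by simp
  then show ?thesis using that s(2) by blast
qed

lemma decaying_mult:
  assumes f: "decaying \<theta> f" and g: "decaying \<theta> g"
  shows "decaying \<theta> (\<lambda>z. f z * g z)"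
proof -
  obtain B where "\<And>z. z \<in> sector \<theta> \<Longrightarrow> cmod (g z) \<le> B" using decaying_bounded[OF g] by blast
  from decaying_mult_bounded(2)[OF f _ this] show ?thesis using g by (simp add: decaying_def)
qed

section \<open>Resolvents and tau(A) as values of the calculus\<close>

context sectorial_operator
begin

lemma scaleC_compose_linear:
  "bounded_linear (\<lambda>S. S o\<^sub>L (T :: 'a \<Rightarrow>\<^sub>L 'a))" "bounded_linear (\<lambda>S. T o\<^sub>L (S :: 'a \<Rightarrow>\<^sub>L 'a))"
  by (rule compose.bounded_linear_left, rule compose.bounded_linear_right)

lemma ray_scaleC_right:
  fixes h :: "complex \<Rightarrow> complex" and S :: "'a \<Rightarrow>\<^sub>L 'a"
  assumes "(\<lambda>t. cis v *\<^sub>C h (of_real t * cis v)) integrable_on {0<..}"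
  shows "ray v (\<lambda>z. h z *\<^sub>C S) = ray v h *\<^sub>C S" "(\<lambda>t. cis v *\<^sub>C (h (of_real t * cis v) *\<^sub>C S)) integrable_on {0<..}"
  by (rule ray_linear[OF assms scaleC.bounded_linear_left]; simp add: scaleC_complex_def scaleC_scaleC)+

text \<open>By the resolvent identity g(z) R(z) R(\<mu>) = (g(z)/(z - \<mu>)) (R(\<mu>) - R(z)), and
  the scalar integral multiplying R(\<mu>) vanishes because \<mu> lies outside the contour.
  Integrability is a separate claim: \<mu> may lie in the larger sector of angle \<theta>, and then
  the quotient is not \<open>decaying\<close>.\<close>

lemma Psi_resolvent:
  assumes w: "\<omega> < w" "w < \<theta>" "\<theta> \<le> pi" and g: "decaying \<theta> g"
    and \<mu>: "\<mu> \<noteq> 0" "Re \<mu> < cmod \<mu> * cos w"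
  shows "Psi w g o\<^sub>L R \<mu> = - Psi w (\<lambda>z. g z / (z - \<mu>))"
    and "v \<in> {- w, w} \<Longrightarrow> (\<lambda>t. cis v *\<^sub>C ((g (of_real t * cis v) / (of_real t * cis v - \<mu>)) *\<^sub>C R (of_real t * cis v))) integrable_on {0<..}"
proof -
  have wpi: "w < pi" and w0: "0 < w" using w angle by auto
  have out: "Re \<mu> < cmod \<mu> * cos \<omega>" using outside_mono[of w \<mu>] w \<mu> wpi by auto
  obtain s C where s: "s > 0" "C \<ge> 0" "\<And>z. z \<in> sector \<theta> \<Longrightarrow> cmod (g z) \<le> C * dk s (cmod z)"
    by (rule decayingE[OF g]) blast
  have main: "ray v (\<lambda>z. (g z / (z - \<mu>)) *\<^sub>C R z) = ray v (\<lambda>z. g z / (z - \<mu>)) *\<^sub>C R \<mu> - (ray v (\<lambda>z. g z *\<^sub>C R z) o\<^sub>L R \<mu>)"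
    "(\<lambda>t. cis v *\<^sub>C ((g (of_real t * cis v) / (of_real t * cis v - \<mu>)) *\<^sub>C R (of_real t * cis v))) integrable_on {0<..}"
    if v: "v \<in> {- w, w}" for v
  proof -
    have cv: "cos v \<le> cos w" and av: "\<bar>v\<bar> < \<theta>" using v w w0 by auto
    have ne: "of_real t * cis v - \<mu> \<noteq> 0" if t: "t > 0" for t
    proof
      assume "of_real t * cis v - \<mu> = 0"
      then have "\<mu> = of_real t * cis v" by simp
      then have "Re \<mu> = cmod \<mu> * cos w" using v t by (auto simp: norm_mult)
      then show False using \<mu>(2) by simp
    qed
    have eq: "(g z / (z - \<mu>)) *\<^sub>C R z = (g z / (z - \<mu>)) *\<^sub>C R \<mu> + - ((g z *\<^sub>C R z) o\<^sub>L R \<mu>)"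
      if z: "z = of_real t * cis v" "t > 0" for z t
    proof -
      have "R z - R \<mu> = (\<mu> - z) *\<^sub>C (R z o\<^sub>L R \<mu>)"
        unfolding z by (rule resolvent_identity[OF outside_ray(1)[OF w(1) wpi z(2) cv] out])
      then have "(g z / (z - \<mu>)) *\<^sub>C (R z - R \<mu>) = (g z / (z - \<mu>) * (\<mu> - z)) *\<^sub>C (R z o\<^sub>L R \<mu>)"
        by (simp add: scaleC_scaleC)
      moreover have "g z / (z - \<mu>) * (\<mu> - z) = - g z" using ne[OF z(2)] unfolding z by (simp add: field_simps)
      ultimately show ?thesis by (simp add: scaleC.diff_right scaleC.minus_left scaleC_compose_left algebra_simps)
    qed
    have dq: "decays (\<lambda>z. g z / (z - \<mu>)) {v}"
      by (rule decays_quotient[OF \<mu>(1) s(1), of _ _ C])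
        (use s(3)[OF cis_in_sector] av w in \<open>auto simp: norm_mult\<close>)
    have iq: "(\<lambda>t. cis v *\<^sub>C (g (of_real t * cis v) / (of_real t * cis v - \<mu>))) integrable_on {0<..}"
      by (rule ray_integrable_decays(1)[OF _ dq], intro continuous_on_divide continuous_intros decaying_continuous_on_ray[OF g w(3) av])
        (use ne in auto)
    have i1: "(\<lambda>t. cis v *\<^sub>C ((g (of_real t * cis v) / (of_real t * cis v - \<mu>)) *\<^sub>C R \<mu>)) integrable_on {0<..}"
      by (rule ray_scaleC_right(2)[OF iq])
    have L: "bounded_linear (\<lambda>S. - (S o\<^sub>L R \<mu>))" by (intro bounded_linear_minus scaleC_compose_linear)
    note l2 = ray_linear[OF ray_resolvent(1)[OF w v g] L, simplified scaleC_compose_left scaleC.minus_right, OF refl]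
    show "ray v (\<lambda>z. (g z / (z - \<mu>)) *\<^sub>C R z) = ray v (\<lambda>z. g z / (z - \<mu>)) *\<^sub>C R \<mu> - (ray v (\<lambda>z. g z *\<^sub>C R z) o\<^sub>L R \<mu>)"
    proof -
      have "ray v (\<lambda>z. (g z / (z - \<mu>)) *\<^sub>C R z) = ray v (\<lambda>z. (g z / (z - \<mu>)) *\<^sub>C R \<mu> + - ((g z *\<^sub>C R z) o\<^sub>L R \<mu>))"
        by (rule ray_cong) (rule eq[OF refl])
      also have "\<dots> = ray v (\<lambda>z. (g z / (z - \<mu>)) *\<^sub>C R \<mu>) + ray v (\<lambda>z. - ((g z *\<^sub>C R z) o\<^sub>L R \<mu>))"
        by (rule ray_add[OF i1]) (use l2(2) in \<open>simp add: scaleC_compose_left scaleC.minus_right\<close>)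
      finally show ?thesis using l2(1) ray_scaleC_right(1)[OF iq, of "R \<mu>"]
        by (simp add: scaleC_compose_left)
    qed
    have "(\<lambda>t. cis v *\<^sub>C ((g (of_real t * cis v) / (of_real t * cis v - \<mu>)) *\<^sub>C R \<mu>) + cis v *\<^sub>C (- ((g (of_real t * cis v) *\<^sub>C R (of_real t * cis v)) o\<^sub>L R \<mu>))) integrable_on {0<..}"
      by (rule integrable_add[OF i1]) (use l2(2) in \<open>simp add: scaleC_compose_left scaleC.minus_right\<close>)
    then show "(\<lambda>t. cis v *\<^sub>C ((g (of_real t * cis v) / (of_real t * cis v - \<mu>)) *\<^sub>C R (of_real t * cis v))) integrable_on {0<..}"
      by (rule integrable_eq) (use eq[OF refl] in \<open>simp add: scaleC.minus_right scaleC.diff_right\<close>)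
  qed
  show "v \<in> {- w, w} \<Longrightarrow> (\<lambda>t. cis v *\<^sub>C ((g (of_real t * cis v) / (of_real t * cis v - \<mu>)) *\<^sub>C R (of_real t * cis v))) integrable_on {0<..}"
    by (rule main(2))
  have "ray (- w) (\<lambda>z. g z / (z - \<mu>)) = ray w (\<lambda>z. g z / (z - \<mu>))"
    by (rule ray_quotient_outside[OF g w0 w(2,3) \<mu>])
  then have "ray (- w) (\<lambda>z. (g z / (z - \<mu>)) *\<^sub>C R z) - ray w (\<lambda>z. (g z / (z - \<mu>)) *\<^sub>C R z)
      = - ((ray (- w) (\<lambda>z. g z *\<^sub>C R z) - ray w (\<lambda>z. g z *\<^sub>C R z)) o\<^sub>L R \<mu>)"
    using main(1)[of w] main(1)[of "- w"] by (simp add: compose.diff_left)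
  then show "Psi w g o\<^sub>L R \<mu> = - Psi w (\<lambda>z. g z / (z - \<mu>))"
    unfolding Psi_def by (simp add: scaleC_compose_left scaleC.minus_right)
qed

lemma minus_real_outside: "r > 0 \<Longrightarrow> w < pi \<Longrightarrow> 0 \<le> w \<Longrightarrow> Re (- complex_of_real r) < cmod (- complex_of_real r) * cos w"
proof -
  assume a: "r > 0" "w < pi" "0 \<le> w"
  have "- 1 < cos w" using cos_monotone_0_pi[of w pi] a by simp
  then have "r * - 1 < r * cos w" using a by (intro mult_strict_left_mono) auto
  then show ?thesis using a by simp
qed

lemma minus_one_outside: "Re (- 1) < cmod (- 1) * cos \<omega>"
  using minus_real_outside[of 1 \<omega>] angle by simp

text \<open>Since \<open>R (- 1)\<close> is - (1 + A)^-1, this is (1 + A)^-1 - (1 + A)^-2 = A (1 +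
  A)^-2, written with bounded operators only.\<close>

definition tauA :: "'a \<Rightarrow>\<^sub>L 'a" where
  "tauA = - R (- 1) - (R (- 1) o\<^sub>L R (- 1))"

lemma tauA_bounded_ops: "tauA \<in> bounded_ops"
  unfolding tauA_def by (intro bounded_ops_intros outside_resolvent minus_one_outside)

text \<open>The summands are separated according to their singularities: those of the first bracket,
  the spectrum and 1, lie inside the contour, that of the last term, - 1, lies outside, and
  \<open>kappa 1\<close> carries the residue that produces \<tau>(A).\<close>

lemma tau_resolvent:
  assumes z: "Re z < cmod z * cos \<omega>" "z \<noteq> 1" "z \<noteq> - 1"
  shows "tau z *\<^sub>C R z = ((R z o\<^sub>L tauA) - (1 / (z - 1)) *\<^sub>C tauA) + kappa 1 z *\<^sub>C tauA
     + (1 / ((z - - 1) * (z - - 1))) *\<^sub>C (- R (- 1))"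
proof -
  define c where "c = 1 / (1 + z)"
  define d where "d = 1 / (z - 1)"
  have z1: "1 + z \<noteq> 0" using z(3) by (metis add_eq_0_iff)
  have z2: "z + 1 \<noteq> 0" using z1 by (simp add: add.commute)
  have t: "tau z = c - c * c" unfolding tau_def c_def using z1
    by (simp add: divide_simps power2_eq_square)
  have k: "kappa 1 z = d - c" unfolding c_def d_def using z1 z2 z(2) by (simp add: divide_simps)
  have q: "1 / ((z - - 1) * (z - - 1)) = c * c" unfolding c_def by (simp add: add.commute)
  let ?X = "R z" and ?Y = "R (- 1)"
  have XmY: "(- 1 - z) *\<^sub>C (?X o\<^sub>L ?Y) = ?X - ?Y"
    using resolvent_identity[OF z(1) minus_one_outside] by simp
  have e: "- c * (- 1 - z) = 1"
  proof -
    have "- c * (- 1 - z) = c * (1 + z)" by (simp add: algebra_simps)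
    then show ?thesis using z1 by (simp add: c_def)
  qed
  have "?X o\<^sub>L ?Y = (- c * (- 1 - z)) *\<^sub>C (?X o\<^sub>L ?Y)" unfolding e by simp
  also have "\<dots> = (- c) *\<^sub>C (?X - ?Y)" unfolding XmY[symmetric] scaleC_scaleC ..
  finally have XY: "?X o\<^sub>L ?Y = - (c *\<^sub>C ?X) + c *\<^sub>C ?Y"
    by (simp add: scaleC.diff_right scaleC.minus_left)
  have "?X o\<^sub>L (?Y o\<^sub>L ?Y) = (?X o\<^sub>L ?Y) o\<^sub>L ?Y" by (simp add: blinfun_compose_assoc)
  also have "\<dots> = - (c *\<^sub>C (?X o\<^sub>L ?Y)) + c *\<^sub>C (?Y o\<^sub>L ?Y)"
    by (subst (1) XY) (simp add: compose.add_left compose.diff_left compose.minus_left scaleC_compose_left)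
  also have "\<dots> = (c * c) *\<^sub>C ?X - (c * c) *\<^sub>C ?Y + c *\<^sub>C (?Y o\<^sub>L ?Y)"
    unfolding XY by (simp add: scaleC_add_right scaleC.diff_right scaleC.minus_right scaleC_scaleC)
  finally have XT: "?X o\<^sub>L tauA = c *\<^sub>C ?X - c *\<^sub>C ?Y - ((c * c) *\<^sub>C ?X - (c * c) *\<^sub>C ?Y + c *\<^sub>C (?Y o\<^sub>L ?Y))"
    unfolding tauA_def by (simp add: compose.diff_right compose.minus_right XY)
  show ?thesis unfolding t k q XT d_def[symmetric]
    unfolding tauA_def by (simp add: scaleC.diff_left scaleC.diff_right scaleC.minus_right scaleC.minus_left algebra_simps)
qed

text \<open>In the decomposition of \<tau>(z) R(z), the boundary rays of the first bracket are
  turned into each other through the complement of the sector, those of the last term through the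
  sector. Both drop out, and \<open>kappa 1\<close> yields 2 pi i times \<tau>(A).\<close>

lemma Psi_tau:
  assumes w: "\<omega> < w" "w < pi"
  shows "Psi w tau = tauA"
proof -
  have w0: "0 < w" using w angle by auto
  define \<theta> where "\<theta> = (w + pi) / 2"
  have \<theta>: "w < \<theta>" "\<theta> < pi" unfolding \<theta>_def using w by auto
  have tau: "decaying \<theta> tau" using \<theta> w0 by (intro decaying_tau) auto
  define h where "h z = (R z o\<^sub>L tauA) - (1 / (z - 1)) *\<^sub>C tauA" for z
  define q where "q z = (1::complex) / ((z - - 1) * (z - - 1))" for z
  have one: "1 \<in> sector w" using w w0 sector_iff[of w 1] cos_monotone_0_pi[of 0 w] by simp
  have ne1: "of_real t * cis v \<noteq> 1" if "t > 0" "v \<in> {w..2 * pi - w} \<union> {- w}" for t v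
    using ray_notin_sector[of t w v] ray_neg_notin_sector[of t w] that one w w0 by auto
  have nem1: "of_real t * cis v \<noteq> - 1" if "t > 0" "v \<in> {- w..w}" for t v
  proof
    assume "of_real t * cis v = - 1"
    moreover have "of_real t * cis v \<in> sector \<theta>" using that w0 \<theta> by (intro cis_in_sector) auto
    ultimately show False using sector_iff[of \<theta> "- 1"] cos_ge_minus_one[of \<theta>] \<theta> w0 by auto
  qed
  have split: "tau z *\<^sub>C R z = h z + kappa 1 z *\<^sub>C tauA + q z *\<^sub>C (- R (- 1))"
    if "Re z < cmod z * cos \<omega>" "z \<noteq> 1" "z \<noteq> - 1" for z
    using tau_resolvent[OF that] unfolding h_def q_def .
  have dq: "decays q UNIV" unfolding q_def by (rule decays_rational) auto
  have dk1: "decays (kappa 1) UNIV" by (rule decays_rational) auto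
  have rq: "ray (- w) q = ray w q"
  proof (rule ray_rotate_holomorphic)
    show "- w \<le> w" using w0 by simp
    show "q holomorphic_on - {- 1}" unfolding q_def by (intro holomorphic_intros) (auto simp: eq_neg_iff_add_eq_0)
    show "open (- {- 1 :: complex})" by (intro open_Compl) auto
    show "decays q {- w..w}" using dq by (rule decays_subset) simp
    show "of_real t * cis v \<in> - {- 1}" if "t > 0" "v \<in> {- w..w}" for t v using nem1[OF that] by simp
  qed
  obtain M where M: "M > 0" "\<And>z. z \<noteq> 0 \<Longrightarrow> Re z \<le> cmod z * cos w \<Longrightarrow> norm (R z) \<le> M / cmod z"
    using resolvent_bound[OF w] by blast
  have dtau: "decays (\<lambda>z. tau z *\<^sub>C R z) {w..2 * pi - w}"
  proof (rule decaysI[of 1 "1/2" _ 2 _ "4 * M"])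
    fix t v :: real assume t: "t > 0" "v \<in> {w..2 * pi - w}" "t < 1 / 2 \<or> 2 < t"
    let ?z = "of_real t * cis v"
    have cv: "cos v \<le> cos w" using t cos_le_cos_outside[of w v] w0 by auto
    have zt: "cmod ?z = t" using t by (simp add: norm_mult)
    have "t * norm (R ?z) \<le> M"
      using M(2)[of ?z] outside_ray(2)[OF w t(1) cv] t by (simp add: norm_mult field_simps)
    moreover have "cmod (tau ?z) \<le> 4 * dk 1 t"
    proof (cases "t > 2")
      case True
      have "t / 2 \<le> cmod (1 + ?z)" using norm_triangle_ineq2[of ?z "- 1"] zt True by (simp add: add.commute)
      then have "(t / 2)\<^sup>2 \<le> (cmod (1 + ?z))\<^sup>2" using t by (intro power_mono) auto
      then have "t / (cmod (1 + ?z))\<^sup>2 \<le> t / (t / 2)\<^sup>2" using t by (intro divide_left_mono mult_pos_pos) (auto intro: less_le_trans[rotated])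
      also have "\<dots> = 4 / t" using t by (simp add: field_simps power2_eq_square)
      finally show ?thesis using True zt by (simp add: tau_def norm_divide norm_power dk_ge_1 powr_minus_divide norm_mult)
    next
      case False
      then have th: "t < 1 / 2" using t by auto
      have "1 / 2 \<le> cmod (1 + ?z)" using norm_triangle_ineq2[of 1 "- ?z"] zt th by simp
      then have "(1 / 2)\<^sup>2 \<le> (cmod (1 + ?z))\<^sup>2" by (intro power_mono) auto
      then have "t / (cmod (1 + ?z))\<^sup>2 \<le> t / (1 / 2)\<^sup>2" using t by (intro divide_left_mono mult_pos_pos) (auto intro: less_le_trans[rotated])
      then show ?thesis using th t zt by (simp add: tau_def norm_divide norm_power dk_less_1 power2_eq_square norm_mult)
    qed
    ultimately have "cmod (tau ?z) * (t * norm (R ?z)) \<le> (4 * dk 1 t) * M"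
      using t less_imp_le[OF dk_pos[of 1 t]] by (intro mult_mono) auto
    then show "t * norm (tau ?z *\<^sub>C R ?z) \<le> 4 * M * dk 1 t" by (simp add: norm_scaleC mult_ac)
  qed auto
  \<comment> \<open>The decay of \<open>h\<close> is read off from the decomposition, all of whose
    other terms decay on rays in the complement. The thresholds are moved to 1 because the
    decomposition excludes z = 1 and z = - 1.\<close>
  have dh: "decays h {w..2 * pi - w}"
  proof -
    have "decays (\<lambda>z. tau z *\<^sub>C R z + ((- kappa 1 z) *\<^sub>C tauA + q z *\<^sub>C R (- 1))) {w..2 * pi - w}"
      by (intro decays_add dtau decays_bounded_linear[OF decays_subset[OF dq] scaleC.bounded_linear_left]
          decays_bounded_linear[OF decays_subset[OF dk1] bounded_linear_compose[OF scaleC.bounded_linear_left bounded_linear_minus[OF bounded_linear_ident]]]) auto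
    from decaysE[OF this] obtain s a b C where *: "s > 0" "a > 0" "\<And>t v. t > 0 \<Longrightarrow> v \<in> {w..2 * pi - w} \<Longrightarrow> t < a \<or> b < t \<Longrightarrow>
      t * norm (tau (of_real t * cis v) *\<^sub>C R (of_real t * cis v) + ((- kappa 1 (of_real t * cis v)) *\<^sub>C tauA + q (of_real t * cis v) *\<^sub>C R (- 1))) \<le> C * dk s t"
      by (metis (no_types, lifting))
    show ?thesis
    proof (rule decaysI[of s "min a 1" _ "max b 1" _ C])
      fix t v :: real assume t: "t > 0" "v \<in> {w..2 * pi - w}" "t < min a 1 \<or> max b 1 < t"
      have t': "t < a \<or> b < t" using t(3) by auto
      have cv: "cos v \<le> cos w" using t cos_le_cos_outside[of w v] w0 by auto
      have "cmod (of_real t * cis v) \<noteq> 1" using t by (auto simp: norm_mult)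
      then have ne: "of_real t * cis v \<noteq> 1" "of_real t * cis v \<noteq> - 1" by auto
      have "h (of_real t * cis v) = tau (of_real t * cis v) *\<^sub>C R (of_real t * cis v) + ((- kappa 1 (of_real t * cis v)) *\<^sub>C tauA + q (of_real t * cis v) *\<^sub>C R (- 1))"
        using split[OF outside_ray(1)[OF w t(1) cv] ne] by (simp only: scaleC.minus_left scaleC.minus_right) simp
      then show "t * norm (h (of_real t * cis v)) \<le> C * dk s t" using *(3)[OF t(1,2) t'] by (simp only:)
    qed (use * in auto)
  qed
  have "ray w h = ray (2 * pi - w) h"
  proof (rule ray_rotate_decays[OF _ _ _ dh, where h' = "\<lambda>z. (- (R z o\<^sub>L R z) o\<^sub>L tauA) + (1 / (z - 1)\<^sup>2) *\<^sub>C tauA"])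
    show "w \<le> 2 * pi - w" using w by simp
    fix t v :: real assume t: "t > 0" "v \<in> {w..2 * pi - w}"
    let ?z = "of_real t * cis v"
    have cv: "cos v \<le> cos w" using t cos_le_cos_outside[of w v] w0 by auto
    have out: "Re ?z < cmod ?z * cos \<omega>" by (rule outside_ray(1)[OF w t(1) cv])
    have z1: "?z - 1 \<noteq> 0" using ne1[of t v] t by auto
    have d1: "((\<lambda>z. R z o\<^sub>L tauA) has_derivative (\<lambda>d. (d *\<^sub>C (- (R ?z o\<^sub>L R ?z))) o\<^sub>L tauA)) (at ?z)"
      by (rule bounded_linear.has_derivative[OF scaleC_compose_linear(1) resolvent_has_derivative(1)[OF out]])
    have "((\<lambda>z. 1 / (z - 1)) has_field_derivative - (1 / (?z - 1)\<^sup>2)) (at ?z)"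
      using z1 by (auto intro!: derivative_eq_intros simp: power2_eq_square)
    then have "((\<lambda>z. 1 / (z - 1)) has_derivative (\<lambda>d. - (1 / (?z - 1)\<^sup>2) * d)) (at ?z)" by (simp only: has_field_derivative_def)
    from bounded_linear.has_derivative[OF scaleC.bounded_linear_left this, of tauA]
    have d2: "((\<lambda>z. (1 / (z - 1)) *\<^sub>C tauA) has_derivative (\<lambda>d. (- (1 / (?z - 1)\<^sup>2) * d) *\<^sub>C tauA)) (at ?z)" .
    have "(\<lambda>d. ((d *\<^sub>C (- (R ?z o\<^sub>L R ?z))) o\<^sub>L tauA) - (- (1 / (?z - 1)\<^sup>2) * d) *\<^sub>C tauA)
       = (\<lambda>d. d *\<^sub>C ((- (R ?z o\<^sub>L R ?z) o\<^sub>L tauA) + (1 / (?z - 1)\<^sup>2) *\<^sub>C tauA))"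
      by (rule ext) (simp only: scaleC_compose_left scaleC_add_right scaleC_scaleC scaleC.minus_left mult_minus_left mult_minus_right diff_minus_eq_add mult.commute)
    with has_derivative_diff[OF d1 d2]
    show "(h has_derivative (\<lambda>d. d *\<^sub>C ((- (R ?z o\<^sub>L R ?z) o\<^sub>L tauA) + (1 / (?z - 1)\<^sup>2) *\<^sub>C tauA))) (at ?z)"
      unfolding h_def by (simp only:)
    show "isCont (\<lambda>z. (- (R z o\<^sub>L R z) o\<^sub>L tauA) + (1 / (z - 1)\<^sup>2) *\<^sub>C tauA) ?z"
      using z1 by (intro isCont_add compose.isCont scaleC.isCont resolvent_has_derivative(2)[OF out] continuous_intros) auto
  qed
  then have rh: "ray w h = ray (- w) h" by (simp add: ray_periodic)
  have rays: "ray v (\<lambda>z. tau z *\<^sub>C R z) = ray v h + ray v (kappa 1) *\<^sub>C tauA + ray v q *\<^sub>C (- R (- 1))" if v: "v \<in> {- w, w}" for v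
  proof -
    have cv: "cos v \<le> cos w" using v by auto
    have iq: "(\<lambda>t. cis v *\<^sub>C q (of_real t * cis v)) integrable_on {0<..}"
    proof (rule ray_integrable_decays(1)[OF _ dq UNIV_I])
      show "continuous_on {0<..} (\<lambda>t. q (of_real t * cis v))"
        unfolding q_def using nem1[of _ v] v w0 by (intro continuous_intros) (auto simp: eq_neg_iff_add_eq_0)
    qed
    have ik: "(\<lambda>t. cis v *\<^sub>C kappa 1 (of_real t * cis v)) integrable_on {0<..}"
      by (rule ray_kappa(2)[OF w0 w(2) one v])
    note q2 = ray_scaleC_right[OF iq, of "- R (- 1)"] and k2 = ray_scaleC_right[OF ik, of tauA]
    note t2 = ray_resolvent(1)[OF w(1) \<theta>(1) less_imp_le[OF \<theta>(2)] v tau]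
    have heq: "h (of_real t * cis v) = tau (of_real t * cis v) *\<^sub>C R (of_real t * cis v) - kappa 1 (of_real t * cis v) *\<^sub>C tauA - q (of_real t * cis v) *\<^sub>C (- R (- 1))" if "t > 0" for t
      using split[OF outside_ray(1)[OF w that cv] ne1[OF that] nem1[OF that]] v w w0 by auto
    have ih: "(\<lambda>t. cis v *\<^sub>C h (of_real t * cis v)) integrable_on {0<..}"
      by (rule integrable_eq[OF integrable_diff[OF integrable_diff[OF t2 k2(2)] q2(2)]])
        (use heq in \<open>simp add: scaleC.diff_right\<close>)
    have ihk: "(\<lambda>t. cis v *\<^sub>C (h (of_real t * cis v) + kappa 1 (of_real t * cis v) *\<^sub>C tauA)) integrable_on {0<..}"
      unfolding scaleC_add_right by (rule integrable_add[OF ih k2(2)])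
    have "ray v (\<lambda>z. tau z *\<^sub>C R z) = ray v (\<lambda>z. h z + kappa 1 z *\<^sub>C tauA + q z *\<^sub>C (- R (- 1)))"
      by (rule ray_cong) (use heq in simp)
    also have "\<dots> = ray v h + ray v (kappa 1) *\<^sub>C tauA + ray v q *\<^sub>C (- R (- 1))"
      by (simp only: ray_add[OF ihk q2(2)] ray_add[OF ih k2(2)] q2(1) k2(1))
    finally show ?thesis .
  qed
  have "ray (- w) (\<lambda>z. tau z *\<^sub>C R z) - ray w (\<lambda>z. tau z *\<^sub>C R z) = (ray (- w) (kappa 1) - ray w (kappa 1)) *\<^sub>C tauA"
    using rays[of w] rays[of "- w"] rh rq by (simp add: scaleC.diff_left)
  also have "\<dots> = (2 * of_real pi * \<i>) *\<^sub>C tauA" by (simp only: ray_kappa_one[OF w0 w(2)])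
  finally show ?thesis unfolding Psi_def by (simp add: scaleC_scaleC)
qed

end

section \<open>Multiplicativity of the calculus\<close>

lemma ray_diff:
  fixes h k :: "complex \<Rightarrow> 'b::{complex_normed_vector,banach}"
  assumes "(\<lambda>t. cis v *\<^sub>C h (of_real t * cis v)) integrable_on {0<..}"
    "(\<lambda>t. cis v *\<^sub>C k (of_real t * cis v)) integrable_on {0<..}"
  shows "ray v (\<lambda>z. h z - k z) = ray v h - ray v k"
  unfolding ray_def scaleC.diff_right by (rule integral_diff[OF assms])

text \<open>The left side is the distance from the point on the ray of angle \<sigma> to the line
  through the ray of angle v; rotating by - v turns it into an imaginary part.\<close>

lemma cmod_ray_diff_ge:
  assumes "x > 0" "y > 0"
  shows "x * \<bar>sin (\<sigma> - v)\<bar> \<le> cmod (of_real y * cis v - of_real x * cis \<sigma>)"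
proof -
  have "of_real y * cis v - of_real x * cis \<sigma> = cis v * (of_real y - of_real x * cis (\<sigma> - v))"
    by (simp add: algebra_simps cis_mult)
  then have "cmod (of_real y * cis v - of_real x * cis \<sigma>) = cmod (of_real y - of_real x * cis (\<sigma> - v))"
    by (simp add: norm_mult)
  moreover have "\<bar>Im (of_real y - of_real x * cis (\<sigma> - v))\<bar> \<le> cmod (of_real y - of_real x * cis (\<sigma> - v))"
    by (rule abs_Im_le_cmod)
  ultimately show ?thesis using assms by (simp add: abs_mult)
qed

context sectorial_operator
begin

text \<open>On rays that are not collinear, |\<lambda> - \<mu>| is at least a multiple of |\<mu>|,
  and the resolvent contributes 1/|\<lambda>|. So the double integrand is dominated by a product of
  two functions \<open>dk s t / t\<close>, as \<open>improper_fubini\<close> requires.\<close>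

lemma Psi_Fubini:
  assumes w: "\<omega> < w1" "w1 < w2" "w2 < \<theta>" "\<theta> \<le> pi" and f: "decaying \<theta> f" and g: "decaying \<theta> g"
    and v: "v \<in> {- w1, w1}" and \<sigma>: "\<sigma> \<in> {- w2, w2}" and sn: "sin (\<sigma> - v) \<noteq> 0"
  shows "(\<lambda>x. cis \<sigma> *\<^sub>C (g (of_real x * cis \<sigma>) *\<^sub>C ray v (\<lambda>l. (f l / (l - of_real x * cis \<sigma>)) *\<^sub>C R l))) integrable_on {0<..}"
    and "(\<lambda>y. cis v *\<^sub>C ((f (of_real y * cis v) * ray \<sigma> (\<lambda>\<mu>. g \<mu> / (of_real y * cis v - \<mu>))) *\<^sub>C R (of_real y * cis v))) integrable_on {0<..}"
    and "ray \<sigma> (\<lambda>\<mu>. g \<mu> *\<^sub>C ray v (\<lambda>l. (f l / (l - \<mu>)) *\<^sub>C R l)) = ray v (\<lambda>l. (f l * ray \<sigma> (\<lambda>\<mu>. g \<mu> / (l - \<mu>))) *\<^sub>C R l)"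
proof -
  have wpi: "w1 < pi" "w2 < pi" and w0: "0 < w1" "0 < w2" using w angle by auto
  have av: "\<bar>v\<bar> < \<theta>" and as: "\<bar>\<sigma>\<bar> < \<theta>" using v \<sigma> w w0 by auto
  have cv: "cos v \<le> cos w1" using v by auto
  define X where "X x = of_real x * cis \<sigma>" for x :: real
  define Y where "Y y = of_real y * cis v" for y :: real
  define H where "H x y = (cis \<sigma> * g (X x) * (cis v * (f (Y y) / (Y y - X x)))) *\<^sub>C R (Y y)" for x y
  obtain s1 C1 where s1: "s1 > 0" "C1 \<ge> 0" "\<And>z. z \<in> sector \<theta> \<Longrightarrow> cmod (f z) \<le> C1 * dk s1 (cmod z)"
    by (rule decayingE[OF f]) blast
  obtain s2 C2 where s2: "s2 > 0" "C2 \<ge> 0" "\<And>z. z \<in> sector \<theta> \<Longrightarrow> cmod (g z) \<le> C2 * dk s2 (cmod z)"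
    by (rule decayingE[OF g]) blast
  obtain M where M: "M > 0" "\<And>z. z \<noteq> 0 \<Longrightarrow> Re z \<le> cmod z * cos w1 \<Longrightarrow> norm (R z) \<le> M / cmod z"
    using resolvent_bound[OF w(1) wpi(1)] by blast
  define s where "s = min s1 s2"
  have s: "s > 0" unfolding s_def using s1 s2 by simp
  define c where "c = \<bar>sin (\<sigma> - v)\<bar>"
  have c: "c > 0" unfolding c_def using sn by simp
  have ge: "x * c \<le> cmod (Y y - X x)" if "x > 0" "y > 0" for x y
    unfolding c_def X_def Y_def by (rule cmod_ray_diff_ge[OF that])
  have ne: "Y y - X x \<noteq> 0" if "x > 0" "y > 0" for x y
  proof -
    have "0 < x * c" using that c by simp
    from less_le_trans[OF this ge[OF that]] show ?thesis by auto
  qed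
  have Ys: "Y y \<in> sector \<theta>" "Re (Y y) < cmod (Y y) * cos \<omega>" "Re (Y y) \<le> cmod (Y y) * cos w1" "cmod (Y y) = y" "Y y \<noteq> 0" if "y > 0" for y
    unfolding Y_def using cis_in_sector[OF that av w(4)] outside_ray[OF w(1) wpi(1) that cv] that by (auto simp: norm_mult)
  have Xs: "X x \<in> sector \<theta>" "cmod (X x) = x" "X x \<noteq> 0" "Re (X x) < cmod (X x) * cos w1" if "x > 0" for x
    unfolding X_def using cis_in_sector[OF that as w(4)] that \<sigma> cos_monotone_0_pi[of w1 w2] w w0 by (auto simp: norm_mult)
  have contf: "continuous_on {0<..} (\<lambda>y. f (Y y))" unfolding Y_def by (rule decaying_continuous_on_ray[OF f w(4) av])
  have contg: "continuous_on {0<..} (\<lambda>x. g (X x))" unfolding X_def by (rule decaying_continuous_on_ray[OF g w(4) as])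
  have contR: "continuous_on {0<..} (\<lambda>y. R (Y y))" unfolding Y_def by (rule resolvent_continuous_on_ray[OF w(1) wpi(1) cv])
  have contX: "continuous_on UNIV X" "continuous_on UNIV Y" unfolding X_def Y_def by (intro continuous_intros)+
  have contH: "continuous_on ({0<..} \<times> {0<..}) (\<lambda>(x, y). H x y)"
    unfolding H_def case_prod_unfold
    by (intro scaleC.continuous_on continuous_on_mult continuous_on_divide continuous_on_diff continuous_on_const
        continuous_on_compose2[OF contf continuous_on_snd[OF continuous_on_id]]
        continuous_on_compose2[OF contg continuous_on_fst[OF continuous_on_id]]
        continuous_on_compose2[OF contR continuous_on_snd[OF continuous_on_id]]
        continuous_on_compose2[OF contX(1) continuous_on_fst[OF continuous_on_id]]
        continuous_on_compose2[OF contX(2) continuous_on_snd[OF continuous_on_id]])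
      (use ne in auto)
  define D where "D t = dk s t / t" for t
  have D0: "D t \<ge> 0" if "t > 0" for t unfolding D_def using that less_imp_le[OF dk_pos[of s t]] by simp
  have Di: "D integrable_on {0<..}" unfolding D_def by (rule dk_integrable[OF s])
  have Dc: "continuous_on {0<..} D" unfolding D_def by (intro continuous_intros continuous_on_dk) auto
  define K where "K = C1 * C2 * M / c"
  have K0: "K \<ge> 0" unfolding K_def using s1 s2 M c by simp
  have le: "norm (H x y) \<le> K * (D x * D y)" if xy: "x > 0" "y > 0" for x y
  proof -
    have "cmod (f (Y y)) \<le> C1 * dk s1 y" using s1(3)[OF Ys(1)[OF xy(2)]] Ys(4)[OF xy(2)] by simp
    also have "\<dots> \<le> C1 * dk s y" using s1(2) by (intro mult_left_mono dk_mono) (auto simp: s_def)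
    finally have 1: "cmod (f (Y y)) \<le> C1 * dk s y" .
    have "cmod (g (X x)) \<le> C2 * dk s2 x" using s2(3)[OF Xs(1)[OF xy(1)]] Xs(2)[OF xy(1)] by simp
    also have "\<dots> \<le> C2 * dk s x" using s2(2) by (intro mult_left_mono dk_mono) (auto simp: s_def)
    finally have 2: "cmod (g (X x)) \<le> C2 * dk s x" .
    have 3: "norm (R (Y y)) \<le> M / y" using M(2)[OF Ys(5,3)[OF xy(2)]] Ys(4)[OF xy(2)] by simp
    have "0 < x * c" using xy c by simp
    from less_le_trans[OF this ge[OF xy]] this
    have 4: "1 / cmod (Y y - X x) \<le> 1 / (x * c)" using ge[OF xy] xy c by (intro divide_left_mono mult_pos_pos) auto
    have "norm (H x y) = (cmod (g (X x)) * cmod (f (Y y))) * ((1 / cmod (Y y - X x)) * norm (R (Y y)))"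
      unfolding H_def by (simp add: norm_scaleC norm_mult norm_divide)
    also have "\<dots> \<le> ((C2 * dk s x) * (C1 * dk s y)) * ((1 / (x * c)) * (M / y))"
      using 1 2 3 4 M(1) xy c s1(2) s2(2) less_imp_le[OF dk_pos[of s]] by (intro mult_mono mult_nonneg_nonneg) auto
    also have "\<dots> = K * (D x * D y)" unfolding K_def D_def by (simp add: mult_ac)
    finally show ?thesis .
  qed
  have le': "norm (H x y) \<le> K * (D y * D x)" if "y > 0" "x > 0" for x y
    using le[OF that(2,1)] by (simp add: mult.commute)
  have contH': "continuous_on ({0<..} \<times> {0<..}) (\<lambda>(y, x). H x y)"
  proof -
    have "continuous_on ({0<..} \<times> {0<..}) (\<lambda>p. case (snd p, fst p) of (x, y) \<Rightarrow> H x y)"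
      by (rule continuous_on_compose2[OF contH]) (auto intro!: continuous_intros)
    then show ?thesis by (simp add: case_prod_unfold)
  qed
  have Hy: "integral {0<..} (H x) = cis \<sigma> *\<^sub>C (g (X x) *\<^sub>C ray v (\<lambda>l. (f l / (l - X x)) *\<^sub>C R l))" if x: "x > 0" for x
  proof -
    have i: "(\<lambda>y. cis v *\<^sub>C ((f (Y y) / (Y y - X x)) *\<^sub>C R (Y y))) integrable_on {0<..}"
      unfolding Y_def by (rule Psi_resolvent(2)[OF w(1) _ w(4) f Xs(3,4)[OF x] v]) (use w in simp)
    have "integral {0<..} (\<lambda>y. (cis \<sigma> * g (X x)) *\<^sub>C cis v *\<^sub>C ((f (Y y) / (Y y - X x)) *\<^sub>C R (Y y))) = (cis \<sigma> * g (X x)) *\<^sub>C ray v (\<lambda>l. (f l / (l - X x)) *\<^sub>C R l)"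
      using integral_linear[OF i bounded_linear_scaleC] unfolding ray_def Y_def o_def .
    then show ?thesis unfolding H_def by (simp add: scaleC_scaleC mult_ac)
  qed
  have Hx: "integral {0<..} (\<lambda>x. H x y) = cis v *\<^sub>C ((f (Y y) * ray \<sigma> (\<lambda>\<mu>. g \<mu> / (Y y - \<mu>))) *\<^sub>C R (Y y))" if y: "y > 0" for y
  proof -
    have d: "decays (\<lambda>\<mu>. g \<mu> / (\<mu> - Y y)) {\<sigma>}"
      by (rule decays_quotient[OF Ys(5)[OF y] s2(1), of _ _ C2])
        (use s2(3)[OF Xs(1)] Xs(2) in \<open>auto simp: X_def\<close>)
    have "(\<lambda>x. cis \<sigma> *\<^sub>C (g (of_real x * cis \<sigma>) / (of_real x * cis \<sigma> - Y y))) integrable_on {0<..}"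
    proof (rule ray_integrable_decays(1)[OF _ d], fold X_def)
      show "continuous_on {0<..} (\<lambda>x. g (X x) / (X x - Y y))"
        by (intro continuous_on_divide contg continuous_on_diff continuous_on_subset[OF contX(1)] continuous_on_const)
          (use ne y in force)+
    qed simp
    then have i: "(\<lambda>x. cis \<sigma> *\<^sub>C (g (X x) / (Y y - X x))) integrable_on {0<..}"
      using integrable_neg by (fastforce simp: X_def scaleC_complex_def minus_divide_right dest: integrable_neg)
    have L: "bounded_linear (\<lambda>c. (cis v * f (Y y) * c) *\<^sub>C R (Y y))"
      by (rule bounded_linear_compose[OF scaleC.bounded_linear_left bounded_linear_mult_right])
    have "integral {0<..} (\<lambda>x. (cis v * f (Y y) * (cis \<sigma> *\<^sub>C (g (X x) / (Y y - X x)))) *\<^sub>C R (Y y)) = (cis v * f (Y y) * ray \<sigma> (\<lambda>\<mu>. g \<mu> / (Y y - \<mu>))) *\<^sub>C R (Y y)"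
      using integral_linear[OF i L]
      unfolding ray_def X_def o_def .
    then show ?thesis unfolding H_def by (simp add: scaleC_scaleC scaleC_complex_def mult_ac)
  qed
  have "(\<lambda>x. integral {0<..} (H x)) integrable_on {0<..}"
    by (rule parameter_integral_integrable[OF contH le Di D0 K0 Dc])
  then have i1: "(\<lambda>x. cis \<sigma> *\<^sub>C (g (X x) *\<^sub>C ray v (\<lambda>l. (f l / (l - X x)) *\<^sub>C R l))) integrable_on {0<..}"
    by (rule integrable_eq) (simp add: Hy)
  have "(\<lambda>y. integral {0<..} (\<lambda>x. H x y)) integrable_on {0<..}"
    by (rule parameter_integral_integrable[OF contH' le' Di D0 K0 Dc])
  then have i2: "(\<lambda>y. cis v *\<^sub>C ((f (Y y) * ray \<sigma> (\<lambda>\<mu>. g \<mu> / (Y y - \<mu>))) *\<^sub>C R (Y y))) integrable_on {0<..}"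
    by (rule integrable_eq) (simp add: Hx)
  show "(\<lambda>x. cis \<sigma> *\<^sub>C (g (of_real x * cis \<sigma>) *\<^sub>C ray v (\<lambda>l. (f l / (l - of_real x * cis \<sigma>)) *\<^sub>C R l))) integrable_on {0<..}"
    using i1 unfolding X_def .
  show "(\<lambda>y. cis v *\<^sub>C ((f (of_real y * cis v) * ray \<sigma> (\<lambda>\<mu>. g \<mu> / (of_real y * cis v - \<mu>))) *\<^sub>C R (of_real y * cis v))) integrable_on {0<..}"
    using i2 unfolding Y_def .
  have "integral {0<..} (\<lambda>x. integral {0<..} (H x)) = integral {0<..} (\<lambda>y. integral {0<..} (\<lambda>x. H x y))"
    by (rule improper_fubini[OF contH le Di D0 K0 parameter_integral_integrable[OF contH le Di D0 K0 Dc] parameter_integral_integrable[OF contH' le' Di D0 K0 Dc]])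
  moreover have "integral {0<..} (\<lambda>x. integral {0<..} (H x)) = ray \<sigma> (\<lambda>\<mu>. g \<mu> *\<^sub>C ray v (\<lambda>l. (f l / (l - \<mu>)) *\<^sub>C R l))"
    unfolding ray_def[of \<sigma>] X_def[symmetric] by (rule integral_cong) (simp add: Hy)
  moreover have "integral {0<..} (\<lambda>y. integral {0<..} (\<lambda>x. H x y)) = ray v (\<lambda>l. (f l * ray \<sigma> (\<lambda>\<mu>. g \<mu> / (l - \<mu>))) *\<^sub>C R l)"
    unfolding ray_def[of v] Y_def[symmetric] by (rule integral_cong) (simp add: Hx)
  ultimately show "ray \<sigma> (\<lambda>\<mu>. g \<mu> *\<^sub>C ray v (\<lambda>l. (f l / (l - \<mu>)) *\<^sub>C R l)) = ray v (\<lambda>l. (f l * ray \<sigma> (\<lambda>\<mu>. g \<mu> / (l - \<mu>))) *\<^sub>C R l)"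
    by simp
qed

text \<open>The contour of g surrounds that of f. The resolvent at \<mu> is absorbed into f by
  \<open>Psi_resolvent\<close>; after exchanging the integrals, the scalar integral over \<mu> is a
  Cauchy integral with \<lambda> inside and returns g(\<lambda>). If w1 + w2 were pi, the upper ray
  of one contour and the lower ray of the other would lie on one line.\<close>

lemma Psi_mult_two_angles:
  assumes w: "\<omega> < w1" "w1 < w2" "w2 < \<theta>" "\<theta> \<le> pi" and ne: "w1 + w2 \<noteq> pi"
    and f: "decaying \<theta> f" and g: "decaying \<theta> g"
  shows "Psi w1 f o\<^sub>L Psi w2 g = Psi w1 (\<lambda>z. f z * g z)"
proof -
  have wpi: "w1 < pi" "w2 < pi" and w0: "0 < w1" "0 < w2" and w13: "w1 < \<theta>" and w23: "\<omega> < w2" using w angle by auto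
  define k where "k = 1 / (2 * of_real pi * \<i>)"
  have k: "k * (2 * of_real pi * \<i>) = 1" unfolding k_def by simp
  have sin1: "sin x \<noteq> 0" if "0 < x" "x < pi" for x using sin_gt_zero[OF that] by simp
  have sin2: "sin (w1 + w2) \<noteq> 0"
  proof (cases "w1 + w2 < pi")
    case True
    then show ?thesis using w0 by (intro sin1) auto
  next
    case False
    then have "sin (w1 + w2 - pi) \<noteq> 0" using ne wpi by (intro sin1) auto
    then show ?thesis by (simp add: sin_diff)
  qed
  have sin3: "sin (w2 - w1) \<noteq> 0" using w wpi w0 by (intro sin1) auto
  have sn: "sin (\<sigma> - v) \<noteq> 0" if "v \<in> {- w1, w1}" "\<sigma> \<in> {- w2, w2}" for v \<sigma>
  proof -
    have "sin (- w2 - w1) = - sin (w1 + w2)" 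
    proof -
      have "- w2 - w1 = - (w1 + w2)" by simp
      then show ?thesis by (simp only: sin_minus)
    qed
    moreover have "sin (- w2 - - w1) = - sin (w2 - w1)" using sin_minus[of "w2 - w1"] by simp
    ultimately show ?thesis using that sin2 sin3 by (auto simp: add.commute)
  qed
  note F = Psi_Fubini[OF w f g _ _ sn]
  \<comment> \<open>One iterated integral for each pair of boundary rays; the product is a signed
    sum of the four.\<close>
  define N where "N \<sigma> v = ray \<sigma> (\<lambda>\<mu>. g \<mu> *\<^sub>C ray v (\<lambda>l. (f l / (l - \<mu>)) *\<^sub>C R l))" for \<sigma> v
  have Pf: "Psi w1 f \<in> bounded_ops" by (rule Psi_bounded_ops[OF w(1) w13 w(4) f])
  have outer: "Psi w1 f o\<^sub>L ray \<sigma> (\<lambda>z. g z *\<^sub>C R z) = - (k *\<^sub>C (N \<sigma> (- w1) - N \<sigma> w1))" if \<sigma>: "\<sigma> \<in> {- w2, w2}" for \<sigma>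
  proof -
    have "Psi w1 f o\<^sub>L ray \<sigma> (\<lambda>z. g z *\<^sub>C R z) = ray \<sigma> (\<lambda>z. Psi w1 f o\<^sub>L (g z *\<^sub>C R z))"
      by (rule ray_linear(1)[OF ray_resolvent(1)[OF w23 w(3,4) \<sigma> g] scaleC_compose_linear(2), symmetric])
        (rule scaleC_compose_right[OF Pf])
    also have "\<dots> = ray \<sigma> (\<lambda>\<mu>. (- k) *\<^sub>C (g \<mu> *\<^sub>C ray (- w1) (\<lambda>l. (f l / (l - \<mu>)) *\<^sub>C R l) - g \<mu> *\<^sub>C ray w1 (\<lambda>l. (f l / (l - \<mu>)) *\<^sub>C R l)))"
    proof (rule ray_cong)
      fix t :: real assume t: "t > 0"
      let ?z = "of_real t * cis \<sigma>"
      have "Re ?z < cmod ?z * cos w1" "?z \<noteq> 0"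
        using t \<sigma> cos_monotone_0_pi[of w1 w2] w w0 by (auto simp: norm_mult)
      then have P: "Psi w1 f o\<^sub>L R ?z = - Psi w1 (\<lambda>l. f l / (l - ?z))"
        by (intro Psi_resolvent(1)[OF w(1) w13 w(4) f])
      have Q: "Psi w1 (\<lambda>l. f l / (l - ?z)) = k *\<^sub>C (ray (- w1) (\<lambda>l. (f l / (l - ?z)) *\<^sub>C R l) - ray w1 (\<lambda>l. (f l / (l - ?z)) *\<^sub>C R l))"
        by (simp only: Psi_def k_def)
      show "Psi w1 f o\<^sub>L (g ?z *\<^sub>C R ?z) = (- k) *\<^sub>C (g ?z *\<^sub>C ray (- w1) (\<lambda>l. (f l / (l - ?z)) *\<^sub>C R l) - g ?z *\<^sub>C ray w1 (\<lambda>l. (f l / (l - ?z)) *\<^sub>C R l))"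
        unfolding scaleC_compose_right[OF Pf] P Q
        by (simp add: scaleC.diff_right scaleC_scaleC scaleC.minus_left scaleC.minus_right mult.commute)
    qed
    also have "\<dots> = (- k) *\<^sub>C (N \<sigma> (- w1) - N \<sigma> w1)"
    proof -
      have i: "(\<lambda>x. cis \<sigma> *\<^sub>C (g (of_real x * cis \<sigma>) *\<^sub>C ray (- w1) (\<lambda>l. (f l / (l - of_real x * cis \<sigma>)) *\<^sub>C R l))) integrable_on {0<..}"
        "(\<lambda>x. cis \<sigma> *\<^sub>C (g (of_real x * cis \<sigma>) *\<^sub>C ray w1 (\<lambda>l. (f l / (l - of_real x * cis \<sigma>)) *\<^sub>C R l))) integrable_on {0<..}"
        by (rule F(1); use \<sigma> in simp)+
      have "(\<lambda>x. cis \<sigma> *\<^sub>C (g (of_real x * cis \<sigma>) *\<^sub>C ray (- w1) (\<lambda>l. (f l / (l - of_real x * cis \<sigma>)) *\<^sub>C R l) - g (of_real x * cis \<sigma>) *\<^sub>C ray w1 (\<lambda>l. (f l / (l - of_real x * cis \<sigma>)) *\<^sub>C R l))) integrable_on {0<..}"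
        unfolding scaleC.diff_right by (rule integrable_diff[OF i])
      from ray_linear(1)[OF this bounded_linear_scaleC, of "- k"]
      show ?thesis unfolding N_def ray_diff[OF i, symmetric] by (simp add: scaleC_scaleC mult.commute)
    qed
    finally show ?thesis by (simp add: scaleC.minus_left)
  qed
  have inner: "N (- w2) v - N w2 v = - ((2 * of_real pi * \<i>) *\<^sub>C ray v (\<lambda>z. (f z * g z) *\<^sub>C R z))" if v: "v \<in> {- w1, w1}" for v
  proof -
    have fg: "decaying \<theta> (\<lambda>z. f z * g z)" by (rule decaying_mult[OF f g])
    have i: "(\<lambda>y. cis v *\<^sub>C ((f (of_real y * cis v) * ray (- w2) (\<lambda>\<mu>. g \<mu> / (of_real y * cis v - \<mu>))) *\<^sub>C R (of_real y * cis v))) integrable_on {0<..}"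
      "(\<lambda>y. cis v *\<^sub>C ((f (of_real y * cis v) * ray w2 (\<lambda>\<mu>. g \<mu> / (of_real y * cis v - \<mu>))) *\<^sub>C R (of_real y * cis v))) integrable_on {0<..}"
      by (rule F(2); use v in simp)+
    have "N (- w2) v - N w2 v = ray v (\<lambda>l. (f l * ray (- w2) (\<lambda>\<mu>. g \<mu> / (l - \<mu>))) *\<^sub>C R l) - ray v (\<lambda>l. (f l * ray w2 (\<lambda>\<mu>. g \<mu> / (l - \<mu>))) *\<^sub>C R l)"
      unfolding N_def using F(3)[of v "- w2"] F(3)[of v w2] v by auto
    also have "\<dots> = ray v (\<lambda>l. (f l * ray (- w2) (\<lambda>\<mu>. g \<mu> / (l - \<mu>))) *\<^sub>C R l - (f l * ray w2 (\<lambda>\<mu>. g \<mu> / (l - \<mu>))) *\<^sub>C R l)"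
      by (rule ray_diff[OF i, symmetric])
    also have "\<dots> = ray v (\<lambda>z. (- (2 * of_real pi * \<i>)) *\<^sub>C ((f z * g z) *\<^sub>C R z))"
    proof (rule ray_cong)
      fix t :: real assume t: "t > 0"
      let ?z = "of_real t * cis v"
      have zs: "?z \<in> sector w2" using v t w w0 wpi by (intro cis_in_sector) auto
      have neg: "ray u (\<lambda>\<mu>. g \<mu> / (?z - \<mu>)) = - ray u (\<lambda>\<mu>. g \<mu> / (\<mu> - ?z))" for u
      proof -
        have e: "(\<lambda>\<mu>. g \<mu> / (?z - \<mu>)) = (\<lambda>\<mu>. - (g \<mu> / (\<mu> - ?z)))" by (simp add: minus_divide_right fun_eq_iff)
        show ?thesis unfolding e ray_def scaleC.minus_right by (rule integral_neg)
      qed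
      have "ray (- w2) (\<lambda>\<mu>. g \<mu> / (?z - \<mu>)) - ray w2 (\<lambda>\<mu>. g \<mu> / (?z - \<mu>)) = - (2 * of_real pi * \<i> * g ?z)"
        unfolding neg using ray_quotient_inside[OF g w0(2) w(3,4) zs] by (simp add: algebra_simps)
      then have "f ?z * ray (- w2) (\<lambda>\<mu>. g \<mu> / (?z - \<mu>)) - f ?z * ray w2 (\<lambda>\<mu>. g \<mu> / (?z - \<mu>)) = - (2 * of_real pi * \<i>) * (f ?z * g ?z)"
        unfolding right_diff_distrib[symmetric] by simp
      then show "(f ?z * ray (- w2) (\<lambda>\<mu>. g \<mu> / (?z - \<mu>))) *\<^sub>C R ?z - (f ?z * ray w2 (\<lambda>\<mu>. g \<mu> / (?z - \<mu>))) *\<^sub>C R ?z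
          = (- (2 * of_real pi * \<i>)) *\<^sub>C ((f ?z * g ?z) *\<^sub>C R ?z)"
        unfolding scaleC.diff_left[symmetric] scaleC_scaleC by simp
    qed
    also have "\<dots> = (- (2 * of_real pi * \<i>)) *\<^sub>C ray v (\<lambda>z. (f z * g z) *\<^sub>C R z)"
      by (rule ray_linear(1)[OF ray_resolvent(1)[OF w(1) w13 w(4) v fg] bounded_linear_scaleC])
        (simp add: scaleC_scaleC mult.commute)
    finally show ?thesis by (simp add: scaleC.minus_left)
  qed
  have "Psi w1 f o\<^sub>L Psi w2 g = k *\<^sub>C ((Psi w1 f o\<^sub>L ray (- w2) (\<lambda>z. g z *\<^sub>C R z)) - (Psi w1 f o\<^sub>L ray w2 (\<lambda>z. g z *\<^sub>C R z)))"
    unfolding Psi_def[of w2] k_def[symmetric] scaleC_compose_right[OF Pf] compose.diff_right ..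
  also have "\<dots> = (- (k * k)) *\<^sub>C ((N (- w2) (- w1) - N w2 (- w1)) - (N (- w2) w1 - N w2 w1))"
  proof -
    have o: "Psi w1 f o\<^sub>L ray (- w2) (\<lambda>z. g z *\<^sub>C R z) = - (k *\<^sub>C (N (- w2) (- w1) - N (- w2) w1))"
      "Psi w1 f o\<^sub>L ray w2 (\<lambda>z. g z *\<^sub>C R z) = - (k *\<^sub>C (N w2 (- w1) - N w2 w1))"
      by (rule outer; simp)+
    show ?thesis unfolding o
      by (simp add: scaleC.diff_right scaleC.minus_left scaleC.minus_right scaleC_scaleC)
  qed
  also have "\<dots> = (k * k * (2 * of_real pi * \<i>)) *\<^sub>C (ray (- w1) (\<lambda>z. (f z * g z) *\<^sub>C R z) - ray w1 (\<lambda>z. (f z * g z) *\<^sub>C R z))"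
  proof -
    have i: "N (- w2) (- w1) - N w2 (- w1) = - ((2 * of_real pi * \<i>) *\<^sub>C ray (- w1) (\<lambda>z. (f z * g z) *\<^sub>C R z))"
      "N (- w2) w1 - N w2 w1 = - ((2 * of_real pi * \<i>) *\<^sub>C ray w1 (\<lambda>z. (f z * g z) *\<^sub>C R z))"
      by (rule inner; simp)+
    show ?thesis unfolding i
      by (simp add: scaleC.diff_right scaleC.minus_left scaleC.minus_right scaleC_scaleC)
  qed
  also have "k * k * (2 * of_real pi * \<i>) = k" using k by (simp add: mult.assoc)
  finally show ?thesis unfolding Psi_def k_def .
qed

lemma Psi_mult:
  assumes w: "\<omega> < w" "w < \<theta>" "\<theta> \<le> pi" and f: "decaying \<theta> f" and g: "decaying \<theta> g"
  shows "Psi w f o\<^sub>L Psi w g = Psi w (\<lambda>z. f z * g z)"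
proof -
  \<comment> \<open>The midpoint of w and \<theta> will do unless it adds up with w to pi; in that
    case the point one third of the way will.\<close>
  obtain w2 where w2: "w < w2" "w2 < \<theta>" "w + w2 \<noteq> pi"
  proof (cases "w + (w + \<theta>) / 2 = pi")
    case True
    show ?thesis
    proof (rule that[of "w + (\<theta> - w) / 3"])
      show "w < w + (\<theta> - w) / 3" "w + (\<theta> - w) / 3 < \<theta>" using w by (simp_all add: field_simps)
      show "w + (w + (\<theta> - w) / 3) \<noteq> pi" using w True by (auto simp: field_simps)
    qed
  next
    case False
    show ?thesis
    proof (rule that[of "(w + \<theta>) / 2"])
      show "w < (w + \<theta>) / 2" "(w + \<theta>) / 2 < \<theta>" using w by (simp_all add: field_simps)
    qed (rule False)
  qed
  have "Psi w g = Psi w2 g" by (rule Psi_angle[OF w(1) less_imp_le[OF w2(1)] w2(2) w(3) g])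
  then show ?thesis using Psi_mult_two_angles[OF w(1) w2(1,2) w(3) w2(3) f g] by simp
qed

end

section \<open>Approximate identities and regularisers\<close>

lemma real_Suc_pos: "0 < real (Suc n)" "0 < 1 / real (Suc n)"
  by simp_all

lemma dense_eqI:
  fixes f g :: "'a::topological_space \<Rightarrow> 'b::t2_space"
  assumes "closure D = UNIV" "continuous_on UNIV f" "continuous_on UNIV g" "\<And>x. x \<in> D \<Longrightarrow> f x = g x"
  shows "f x = g x"
proof -
  have "closure D \<subseteq> {x. f x = g x}"
    by (rule closure_minimal) (use assms in \<open>auto intro: closed_Collect_eq\<close>)
  then show ?thesis using assms(1) by auto
qed

lemma blinfun_compose_dense_cancel:
  assumes "S o\<^sub>L T = S' o\<^sub>L T" "closure (range (blinfun_apply T)) = UNIV"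
  shows "S = S'"
proof (rule blinfun_eqI)
  fix x
  show "blinfun_apply S x = blinfun_apply S' x"
  proof (rule dense_eqI[OF assms(2)])
    fix y assume "y \<in> range (blinfun_apply T)"
    then show "blinfun_apply S y = blinfun_apply S' y"
      using assms(1) by (metis blinfun_apply_blinfun_compose imageE)
  qed (intro continuous_intros)+
qed

lemma dense_range_compose:
  assumes "closure (range (blinfun_apply S)) = UNIV" "closure (range (blinfun_apply T)) = UNIV"
  shows "closure (range (blinfun_apply (S o\<^sub>L T))) = UNIV"
proof -
  have "blinfun_apply S ` closure (range (blinfun_apply T)) \<subseteq> closure (blinfun_apply S ` range (blinfun_apply T))"
    by (rule image_closure_subset) (auto intro!: continuous_intros closure_subset)
  then have "range (blinfun_apply S) \<subseteq> closure (range (blinfun_apply (S o\<^sub>L T)))"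
    using assms(2) by (simp add: image_image)
  then have "closure (range (blinfun_apply S)) \<subseteq> closure (range (blinfun_apply (S o\<^sub>L T)))"
    by (rule closure_minimal) simp
  then show ?thesis using assms(1) by auto
qed

lemma strong_null_limit:
  fixes S :: "nat \<Rightarrow> 'a::real_normed_vector \<Rightarrow>\<^sub>L 'b::real_normed_vector"
  assumes bound: "\<And>n. norm (S n) \<le> K" and D: "closure D = UNIV"
    and lim: "\<And>x. x \<in> D \<Longrightarrow> (\<lambda>n. blinfun_apply (S n) x) \<longlonglongrightarrow> 0"
  shows "(\<lambda>n. blinfun_apply (S n) x) \<longlonglongrightarrow> 0"
proof (rule LIMSEQ_I)
  fix e :: real assume e: "e > 0"
  have K: "K \<ge> 0" using bound[of 0] norm_ge_zero order_trans by blast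
  have "x \<in> closure D" using D by simp
  moreover have "e / (2 * (K + 1)) > 0" using e K by simp
  ultimately obtain y where y: "y \<in> D" "dist y x < e / (2 * (K + 1))" unfolding closure_approachable by blast
  have "e / 2 > 0" using e by simp
  from LIMSEQ_D[OF lim[OF y(1)] this] obtain N where N: "\<And>n. n \<ge> N \<Longrightarrow> norm (blinfun_apply (S n) y) < e / 2"
    by auto
  show "\<exists>N. \<forall>n\<ge>N. norm (blinfun_apply (S n) x - 0) < e"
  proof (intro exI allI impI)
    fix n assume n: "n \<ge> N"
    have "norm (blinfun_apply (S n) (x - y)) \<le> norm (S n) * norm (x - y)" by (rule norm_blinfun)
    also have "\<dots> \<le> (K + 1) * (e / (2 * (K + 1)))"
      using bound[of n] y(2) K by (intro mult_mono) (auto simp: dist_norm norm_minus_commute)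
    also have "\<dots> = e / 2" using K by (simp add: field_simps)
    finally have 1: "norm (blinfun_apply (S n) (x - y)) \<le> e / 2" .
    have "blinfun_apply (S n) x = blinfun_apply (S n) (x - y) + blinfun_apply (S n) y"
      by (simp add: blinfun.diff_right)
    then have "norm (blinfun_apply (S n) x) \<le> norm (blinfun_apply (S n) (x - y)) + norm (blinfun_apply (S n) y)"
      by (metis norm_triangle_ineq)
    then show "norm (blinfun_apply (S n) x - 0) < e" using 1 N[OF n] by simp
  qed
qed

text \<open>The estimate makes Q x a well-defined Lipschitz function of T x on the dense range of T,
  and S is its continuous extension.\<close>

lemma blinfun_extension:
  fixes T :: "'a::real_normed_vector \<Rightarrow>\<^sub>L 'b::real_normed_vector" and Q :: "'a \<Rightarrow>\<^sub>L 'c::banach"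
  assumes dense: "closure (range (blinfun_apply T)) = UNIV" and C: "C \<ge> 0"
    and le: "\<And>x. norm (blinfun_apply Q x) \<le> C * norm (blinfun_apply T x)"
  obtains S where "S o\<^sub>L T = Q" "norm S \<le> C"
proof -
  \<comment> \<open>Required for all x, this inequality determines z, since T x can be chosen close
    to y. Linearity of the resulting S follows from it by approximation, and its norm bound by
    taking x = 0.\<close>
  have ex: "\<exists>z. \<forall>x. norm (z - blinfun_apply Q x) \<le> C * norm (y - blinfun_apply T x)" for y
  proof -
    have "y \<in> closure (range (blinfun_apply T))" using dense by simp
    then obtain u where u: "\<And>n. u n \<in> range (blinfun_apply T)" "u \<longlonglongrightarrow> y"
      unfolding closure_sequential by blast
    then have "\<forall>n. \<exists>x. u n = blinfun_apply T x" by blast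
    then obtain f where f: "\<And>n. u n = blinfun_apply T (f n)" by metis
    have QQ: "norm (blinfun_apply Q a - blinfun_apply Q b) \<le> C * norm (blinfun_apply T a - blinfun_apply T b)" for a b
      using le[of "a - b"] by (simp add: blinfun.diff_right)
    have "Cauchy (\<lambda>n. blinfun_apply Q (f n))"
    proof (rule metric_CauchyI)
      fix e :: real assume e: "e > 0"
      then have "e / (C + 1) > 0" using C by simp
      from metric_CauchyD[OF LIMSEQ_imp_Cauchy[OF u(2)] this]
      obtain M where M: "\<And>m n. m \<ge> M \<Longrightarrow> n \<ge> M \<Longrightarrow> dist (u m) (u n) < e / (C + 1)" by blast
      show "\<exists>M. \<forall>m\<ge>M. \<forall>n\<ge>M. dist (blinfun_apply Q (f m)) (blinfun_apply Q (f n)) < e"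
      proof (intro exI allI impI)
        fix m n assume "m \<ge> M" "n \<ge> M"
        then have "dist (u m) (u n) < e / (C + 1)" by (rule M)
        then have "(C + 1) * dist (u m) (u n) < e" using C by (simp add: field_simps)
        moreover have "C * dist (u m) (u n) \<le> (C + 1) * dist (u m) (u n)" by (intro mult_right_mono) auto
        moreover have "dist (blinfun_apply Q (f m)) (blinfun_apply Q (f n)) \<le> C * dist (u m) (u n)"
          using QQ[of "f m" "f n"] by (simp add: dist_norm f)
        ultimately show "dist (blinfun_apply Q (f m)) (blinfun_apply Q (f n)) < e" by linarith
      qed
    qed
    then obtain z where z: "(\<lambda>n. blinfun_apply Q (f n)) \<longlonglongrightarrow> z" using Cauchy_convergent convergentD by blast
    have "norm (z - blinfun_apply Q x) \<le> C * norm (y - blinfun_apply T x)" for x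
    proof (rule LIMSEQ_le)
      show "(\<lambda>n. norm (blinfun_apply Q (f n) - blinfun_apply Q x)) \<longlonglongrightarrow> norm (z - blinfun_apply Q x)"
        by (intro tendsto_intros z)
      show "(\<lambda>n. C * norm (u n - blinfun_apply T x)) \<longlonglongrightarrow> C * norm (y - blinfun_apply T x)"
        by (intro tendsto_intros u)
      show "\<exists>N. \<forall>n\<ge>N. norm (blinfun_apply Q (f n) - blinfun_apply Q x) \<le> C * norm (u n - blinfun_apply T x)"
        using QQ f by auto
    qed
    then show ?thesis by blast
  qed
  obtain S where S: "\<And>y x. norm (S y - blinfun_apply Q x) \<le> C * norm (y - blinfun_apply T x)"
    using ex by metis
  have approx: "\<exists>x. norm (y - blinfun_apply T x) < e" if "e > 0" for y e
  proof -
    have "y \<in> closure (range (blinfun_apply T))" using dense by simp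
    then show ?thesis using that unfolding closure_approachable by (auto simp: dist_norm norm_minus_commute)
  qed
  have "bounded_linear S"
  proof (rule bounded_linear_intro)
    fix y y' :: 'b
    have "norm (S (y + y') - (S y + S y')) \<le> 0"
    proof (rule field_le_epsilon)
      fix e :: real assume e: "e > 0"
      define d where "d = e / (4 * (C + 1))"
      have d: "d > 0" unfolding d_def using e C by simp
      obtain x x' where x: "norm (y - blinfun_apply T x) < d" "norm (y' - blinfun_apply T x') < d"
        using approx[OF d] by metis
      have "norm (S (y + y') - (S y + S y')) = norm ((S (y + y') - blinfun_apply Q (x + x')) - ((S y - blinfun_apply Q x) + (S y' - blinfun_apply Q x')))"
        by (simp add: blinfun.add_right algebra_simps)
      also have "\<dots> \<le> norm (S (y + y') - blinfun_apply Q (x + x')) + (norm (S y - blinfun_apply Q x) + norm (S y' - blinfun_apply Q x'))"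
        by (intro order_trans[OF norm_triangle_ineq4] add_left_mono norm_triangle_ineq)
      also have "\<dots> \<le> C * norm (y + y' - blinfun_apply T (x + x')) + (C * norm (y - blinfun_apply T x) + C * norm (y' - blinfun_apply T x'))"
        by (intro add_mono S)
      also have "\<dots> \<le> C * (d + d) + (C * d + C * d)"
      proof -
        have "y + y' - blinfun_apply T (x + x') = (y - blinfun_apply T x) + (y' - blinfun_apply T x')"
          by (simp add: blinfun.add_right)
        then have "norm (y + y' - blinfun_apply T (x + x')) \<le> norm (y - blinfun_apply T x) + norm (y' - blinfun_apply T x')"
          by (simp only: norm_triangle_ineq)
        then have n: "norm (y + y' - blinfun_apply T (x + x')) \<le> d + d" using x by linarith
        show ?thesis
          by (rule add_mono[OF mult_left_mono[OF n C] add_mono[OF mult_left_mono[OF less_imp_le[OF x(1)] C]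
                mult_left_mono[OF less_imp_le[OF x(2)] C]]])
      qed
      also have "\<dots> \<le> 0 + e"
      proof -
        have "C * (d + d) + (C * d + C * d) = 4 * C * d" by simp
        also have "\<dots> \<le> 4 * (C + 1) * d" using d by (intro mult_right_mono) auto
        also have "\<dots> = e" unfolding d_def using C by (simp add: field_simps)
        finally show ?thesis by simp
      qed
      finally show "norm (S (y + y') - (S y + S y')) \<le> 0 + e" .
    qed
    then show "S (y + y') = S y + S y'" by simp
  next
    fix r :: real and y :: 'b
    have "norm (S (r *\<^sub>R y) - r *\<^sub>R S y) \<le> 0"
    proof (rule field_le_epsilon)
      fix e :: real assume e: "e > 0"
      define d where "d = e / (2 * (C + 1) * (\<bar>r\<bar> + 1))"
      have d: "d > 0" unfolding d_def using e C by simp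
      obtain x where x: "norm (y - blinfun_apply T x) < d" using approx[OF d] by metis
      have "norm (S (r *\<^sub>R y) - r *\<^sub>R S y) = norm ((S (r *\<^sub>R y) - blinfun_apply Q (r *\<^sub>R x)) - r *\<^sub>R (S y - blinfun_apply Q x))"
        by (simp add: blinfun.scaleR_right algebra_simps)
      also have "\<dots> \<le> norm (S (r *\<^sub>R y) - blinfun_apply Q (r *\<^sub>R x)) + \<bar>r\<bar> * norm (S y - blinfun_apply Q x)"
        using norm_triangle_ineq4[of "S (r *\<^sub>R y) - blinfun_apply Q (r *\<^sub>R x)" "r *\<^sub>R (S y - blinfun_apply Q x)"] by simp
      also have "\<dots> \<le> C * norm (r *\<^sub>R y - blinfun_apply T (r *\<^sub>R x)) + \<bar>r\<bar> * (C * norm (y - blinfun_apply T x))"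
        by (intro add_mono mult_left_mono S) auto
      also have "\<dots> = 2 * C * \<bar>r\<bar> * norm (y - blinfun_apply T x)"
        by (simp add: blinfun.scaleR_right scaleR_diff_right[symmetric])
      also have "\<dots> \<le> 2 * (C + 1) * (\<bar>r\<bar> + 1) * d" using x C by (intro mult_mono) auto
      also have "\<dots> = 0 + e"
      proof -
        have "2 * (C + 1) * (\<bar>r\<bar> + 1) > 0" using C by (intro mult_pos_pos) auto
        then have nz: "2 * (C + 1) * (\<bar>r\<bar> + 1) \<noteq> 0" by (rule less_imp_neq[symmetric])
        show ?thesis
          unfolding d_def by (simp only: times_divide_eq_right nonzero_mult_div_cancel_left[OF nz] add_0)
      qed
      finally show "norm (S (r *\<^sub>R y) - r *\<^sub>R S y) \<le> 0 + e" .
    qed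
    then show "S (r *\<^sub>R y) = r *\<^sub>R S y" by simp
  next
    fix y show "norm (S y) \<le> norm y * C" using S[of y 0] by (simp add: mult.commute)
  qed
  then have app: "blinfun_apply (Blinfun S) = S" by (rule bounded_linear_Blinfun_apply)
  show ?thesis
  proof (rule that[of "Blinfun S"])
    show "Blinfun S o\<^sub>L T = Q"
    proof (rule blinfun_eqI)
      fix x show "blinfun_apply (Blinfun S o\<^sub>L T) x = blinfun_apply Q x"
        using S[of "blinfun_apply T x" x] by (simp add: app)
    qed
    show "norm (Blinfun S) \<le> C"
      by (rule norm_blinfun_bound[OF C]) (use S[of _ 0] in \<open>simp add: app\<close>)
  qed
qed

lemma bounded_ops_extension:
  fixes S T Q :: "'a::complex_banach \<Rightarrow>\<^sub>L 'a"
  assumes "S o\<^sub>L T = Q" "closure (range (blinfun_apply T)) = UNIV" "T \<in> bounded_ops" "Q \<in> bounded_ops"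
  shows "S \<in> bounded_ops"
  unfolding bounded_ops_def
proof (intro CollectI allI)
  fix c :: complex and x
  have cont: "continuous_on UNIV (\<lambda>y::'a. c *\<^sub>C y)"
    by (rule bounded_linear.continuous_on[OF bounded_linear_scaleC continuous_on_id])
  show "blinfun_apply S (c *\<^sub>C x) = c *\<^sub>C blinfun_apply S x"
  proof (rule dense_eqI[OF assms(2), of "\<lambda>x. blinfun_apply S (c *\<^sub>C x)"])
    show "continuous_on UNIV (\<lambda>x. blinfun_apply S (c *\<^sub>C x))"
      by (intro continuous_intros cont)
    show "continuous_on UNIV (\<lambda>x. c *\<^sub>C blinfun_apply S x)"
      by (intro bounded_linear.continuous_on[OF bounded_linear_scaleC] continuous_intros)
    fix y assume "y \<in> range (blinfun_apply T)"
    then obtain u where u: "y = blinfun_apply T u" by auto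
    have ST: "blinfun_apply S (blinfun_apply T v) = blinfun_apply Q v" for v
      using assms(1) by (metis blinfun_apply_blinfun_compose)
    have "blinfun_apply S (c *\<^sub>C y) = blinfun_apply Q (c *\<^sub>C u)"
      unfolding u bounded_opsD[OF assms(3), symmetric] ST ..
    also have "\<dots> = c *\<^sub>C blinfun_apply S y" unfolding u ST by (rule bounded_opsD[OF assms(4)])
    finally show "blinfun_apply S (c *\<^sub>C y) = c *\<^sub>C blinfun_apply S y" .
  qed
qed

section \<open>Resolvents on the negative axis and an approximate identity\<close>

context sectorial_operator
begin

text \<open>\<open>B r = (r + A)\<^sup>-\<^sup>1\<close>\<close>

definition B :: "real \<Rightarrow> 'a \<Rightarrow>\<^sub>L 'a" where
  "B r = - R (- of_real r)"

lemma B_outside: "r > 0 \<Longrightarrow> Re (- complex_of_real r) < cmod (- complex_of_real r) * cos \<omega>"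
  using minus_real_outside angle by blast

lemma B_in_graph:
  assumes "r > 0"
  shows "(blinfun_apply (B r) x, x - r *\<^sub>R blinfun_apply (B r) x) \<in> A"
proof -
  have "((- 1) *\<^sub>C blinfun_apply (R (- of_real r)) x, (- 1) *\<^sub>C ((- of_real r) *\<^sub>C blinfun_apply (R (- of_real r)) x - x)) \<in> A"
    using linear resolvent_in_graph[OF B_outside[OF assms]] unfolding linear_operator_def by blast
  then show ?thesis
    by (simp add: B_def scaleC.minus_left scaleC.diff_right scaleC.minus_right scaleC_of_real blinfun.minus_left add.commute)
qed

lemma B_left_inverse:
  assumes "r > 0" "(x, y) \<in> A"
  shows "blinfun_apply (B r) (r *\<^sub>R x + y) = x"
proof -
  have "blinfun_apply (R (- of_real r)) ((- of_real r) *\<^sub>C x - y) = x"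
    by (rule resolvent_left_inverse[OF B_outside[OF assms(1)] assms(2)])
  moreover have "(- of_real r) *\<^sub>C x - y = - (r *\<^sub>R x + y)" by (simp add: scaleC.minus_left scaleC_of_real)
  ultimately have "blinfun_apply (R (- of_real r)) (- (r *\<^sub>R x + y)) = x" by (simp only:)
  then show ?thesis unfolding B_def blinfun.minus_left blinfun.minus_right .
qed

lemma B_bound:
  obtains M where "M > 0" "\<And>r. r > 0 \<Longrightarrow> r * norm (B r) \<le> M"
proof -
  define w where "w = (\<omega> + pi) / 2"
  have w: "\<omega> < w" "w < pi" "0 \<le> w" using angle unfolding w_def by auto
  obtain M where M: "M > 0" "\<And>z. z \<noteq> 0 \<Longrightarrow> Re z \<le> cmod z * cos w \<Longrightarrow> norm (R z) \<le> M / cmod z"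
    using resolvent_bound[OF w(1,2)] by blast
  show ?thesis
  proof (rule that[OF M(1)])
    fix r :: real assume r: "r > 0"
    have "norm (R (- of_real r)) \<le> M / cmod (- complex_of_real r)"
      using r minus_real_outside[OF r w(2,3)] by (intro M(2)) auto
    then show "r * norm (B r) \<le> M" using r by (simp add: B_def field_simps)
  qed
qed

lemma dense_domain: "closure (Domain A) = UNIV"
  using sectorial by (simp add: sectorial_def)

text \<open>With r = n + 1, the expression equals - B(r) A x on the domain, which is O(1/r); uniform
  boundedness of r B(r) extends the limit to the closure.\<close>

lemma B_infinity_LIMSEQ: "(\<lambda>n. real (Suc n) *\<^sub>R blinfun_apply (B (real (Suc n))) x - x) \<longlonglongrightarrow> 0"
proof -
  obtain M where M: "M > 0" "\<And>r. r > 0 \<Longrightarrow> r * norm (B r) \<le> M" using B_bound by blast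
  have "(\<lambda>n. blinfun_apply (real (Suc n) *\<^sub>R B (real (Suc n)) - id_blinfun) x) \<longlonglongrightarrow> 0"
  proof (rule strong_null_limit[OF _ dense_domain])
    fix n
    have "norm (real (Suc n) *\<^sub>R B (real (Suc n)) - id_blinfun) \<le> norm (real (Suc n) *\<^sub>R B (real (Suc n))) + norm (id_blinfun :: 'a \<Rightarrow>\<^sub>L 'a)"
      by (rule norm_triangle_ineq4)
    also have "\<dots> \<le> M + norm (id_blinfun :: 'a \<Rightarrow>\<^sub>L 'a)"
      using M(2)[OF real_Suc_pos(1)[of n]] by (simp only: norm_scaleR abs_of_nat add_right_mono)
    finally show "norm (real (Suc n) *\<^sub>R B (real (Suc n)) - id_blinfun) \<le> M + norm (id_blinfun :: 'a \<Rightarrow>\<^sub>L 'a)" .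
  next
    fix x assume "x \<in> Domain A"
    then obtain y where xy: "(x, y) \<in> A" by auto
    have eq: "blinfun_apply (r *\<^sub>R B r - id_blinfun) x = - blinfun_apply (B r) y" if "r > 0" for r
      using B_left_inverse[OF that xy]
      by (simp add: blinfun.diff_left blinfun.scaleR_left blinfun.add_right blinfun.scaleR_right algebra_simps)
    show "(\<lambda>n. blinfun_apply (real (Suc n) *\<^sub>R B (real (Suc n)) - id_blinfun) x) \<longlonglongrightarrow> 0"
    proof (rule Lim_null_comparison[OF always_eventually[OF allI]])
      fix n
      have "norm (blinfun_apply (B (real (Suc n))) y) \<le> norm (B (real (Suc n))) * norm y" by (rule norm_blinfun)
      also have "norm (B (real (Suc n))) \<le> M * (1 / real (Suc n))"
        using M(2)[OF real_Suc_pos(1)[of n]] by (simp add: field_simps del: of_nat_Suc)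
      finally show "norm (blinfun_apply (real (Suc n) *\<^sub>R B (real (Suc n)) - id_blinfun) x) \<le> M * (1 / real (Suc n)) * norm y"
        unfolding eq[OF real_Suc_pos(1)] norm_minus_cancel by (simp add: mult_right_mono)
    next
      have "(\<lambda>n. M * (1 / real (Suc n)) * norm y) \<longlonglongrightarrow> M * 0 * norm y"
        by (intro tendsto_mult tendsto_const LIMSEQ_inverse_real_of_nat[unfolded inverse_eq_divide])
      then show "(\<lambda>n. M * (1 / real (Suc n)) * norm y) \<longlonglongrightarrow> 0" by (simp only: mult_zero_right mult_zero_left)
    qed
  qed
  then show ?thesis by (simp only: blinfun.diff_left blinfun.scaleR_left id_blinfun.rep_eq id_apply)
qed

text \<open>For y = A x one has r B(r) y = r (x - r B(r) x), which is O(r) as r tends to 0. This is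
  where the density of the range enters.\<close>

lemma B_zero_LIMSEQ: "(\<lambda>n. (1 / real (Suc n)) *\<^sub>R blinfun_apply (B (1 / real (Suc n))) x) \<longlonglongrightarrow> 0"
proof -
  obtain M where M: "M > 0" "\<And>r. r > 0 \<Longrightarrow> r * norm (B r) \<le> M" using B_bound by blast
  have nB: "norm (r *\<^sub>R B r) \<le> M" if "r > 0" for r using M(2)[OF that] that by simp
  have "(\<lambda>n. blinfun_apply ((1 / real (Suc n)) *\<^sub>R B (1 / real (Suc n))) x) \<longlonglongrightarrow> 0"
  proof (rule strong_null_limit[OF nB[OF real_Suc_pos(2)] dense_range])
    fix y assume "y \<in> Range A"
    then obtain x where xy: "(x, y) \<in> A" by auto
    have eq: "blinfun_apply (r *\<^sub>R B r) y = r *\<^sub>R (x - blinfun_apply (r *\<^sub>R B r) x)" if "r > 0" for r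
    proof -
      have "blinfun_apply (B r) y = x - r *\<^sub>R blinfun_apply (B r) x"
        using B_left_inverse[OF that xy] by (simp add: blinfun.add_right blinfun.scaleR_right eq_diff_eq add.commute)
      then show ?thesis by (simp only: blinfun.scaleR_left)
    qed
    show "(\<lambda>n. blinfun_apply ((1 / real (Suc n)) *\<^sub>R B (1 / real (Suc n))) y) \<longlonglongrightarrow> 0"
    proof (rule Lim_null_comparison[OF always_eventually[OF allI]])
      fix n
      let ?r = "1 / real (Suc n)"
      have "norm (x - blinfun_apply (?r *\<^sub>R B ?r) x) \<le> norm x + norm (blinfun_apply (?r *\<^sub>R B ?r) x)"
        by (rule norm_triangle_ineq4)
      also have "norm (blinfun_apply (?r *\<^sub>R B ?r) x) \<le> M * norm x"
        by (rule order_trans[OF norm_blinfun mult_right_mono[OF nB[OF real_Suc_pos(2)]]]) simp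
      finally have "?r * norm (x - blinfun_apply (?r *\<^sub>R B ?r) x) \<le> ?r * (norm x + M * norm x)"
        by (intro mult_left_mono) auto
      then show "norm (blinfun_apply (?r *\<^sub>R B ?r) y) \<le> ?r * (norm x + M * norm x)"
        unfolding eq[OF real_Suc_pos(2)] norm_scaleR abs_of_pos[OF real_Suc_pos(2)] .
    next
      have "(\<lambda>n. 1 / real (Suc n) * (norm x + M * norm x)) \<longlonglongrightarrow> 0 * (norm x + M * norm x)"
        by (intro tendsto_mult tendsto_const LIMSEQ_inverse_real_of_nat[unfolded inverse_eq_divide])
      then show "(\<lambda>n. 1 / real (Suc n) * (norm x + M * norm x)) \<longlonglongrightarrow> 0" by (simp only: mult_zero_left)
    qed
  qed
  then show ?thesis by (simp only: blinfun.scaleR_left)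
qed

text \<open>With k = n + 1 this is A (1/k + A)^-1 k (k + A)^-1, an approximate identity that damps
  the spectrum at 0 and at infinity. Its symbol is the function \<open>cutoff n\<close> defined
  below.\<close>

definition E :: "nat \<Rightarrow> 'a \<Rightarrow>\<^sub>L 'a" where
  "E n = (id_blinfun - (1 / real (Suc n)) *\<^sub>R B (1 / real (Suc n))) o\<^sub>L (real (Suc n) *\<^sub>R B (real (Suc n)))"

lemma E_LIMSEQ: "(\<lambda>n. blinfun_apply (E n) x) \<longlonglongrightarrow> x"
proof -
  obtain M where M: "M > 0" "\<And>r. r > 0 \<Longrightarrow> r * norm (B r) \<le> M" using B_bound by blast
  define a where "a n = real (Suc n) *\<^sub>R blinfun_apply (B (real (Suc n))) x - x" for n
  define b where "b n = (1 / real (Suc n)) *\<^sub>R blinfun_apply (B (1 / real (Suc n))) x" for n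
  have a: "a \<longlonglongrightarrow> 0" unfolding a_def by (rule B_infinity_LIMSEQ)
  have b: "b \<longlonglongrightarrow> 0" unfolding b_def by (rule B_zero_LIMSEQ)
  have "(\<lambda>n. blinfun_apply (E n) x - x) \<longlonglongrightarrow> 0"
  proof (rule Lim_null_comparison[OF always_eventually[OF allI]])
    fix n
    let ?r = "1 / real (Suc n)"
    have nB: "norm (blinfun_apply (?r *\<^sub>R B ?r) y) \<le> M * norm y" for y
    proof -
      have "norm (?r *\<^sub>R B ?r) \<le> M"
        unfolding norm_scaleR abs_of_pos[OF real_Suc_pos(2)] by (rule M(2)[OF real_Suc_pos(2)])
      then show ?thesis by (rule order_trans[OF norm_blinfun mult_right_mono]) simp
    qed
    have "blinfun_apply (E n) x - x = a n - blinfun_apply (?r *\<^sub>R B ?r) (a n) - b n"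
      unfolding E_def a_def b_def
      by (simp only: blinfun_apply_blinfun_compose blinfun.diff_left id_blinfun.rep_eq id_apply blinfun.diff_right blinfun.scaleR_left)
        (simp only: algebra_simps)
    also have "norm \<dots> \<le> norm (a n) + M * norm (a n) + norm (b n)"
      by (intro order_trans[OF norm_triangle_ineq4] add_mono nB order_refl)
    finally show "norm (blinfun_apply (E n) x - x) \<le> norm (a n) + M * norm (a n) + norm (b n)" .
  next
    have "(\<lambda>n. norm (a n) + M * norm (a n) + norm (b n)) \<longlonglongrightarrow> norm (0::'a) + M * norm (0::'a) + norm (0::'a)"
      by (intro tendsto_intros a b)
    then show "(\<lambda>n. norm (a n) + M * norm (a n) + norm (b n)) \<longlonglongrightarrow> 0" by simp
  qed
  then show ?thesis by (rule LIM_zero_cancel)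
qed

lemma tauA_B: "tauA = (id_blinfun - B 1) o\<^sub>L B 1"
  unfolding tauA_def B_def by (rule blinfun_eqI) (simp add: blinfun.diff_left blinfun.add_left blinfun.minus_left blinfun.minus_right)

text \<open>A vector u with A u = 0 satisfies r B(r) u = u for every r > 0, which is compatible with
  the null limit as r tends to 0 only for u = 0. Thus the density of the range yields
  injectivity.\<close>

lemma tauA_injective:
  assumes "blinfun_apply tauA x = 0"
  shows "x = 0"
proof -
  have sv: "single_valued A" and z: "(0, 0) \<in> A"
    using linear subspace_0[of A] by (auto simp: linear_operator_def zero_prod_def)
  define u where "u = blinfun_apply (B 1) x"
  have "blinfun_apply (B 1) u = u"
    using assms unfolding tauA_B u_def by (simp add: blinfun.diff_left)
  then have u0: "(u, 0) \<in> A" using B_in_graph[of 1 u] by simp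
  have "blinfun_apply (B r) (r *\<^sub>R u) = u" if "r > 0" for r
    using B_left_inverse[OF that u0] by simp
  then have "(\<lambda>n. (1 / real (Suc n)) *\<^sub>R blinfun_apply (B (1 / real (Suc n))) u) = (\<lambda>n. u)"
    by (simp only: blinfun.scaleR_right[symmetric] real_Suc_pos(2))
  with B_zero_LIMSEQ[of u] have "(\<lambda>n. u) \<longlonglongrightarrow> 0" by (simp only:)
  then have "u = 0" by (simp add: LIMSEQ_const_iff)
  then have "(0, x) \<in> A" using B_in_graph[of 1 x] unfolding u_def by simp
  then show ?thesis using sv z by (auto simp: single_valued_def)
qed

lemma tauA_dense: "closure (range (blinfun_apply tauA)) = UNIV"
  unfolding tauA_B
proof (rule dense_range_compose)
  have l: "blinfun_apply (B 1) (x + y) = x" if "(x, y) \<in> A" for x y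
    using B_left_inverse[of 1 x y] that by simp
  have "Domain A \<subseteq> range (blinfun_apply (B 1))"
  proof
    fix x assume "x \<in> Domain A"
    then obtain y where "(x, y) \<in> A" by auto
    from l[OF this] show "x \<in> range (blinfun_apply (B 1))" by (metis rangeI)
  qed
  then show "closure (range (blinfun_apply (B 1))) = UNIV"
    using closure_mono dense_domain by blast
  have "Range A \<subseteq> range (blinfun_apply (id_blinfun - B 1))"
  proof
    fix y assume "y \<in> Range A"
    then obtain x where "(x, y) \<in> A" by auto
    then have "blinfun_apply (id_blinfun - B 1) (x + y) = y" using l by (simp add: blinfun.diff_left)
    then show "y \<in> range (blinfun_apply (id_blinfun - B 1))" by (metis rangeI)
  qed
  then show "closure (range (blinfun_apply (id_blinfun - B 1))) = UNIV"
    using closure_mono dense_range by blast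
qed

text \<open>The composition is defined everywhere because (1 + A)^-2 maps into the domain of
  A.\<close>

lemma tau_op_eq: "tau_op A = op_graph tauA"
proof -
  have inv: "(affine_op 1 1 A)\<inverse> = op_graph (B 1)"
    using affine_inverse[OF minus_one_outside] by (simp add: B_def)
  have sv: "single_valued A" using linear by (simp add: linear_operator_def)
  have "op_graph (B 1) ^^ 2 = {(x, blinfun_apply (B 1) (blinfun_apply (B 1) x)) | x. True}"
    by (auto simp: numeral_2_eq_2 op_graph_def relcomp_unfold)
  then have "tau_op A = {(x, y) | x y. (blinfun_apply (B 1) (blinfun_apply (B 1) x), y) \<in> A}"
    unfolding tau_op_def inv by (auto simp: relcomp_unfold)
  also have "\<dots> = op_graph tauA"
  proof -
    have "(blinfun_apply (B 1) (blinfun_apply (B 1) x), y) \<in> A \<longleftrightarrow> y = blinfun_apply tauA x" for x y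
      using B_in_graph[of 1 "blinfun_apply (B 1) x"] sv
      by (auto simp: tauA_B blinfun.diff_left single_valued_def)
    then show ?thesis by (auto simp: op_graph_def)
  qed
  finally show ?thesis .
qed

primrec tauA_pow :: "nat \<Rightarrow> 'a \<Rightarrow>\<^sub>L 'a" where
  "tauA_pow 0 = id_blinfun"
| "tauA_pow (Suc n) = tauA o\<^sub>L tauA_pow n"

lemma tau_op_pow_eq: "tau_op A ^^ n = op_graph (tauA_pow n)"
  by (induction n) (auto simp: tau_op_eq op_graph_def relcomp_unfold)

lemma tauA_pow_injective: "blinfun_apply (tauA_pow n) x = 0 \<Longrightarrow> x = 0"
  by (induction n) (auto dest: tauA_injective)

lemma tauA_pow_dense: "closure (range (blinfun_apply (tauA_pow n))) = UNIV"
proof (induction n)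
  case 0
  have "range (blinfun_apply (id_blinfun :: 'a \<Rightarrow>\<^sub>L 'a)) = UNIV" by auto
  then show ?case by simp
next
  case (Suc n)
  then show ?case by (simp only: tauA_pow.simps) (rule dense_range_compose[OF tauA_dense])
qed

text \<open>The exponents start at 1 because the constant function 1 does not decay and hence is no
  symbol for \<open>Psi\<close>.\<close>

lemma tauA_pow_Psi:
  assumes w: "\<omega> < w" "w < \<theta>" "\<theta> < pi"
  shows "Psi w (\<lambda>z. tau z ^ Suc n) = tauA_pow (Suc n)" "decaying \<theta> (\<lambda>z. tau z ^ Suc n)"
proof -
  have tau: "decaying \<theta> tau" using w angle by (intro decaying_tau) auto
  show 1: "decaying \<theta> (\<lambda>z. tau z ^ Suc n)" for n
    by (induction n) (use tau decaying_mult[OF tau] in auto)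
  show "Psi w (\<lambda>z. tau z ^ Suc n) = tauA_pow (Suc n)"
  proof (induction n)
    case 0
    have "tauA o\<^sub>L id_blinfun = tauA" by (rule blinfun_eqI) simp
    then show ?case using Psi_tau[of w] w by simp
  next
    case (Suc n)
    have "Psi w tau o\<^sub>L Psi w (\<lambda>z. tau z ^ Suc n) = Psi w (\<lambda>z. tau z * tau z ^ Suc n)"
      by (rule Psi_mult[OF w(1,2) less_imp_le[OF w(3)] tau 1])
    then have "Psi w (\<lambda>z. tau z * tau z ^ Suc n) = tauA o\<^sub>L tauA_pow (Suc n)"
      using Suc Psi_tau[OF w(1)] w by simp
    then show ?case by (simp only: power_Suc tauA_pow.simps)
  qed
qed

end

section \<open>Functions of bounded variation along rays\<close>

lemma has_vector_derivative_cis_scaleC: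
  fixes h :: "complex \<Rightarrow> 'b::{complex_normed_vector,banach}"
  assumes "(h has_derivative (\<lambda>d. d *\<^sub>C H)) (at (of_real t * cis v))"
  shows "((\<lambda>v. cis v *\<^sub>C h (of_real t * cis v)) has_vector_derivative
            \<i> *\<^sub>C (cis v *\<^sub>C (h (of_real t * cis v) + (of_real t * cis v) *\<^sub>C H))) (at v within S)"
    and "((\<lambda>t. (of_real t * cis v) *\<^sub>C h (of_real t * cis v)) has_vector_derivative
            cis v *\<^sub>C (h (of_real t * cis v) + (of_real t * cis v) *\<^sub>C H)) (at t within S)"
proof -
  have c: "(cis has_vector_derivative \<i> * cis v) (at v within S)"
    unfolding has_vector_derivative_def by (rule has_derivative_cis[OF has_derivative_ident])
  show "((\<lambda>v. cis v *\<^sub>C h (of_real t * cis v)) has_vector_derivative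
            \<i> *\<^sub>C (cis v *\<^sub>C (h (of_real t * cis v) + (of_real t * cis v) *\<^sub>C H))) (at v within S)"
    using scaleC.has_vector_derivative[OF c has_vector_derivative_scaleC_chain[OF has_vector_derivative_arc assms]]
    by (simp add: scaleC_scaleC scaleC_add_right mult_ac add.commute)
  show "((\<lambda>t. (of_real t * cis v) *\<^sub>C h (of_real t * cis v)) has_vector_derivative
            cis v *\<^sub>C (h (of_real t * cis v) + (of_real t * cis v) *\<^sub>C H)) (at t within S)"
    using scaleC.has_vector_derivative[OF has_vector_derivative_ray has_vector_derivative_scaleC_chain[OF has_vector_derivative_ray assms]]
    by (simp add: scaleC_scaleC scaleC_add_right mult_ac add.commute)
qed

context sectorial_operator
begin

text \<open>One quantity D serves two purposes: the difference of e^(is) R(t e^(is)) between the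
  rays is the integral of i D(t, s) over s, and D(t, s) is the t-derivative of z R(z) at z = t
  e^(is). As z R(z) is bounded by M, integration by parts in t costs only the end values of q and
  its variation.\<close>

lemma arc_integral_bound:
  fixes q q' :: "real \<Rightarrow> complex" and W W' :: "real \<Rightarrow> real"
  assumes w: "\<omega> < w" "w < pi" and v: "w \<le> v1" "v1 \<le> v2" "v2 \<le> 2 * pi - w"
    and M: "M > 0" "\<And>z. z \<noteq> 0 \<Longrightarrow> Re z \<le> cmod z * cos w \<Longrightarrow> norm (R z) \<le> M / cmod z"
    and cd: "0 < c" "c \<le> d"
    and q: "\<And>t. t \<in> {c..d} \<Longrightarrow> (q has_vector_derivative q' t) (at t within {c..d})" and q': "continuous_on {c..d} q'"
    and W: "\<And>t. t \<in> {c..d} \<Longrightarrow> (W has_vector_derivative W' t) (at t within {c..d})"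
    and le: "\<And>t. t \<in> {c..d} \<Longrightarrow> cmod (q' t) \<le> W' t"
  shows "norm (integral {c..d} (\<lambda>t. q t *\<^sub>C (cis v2 *\<^sub>C R (of_real t * cis v2) - cis v1 *\<^sub>C R (of_real t * cis v1))))
     \<le> M * (cmod (q d) + cmod (q c) + (W d - W c)) * (v2 - v1)"
proof -
  have w0: "0 < w" using w angle by auto
  define D where "D t s = cis s *\<^sub>C (R (of_real t * cis s) + (of_real t * cis s) *\<^sub>C (- (R (of_real t * cis s) o\<^sub>L R (of_real t * cis s))))" for t s
  have out: "Re (of_real t * cis s) < cmod (of_real t * cis s) * cos \<omega>" "norm (R (of_real t * cis s)) \<le> M / t"
    if "t > 0" "s \<in> {v1..v2}" for t s
  proof -
    have cv: "cos s \<le> cos w" using that v w0 by (intro cos_le_cos_outside) auto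
    show "Re (of_real t * cis s) < cmod (of_real t * cis s) * cos \<omega>" by (rule outside_ray(1)[OF w that(1) cv])
    show "norm (R (of_real t * cis s)) \<le> M / t"
      using M(2)[of "of_real t * cis s"] outside_ray(2)[OF w that(1) cv] that by (simp add: norm_mult)
  qed
  have zn: "norm ((of_real t * cis s) *\<^sub>C R (of_real t * cis s)) \<le> M" if "t > 0" "s \<in> {v1..v2}" for t s
    using out(2)[OF that] that(1) by (simp add: norm_scaleC norm_mult field_simps)
  define Ou where "Ou = {z. Re z < cmod z * cos \<omega>}"
  have cR: "continuous_on Ou R" "continuous_on Ou (\<lambda>z. - (R z o\<^sub>L R z))"
    unfolding Ou_def by (auto intro!: continuous_at_imp_continuous_on resolvent_isCont resolvent_has_derivative(2))
  have tO: "(\<lambda>p. complex_of_real (fst p) * cis (snd p)) ` ({c..d} \<times> {v1..v2}) \<subseteq> Ou"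
  proof clarify
    fix t s assume "t \<in> {c..d}" "s \<in> {v1..v2}"
    then show "complex_of_real (fst (t, s)) * cis (snd (t, s)) \<in> Ou" unfolding Ou_def using out(1)[of t s] cd by auto
  qed
  have ci: "continuous_on S (\<lambda>p. complex_of_real (fst p) * cis (snd p))" for S by (intro continuous_intros)
  have contD: "continuous_on ({c..d} \<times> {v1..v2}) (\<lambda>(t, s). D t s)"
    unfolding D_def case_prod_unfold
    by (intro scaleC.continuous_on continuous_on_add continuous_on_compose2[OF cR(1) ci tO] continuous_on_compose2[OF cR(2) ci tO] ci continuous_intros)
  have contq: "continuous_on {c..d} q"
    by (rule continuous_on_vector_derivative) (rule q)
  have dv: "((\<lambda>s. \<i> *\<^sub>C D t s) has_integral (cis v2 *\<^sub>C R (of_real t * cis v2) - cis v1 *\<^sub>C R (of_real t * cis v1))) {v1..v2}"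
    if "t > 0" for t
    unfolding D_def
    by (rule fundamental_theorem_of_calculus[OF v(2)], rule has_vector_derivative_cis_scaleC(1),
        rule resolvent_has_derivative(1), rule out(1)[OF that])
  define Z where "Z t s = \<i> *\<^sub>C ((of_real t * cis s) *\<^sub>C R (of_real t * cis s))" for t s
  have Zn: "norm (Z t s) \<le> M" if "t > 0" "s \<in> {v1..v2}" for t s
    using zn[OF that] by (simp add: Z_def norm_scaleC)
  have qD: "norm (integral {c..d} (\<lambda>t. q t *\<^sub>C (\<i> *\<^sub>C D t s))) \<le> M * (cmod (q d) + cmod (q c) + (W d - W c))"
    if s: "s \<in> {v1..v2}" for s
  proof -
    have dZ: "((\<lambda>t. Z t s) has_vector_derivative \<i> *\<^sub>C D t s) (at t within {c..d})" if "t \<in> {c..d}" for t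
      unfolding Z_def D_def using that cd s
      by (intro bounded_linear.has_vector_derivative[OF bounded_linear_scaleC] has_vector_derivative_cis_scaleC(2)
          resolvent_has_derivative(1) out(1)) auto
    have contZ: "continuous_on {c..d} (\<lambda>t. Z t s)"
      by (rule continuous_on_vector_derivative) (rule dZ)
    have i1: "((\<lambda>t. q t *\<^sub>C (\<i> *\<^sub>C D t s) + q' t *\<^sub>C Z t s) has_integral (q d *\<^sub>C Z d s - q c *\<^sub>C Z c s)) {c..d}"
      by (rule fundamental_theorem_of_calculus[OF cd(2)]) (intro scaleC.has_vector_derivative q dZ)
    have i2: "(\<lambda>t. q' t *\<^sub>C Z t s) integrable_on {c..d}"
      by (intro integrable_continuous_real scaleC.continuous_on q' contZ)
    have iW: "(W' has_integral (W d - W c)) {c..d}"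
      by (rule fundamental_theorem_of_calculus[OF cd(2) W])
    have "norm (integral {c..d} (\<lambda>t. q' t *\<^sub>C Z t s)) \<le> integral {c..d} (\<lambda>t. M * W' t)"
    proof (rule integral_norm_bound_integral[OF i2])
      show "(\<lambda>t. M * W' t) integrable_on {c..d}" using has_integral_mult_right[OF iW] by blast
      fix t assume t: "t \<in> {c..d}"
      have "norm (q' t *\<^sub>C Z t s) \<le> W' t * M"
        unfolding norm_scaleC using le[OF t] Zn[of t s] t cd s by (intro mult_mono) (auto intro: order_trans[OF norm_ge_zero])
      then show "norm (q' t *\<^sub>C Z t s) \<le> M * W' t" by (simp add: mult.commute)
    qed
    also have "\<dots> = M * (W d - W c)" using integral_unique[OF has_integral_mult_right[OF iW]] by blast
    finally have b2: "norm (integral {c..d} (\<lambda>t. q' t *\<^sub>C Z t s)) \<le> M * (W d - W c)" .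
    have "integral {c..d} (\<lambda>t. q t *\<^sub>C (\<i> *\<^sub>C D t s)) = (q d *\<^sub>C Z d s - q c *\<^sub>C Z c s) - integral {c..d} (\<lambda>t. q' t *\<^sub>C Z t s)"
      using integral_unique[OF has_integral_diff[OF i1 integrable_integral[OF i2]]] by simp
    also have "norm \<dots> \<le> (cmod (q d) * M + cmod (q c) * M) + M * (W d - W c)"
    proof (intro order_trans[OF norm_triangle_ineq4] add_mono b2)
      show "norm (q d *\<^sub>C Z d s) \<le> cmod (q d) * M" "norm (q c *\<^sub>C Z c s) \<le> cmod (q c) * M"
        unfolding norm_scaleC using Zn[of d s] Zn[of c s] cd s by (intro mult_left_mono; auto)+
    qed
    finally show ?thesis by (simp add: algebra_simps)
  qed
  have contqD: "continuous_on ({c..d} \<times> {v1..v2}) (\<lambda>(t, s). q t *\<^sub>C (\<i> *\<^sub>C D t s))"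
    using contD unfolding case_prod_unfold
    by (intro scaleC.continuous_on continuous_on_const continuous_on_compose2[OF contq continuous_on_fst[OF continuous_on_id]]) auto
  have "integral {c..d} (\<lambda>t. q t *\<^sub>C (cis v2 *\<^sub>C R (of_real t * cis v2) - cis v1 *\<^sub>C R (of_real t * cis v1)))
     = integral {c..d} (\<lambda>t. integral {v1..v2} (\<lambda>s. q t *\<^sub>C (\<i> *\<^sub>C D t s)))"
  proof (rule integral_cong)
    fix t assume "t \<in> {c..d}"
    then have "t > 0" using cd by auto
    from integral_unique[OF has_integral_linear[OF dv[OF this] bounded_linear_scaleC]]
    show "q t *\<^sub>C (cis v2 *\<^sub>C R (of_real t * cis v2) - cis v1 *\<^sub>C R (of_real t * cis v1)) = integral {v1..v2} (\<lambda>s. q t *\<^sub>C (\<i> *\<^sub>C D t s))"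
      by (simp add: o_def)
  qed
  also have "\<dots> = integral {v1..v2} (\<lambda>s. integral {c..d} (\<lambda>t. q t *\<^sub>C (\<i> *\<^sub>C D t s)))"
    using integral_swap_continuous[of c v1 d v2 "\<lambda>t s. q t *\<^sub>C (\<i> *\<^sub>C D t s)"] contqD by (simp add: cbox_Pair_eq)
  also have "norm \<dots> \<le> M * (cmod (q d) + cmod (q c) + (W d - W c)) * (v2 - v1)"
  proof (rule integral_bound[OF v(2) _ qD])
    have "continuous_on ({v1..v2} \<times> {c..d}) (\<lambda>p. case (snd p, fst p) of (t, s) \<Rightarrow> q t *\<^sub>C (\<i> *\<^sub>C D t s))"
      by (rule continuous_on_compose2[OF contqD]) (auto intro!: continuous_intros)
    then have "continuous_on ({v1..v2} \<times> cbox c d) (\<lambda>(s, t). q t *\<^sub>C (\<i> *\<^sub>C D t s))"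
      by (simp add: case_prod_unfold)
    from integral_continuous_on_param[OF this]
    show "continuous_on {v1..v2} (\<lambda>s. integral {c..d} (\<lambda>t. q t *\<^sub>C (\<i> *\<^sub>C D t s)))" by simp
  qed
  finally show ?thesis .
qed

text \<open>
  The norm of \<open>g(A)\<close> is controlled by the variation of \<open>g\<close> along rays: \<open>cis w R(t cis w) + R(- t)\<close> is the
  \<open>t\<close>-derivative of the bounded operator \<open>\<integral> R(z) dz\<close> over the circular arc from \<open>- t\<close> to \<open>t cis w\<close>, so that
  one can integrate by parts; what remains is the integral of the jump of \<open>g\<close> against \<open>R(- t)\<close>.
\<close>

lemma Psi_variation_bound:
  assumes w: "\<omega> < w" "w < pi"
  obtains K where "K \<ge> 0" "\<And>\<theta> g W W' L. w < \<theta> \<Longrightarrow> \<theta> \<le> pi \<Longrightarrow> decaying \<theta> g \<Longrightarrow>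
      (\<And>t. t > 0 \<Longrightarrow> (W has_real_derivative W' t) (at t)) \<Longrightarrow>
      (\<And>t v. t > 0 \<Longrightarrow> \<bar>v\<bar> \<le> w \<Longrightarrow> cmod (deriv g (of_real t * cis v)) \<le> W' t) \<Longrightarrow>
      (\<And>t. t > 0 \<Longrightarrow> \<bar>W t\<bar> \<le> L) \<Longrightarrow> norm (Psi w g) \<le> K * L"
proof -
  have w0: "0 < w" using w angle by auto
  obtain M where M: "M > 0" "\<And>z. z \<noteq> 0 \<Longrightarrow> Re z \<le> cmod z * cos w \<Longrightarrow> norm (R z) \<le> M / cmod z"
    using resolvent_bound[OF w] by blast
  show ?thesis
  proof (rule that[of "2 * M"])
    fix \<theta> g W W' L
    assume \<theta>: "w < \<theta>" "\<theta> \<le> pi" and g: "decaying \<theta> g"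
      and W: "\<And>t. t > 0 \<Longrightarrow> (W has_real_derivative W' t) (at t)"
      and g': "\<And>t v. t > 0 \<Longrightarrow> \<bar>v\<bar> \<le> w \<Longrightarrow> cmod (deriv g (of_real t * cis v)) \<le> W' t"
      and L: "\<And>t. t > 0 \<Longrightarrow> \<bar>W t\<bar> \<le> L"
    have hol: "g holomorphic_on sector \<theta>" and op: "open (sector \<theta>)" using g \<theta> w0 by (auto simp: decaying_def open_sector)
    note hd = holomorphic_has_derivative_scaleC[OF hol op]
    obtain s C where s: "s > 0" "C \<ge> 0" "\<And>z. z \<in> sector \<theta> \<Longrightarrow> cmod (g z) \<le> C * dk s (cmod z)"
      by (rule decayingE[OF g]) blast
    have gle: "cmod (g (of_real t * cis v)) \<le> C * dk s t" if "t > 0" "\<bar>v\<bar> \<le> w" for t v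
      using s(3)[OF cis_in_sector[of t v \<theta>]] that \<theta> by (auto simp: norm_mult)
    define Q where "Q v c d = integral {c..d} (\<lambda>t. cis v *\<^sub>C (g (of_real t * cis v) *\<^sub>C R (of_real t * cis v)))" for v c d
    \<comment> \<open>On a truncated contour the end values of g enter through \<open>dk s\<close>.
      They vanish as c tends to 0 and d to infinity, and only the variation remains.\<close>
    have fin: "norm (Q (- w) c d - Q w c d) \<le> 4 * pi * M * L + 2 * pi * M * (C * dk s d + C * dk s c)"
      if cd: "0 < c" "c \<le> d" for c d
    proof -
      have pos: "t > 0" if "t \<in> {c..d}" for t using that cd by auto
      have Wv: "(W has_vector_derivative W' t) (at t within {c..d})" if "t \<in> {c..d}" for t
        using W[OF pos[OF that]] has_real_derivative_iff_has_vector_derivative has_vector_derivative_at_within by blast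
      define qp where "qp v t = g (of_real t * cis v)" for v t
      have qd: "(qp v has_vector_derivative cis v *\<^sub>C deriv g (of_real t * cis v)) (at t within {c..d})" if "\<bar>v\<bar> \<le> w" "t \<in> {c..d}" for v t
        unfolding qp_def
        by (rule has_vector_derivative_scaleC_chain[OF has_vector_derivative_ray hd(1)])
          (use that pos \<theta> in \<open>auto intro!: cis_in_sector\<close>)
      have contg': "continuous_on (sector \<theta>) (deriv g)"
        using holomorphic_deriv[OF hol op] by (rule holomorphic_on_imp_continuous_on)
      have qc: "continuous_on {c..d} (\<lambda>t. cis v *\<^sub>C deriv g (of_real t * cis v))" if "\<bar>v\<bar> \<le> w" for v
        by (intro scaleC.continuous_on continuous_on_const continuous_on_compose2[OF contg'] continuous_intros)
          (use that pos \<theta> in \<open>auto intro!: cis_in_sector\<close>)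
      have ql: "cmod (cis v *\<^sub>C deriv g (of_real t * cis v)) \<le> W' t" if "\<bar>v\<bar> \<le> w" "t \<in> {c..d}" for v t
        using g'[OF pos[OF that(2)] that(1)] by (simp add: norm_scaleC)
      have contq: "continuous_on {c..d} (qp v)" if "\<bar>v\<bar> \<le> w" for v
        by (rule continuous_on_vector_derivative) (rule qd[OF that])
      define X where "X v t = cis v *\<^sub>C R (of_real t * cis v)" for v t
      have contX: "continuous_on {c..d} (X v)" if "w \<le> v" "v \<le> 2 * pi - w" for v
        unfolding X_def using cos_le_cos_outside[of w v] that w0 pos
        by (intro scaleC.continuous_on continuous_on_const continuous_on_subset[OF resolvent_continuous_on_ray[OF w]]) auto
      have dW: "W d - W c \<le> 2 * L" using L[of d] L[of c] cd by auto
      have C2: "cmod (qp v d) + cmod (qp v c) \<le> C * dk s d + C * dk s c" if "\<bar>v\<bar> \<le> w" for v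
        unfolding qp_def using gle[of d v] gle[of c v] cd that by auto
      have arc: "norm (integral {c..d} (\<lambda>t. qp v t *\<^sub>C (X v2 t - X v1 t))) \<le> M * (C * dk s d + C * dk s c + 2 * L) * (pi - w)"
        if v: "\<bar>v\<bar> \<le> w" and v12: "w \<le> v1" "v1 \<le> v2" "v2 \<le> 2 * pi - w" "v2 - v1 = pi - w" for v v1 v2
      proof -
        have "norm (integral {c..d} (\<lambda>t. qp v t *\<^sub>C (X v2 t - X v1 t))) \<le> M * (cmod (qp v d) + cmod (qp v c) + (W d - W c)) * (v2 - v1)"
          unfolding X_def by (rule arc_integral_bound[OF w v12(1-3) M cd qd[OF v] qc[OF v] Wv ql[OF v]])
        also have "\<dots> \<le> M * (C * dk s d + C * dk s c + 2 * L) * (v2 - v1)"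
          using v12 M(1) C2[OF v] dW by (intro mult_right_mono mult_left_mono) auto
        finally show ?thesis unfolding v12(4) .
      qed
      \<comment> \<open>Integrating the derivative along the arc from - w to w produces a factor t,
        which will cancel the 1/t of the resolvent on the negative axis.\<close>
      have jump: "cmod (qp (- w) t - qp w t) \<le> (t * W' t) * (2 * w)" if t: "t \<in> {c..d}" for t
      proof -
        have "((\<lambda>v. (\<i> * (of_real t * cis v)) *\<^sub>C deriv g (of_real t * cis v)) has_integral (g (of_real t * cis w) - g (of_real t * cis (- w)))) {- w..w}"
          by (rule fundamental_theorem_of_calculus, use w0 in simp,
              rule has_vector_derivative_scaleC_chain[OF has_vector_derivative_arc hd(1)])
            (use pos[OF t] \<theta> in \<open>auto intro!: cis_in_sector\<close>)
        then have "g (of_real t * cis w) - g (of_real t * cis (- w)) = integral {- w..w} (\<lambda>v. (\<i> * (of_real t * cis v)) *\<^sub>C deriv g (of_real t * cis v))"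
          by (rule integral_unique[symmetric])
        also have "cmod \<dots> \<le> (t * W' t) * (w - - w)"
        proof (rule integral_bound)
          show "continuous_on {- w..w} (\<lambda>v. (\<i> * (of_real t * cis v)) *\<^sub>C deriv g (of_real t * cis v))"
            by (intro scaleC.continuous_on continuous_on_compose2[OF contg'] continuous_intros)
              (use pos[OF t] \<theta> in \<open>auto intro!: cis_in_sector\<close>)
          fix v assume "v \<in> {- w..w}"
          then show "cmod ((\<i> * (of_real t * cis v)) *\<^sub>C deriv g (of_real t * cis v)) \<le> t * W' t"
            using g'[OF pos[OF t], of v] pos[OF t] by (auto simp: norm_scaleC norm_mult intro!: mult_left_mono)
        qed (use w0 in simp)
        finally show ?thesis unfolding qp_def by (simp add: norm_minus_commute)
      qed
      have iW: "(W' has_integral (W d - W c)) {c..d}"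
        by (rule fundamental_theorem_of_calculus[OF cd(2) Wv])
      have jb: "norm (integral {c..d} (\<lambda>t. (qp (- w) t - qp w t) *\<^sub>C X pi t)) \<le> 2 * w * M * (W d - W c)"
      proof -
        have "norm (integral {c..d} (\<lambda>t. (qp (- w) t - qp w t) *\<^sub>C X pi t)) \<le> integral {c..d} (\<lambda>t. (2 * w * M) * W' t)"
        proof (rule integral_norm_bound_integral)
          show "(\<lambda>t. (qp (- w) t - qp w t) *\<^sub>C X pi t) integrable_on {c..d}"
            by (intro integrable_continuous_real scaleC.continuous_on continuous_on_diff contq contX) (use w w0 in auto)
          show "(\<lambda>t. 2 * w * M * W' t) integrable_on {c..d}" using has_integral_mult_right[OF iW] by blast
          fix t assume t: "t \<in> {c..d}"
          have "norm (X pi t) \<le> M / t"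
            using M(2)[of "of_real t * cis pi"] outside_ray(2)[OF w pos[OF t], of pi] cos_ge_minus_one[of w] pos[OF t] by (simp add: X_def norm_scaleC norm_mult)
          then have "norm ((qp (- w) t - qp w t) *\<^sub>C X pi t) \<le> ((t * W' t) * (2 * w)) * (M / t)"
            unfolding norm_scaleC by (intro mult_mono jump[OF t] order_trans[OF norm_ge_zero jump[OF t]]) auto
          also have "\<dots> = 2 * w * M * W' t" using pos[OF t] by simp
          finally show "norm ((qp (- w) t - qp w t) *\<^sub>C X pi t) \<le> 2 * w * M * W' t" .
        qed
        also have "\<dots> = 2 * w * M * (W d - W c)" using integral_unique[OF has_integral_mult_right[OF iW]] by blast
        finally show ?thesis .
      qed
      have per: "X (2 * pi - w) t = X (- w) t" for t
      proof -
        have "cis (2 * pi - w) = cis (- w)" by (simp add: complex_eq_iff cos_diff sin_diff)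
        then show ?thesis by (simp add: X_def)
      qed
      have Qq: "Q v c d = integral {c..d} (\<lambda>t. qp v t *\<^sub>C X v t)" for v
        unfolding Q_def qp_def X_def by (simp add: scaleC_scaleC mult.commute)
      have ints: "(\<lambda>t. qp v t *\<^sub>C X u t) integrable_on {c..d}" if "\<bar>v\<bar> \<le> w" "w \<le> u" "u \<le> 2 * pi - w" for u v
        using that by (intro integrable_continuous_real scaleC.continuous_on contq contX)
      have e1: "integral {c..d} (\<lambda>t. qp (- w) t *\<^sub>C (X (2 * pi - w) t - X pi t)) = Q (- w) c d - integral {c..d} (\<lambda>t. qp (- w) t *\<^sub>C X pi t)"
        unfolding scaleC.diff_right Qq per[symmetric] using w w0 by (intro integral_diff ints) auto
      have e2: "integral {c..d} (\<lambda>t. qp w t *\<^sub>C (X pi t - X w t)) = integral {c..d} (\<lambda>t. qp w t *\<^sub>C X pi t) - Q w c d"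
        unfolding scaleC.diff_right Qq using w w0 by (intro integral_diff ints) auto
      have e3: "integral {c..d} (\<lambda>t. (qp (- w) t - qp w t) *\<^sub>C X pi t) = integral {c..d} (\<lambda>t. qp (- w) t *\<^sub>C X pi t) - integral {c..d} (\<lambda>t. qp w t *\<^sub>C X pi t)"
        unfolding scaleC.diff_left using w w0 by (intro integral_diff ints) auto
      \<comment> \<open>Both boundary rays of the resolvent are moved to the negative axis, the
        lower one seen at angle 2 pi - w. The values of g stay at the angles - w and w; their
        difference makes up the third term.\<close>
      have "Q (- w) c d - Q w c d = integral {c..d} (\<lambda>t. qp (- w) t *\<^sub>C (X (2 * pi - w) t - X pi t))
         + integral {c..d} (\<lambda>t. qp w t *\<^sub>C (X pi t - X w t)) + integral {c..d} (\<lambda>t. (qp (- w) t - qp w t) *\<^sub>C X pi t)"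
        unfolding e1 e2 e3 by simp
      also have "norm \<dots> \<le> M * (C * dk s d + C * dk s c + 2 * L) * (pi - w) + M * (C * dk s d + C * dk s c + 2 * L) * (pi - w) + 2 * w * M * (W d - W c)"
        by (intro order_trans[OF norm_triangle_ineq] add_mono arc jb) (use w w0 in auto)
      also have "\<dots> \<le> M * (C * dk s d + C * dk s c + 2 * L) * (pi - w) + M * (C * dk s d + C * dk s c + 2 * L) * (pi - w) + 2 * w * M * (2 * L)"
        using w0 M(1) dW by (intro add_left_mono mult_left_mono) auto
      \<comment> \<open>The two arcs contribute 4 (pi - w) M L and the jump 4 w M L, together 4 pi M
        L for every w.\<close>
      also have "\<dots> = 4 * pi * M * L + 2 * (pi - w) * (M * (C * dk s d + C * dk s c))"
        by (simp add: algebra_simps)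
      also have "\<dots> \<le> 4 * pi * M * L + 2 * pi * (M * (C * dk s d + C * dk s c))"
        using w0 M(1) s(2) less_imp_le[OF dk_pos[of s]] by (intro add_left_mono mult_right_mono mult_nonneg_nonneg add_nonneg_nonneg) auto
      finally show ?thesis by (simp add: mult.assoc)
    qed
    have lim: "(\<lambda>k. Q v (1 / real (Suc k)) (real (Suc k))) \<longlonglongrightarrow> ray v (\<lambda>z. g z *\<^sub>C R z)" if "v \<in> {- w, w}" for v
      unfolding Q_def by (rule ray_resolvent(3)[OF w(1) \<theta> that g])
    have l1: "(\<lambda>k. norm (Q (- w) (1 / real (Suc k)) (real (Suc k)) - Q w (1 / real (Suc k)) (real (Suc k)))) \<longlonglongrightarrow> norm (ray (- w) (\<lambda>z. g z *\<^sub>C R z) - ray w (\<lambda>z. g z *\<^sub>C R z))"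
      by (intro tendsto_norm tendsto_diff lim) auto
    have l2: "(\<lambda>k. 4 * pi * M * L + 2 * pi * M * (C * dk s (real (Suc k)) + C * dk s (real (Suc k)))) \<longlonglongrightarrow> 4 * pi * M * L + 2 * pi * M * (C * 0 + C * 0)"
      by (intro tendsto_add tendsto_mult tendsto_const dk_Suc_LIMSEQ s)
    have l3: "norm (Q (- w) (1 / real (Suc k)) (real (Suc k)) - Q w (1 / real (Suc k)) (real (Suc k))) \<le> 4 * pi * M * L + 2 * pi * M * (C * dk s (real (Suc k)) + C * dk s (real (Suc k)))" for k
    proof -
      have "1 / real (Suc k) \<le> real (Suc k)" by (simp add: field_simps)
      from fin[OF real_Suc_pos(2) this] show ?thesis unfolding dk_inverse[OF real_Suc_pos(1)] .
    qed
    have "norm (ray (- w) (\<lambda>z. g z *\<^sub>C R z) - ray w (\<lambda>z. g z *\<^sub>C R z)) \<le> 4 * pi * M * L + 2 * pi * M * (C * 0 + C * 0)"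
      by (rule LIMSEQ_le[OF l1 l2]) (intro exI[of _ 0] allI impI l3)
    then have "norm (ray (- w) (\<lambda>z. g z *\<^sub>C R z) - ray w (\<lambda>z. g z *\<^sub>C R z)) / (2 * pi) \<le> 4 * pi * M * L / (2 * pi)"
      by (intro divide_right_mono) auto
    then show "norm (Psi w g) \<le> 2 * M * L" by (simp add: Psi_def norm_scaleC norm_mult norm_divide mult_ac)
  qed (use M in simp)
qed

end

section \<open>Cutoff functions, and passage to bounded symbols\<close>

lemma shifted_quotient_bounds:
  assumes c: "c > 0" and \<rho>: "\<rho> > 0" and t: "t > 0" "cmod z = t" and le: "c * (t + \<rho>) \<le> cmod (z + of_real \<rho>)"
  shows "z + of_real \<rho> \<noteq> 0" "cmod (of_real \<rho> / (z + of_real \<rho>)) \<le> 1 / c" "cmod (z / (z + of_real \<rho>)) \<le> 1 / c"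
    "cmod (of_real \<rho> / (z + of_real \<rho>)\<^sup>2) \<le> 1 / c\<^sup>2 * (\<rho> / (t + \<rho>)\<^sup>2)"
    "cmod (1 / (z + of_real \<rho>)) \<le> 1 / (c * \<rho>)" "cmod (z / (z + of_real \<rho>)) \<le> 1 / (c * \<rho>) * t"
    "cmod (of_real \<rho> / (z + of_real \<rho>)) \<le> \<rho> / (c * t)"
proof -
  let ?m = "cmod (z + of_real \<rho>)"
  have p: "0 < c * (t + \<rho>)" using c \<rho> t by simp
  have m: "0 < ?m" using less_le_trans[OF p le] .
  then show "z + of_real \<rho> \<noteq> 0" by auto
  have i: "1 / ?m \<le> 1 / (c * (t + \<rho>))" using le m p by (intro divide_left_mono) auto
  have q: "x / ?m \<le> x / (c * (t + \<rho>))" if "x \<ge> 0" for x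
    using mult_left_mono[OF i that] by simp
  have q2: "x / (c * (t + \<rho>)) \<le> y" if "x \<le> y * c * (t + \<rho>)" for x y
    using that p by (simp add: pos_divide_le_eq mult.assoc)
  have "\<rho> / ?m \<le> 1 / c" by (rule order_trans[OF q q2]) (use \<rho> t c in auto)
  then show "cmod (of_real \<rho> / (z + of_real \<rho>)) \<le> 1 / c" using \<rho> by (simp add: norm_divide)
  have "t / ?m \<le> 1 / c" by (rule order_trans[OF q q2]) (use \<rho> t c in auto)
  then show "cmod (z / (z + of_real \<rho>)) \<le> 1 / c" using t by (simp add: norm_divide)
  have "1 / ?m \<le> 1 / (c * \<rho>)" by (rule order_trans[OF q q2]) (use \<rho> t c in \<open>auto simp: field_simps\<close>)
  then show "cmod (1 / (z + of_real \<rho>)) \<le> 1 / (c * \<rho>)" by (simp add: norm_divide)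
  from mult_right_mono[OF this, of t] show "cmod (z / (z + of_real \<rho>)) \<le> 1 / (c * \<rho>) * t"
    using t by (simp add: norm_divide)
  have "\<rho> / ?m \<le> \<rho> / (c * t)" by (rule order_trans[OF q q2]) (use \<rho> t c in \<open>auto simp: field_simps\<close>)
  then show "cmod (of_real \<rho> / (z + of_real \<rho>)) \<le> \<rho> / (c * t)" using \<rho> by (simp add: norm_divide)
  have "(c * (t + \<rho>))\<^sup>2 \<le> ?m\<^sup>2" using le p by (intro power_mono) auto
  then have "\<rho> / ?m\<^sup>2 \<le> \<rho> / (c * (t + \<rho>))\<^sup>2" using \<rho> p m c t by (intro divide_left_mono mult_pos_pos zero_less_power) auto
  then show "cmod (of_real \<rho> / (z + of_real \<rho>)\<^sup>2) \<le> 1 / c\<^sup>2 * (\<rho> / (t + \<rho>)\<^sup>2)"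
    using \<rho> by (simp add: norm_divide norm_power power_mult_distrib)
qed

definition cutoff :: "nat \<Rightarrow> complex \<Rightarrow> complex" where
  "cutoff n z = (z / (z + of_real (1 / real (Suc n)))) * (of_real (real (Suc n)) / (z + of_real (real (Suc n))))"

text \<open>With k = n + 1, the bound for the derivative is a constant times the derivative of t/(t
  + 1/k) + t/(t + k), which takes values between 0 and 2. So the variation of the cutoffs is bounded
  uniformly in n, although the constant in their decay grows with n.\<close>

lemma cutoff_bounds:
  assumes \<theta>: "0 < \<theta>" "\<theta> < pi"
  obtains c where "c > 0" "c \<le> 1"
    "\<And>z \<rho>. z \<in> sector \<theta> \<Longrightarrow> \<rho> > 0 \<Longrightarrow> c * (cmod z + \<rho>) \<le> cmod (z + of_real \<rho>)"
    "\<And>n. cutoff n holomorphic_on sector \<theta>"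
    "\<And>n z. z \<in> sector \<theta> \<Longrightarrow> cmod (cutoff n z) \<le> 1 / c\<^sup>2"
    "\<And>n z. z \<in> sector \<theta> \<Longrightarrow> cmod (cutoff n z) \<le> real (Suc n) / c\<^sup>2 * dk 1 (cmod z)"
    "\<And>n z. z \<in> sector \<theta> \<Longrightarrow> cmod (deriv (cutoff n) z) \<le>
       1 / c ^ 3 * ((1 / real (Suc n)) / (cmod z + 1 / real (Suc n))\<^sup>2 + real (Suc n) / (cmod z + real (Suc n))\<^sup>2)"
proof -
  define c where "c = (1 + cos \<theta>) / 2"
  have c: "c > 0" using cos_monotone_0_pi[of \<theta> pi] \<theta> unfolding c_def by simp
  have c1: "c \<le> 1" using cos_le_one[of \<theta>] unfolding c_def by simp
  have ge: "c * (cmod z + \<rho>) \<le> cmod (z + of_real \<rho>)" if "z \<in> sector \<theta>" "\<rho> > 0" for z \<rho>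
    unfolding c_def by (rule cmod_add_real_ge) (use that sector_iff[of \<theta> z] \<theta> in auto)
  have zp: "cmod z > 0" if "z \<in> sector \<theta>" for z using that sector_iff[of \<theta> z] \<theta> by auto
  note sq = shifted_quotient_bounds[OF c _ zp refl ge]
  have hol: "cutoff n holomorphic_on sector \<theta>" for n
    unfolding cutoff_def using sq(1)[OF real_Suc_pos(1)[of n]] sq(1)[OF real_Suc_pos(2)[of n]] real_Suc_pos[of n]
    by (intro holomorphic_intros) auto
  define k where "k n = real (Suc n)" for n
  define r where "r n = 1 / real (Suc n)" for n
  have kr: "k n > 0" "r n > 0" "1 / r n = k n" for n unfolding k_def r_def by simp_all
  have cut: "cutoff n z = (z / (z + of_real (r n))) * (of_real (k n) / (z + of_real (k n)))" for n z
    unfolding cutoff_def k_def r_def ..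
  have b1: "cmod (cutoff n z) \<le> 1 / c\<^sup>2" if z: "z \<in> sector \<theta>" for n z
  proof -
    have "cmod (cutoff n z) \<le> (1 / c) * (1 / c)"
      unfolding cut norm_mult using c kr(1,2)[of n] by (intro mult_mono sq(2) sq(3) z) auto
    then show ?thesis by (simp add: power2_eq_square)
  qed
  have b2: "cmod (cutoff n z) \<le> k n / c\<^sup>2 * dk 1 (cmod z)" if z: "z \<in> sector \<theta>" for n z
  proof (cases "cmod z \<le> 1")
    case True
    have "cmod (cutoff n z) \<le> (1 / (c * r n) * cmod z) * (1 / c)"
      unfolding cut norm_mult using c kr(1,2)[of n] by (intro mult_mono sq(2) sq(6) z) auto
    also have "\<dots> = k n / c\<^sup>2 * cmod z" unfolding kr(3)[symmetric] by (simp add: power2_eq_square)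
    finally show ?thesis using True zp[OF z] by (simp add: dk_less_1)
  next
    case False
    have "cmod (cutoff n z) \<le> (1 / c) * (k n / (c * cmod z))"
      unfolding cut norm_mult using c kr(1,2)[of n] by (intro mult_mono sq(3) sq(7) z) auto
    also have "\<dots> = k n / c\<^sup>2 * (1 / cmod z)" by (simp add: power2_eq_square)
    finally show ?thesis using False by (simp add: dk_ge_1 powr_minus_divide)
  qed
  have b3: "cmod (deriv (cutoff n) z) \<le> 1 / c ^ 3 * (r n / (cmod z + r n)\<^sup>2 + k n / (cmod z + k n)\<^sup>2)"
    if z: "z \<in> sector \<theta>" for n z
  proof -
    have n1: "z + of_real (r n) \<noteq> 0" and n2: "z + of_real (k n) \<noteq> 0"
      using sq(1)[OF kr(1) z z] sq(1)[OF kr(2) z z] kr by auto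
    let ?d = "(of_real (r n) / (z + of_real (r n))\<^sup>2) * (of_real (k n) / (z + of_real (k n))) - (z / (z + of_real (r n))) * (of_real (k n) / (z + of_real (k n))\<^sup>2)"
    have d1: "((\<lambda>z. z / (z + of_real (r n))) has_field_derivative of_real (r n) / (z + of_real (r n))\<^sup>2) (at z)"
      using n1 by (auto intro!: derivative_eq_intros simp: power2_eq_square)
    have d2: "((\<lambda>z. of_real (k n) / (z + of_real (k n))) has_field_derivative - (of_real (k n) / (z + of_real (k n))\<^sup>2)) (at z)"
      using n2 by (auto intro!: derivative_eq_intros simp: power2_eq_square)
    have "(cutoff n has_field_derivative ?d) (at z)"
      using DERIV_mult[OF d1 d2] unfolding cut[abs_def] by (simp add: algebra_simps)
    then have "deriv (cutoff n) z = ?d" by (rule DERIV_imp_deriv)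
    also have "cmod \<dots> \<le> (1 / c\<^sup>2 * (r n / (cmod z + r n)\<^sup>2)) * (1 / c) + (1 / c) * (1 / c\<^sup>2 * (k n / (cmod z + k n)\<^sup>2))"
      using c kr[of n]
      by (intro order_trans[OF norm_triangle_ineq4] add_mono; unfold norm_mult; intro mult_mono sq z)
        (auto intro!: mult_nonneg_nonneg divide_nonneg_nonneg)
    also have "\<dots> = 1 / c ^ 3 * (r n / (cmod z + r n)\<^sup>2 + k n / (cmod z + k n)\<^sup>2)"
      using c by (simp add: power2_eq_square power3_eq_cube algebra_simps)
    finally show ?thesis .
  qed
  show ?thesis
    by (rule that[OF c c1 ge hol b1 b2[unfolded k_def] b3[unfolded k_def r_def]])
qed

context sectorial_operator
begin

lemma Psi_compose_B:
  assumes w: "\<omega> < w" "w < \<theta>" "\<theta> < pi" and h: "decaying \<theta> h" and r: "r > 0"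
  shows "Psi w h o\<^sub>L B r = Psi w (\<lambda>z. h z / (z + of_real r))" "decaying \<theta> (\<lambda>z. h z / (z + of_real r))"
proof -
  have w0: "0 < w" "w < pi" using w angle by auto
  have "Psi w h o\<^sub>L R (- of_real r) = - Psi w (\<lambda>z. h z / (z - - of_real r))"
    using r minus_real_outside[OF r w0(2)] w0 by (intro Psi_resolvent(1)[OF w(1,2) less_imp_le[OF w(3)] h]) auto
  then show "Psi w h o\<^sub>L B r = Psi w (\<lambda>z. h z / (z + of_real r))"
    unfolding B_def by (simp add: compose.minus_right)
  obtain c where c: "c > 0" "\<And>z \<rho>. z \<in> sector \<theta> \<Longrightarrow> \<rho> > 0 \<Longrightarrow> c * (cmod z + \<rho>) \<le> cmod (z + of_real \<rho>)"
    using cutoff_bounds[of \<theta>] w w0 by (metis less_trans)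
  have zp: "cmod z > 0" if "z \<in> sector \<theta>" for z using that sector_iff[of \<theta> z] w w0 by auto
  have "decaying \<theta> (\<lambda>z. h z * (1 / (z + of_real r)))"
  proof (rule decaying_mult_bounded(2)[OF h])
    show "(\<lambda>z. 1 / (z + of_real r)) holomorphic_on sector \<theta>"
      using shifted_quotient_bounds(1)[OF c(1) r zp refl c(2)[OF _ r]] by (intro holomorphic_intros) auto
    show "cmod (1 / (z + of_real r)) \<le> 1 / (c * r)" if "z \<in> sector \<theta>" for z
      by (rule shifted_quotient_bounds(5)[OF c(1) r zp[OF that] refl c(2)[OF that r]])
  qed
  then show "decaying \<theta> (\<lambda>z. h z / (z + of_real r))" by simp
qed

lemma Psi_compose_E:
  assumes w: "\<omega> < w" "w < \<theta>" "\<theta> < pi" and h: "decaying \<theta> h"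
  shows "Psi w h o\<^sub>L E n = Psi w (\<lambda>z. h z * cutoff n z)"
proof -
  have w0: "0 < w" and wle: "\<theta> \<le> pi" using w angle by auto
  define r where "r = 1 / real (Suc n)"
  define k where "k = real (Suc n)"
  have r: "r > 0" and k: "k > 0" unfolding r_def k_def by (rule real_Suc_pos)+
  have ne: "z + of_real \<rho> \<noteq> 0" if z: "z \<in> sector \<theta>" and \<rho>: "\<rho> > 0" for z \<rho>
  proof
    assume "z + of_real \<rho> = 0"
    then have "z = - of_real \<rho>" by (simp add: add_eq_0_iff2)
    then show False using z \<rho> sector_iff[of \<theta> z] minus_real_outside[OF \<rho> w(3)] w w0 by auto
  qed
  define u where "u z = h z + (- of_real r) * (h z / (z + of_real r))" for z
  have d1: "decaying \<theta> (\<lambda>z. h z / (z + of_real r))" by (rule Psi_compose_B(2)[OF w h r])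
  have d2: "decaying \<theta> (\<lambda>z. (- of_real r) * (h z / (z + of_real r)))"
    by (rule decaying_mult_bounded(1)[OF d1, of _ r]) (use r in auto)
  have "Psi w u = Psi w h + (- of_real r) *\<^sub>C (Psi w h o\<^sub>L B r)"
    unfolding u_def Psi_add[OF w(1,2) wle h d2] Psi_mult_const[OF w(1,2) wle d1] Psi_compose_B(1)[OF w h r] ..
  then have P1: "Psi w h o\<^sub>L (id_blinfun - r *\<^sub>R B r) = Psi w u"
    by (simp add: compose.diff_right compose.scaleR_right scaleC.minus_left scaleC_of_real)
      (rule blinfun_eqI, simp)
  have du: "decaying \<theta> u"
  proof -
    have "decaying \<theta> (\<lambda>z. h z * (1 - of_real r / (z + of_real r)))"
    proof -
      obtain c where c: "c > 0" "\<And>z \<rho>. z \<in> sector \<theta> \<Longrightarrow> \<rho> > 0 \<Longrightarrow> c * (cmod z + \<rho>) \<le> cmod (z + of_real \<rho>)"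
        using cutoff_bounds[of \<theta>] w w0 by (metis less_trans)
      have zp: "cmod z > 0" if "z \<in> sector \<theta>" for z using that sector_iff[of \<theta> z] w w0 by auto
      show ?thesis
      proof (rule decaying_mult_bounded(2)[OF h])
        show "(\<lambda>z. 1 - of_real r / (z + of_real r)) holomorphic_on sector \<theta>"
          using ne r by (intro holomorphic_intros) auto
        show "cmod (1 - of_real r / (z + of_real r)) \<le> 1 + 1 / c" if z: "z \<in> sector \<theta>" for z
          by (rule order_trans[OF norm_triangle_ineq4 add_mono])
            (use shifted_quotient_bounds(2)[OF c(1) r zp[OF z] refl c(2)[OF z r]] in auto)
      qed
    qed
    then show ?thesis unfolding u_def by (simp add: algebra_simps)
  qed
  have d3: "decaying \<theta> (\<lambda>z. u z / (z + of_real k))" by (rule Psi_compose_B(2)[OF w du k])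
  have P2: "Psi w u o\<^sub>L (k *\<^sub>R B k) = Psi w (\<lambda>z. of_real k * (u z / (z + of_real k)))"
    unfolding Psi_mult_const[OF w(1,2) wle d3] Psi_compose_B(1)[OF w du k, symmetric]
    by (simp add: compose.scaleR_right scaleC_of_real)
  have "Psi w h o\<^sub>L E n = Psi w u o\<^sub>L (k *\<^sub>R B k)"
    unfolding E_def P1[symmetric] blinfun_compose_assoc r_def k_def ..
  also have "\<dots> = Psi w (\<lambda>z. h z * cutoff n z)"
    unfolding P2
  proof (rule Psi_cong[OF w0 w(2) wle])
    fix z assume z: "z \<in> sector \<theta>"
    have "u z = h z * (z / (z + of_real r))" unfolding u_def using ne[OF z r] by (simp add: field_simps)
    then show "of_real k * (u z / (z + of_real k)) = h z * cutoff n z"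
      unfolding cutoff_def unfolding r_def[symmetric] unfolding k_def[symmetric] by simp
  qed
  finally show ?thesis .
qed

text \<open>A bounded symbol need not decay, so the variation bound is applied to g times
  \<open>cutoff n\<close>, uniformly in n. Since (g \<tau>)(A) E_n = (g cutoff_n)(A) \<tau>(A),
  letting n grow bounds the norm of (g \<tau>)(A) x by a multiple of that of \<tau>(A) x. Then g(A)
  is obtained by extension from the dense range of \<tau>(A).\<close>

lemma bounded_variation_calculus:
  assumes w: "\<omega> < w" "w < pi"
  obtains K where "K \<ge> 0" "\<And>\<theta> g W W' L. w < \<theta> \<Longrightarrow> \<theta> \<le> pi \<Longrightarrow> g holomorphic_on sector \<theta> \<Longrightarrow>
      (\<And>z. z \<in> sector \<theta> \<Longrightarrow> cmod (g z) \<le> L) \<Longrightarrow>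
      (\<And>t. t > 0 \<Longrightarrow> (W has_real_derivative W' t) (at t)) \<Longrightarrow>
      (\<And>t v. t > 0 \<Longrightarrow> \<bar>v\<bar> \<le> w \<Longrightarrow> cmod (deriv g (of_real t * cis v)) \<le> W' t) \<Longrightarrow>
      (\<And>t. t > 0 \<Longrightarrow> \<bar>W t\<bar> \<le> L) \<Longrightarrow>
      \<exists>S\<in>bounded_ops. S o\<^sub>L tauA = Psi w (\<lambda>z. g z * tau z) \<and> norm S \<le> K * L"
proof -
  have w0: "0 < w" using w angle by auto
  define \<theta>1 where "\<theta>1 = (w + pi) / 2"
  have \<theta>1: "w < \<theta>1" "\<theta>1 < pi" "0 < \<theta>1" unfolding \<theta>1_def using w w0 by auto
  obtain c where c: "c > 0" "c \<le> 1"
    "\<And>n. cutoff n holomorphic_on sector \<theta>1"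
    "\<And>n z. z \<in> sector \<theta>1 \<Longrightarrow> cmod (cutoff n z) \<le> 1 / c\<^sup>2"
    "\<And>n z. z \<in> sector \<theta>1 \<Longrightarrow> cmod (cutoff n z) \<le> real (Suc n) / c\<^sup>2 * dk 1 (cmod z)"
    "\<And>n z. z \<in> sector \<theta>1 \<Longrightarrow> cmod (deriv (cutoff n) z) \<le>
       1 / c ^ 3 * ((1 / real (Suc n)) / (cmod z + 1 / real (Suc n))\<^sup>2 + real (Suc n) / (cmod z + real (Suc n))\<^sup>2)"
    by (rule cutoff_bounds[OF \<theta>1(3,2)]) blast
  obtain K where K: "K \<ge> 0" "\<And>\<theta> g W W' L. w < \<theta> \<Longrightarrow> \<theta> \<le> pi \<Longrightarrow> decaying \<theta> g \<Longrightarrow>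
      (\<And>t. t > 0 \<Longrightarrow> (W has_real_derivative W' t) (at t)) \<Longrightarrow>
      (\<And>t v. t > 0 \<Longrightarrow> \<bar>v\<bar> \<le> w \<Longrightarrow> cmod (deriv g (of_real t * cis v)) \<le> W' t) \<Longrightarrow>
      (\<And>t. t > 0 \<Longrightarrow> \<bar>W t\<bar> \<le> L) \<Longrightarrow> norm (Psi w g) \<le> K * L"
    by (rule Psi_variation_bound[OF w]) blast
  \<comment> \<open>By the product rule: the sup norm 1/c^2 of the cutoffs goes with the variation
    of g, and their variation 2/c^3 with the sup norm of g.\<close>
  define b where "b = 1 / c\<^sup>2 + 2 * (1 / c ^ 3)"
  have b: "b \<ge> 0" unfolding b_def using c by simp
  show ?thesis
  proof (rule that[of "K * b"])
    show "K * b \<ge> 0" using K(1) b by simp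
    fix \<theta> g W W' L
    assume \<theta>: "w < \<theta>" "\<theta> \<le> pi" and hol: "g holomorphic_on sector \<theta>"
      and gL: "\<And>z. z \<in> sector \<theta> \<Longrightarrow> cmod (g z) \<le> L"
      and W: "\<And>t. t > 0 \<Longrightarrow> (W has_real_derivative W' t) (at t)"
      and g': "\<And>t v. t > 0 \<Longrightarrow> \<bar>v\<bar> \<le> w \<Longrightarrow> cmod (deriv g (of_real t * cis v)) \<le> W' t"
      and WL: "\<And>t. t > 0 \<Longrightarrow> \<bar>W t\<bar> \<le> L"
    have L0: "L \<ge> 0" using WL[of 1] by simp
    define \<theta>' where "\<theta>' = min \<theta> \<theta>1"
    have \<theta>': "w < \<theta>'" "\<theta>' < pi" "0 < \<theta>'" "\<theta>' \<le> pi" unfolding \<theta>'_def using \<theta> \<theta>1 w0 by auto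
    have sub: "sector \<theta>' \<subseteq> sector \<theta>" "sector \<theta>' \<subseteq> sector \<theta>1"
      using sector_mono[of \<theta>'] \<theta>' unfolding \<theta>'_def by auto
    have op: "open (sector \<theta>')" by (rule open_sector[OF \<theta>'(3,4)])
    have holg: "g holomorphic_on sector \<theta>'" and holc: "\<And>n. cutoff n holomorphic_on sector \<theta>'"
      using hol c(3) sub holomorphic_on_subset by blast+
    have tau: "decaying \<theta>' tau" by (rule decaying_tau[OF \<theta>'(3,2)])
    have dgt: "decaying \<theta>' (\<lambda>z. g z * tau z)"
      by (rule decaying_mult_bounded(1)[OF tau holg, of L]) (use gL sub in auto)
    have dc: "decaying \<theta>' (cutoff n)" for n
      unfolding decaying_def using holc c(5) sub(2) c(1)
      by (intro conjI exI[of _ 1] exI[of _ "real (Suc n) / c\<^sup>2"]) auto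
    have dgc: "decaying \<theta>' (\<lambda>z. g z * cutoff n z)" for n
      by (rule decaying_mult_bounded(1)[OF dc holg, of L]) (use gL sub in auto)
    have main: "norm (Psi w (\<lambda>z. g z * cutoff n z)) \<le> K * (b * L)" for n
    proof -
      define r where "r = 1 / real (Suc n)"
      define k where "k = real (Suc n)"
      have r: "r > 0" and k: "k > 0" unfolding r_def k_def by (rule real_Suc_pos)+
      define V where "V t = 1 / c\<^sup>2 * W t + (L / c ^ 3) * (t / (t + r) + t / (t + k))" for t
      define V' where "V' t = 1 / c\<^sup>2 * W' t + (L / c ^ 3) * (r / (t + r)\<^sup>2 + k / (t + k)\<^sup>2)" for t
      show ?thesis
      proof (rule K(2)[OF \<theta>'(1,4) dgc])
        fix t :: real assume t: "t > 0"
        have q: "((\<lambda>t. t / (t + \<rho>)) has_real_derivative \<rho> / (t + \<rho>)\<^sup>2) (at t)" if "\<rho> > 0" for \<rho>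
          using t that by (auto intro!: derivative_eq_intros simp: power2_eq_square)
        show "(V has_real_derivative V' t) (at t)"
          unfolding V_def V'_def by (intro DERIV_add DERIV_cmult W t q r k)
        have W1: "1 / c\<^sup>2 * \<bar>W t\<bar> \<le> 1 / c\<^sup>2 * L" by (intro mult_left_mono WL[OF t]) auto
        define T where "T = t / (t + r) + t / (t + k)"
        have "0 \<le> t / (t + r)" "0 \<le> t / (t + k)" "t / (t + r) \<le> 1" "t / (t + k) \<le> 1" using t r k by simp_all
        then have T: "0 \<le> T" "T \<le> 2" unfolding T_def by linarith+
        have Lc: "0 \<le> L / c ^ 3" using L0 c(1) by simp
        have "\<bar>V t\<bar> \<le> \<bar>1 / c\<^sup>2 * W t\<bar> + \<bar>(L / c ^ 3) * T\<bar>"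
          unfolding V_def T_def by (rule abs_triangle_ineq)
        also have "\<dots> = 1 / c\<^sup>2 * \<bar>W t\<bar> + (L / c ^ 3) * T"
          using T(1) L0 c(1) by (simp add: abs_mult)
        also have "\<dots> \<le> 1 / c\<^sup>2 * L + (L / c ^ 3) * 2"
          by (intro add_mono W1 mult_left_mono T(2) Lc)
        finally have "\<bar>V t\<bar> \<le> 1 / c\<^sup>2 * L + (L / c ^ 3) * 2" .
        then show "\<bar>V t\<bar> \<le> b * L" unfolding b_def by (simp add: algebra_simps)
        fix v :: real assume v: "\<bar>v\<bar> \<le> w"
        let ?z = "of_real t * cis v"
        have z: "?z \<in> sector \<theta>'" using v t \<theta>' by (intro cis_in_sector) auto
        have nz: "cmod ?z = t" using t by (simp add: norm_mult)
        have "((\<lambda>z. g z * cutoff n z) has_field_derivative deriv g ?z * cutoff n ?z + deriv (cutoff n) ?z * g ?z) (at ?z)"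
          by (intro DERIV_mult holomorphic_derivI[OF holg op z] holomorphic_derivI[OF holc op z])
        then have "deriv (\<lambda>z. g z * cutoff n z) ?z = deriv g ?z * cutoff n ?z + deriv (cutoff n) ?z * g ?z"
          by (rule DERIV_imp_deriv)
        also have "cmod \<dots> \<le> W' t * (1 / c\<^sup>2) + (1 / c ^ 3 * (r / (t + r)\<^sup>2 + k / (t + k)\<^sup>2)) * L"
        proof (rule order_trans[OF norm_triangle_ineq add_mono]; unfold norm_mult)
          have zs: "?z \<in> sector \<theta>" "?z \<in> sector \<theta>1" using z sub by auto
          show "cmod (deriv g ?z) * cmod (cutoff n ?z) \<le> W' t * (1 / c\<^sup>2)"
            by (intro mult_mono g' t v c(4) zs order_trans[OF norm_ge_zero g'[OF t v]]) auto
          have "cmod (deriv (cutoff n) ?z) \<le> 1 / c ^ 3 * (r / (t + r)\<^sup>2 + k / (t + k)\<^sup>2)"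
            using c(6)[OF zs(2), of n] unfolding nz r_def k_def .
          then show "cmod (deriv (cutoff n) ?z) * cmod (g ?z) \<le> (1 / c ^ 3 * (r / (t + r)\<^sup>2 + k / (t + k)\<^sup>2)) * L"
            using gL[OF zs(1)] by (rule mult_mono) (use c(1) r k t in \<open>auto intro!: mult_nonneg_nonneg add_nonneg_nonneg divide_nonneg_nonneg\<close>)
        qed
        also have "\<dots> = V' t" unfolding V'_def by (simp add: mult_ac)
        finally show "cmod (deriv (\<lambda>z. g z * cutoff n z) ?z) \<le> V' t" .
      qed
    qed
    have bound: "norm (blinfun_apply (Psi w (\<lambda>z. g z * tau z)) x) \<le> K * (b * L) * norm (blinfun_apply tauA x)" for x
    proof (rule LIMSEQ_le_const2)
      show "(\<lambda>n. norm (blinfun_apply (Psi w (\<lambda>z. g z * tau z)) (blinfun_apply (E n) x))) \<longlonglongrightarrow> norm (blinfun_apply (Psi w (\<lambda>z. g z * tau z)) x)"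
        by (intro tendsto_intros E_LIMSEQ)
      have "norm (blinfun_apply (Psi w (\<lambda>z. g z * tau z)) (blinfun_apply (E n) x)) \<le> K * (b * L) * norm (blinfun_apply tauA x)" for n
      proof -
        have "Psi w (\<lambda>z. g z * tau z) o\<^sub>L E n = Psi w (\<lambda>z. (g z * tau z) * cutoff n z)"
          by (rule Psi_compose_E[OF w(1) \<theta>'(1,2) dgt])
        also have "\<dots> = Psi w (\<lambda>z. (g z * cutoff n z) * tau z)" by (simp add: mult_ac)
        also have "\<dots> = Psi w (\<lambda>z. g z * cutoff n z) o\<^sub>L tauA"
          using Psi_mult[OF w(1) \<theta>'(1,4) dgc tau] Psi_tau[OF w] by simp
        finally have "blinfun_apply (Psi w (\<lambda>z. g z * tau z)) (blinfun_apply (E n) x) = blinfun_apply (Psi w (\<lambda>z. g z * cutoff n z)) (blinfun_apply tauA x)"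
          by (metis blinfun_apply_blinfun_compose)
        also have "norm \<dots> \<le> norm (Psi w (\<lambda>z. g z * cutoff n z)) * norm (blinfun_apply tauA x)" by (rule norm_blinfun)
        also have "\<dots> \<le> K * (b * L) * norm (blinfun_apply tauA x)" by (intro mult_right_mono main) auto
        finally show ?thesis .
      qed
      then show "\<exists>N. \<forall>n\<ge>N. norm (blinfun_apply (Psi w (\<lambda>z. g z * tau z)) (blinfun_apply (E n) x)) \<le> K * (b * L) * norm (blinfun_apply tauA x)"
        by blast
    qed
    have KL: "K * (b * L) \<ge> 0" using K(1) b L0 by simp
    obtain S where S: "S o\<^sub>L tauA = Psi w (\<lambda>z. g z * tau z)" "norm S \<le> K * (b * L)"
      using blinfun_extension[OF tauA_dense KL bound] by blast
    have "S \<in> bounded_ops"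
      by (rule bounded_ops_extension[OF S(1) tauA_dense tauA_bounded_ops Psi_bounded_ops[OF w(1) \<theta>'(1,4) dgt]])
    then show "\<exists>S\<in>bounded_ops. S o\<^sub>L tauA = Psi w (\<lambda>z. g z * tau z) \<and> norm S \<le> K * b * L"
      using S by (auto simp: mult.assoc)
  qed
qed

end

section \<open>The semigroup of a symbol\<close>

text \<open>All derivatives of exp(- x) are bounded by 1 on the closed right half-plane, which is
  convex.\<close>

lemma exp_minus_Taylor:
  assumes "Re p \<ge> 0" "Re q \<ge> 0"
  shows "cmod (exp (- p) - exp (- q)) \<le> cmod (p - q)"
    and "cmod (exp (- p) - exp (- q) + (p - q) * exp (- q)) \<le> (cmod (p - q))\<^sup>2"
proof -
  define F where "F i x = (- 1) ^ i * exp (- x)" for i :: nat and x :: complex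
  have conv: "convex {z. Re z \<ge> 0}" by (rule convex_halfspace_Re_ge)
  have d: "(F i has_field_derivative F (Suc i) x) (at x within {z. Re z \<ge> 0})" for i x
    unfolding F_def by (auto intro!: derivative_eq_intros)
  have B: "cmod (F i x) \<le> 1" if "x \<in> {z. Re z \<ge> 0}" for i x
    using that by (simp add: F_def norm_mult norm_power)
  show "cmod (exp (- p) - exp (- q)) \<le> cmod (p - q)"
    using complex_Taylor[where f = F and n = 0 and B = 1 and w = q and z = p, OF conv d B] assms by (simp add: F_def)
  show "cmod (exp (- p) - exp (- q) + (p - q) * exp (- q)) \<le> (cmod (p - q))\<^sup>2"
    using complex_Taylor[where f = F and n = 1 and B = 1 and w = q and z = p, OF conv d B] assms by (simp add: F_def power2_eq_square algebra_simps)
qed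

text \<open>Half of the exponent absorbs the power, by y \<le> e^y and y^2 \<le> 2 e^y at y = m x/2.
  The other half survives, in the form in which \<open>composition_calculus\<close> asks for
  it.\<close>

lemma mult_exp_minus_le:
  assumes "m > 0" "x \<ge> (0::real)"
  shows "x * exp (- (m * x)) \<le> 2 / m * exp (- (m / 2 * x))"
    and "x\<^sup>2 * exp (- (m * x)) \<le> 8 / m\<^sup>2 * exp (- (m / 2 * x))"
proof -
  define y where "y = m / 2 * x"
  have y: "y \<ge> 0" "x = 2 / m * y" "m * x = y + y" unfolding y_def using assms by (auto simp: field_simps)
  have e1: "y \<le> exp y" using exp_ge_add_one_self[of y] by linarith
  have e2: "y\<^sup>2 \<le> 2 * exp y" using exp_lower_Taylor_quadratic[OF y(1)] y(1) by simp
  have ee: "exp (- (m * x)) = exp (- y) * exp (- y)" unfolding y(3) by (simp add: exp_add[symmetric])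
  have n1: "y * exp (- y) \<le> 1" using mult_right_mono[OF e1, of "exp (- y)"] by (simp add: exp_minus field_simps)
  have n2: "y\<^sup>2 * exp (- y) \<le> 2" using mult_right_mono[OF e2, of "exp (- y)"] by (simp add: exp_minus field_simps)
  have "x * exp (- (m * x)) = 2 / m * (y * exp (- y)) * exp (- y)" unfolding ee by (subst y(2)) simp
  also have "\<dots> \<le> 2 / m * 1 * exp (- y)" using assms by (intro mult_right_mono mult_left_mono n1) auto
  finally show "x * exp (- (m * x)) \<le> 2 / m * exp (- (m / 2 * x))" unfolding y_def by simp
  have "x\<^sup>2 * exp (- (m * x)) = 4 / m\<^sup>2 * (y\<^sup>2 * exp (- y)) * exp (- y)" unfolding ee by (subst y(2)) (simp add: power_mult_distrib power_divide)
  also have "\<dots> \<le> 4 / m\<^sup>2 * 2 * exp (- y)" using assms by (intro mult_right_mono mult_left_mono n2) auto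
  finally show "x\<^sup>2 * exp (- (m * x)) \<le> 8 / m\<^sup>2 * exp (- (m / 2 * x))" unfolding y_def by simp
qed

lemma quadratic_remainder_has_derivative:
  fixes F :: "'a::real_normed_vector \<Rightarrow> 'b::real_normed_vector"
  assumes D: "bounded_linear D" and r: "r > 0"
    and le: "\<And>y. y \<in> S \<Longrightarrow> norm (y - x) < r \<Longrightarrow> norm (F y - F x - D (y - x)) \<le> K * (norm (y - x))\<^sup>2"
  shows "(F has_derivative D) (at x within S)"
  unfolding has_derivative_within
proof (intro conjI D)
  have "((\<lambda>y. K * norm (y - x)) \<longlongrightarrow> K * norm (x - x)) (at x within S)" by (intro tendsto_intros)
  then have lim: "((\<lambda>y. K * norm (y - x)) \<longlongrightarrow> 0) (at x within S)" by simp
  show "((\<lambda>y. (1 / norm (y - x)) *\<^sub>R (F y - (F x + D (y - x)))) \<longlongrightarrow> 0) (at x within S)"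
  proof (rule Lim_null_comparison[OF _ lim])
    show "\<forall>\<^sub>F y in at x within S. norm ((1 / norm (y - x)) *\<^sub>R (F y - (F x + D (y - x)))) \<le> K * norm (y - x)"
      unfolding eventually_at
    proof (intro exI conjI ballI impI)
      show "r > 0" by (rule r)
      fix y assume y: "y \<in> S" "y \<noteq> x \<and> dist y x < r"
      then have n: "norm (y - x) > 0" "norm (y - x) < r" by (auto simp: dist_norm)
      have "norm ((1 / norm (y - x)) *\<^sub>R (F y - (F x + D (y - x)))) = norm (F y - F x - D (y - x)) / norm (y - x)"
        using n by (simp add: diff_diff_eq)
      also have "\<dots> \<le> K * (norm (y - x))\<^sup>2 / norm (y - x)" using le[OF y(1) n(2)] n by (intro divide_right_mono) auto
      also have "\<dots> = K * norm (y - x)" using n by (simp add: power2_eq_square)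
      finally show "norm ((1 / norm (y - x)) *\<^sub>R (F y - (F x + D (y - x)))) \<le> K * norm (y - x)" .
    qed
  qed
qed

text \<open>What the construction uses of F. By \<open>a\<theta>\<close>, a |Arg z| stays below pi/2
  on the sector. The condition \<open>angle_f\<close> says that |Arg f(z)| \<le> a |Arg z|, phrased
  as a lower bound for a real part so that arguments cannot wrap and zeros need no exception. Growth
  of order 1 makes the exponent 2 admissible in the calculus.\<close>

locale sectorial_symbol = sectorial_operator A \<omega>
  for A :: "('a::complex_banach) rel" and \<omega> :: real +
  fixes f :: "complex \<Rightarrow> complex" and a \<theta> :: real
  assumes a: "0 < a" and a\<theta>: "a * \<theta> = pi / 2" and \<theta>: "\<omega> < \<theta>" "\<theta> < pi"
    and hol: "f holomorphic_on sector \<theta>"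
    and growth: "\<And>\<theta>'. 0 < \<theta>' \<Longrightarrow> \<theta>' < \<theta> \<Longrightarrow>
       \<exists>C. \<forall>z\<in>sector \<theta>'. cmod (f z) \<le> C * max (cmod z powr 1) (cmod z powr - 1)"
    and angle_f: "\<And>w \<psi> z \<zeta>. 0 \<le> w \<Longrightarrow> 0 \<le> \<psi> \<Longrightarrow> a * w + \<psi> < pi / 2 \<Longrightarrow> z \<in> sector \<theta> \<Longrightarrow>
       \<bar>Arg z\<bar> \<le> w \<Longrightarrow> \<bar>Arg \<zeta>\<bar> \<le> \<psi> \<Longrightarrow> cos (a * w + \<psi>) * (cmod \<zeta> * cmod (f z)) \<le> Re (\<zeta> * f z)"
    and variation: "\<And>w. 0 < w \<Longrightarrow> w < \<theta> \<Longrightarrow> \<exists>C>0. \<exists>p p'. \<forall>t>0. (p has_real_derivative p' t) (at t) \<and> 0 \<le> p t \<and>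
       (\<forall>v. \<bar>v\<bar> \<le> w \<longrightarrow> p t \<le> cmod (f (of_real t * cis v)) \<and> cmod (deriv f (of_real t * cis v)) \<le> C * p' t)"
begin

lemma theta_pos: "0 < \<theta>"
  using \<theta> angle by auto

lemma angle_less:
  assumes "\<omega> < w" "0 \<le> \<psi>" "a * w + \<psi> < pi / 2"
  shows "w < (pi / 2 - \<psi>) / a" "(pi / 2 - \<psi>) / a \<le> \<theta>" "w < \<theta>" "w < pi"
proof -
  show "w < (pi / 2 - \<psi>) / a" using assms a by (simp add: pos_less_divide_eq mult.commute)
  moreover show "(pi / 2 - \<psi>) / a \<le> \<theta>" using assms a a\<theta> by (simp add: pos_divide_le_eq mult.commute)
  ultimately show "w < \<theta>" "w < pi" using \<theta> by auto
qed

text \<open>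
  If \<open>|\<phi>'| \<le> L \<delta> exp (- \<delta> |v|)\<close> on the range of \<open>f\<close>, then \<open>\<phi> \<circ> f\<close> has variation bounded by a multiple of \<open>L\<close>
  along rays, since \<open>|f'| \<le> C p'\<close> and \<open>p \<le> |f|\<close> there and \<open>\<delta> p' exp (- \<delta> p)\<close> has an explicit primitive.
\<close>

lemma composition_calculus:
  assumes w: "\<omega> < w" "0 \<le> \<psi>" "a * w + \<psi> < pi / 2"
  obtains K c \<theta>2 where "K \<ge> 0" "c > 0" "w < \<theta>2" "\<theta>2 \<le> \<theta>"
    "\<And>\<zeta> z. \<bar>Arg \<zeta>\<bar> \<le> \<psi> \<Longrightarrow> z \<in> sector \<theta>2 \<Longrightarrow> c * (cmod \<zeta> * cmod (f z)) \<le> Re (\<zeta> * f z)"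
    "\<And>\<phi> \<phi>' \<delta> L. \<delta> > 0 \<Longrightarrow>
      (\<And>z. z \<in> sector \<theta>2 \<Longrightarrow> (\<phi> has_field_derivative \<phi>' (f z)) (at (f z))) \<Longrightarrow>
      (\<And>z. z \<in> sector \<theta>2 \<Longrightarrow> cmod (\<phi> (f z)) \<le> L) \<Longrightarrow>
      (\<And>z. z \<in> sector \<theta>2 \<Longrightarrow> cmod (\<phi>' (f z)) \<le> L * \<delta> * exp (- (\<delta> * cmod (f z)))) \<Longrightarrow>
      \<exists>S\<in>bounded_ops. S o\<^sub>L tauA = Psi w (\<lambda>z. \<phi> (f z) * tau z) \<and> norm S \<le> K * L"
proof -
  define X where "X = (pi / 2 - \<psi>) / a"
  \<comment> \<open>An angle strictly between w and the critical angle leaves room on both sides: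
    the contour lies inside the sector of angle \<theta>2, and c = cos (a \<theta>2 + \<psi>) is
    still positive.\<close>
  define \<theta>2 where "\<theta>2 = (w + X) / 2"
  note al = angle_less[OF w, folded X_def]
  have \<theta>2: "w < \<theta>2" "\<theta>2 < X" "\<theta>2 \<le> \<theta>" unfolding \<theta>2_def using al by auto
  have w0: "0 < w" "0 < \<theta>2" using w angle \<theta>2 by auto
  have a2: "a * \<theta>2 + \<psi> < pi / 2" using \<theta>2(2) a unfolding X_def by (simp add: pos_less_divide_eq mult.commute)
  define c where "c = cos (a * \<theta>2 + \<psi>)"
  have "0 \<le> a * \<theta>2 + \<psi>" using a w0 w by simp
  then have c: "c > 0" unfolding c_def using a2 by (intro cos_gt_zero_pi) auto
  have sub: "sector \<theta>2 \<subseteq> sector \<theta>" by (rule sector_mono[OF w0(2) \<theta>2(3)])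
  have op: "open (sector \<theta>2)" "open (sector \<theta>)" using w0 \<theta>2 \<theta> theta_pos by (auto intro!: open_sector)
  obtain C p p' where C: "C > 0" and p: "\<And>t. t > 0 \<Longrightarrow> (p has_real_derivative p' t) (at t)"
    and p0: "\<And>t. t > 0 \<Longrightarrow> 0 \<le> p t"
    and pf: "\<And>t v. t > 0 \<Longrightarrow> \<bar>v\<bar> \<le> w \<Longrightarrow> p t \<le> cmod (f (of_real t * cis v))"
    and pd: "\<And>t v. t > 0 \<Longrightarrow> \<bar>v\<bar> \<le> w \<Longrightarrow> cmod (deriv f (of_real t * cis v)) \<le> C * p' t"
    using variation[OF w0(1) al(3)] by metis
  obtain K where K: "K \<ge> 0" "\<And>\<theta> g W W' L. w < \<theta> \<Longrightarrow> \<theta> \<le> pi \<Longrightarrow> g holomorphic_on sector \<theta> \<Longrightarrow>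
      (\<And>z. z \<in> sector \<theta> \<Longrightarrow> cmod (g z) \<le> L) \<Longrightarrow>
      (\<And>t. t > 0 \<Longrightarrow> (W has_real_derivative W' t) (at t)) \<Longrightarrow>
      (\<And>t v. t > 0 \<Longrightarrow> \<bar>v\<bar> \<le> w \<Longrightarrow> cmod (deriv g (of_real t * cis v)) \<le> W' t) \<Longrightarrow>
      (\<And>t. t > 0 \<Longrightarrow> \<bar>W t\<bar> \<le> L) \<Longrightarrow>
      \<exists>S\<in>bounded_ops. S o\<^sub>L tauA = Psi w (\<lambda>z. g z * tau z) \<and> norm S \<le> K * L"
    by (rule bounded_variation_calculus[OF w(1) al(4)]) blast
  show ?thesis
  proof (rule that[of "K * (1 + C)" c \<theta>2])
    show "K * (1 + C) \<ge> 0" using K C by simp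
    show "c > 0" "w < \<theta>2" "\<theta>2 \<le> \<theta>" by (rule c \<theta>2)+
    fix \<zeta> z assume "\<bar>Arg \<zeta>\<bar> \<le> \<psi>" "z \<in> sector \<theta>2"
    then show "c * (cmod \<zeta> * cmod (f z)) \<le> Re (\<zeta> * f z)"
      unfolding c_def using w0 w a2 sub by (intro angle_f) (auto simp: sector_def split: if_splits)
  next
    fix \<phi> \<phi>' \<delta> L
    assume \<delta>: "\<delta> > (0::real)" and d: "\<And>z. z \<in> sector \<theta>2 \<Longrightarrow> (\<phi> has_field_derivative \<phi>' (f z)) (at (f z))"
      and L: "\<And>z. z \<in> sector \<theta>2 \<Longrightarrow> cmod (\<phi> (f z)) \<le> L"
      and L': "\<And>z. z \<in> sector \<theta>2 \<Longrightarrow> cmod (\<phi>' (f z)) \<le> L * \<delta> * exp (- (\<delta> * cmod (f z)))"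
    have "1 \<in> sector \<theta>2" using w0 by (auto simp: sector_def)
    then have L0: "L \<ge> 0" using L[of 1] norm_ge_zero order_trans by blast
    have dc: "((\<lambda>z. \<phi> (f z)) has_field_derivative \<phi>' (f z) * deriv f z) (at z)" if "z \<in> sector \<theta>2" for z
      by (rule DERIV_chain2[OF d[OF that] holomorphic_derivI[OF hol op(2)]]) (use that sub in auto)
    have "\<exists>S\<in>bounded_ops. S o\<^sub>L tauA = Psi w (\<lambda>z. \<phi> (f z) * tau z) \<and> norm S \<le> K * (L * (1 + C))"
    \<comment> \<open>The function - L C exp(- \<delta> p) is a primitive of the bound for the
      derivative, and p \<ge> 0 keeps it between - L C and 0 for every \<delta>. The 1 in 1 + C
      accounts for the sup norm L of the symbol.\<close>
    proof (rule K(2)[of \<theta>2 _ _ "\<lambda>t. - (L * C) * exp (- (\<delta> * p t))" "\<lambda>t. (L * C) * (\<delta> * p' t * exp (- (\<delta> * p t)))"])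
      show "w < \<theta>2" "\<theta>2 \<le> pi" using \<theta>2 \<theta> by auto
      show "(\<lambda>z. \<phi> (f z)) holomorphic_on sector \<theta>2"
        unfolding holomorphic_on_def field_differentiable_def
        using dc has_field_derivative_at_within by blast
      show "cmod (\<phi> (f z)) \<le> L * (1 + C)" if "z \<in> sector \<theta>2" for z
        using L[OF that] mult_nonneg_nonneg[OF L0 less_imp_le[OF C]] by (simp add: distrib_left)
      fix t :: real assume t: "t > 0"
      show "((\<lambda>t. - (L * C) * exp (- (\<delta> * p t))) has_real_derivative L * C * (\<delta> * p' t * exp (- (\<delta> * p t)))) (at t)"
        by (auto intro!: derivative_eq_intros p[OF t])
      fix v :: real assume v: "\<bar>v\<bar> \<le> w"
      let ?z = "of_real t * cis v"
      have z: "?z \<in> sector \<theta>2" using t v \<theta>2 \<theta> by (intro cis_in_sector) auto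
      have "cmod (\<phi>' (f ?z)) \<le> L * \<delta> * exp (- (\<delta> * cmod (f ?z)))" by (rule L'[OF z])
      also have "\<dots> \<le> L * \<delta> * exp (- (\<delta> * p t))"
        using pf[OF t v] \<delta> L0 by (intro mult_left_mono) auto
      finally have 1: "cmod (\<phi>' (f ?z)) \<le> L * \<delta> * exp (- (\<delta> * p t))" .
      have "deriv (\<lambda>z. \<phi> (f z)) ?z = \<phi>' (f ?z) * deriv f ?z" by (rule DERIV_imp_deriv[OF dc[OF z]])
      also have "cmod \<dots> \<le> (L * \<delta> * exp (- (\<delta> * p t))) * (C * p' t)"
        unfolding norm_mult by (intro mult_mono 1 pd t v) (use L0 \<delta> in auto)
      finally show "cmod (deriv (\<lambda>z. \<phi> (f z)) ?z) \<le> L * C * (\<delta> * p' t * exp (- (\<delta> * p t)))" by (simp add: mult_ac)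
    next
      fix t :: real assume t: "t > 0"
      show "\<bar>- (L * C) * exp (- (\<delta> * p t))\<bar> \<le> L * (1 + C)"
      proof -
        have "exp (- (\<delta> * p t)) \<le> 1" using p0[OF t] \<delta> by simp
        then have "L * C * exp (- (\<delta> * p t)) \<le> L * C * 1" using L0 C by (intro mult_left_mono) auto
        also have "\<dots> \<le> L * (1 + C)" using L0 by (simp add: distrib_left)
        finally show ?thesis using L0 C by (simp add: abs_mult)
      qed
    qed
    then show "\<exists>S\<in>bounded_ops. S o\<^sub>L tauA = Psi w (\<lambda>z. \<phi> (f z) * tau z) \<and> norm S \<le> K * (1 + C) * L"
      by (simp add: mult_ac)
  qed
qed

end

text \<open>Taylor expansion in \<zeta> with a quadratic remainder, uniformly in v. The second
  expression is the v-derivative of the first and keeps the factor exp(- (m/2) |v|). Together the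
  bounds are the hypotheses of \<open>composition_calculus\<close> with \<delta> = m/2; dividing by
  m/2 in \<open>Q\<close> provides the factor \<delta> there.\<close>

lemma exp_minus_parameter_bounds:
  assumes m: "m > 0" and c: "cmod z * 2 \<le> M"
    and half: "\<And>\<zeta>. \<zeta> \<in> ball z r \<Longrightarrow> m * cmod v \<le> Re (\<zeta> * v)"
    and r: "r \<le> cmod z" and \<zeta>: "\<zeta> \<in> ball z r"
  defines "Q \<equiv> 8 / m\<^sup>2 + (4 / m + M * (8 / m\<^sup>2)) / (m / 2)"
  shows "cmod (exp (- (\<zeta> * v)) - exp (- (z * v)) + (\<zeta> - z) * (v * exp (- (z * v)))) \<le> Q * (cmod (\<zeta> - z))\<^sup>2"
    and "cmod (- \<zeta> * exp (- (\<zeta> * v)) + z * exp (- (z * v)) + (\<zeta> - z) * ((1 - z * v) * exp (- (z * v))))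
       \<le> Q * (cmod (\<zeta> - z))\<^sup>2 * (m / 2) * exp (- (m / 2 * cmod v))"
proof -
  let ?x = "cmod v"
  have r0: "r > 0" and z: "z \<in> ball z r" using \<zeta> by (auto simp: le_less_trans[OF zero_le_dist])
  have M0: "M \<ge> 0" using c norm_ge_zero[of z] by linarith
  have e: "cmod (exp (- (\<xi> * v))) \<le> exp (- (m * ?x))" if "\<xi> \<in> ball z r" for \<xi>
    using half[OF that] by simp
  have \<xi>: "cmod \<xi> \<le> M" if "\<xi> \<in> ball z r" for \<xi>
    using that norm_triangle_ineq2[of \<xi> z] r c by (auto simp: dist_norm norm_minus_commute)
  define X where "X = exp (- (m / 2 * ?x))"
  have X: "X > 0" "X \<le> 1" unfolding X_def using m by auto
  have Y: "exp (- (m * ?x)) \<ge> 0" by simp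
  note xe = mult_exp_minus_le[OF m norm_ge_zero[of v], folded X_def]
  \<comment> \<open>The successive derivatives of exp(- \<xi> v) with respect to \<xi>.\<close>
  define F where "F i \<xi> = (- v) ^ i * exp (- (\<xi> * v))" for i :: nat and \<xi>
  have dF: "(F i has_field_derivative F (Suc i) \<xi>) (at \<xi> within ball z r)" for i \<xi>
    unfolding F_def by (auto intro!: derivative_eq_intros)
  have BF: "cmod (F (Suc 1) \<xi>) \<le> 8 / m\<^sup>2" if "\<xi> \<in> ball z r" for \<xi>
  proof -
    have "cmod (F (Suc 1) \<xi>) = ?x\<^sup>2 * cmod (exp (- (\<xi> * v)))" by (simp add: F_def norm_mult power2_eq_square del: norm_exp_eq_Re)
    also have "\<dots> \<le> ?x\<^sup>2 * exp (- (m * ?x))" by (intro mult_left_mono e that) auto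
    also have "\<dots> \<le> 8 / m\<^sup>2 * X" by (rule xe(2))
    also have "\<dots> \<le> 8 / m\<^sup>2 * 1" using X by (intro mult_left_mono) auto
    finally show ?thesis by simp
  qed
  have "cmod (F 0 \<zeta> - (\<Sum>i\<le>1. F i z * (\<zeta> - z) ^ i / fact i)) \<le> 8 / m\<^sup>2 * cmod (\<zeta> - z) ^ Suc 1 / fact 1"
    by (rule complex_Taylor[OF convex_ball dF BF z \<zeta>])
  then have "cmod (exp (- (\<zeta> * v)) - exp (- (z * v)) + (\<zeta> - z) * (v * exp (- (z * v)))) \<le> 8 / m\<^sup>2 * (cmod (\<zeta> - z))\<^sup>2"
    by (simp add: F_def power2_eq_square algebra_simps)
  also have "\<dots> \<le> Q * (cmod (\<zeta> - z))\<^sup>2" unfolding Q_def using m M0 by (intro mult_right_mono) auto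
  finally show "cmod (exp (- (\<zeta> * v)) - exp (- (z * v)) + (\<zeta> - z) * (v * exp (- (z * v)))) \<le> Q * (cmod (\<zeta> - z))\<^sup>2" .

  \<comment> \<open>Derivatives with respect to \<xi> of - \<xi> exp(- \<xi> v), which is the
    v-derivative of exp(- \<xi> v); the last branch is meant for order 2.\<close>
  define H where "H i = (\<lambda>\<xi>. (if i = (0::nat) then - \<xi> else if i = 1 then \<xi> * v - 1 else 2 * v - \<xi> * v\<^sup>2) * exp (- (\<xi> * v)))" for i
  have dH: "(H i has_field_derivative H (Suc i) \<xi>) (at \<xi> within ball z r)" if "i \<le> 1" for i \<xi>
  proof -
    consider "i = 0" | "i = 1" using \<open>i \<le> 1\<close> by linarith
    then show ?thesis
      by cases (auto simp: H_def intro!: derivative_eq_intros simp: algebra_simps power2_eq_square)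
  qed
  have BH: "cmod (H (Suc 1) \<xi>) \<le> (4 / m + M * (8 / m\<^sup>2)) * X" if "\<xi> \<in> ball z r" for \<xi>
  proof -
    have "cmod (H (Suc 1) \<xi>) = cmod (2 * v - \<xi> * v\<^sup>2) * cmod (exp (- (\<xi> * v)))" by (simp add: H_def norm_mult del: norm_exp_eq_Re)
    also have "\<dots> \<le> (2 * ?x + M * ?x\<^sup>2) * exp (- (m * ?x))"
    proof (intro mult_mono e that)
      have "cmod (2 * v - \<xi> * v\<^sup>2) \<le> cmod (2 * v) + cmod (\<xi> * v\<^sup>2)" by (rule norm_triangle_ineq4)
      also have "\<dots> \<le> 2 * ?x + M * ?x\<^sup>2"
        unfolding norm_mult norm_power by (intro add_mono mult_right_mono \<xi> that) auto
      finally show "cmod (2 * v - \<xi> * v\<^sup>2) \<le> 2 * ?x + M * ?x\<^sup>2" .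
    qed (use M0 in auto)
    also have "\<dots> = 2 * (?x * exp (- (m * ?x))) + M * (?x\<^sup>2 * exp (- (m * ?x)))" by (simp add: algebra_simps)
    also have "\<dots> \<le> 2 * (2 / m * X) + M * (8 / m\<^sup>2 * X)" using M0 by (intro add_mono mult_left_mono xe) auto
    also have "\<dots> = (4 / m + M * (8 / m\<^sup>2)) * X" by (simp add: algebra_simps)
    finally show ?thesis .
  qed
  have "cmod (H 0 \<zeta> - (\<Sum>i\<le>1. H i z * (\<zeta> - z) ^ i / fact i)) \<le> (4 / m + M * (8 / m\<^sup>2)) * X * cmod (\<zeta> - z) ^ Suc 1 / fact 1"
    by (rule complex_Taylor[OF convex_ball dH BH z \<zeta>])
  then have "cmod (- \<zeta> * exp (- (\<zeta> * v)) + z * exp (- (z * v)) + (\<zeta> - z) * ((1 - z * v) * exp (- (z * v))))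
      \<le> (4 / m + M * (8 / m\<^sup>2)) * X * (cmod (\<zeta> - z))\<^sup>2"
    by (simp add: H_def power2_eq_square algebra_simps)
  also have "\<dots> = ((4 / m + M * (8 / m\<^sup>2)) / (m / 2)) * (cmod (\<zeta> - z))\<^sup>2 * (m / 2) * X" using m by simp
  also have "\<dots> \<le> Q * (cmod (\<zeta> - z))\<^sup>2 * (m / 2) * X"
    unfolding Q_def using m M0 X by (intro mult_right_mono) auto
  finally show "cmod (- \<zeta> * exp (- (\<zeta> * v)) + z * exp (- (z * v)) + (\<zeta> - z) * ((1 - z * v) * exp (- (z * v))))
       \<le> Q * (cmod (\<zeta> - z))\<^sup>2 * (m / 2) * exp (- (m / 2 * cmod v))" unfolding X_def .
qed

lemma decaying_add:
  assumes "decaying \<theta> g" "decaying \<theta> h"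
  shows "decaying \<theta> (\<lambda>z. g z + h z)"
proof -
  obtain s C where s: "s > 0" "C \<ge> 0" "\<And>z. z \<in> sector \<theta> \<Longrightarrow> cmod (g z) \<le> C * dk s (cmod z)"
    by (rule decayingE[OF assms(1)]) blast
  obtain s' C' where s': "s' > 0" "C' \<ge> 0" "\<And>z. z \<in> sector \<theta> \<Longrightarrow> cmod (h z) \<le> C' * dk s' (cmod z)"
    by (rule decayingE[OF assms(2)]) blast
  show ?thesis unfolding decaying_def
  proof (intro conjI exI ballI)
    show "(\<lambda>z. g z + h z) holomorphic_on sector \<theta>" using assms by (auto simp: decaying_def intro: holomorphic_on_add)
    show "min s s' > 0" "C + C' \<ge> 0" using s s' by auto
    fix z assume z: "z \<in> sector \<theta>"
    have "cmod (g z + h z) \<le> C * dk s (cmod z) + C' * dk s' (cmod z)"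
      using norm_triangle_ineq[of "g z" "h z"] s(3)[OF z] s'(3)[OF z] by linarith
    also have "\<dots> \<le> C * dk (min s s') (cmod z) + C' * dk (min s s') (cmod z)"
      using s s' by (intro add_mono mult_left_mono) (auto simp: dk_def intro: mult_right_mono)
    finally show "cmod (g z + h z) \<le> (C + C') * dk (min s s') (cmod z)" by (simp add: algebra_simps)
  qed
qed

lemma decaying_mult_const: "decaying \<theta> g \<Longrightarrow> decaying \<theta> (\<lambda>z. c * g z)"
  using decaying_mult_bounded(1)[of \<theta> g "\<lambda>_. c" "cmod c"] by simp

context sectorial_operator
begin

lemma Psi_lin:
  assumes "\<omega> < w" "w < \<theta>" "\<theta> \<le> pi" "decaying \<theta> g" "decaying \<theta> h"
  shows "Psi w (\<lambda>z. g z + c * h z) = Psi w g + c *\<^sub>C Psi w h"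
  using Psi_add[OF assms(1-4) decaying_mult_const[OF assms(5)]] Psi_mult_const[OF assms(1-3,5)] by simp

end

section \<open>The operators exp(- zeta f)(A): uniform bounds and holomorphy\<close>

context sectorial_symbol
begin

text \<open>In the boundary case a w + \<psi> = pi/2 the strict inequality needed for
  \<open>angle_f\<close> is recovered by using the angle |Arg z| < w of the point itself.\<close>

lemma Re_mult_nonneg:
  assumes "0 \<le> \<psi>" "a * w + \<psi> \<le> pi / 2" "0 < w" "z \<in> sector w" "\<bar>Arg \<zeta>\<bar> \<le> \<psi>"
  shows "0 \<le> Re (\<zeta> * f z)"
proof -
  have z: "z \<noteq> 0" "\<bar>Arg z\<bar> < w" using assms by (auto simp: sector_def)
  have "a * \<bar>Arg z\<bar> < a * w" using z a by simp
  then have lt: "a * \<bar>Arg z\<bar> + \<psi> < pi / 2" using assms by linarith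
  have "a * w \<le> a * \<theta>" unfolding a\<theta> using assms by linarith
  then have "z \<in> sector \<theta>" using z a theta_pos by (auto simp: sector_def)
  then have "cos (a * \<bar>Arg z\<bar> + \<psi>) * (cmod \<zeta> * cmod (f z)) \<le> Re (\<zeta> * f z)"
    by (rule angle_f[OF _ assms(1) lt _ order_refl assms(5), rotated]) simp
  moreover have "0 \<le> cos (a * \<bar>Arg z\<bar> + \<psi>)"
    using lt a assms(1) by (intro cos_ge_zero) (auto intro: order_trans[of _ 0])
  ultimately show ?thesis by (meson mult_nonneg_nonneg norm_ge_zero order_trans)
qed

lemma exp_minus_bounded:
  assumes "0 \<le> \<psi>" "a * w + \<psi> \<le> pi / 2" "0 < w" "z \<in> sector w" "\<bar>Arg \<zeta>\<bar> \<le> \<psi>"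
  shows "cmod (exp (- (\<zeta> * f z))) \<le> 1"
  using Re_mult_nonneg[OF assms] by simp

lemma exp_minus_holomorphic:
  assumes "w \<le> \<theta>" "0 < w"
  shows "(\<lambda>z. exp (- (\<zeta> * f z))) holomorphic_on sector w"
  using holomorphic_on_subset[OF hol sector_mono[OF assms(2,1)]] by (intro holomorphic_intros)

lemma decaying_exp_minus:
  assumes "0 \<le> \<psi>" "a * w + \<psi> \<le> pi / 2" "0 < w" "\<bar>Arg \<zeta>\<bar> \<le> \<psi>" "decaying w g"
  shows "decaying w (\<lambda>z. exp (- (\<zeta> * f z)) * g z)"
proof (rule decaying_mult_bounded(1)[OF assms(5) exp_minus_holomorphic])
  have "a * w \<le> a * \<theta>" unfolding a\<theta> using assms by linarith
  then show "w \<le> \<theta>" using a by simp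
  show "cmod (exp (- (\<zeta> * f z))) \<le> 1" if "z \<in> sector w" for z
    by (rule exp_minus_bounded[OF assms(1-3) that assms(4)])
qed (rule assms(3))

text \<open>With \<delta> = c |\<zeta>|, the derivative bound |\<zeta>| exp(- \<delta> |f|) equals
  (1/c) \<delta> exp(- \<delta> |f|). So L = 1 + 1/c serves for every \<zeta> in the sector, large
  or small.\<close>

lemma exp_calculus:
  assumes w: "\<omega> < w" "0 \<le> \<psi>" "a * w + \<psi> < pi / 2"
  obtains K where "K \<ge> 0" "\<And>\<zeta>. \<zeta> \<noteq> 0 \<Longrightarrow> \<bar>Arg \<zeta>\<bar> \<le> \<psi> \<Longrightarrow>
    \<exists>S\<in>bounded_ops. S o\<^sub>L tauA = Psi w (\<lambda>z. exp (- (\<zeta> * f z)) * tau z) \<and> norm S \<le> K"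
proof -
  obtain K c \<theta>2 where K: "K \<ge> 0" "c > 0" "w < \<theta>2" "\<theta>2 \<le> \<theta>"
    and half: "\<And>\<zeta> z. \<bar>Arg \<zeta>\<bar> \<le> \<psi> \<Longrightarrow> z \<in> sector \<theta>2 \<Longrightarrow> c * (cmod \<zeta> * cmod (f z)) \<le> Re (\<zeta> * f z)"
    and calc: "\<And>\<phi> \<phi>' \<delta> L. \<delta> > 0 \<Longrightarrow>
      (\<And>z. z \<in> sector \<theta>2 \<Longrightarrow> (\<phi> has_field_derivative \<phi>' (f z)) (at (f z))) \<Longrightarrow>
      (\<And>z. z \<in> sector \<theta>2 \<Longrightarrow> cmod (\<phi> (f z)) \<le> L) \<Longrightarrow>
      (\<And>z. z \<in> sector \<theta>2 \<Longrightarrow> cmod (\<phi>' (f z)) \<le> L * \<delta> * exp (- (\<delta> * cmod (f z)))) \<Longrightarrow>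
      \<exists>S\<in>bounded_ops. S o\<^sub>L tauA = Psi w (\<lambda>z. \<phi> (f z) * tau z) \<and> norm S \<le> K * L"
    by (rule composition_calculus[OF w]) blast
  show ?thesis
  proof (rule that)
    show "K * (1 + 1 / c) \<ge> 0" using K by simp
    fix \<zeta> assume \<zeta>: "\<zeta> \<noteq> 0" "\<bar>Arg \<zeta>\<bar> \<le> \<psi>"
    show "\<exists>S\<in>bounded_ops. S o\<^sub>L tauA = Psi w (\<lambda>z. exp (- (\<zeta> * f z)) * tau z) \<and> norm S \<le> K * (1 + 1 / c)"
    proof (rule calc[where \<phi> = "\<lambda>v. exp (- (\<zeta> * v))" and \<phi>' = "\<lambda>v. - \<zeta> * exp (- (\<zeta> * v))" and \<delta> = "c * cmod \<zeta>"])
      show "c * cmod \<zeta> > 0" using K \<zeta> by simp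
      fix z assume z: "z \<in> sector \<theta>2"
      note h = half[OF \<zeta>(2) z]
      show "((\<lambda>v. exp (- (\<zeta> * v))) has_field_derivative - \<zeta> * exp (- (\<zeta> * f z))) (at (f z))"
        by (auto intro!: derivative_eq_intros)
      have "0 \<le> c * (cmod \<zeta> * cmod (f z))" using K by simp
      then have "cmod (exp (- (\<zeta> * f z))) \<le> 1" using h by simp
      then show "cmod (exp (- (\<zeta> * f z))) \<le> 1 + 1 / c" using K by (simp add: add_increasing2 del: norm_exp_eq_Re)
      have "cmod (- \<zeta> * exp (- (\<zeta> * f z))) \<le> cmod \<zeta> * exp (- (c * cmod \<zeta> * cmod (f z)))"
        using h by (simp add: norm_mult mult_left_mono mult.assoc)
      also have "\<dots> \<le> (1 + 1 / c) * (c * cmod \<zeta>) * exp (- (c * cmod \<zeta> * cmod (f z)))"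
      proof (rule mult_right_mono)
        show "cmod \<zeta> \<le> (1 + 1 / c) * (c * cmod \<zeta>)" using K by (simp add: field_simps)
      qed simp
      finally show "cmod (- \<zeta> * exp (- (\<zeta> * f z))) \<le> (1 + 1 / c) * (c * cmod \<zeta>) * exp (- (c * cmod \<zeta> * cmod (f z)))" .
    qed
  qed
qed

text \<open>The identity expresses that S is exp(- \<zeta> f)(A), regularised by \<tau>. Asking for
  it at all admissible angles avoids choosing one, and the dense range of \<tau>(A) makes S
  unique.\<close>

definition U :: "complex \<Rightarrow> 'a \<Rightarrow>\<^sub>L 'a" where
  "U \<zeta> = (THE S. \<forall>w. \<omega> < w \<and> a * w + \<bar>Arg \<zeta>\<bar> < pi / 2 \<longrightarrow>
     S o\<^sub>L tauA = Psi w (\<lambda>z. exp (- (\<zeta> * f z)) * tau z))"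

lemma U_eq:
  assumes w: "\<omega> < w" "a * w + \<bar>Arg \<zeta>\<bar> < pi / 2"
    and S: "S o\<^sub>L tauA = Psi w (\<lambda>z. exp (- (\<zeta> * f z)) * tau z)"
  shows "U \<zeta> = S"
  unfolding U_def
proof (rule the_equality)
  show "\<forall>w. \<omega> < w \<and> a * w + \<bar>Arg \<zeta>\<bar> < pi / 2 \<longrightarrow> S o\<^sub>L tauA = Psi w (\<lambda>z. exp (- (\<zeta> * f z)) * tau z)"
  proof (intro allI impI, elim conjE)
    fix w' assume w': "\<omega> < w'" "a * w' + \<bar>Arg \<zeta>\<bar> < pi / 2"
    \<comment> \<open>The critical angle for \<zeta>: exp(- \<zeta> f) is bounded on the sector of
      angle X, and that sector contains both contours.\<close>
    define X where "X = (pi / 2 - \<bar>Arg \<zeta>\<bar>) / a"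
    have X: "w < X" "w' < X" "X < pi"
      using angle_less[OF w(1) _ w(2)] angle_less[OF w'(1) _ w'(2)] \<theta> unfolding X_def by auto
    have "X > 0" using X w angle by linarith
    have d: "decaying X (\<lambda>z. exp (- (\<zeta> * f z)) * tau z)"
    proof (rule decaying_exp_minus[OF abs_ge_zero _ _ order_refl decaying_tau])
      show "a * X + \<bar>Arg \<zeta>\<bar> \<le> pi / 2" using a by (simp add: X_def)
    qed (use X \<open>X > 0\<close> in auto)
    have "Psi w (\<lambda>z. exp (- (\<zeta> * f z)) * tau z) = Psi w' (\<lambda>z. exp (- (\<zeta> * f z)) * tau z)"
    proof (cases "w \<le> w'")
      case True
      show ?thesis by (rule Psi_angle[OF w(1) True X(2) less_imp_le[OF X(3)] d])
    next
      case False
      then have "w' \<le> w" by simp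
      then show ?thesis by (rule Psi_angle[OF w'(1) _ X(1) less_imp_le[OF X(3)] d, symmetric])
    qed
    with S show "S o\<^sub>L tauA = Psi w' (\<lambda>z. exp (- (\<zeta> * f z)) * tau z)" by simp
  qed
  fix S' assume "\<forall>w. \<omega> < w \<and> a * w + \<bar>Arg \<zeta>\<bar> < pi / 2 \<longrightarrow> S' o\<^sub>L tauA = Psi w (\<lambda>z. exp (- (\<zeta> * f z)) * tau z)"
  then have "S' o\<^sub>L tauA = S o\<^sub>L tauA" using w S by simp
  then show "S' = S" by (rule blinfun_compose_dense_cancel[OF _ tauA_dense])
qed

lemma U_bounded:
  assumes w: "\<omega> < w" "0 \<le> \<psi>" "a * w + \<psi> < pi / 2"
  obtains K where "K \<ge> 0" "\<And>\<zeta>. \<zeta> \<noteq> 0 \<Longrightarrow> \<bar>Arg \<zeta>\<bar> \<le> \<psi> \<Longrightarrow>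
    U \<zeta> \<in> bounded_ops \<and> U \<zeta> o\<^sub>L tauA = Psi w (\<lambda>z. exp (- (\<zeta> * f z)) * tau z) \<and> norm (U \<zeta>) \<le> K"
proof -
  obtain K where K: "K \<ge> 0" "\<And>\<zeta>. \<zeta> \<noteq> 0 \<Longrightarrow> \<bar>Arg \<zeta>\<bar> \<le> \<psi> \<Longrightarrow>
    \<exists>S\<in>bounded_ops. S o\<^sub>L tauA = Psi w (\<lambda>z. exp (- (\<zeta> * f z)) * tau z) \<and> norm S \<le> K"
    by (rule exp_calculus[OF w]) blast
  show ?thesis
  proof (rule that[OF K(1)])
    fix \<zeta> assume \<zeta>: "\<zeta> \<noteq> 0" "\<bar>Arg \<zeta>\<bar> \<le> \<psi>"
    obtain S where S: "S \<in> bounded_ops" "S o\<^sub>L tauA = Psi w (\<lambda>z. exp (- (\<zeta> * f z)) * tau z)" "norm S \<le> K"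
      using K(2)[OF \<zeta>] by blast
    have "U \<zeta> = S" by (rule U_eq[OF w(1) _ S(2)]) (use w \<zeta> in linarith)
    with S show "U \<zeta> \<in> bounded_ops \<and> U \<zeta> o\<^sub>L tauA = Psi w (\<lambda>z. exp (- (\<zeta> * f z)) * tau z) \<and> norm (U \<zeta>) \<le> K" by simp
  qed
qed

lemma intermediate_angle:
  assumes "\<psi> < pi / 2 - a * \<omega>"
  obtains w where "\<omega> < w" "a * w + \<psi> < pi / 2"
proof -
  have "\<omega> < (pi / 2 - \<psi>) / a" using assms a by (simp add: pos_less_divide_eq mult.commute)
  then obtain w where w: "\<omega> < w" "w < (pi / 2 - \<psi>) / a" using dense by blast
  have "a * w + \<psi> < pi / 2" using w(2) a by (simp add: pos_less_divide_eq mult.commute)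
  with w(1) show ?thesis by (rule that)
qed

lemma semigroup_angle: "0 < pi / 2 - a * \<omega>" "pi / 2 - a * \<omega> \<le> pi / 2"
proof -
  have "a * \<omega> < a * \<theta>" using \<theta> a by simp
  then show "0 < pi / 2 - a * \<omega>" unfolding a\<theta> by simp
  show "pi / 2 - a * \<omega> \<le> pi / 2" using a angle by simp
qed

text \<open>The derivative is (- f exp(- z f))(A), bounded because half of the exponential absorbs
  f. The remainder U(\<zeta>) - U(z) - (\<zeta> - z) D is again \<phi>(f)(A) for an explicit \<phi>
  of size |\<zeta> - z|^2, so the calculus itself bounds it quadratically in operator norm.\<close>

lemma U_has_derivative:
  assumes z: "z \<in> sector (pi / 2 - a * \<omega>)"
  shows "\<exists>D. (U has_derivative (\<lambda>h. h *\<^sub>C D)) (at z within sector (pi / 2 - a * \<omega>))"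
proof -
  have z0: "z \<noteq> 0" "\<bar>Arg z\<bar> < pi / 2 - a * \<omega>" using z semigroup_angle by (auto simp: sector_def)
  obtain \<psi> where \<psi>: "\<bar>Arg z\<bar> < \<psi>" "\<psi> < pi / 2 - a * \<omega>" using dense[OF z0(2)] by blast
  have \<psi>0: "0 < \<psi>" "\<psi> \<le> pi" using \<psi> semigroup_angle by linarith+
  obtain w where w: "\<omega> < w" "a * w + \<psi> < pi / 2" by (rule intermediate_angle[OF \<psi>(2)])
  note w' = w(1) less_imp_le[OF \<psi>0(1)] w(2)
  obtain K c \<theta>2 where K: "K \<ge> 0" "c > 0" "w < \<theta>2" "\<theta>2 \<le> \<theta>"
    and half: "\<And>\<zeta> z. \<bar>Arg \<zeta>\<bar> \<le> \<psi> \<Longrightarrow> z \<in> sector \<theta>2 \<Longrightarrow> c * (cmod \<zeta> * cmod (f z)) \<le> Re (\<zeta> * f z)"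
    and calc: "\<And>\<phi> \<phi>' \<delta> L. \<delta> > 0 \<Longrightarrow>
      (\<And>z. z \<in> sector \<theta>2 \<Longrightarrow> (\<phi> has_field_derivative \<phi>' (f z)) (at (f z))) \<Longrightarrow>
      (\<And>z. z \<in> sector \<theta>2 \<Longrightarrow> cmod (\<phi> (f z)) \<le> L) \<Longrightarrow>
      (\<And>z. z \<in> sector \<theta>2 \<Longrightarrow> cmod (\<phi>' (f z)) \<le> L * \<delta> * exp (- (\<delta> * cmod (f z)))) \<Longrightarrow>
      \<exists>S\<in>bounded_ops. S o\<^sub>L tauA = Psi w (\<lambda>z. \<phi> (f z) * tau z) \<and> norm S \<le> K * L"
    by (rule composition_calculus[OF w']) blast
  obtain KU where U: "\<And>\<zeta>. \<zeta> \<noteq> 0 \<Longrightarrow> \<bar>Arg \<zeta>\<bar> \<le> \<psi> \<Longrightarrow>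
    U \<zeta> \<in> bounded_ops \<and> U \<zeta> o\<^sub>L tauA = Psi w (\<lambda>z. exp (- (\<zeta> * f z)) * tau z) \<and> norm (U \<zeta>) \<le> KU"
    by (rule U_bounded[OF w']) blast
  have w0: "0 < w" "0 < \<theta>2" "\<theta>2 < pi" using w angle K \<theta> by auto
  have "z \<in> sector \<psi>" using z0 \<psi> by (auto simp: sector_def)
  then obtain r0 where r0: "r0 > 0" "ball z r0 \<subseteq> sector \<psi>"
    using open_sector[OF \<psi>0] open_contains_ball by blast
  \<comment> \<open>A radius of at most |z|/2 gives |\<zeta>| \<ge> |z|/2 and hence the common rate
    \<open>m\<close> on the ball; a radius of at most \<open>r0\<close> keeps |Arg \<zeta>| below
    \<psi>.\<close>
  define r where "r = min r0 (cmod z / 2)"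
  have r: "r > 0" "r \<le> cmod z" "r \<le> r0" "r \<le> cmod z / 2" unfolding r_def using r0 z0 by (auto simp: min_le_iff_disj)
  define m where "m = c * (cmod z / 2)"
  have m: "m > 0" unfolding m_def using K z0 by simp
  have zb: "z \<in> ball z r" using r by simp
  have in_ball: "\<zeta> \<noteq> 0" "\<bar>Arg \<zeta>\<bar> \<le> \<psi>" "cmod z / 2 \<le> cmod \<zeta>" if "\<zeta> \<in> ball z r" for \<zeta>
  proof -
    have "\<zeta> \<in> sector \<psi>" using that r r0 by auto
    then show "\<zeta> \<noteq> 0" "\<bar>Arg \<zeta>\<bar> \<le> \<psi>" using \<psi>0 by (auto simp: sector_def)
    show "cmod z / 2 \<le> cmod \<zeta>" using that norm_triangle_ineq2[of z \<zeta>] r(4) by (auto simp: dist_norm)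
  qed
  have half': "m * cmod (f l) \<le> Re (\<zeta> * f l)" if "\<zeta> \<in> ball z r" "l \<in> sector \<theta>2" for \<zeta> l
  proof -
    have "m * cmod (f l) = c * (cmod z / 2 * cmod (f l))" by (simp add: m_def)
    also have "\<dots> \<le> c * (cmod \<zeta> * cmod (f l))" using in_ball[OF that(1)] K by (intro mult_left_mono mult_right_mono) auto
    also have "\<dots> \<le> Re (\<zeta> * f l)" by (rule half[OF in_ball(2)[OF that(1)] that(2)])
    finally show ?thesis .
  qed
  define M where "M = cmod z * 2"
  define Q where "Q = 8 / m\<^sup>2 + (4 / m + M * (8 / m\<^sup>2)) / (m / 2)"
  note par = exp_minus_parameter_bounds[OF m order_refl half' r(2), folded M_def, folded Q_def]
  define e where "e \<zeta> l = exp (- (\<zeta> * f l))" for \<zeta> l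
  have e_le: "cmod (e \<zeta> l) \<le> exp (- (m * cmod (f l)))" if "\<zeta> \<in> ball z r" "l \<in> sector \<theta>2" for \<zeta> l
    using half'[OF that] unfolding e_def by simp
  have hol2: "f holomorphic_on sector \<theta>2" by (rule holomorphic_on_subset[OF hol sector_mono[OF w0(2) K(4)]])
  \<comment> \<open>One summand bounds f exp(- z f); the other bounds its derivative with respect to
    the value of f, divided by \<delta> = m/2 as the calculus demands.\<close>
  define L where "L = 2 / m + (1 + M * (2 / m)) / (m / 2)"
  have M: "M \<ge> 0" "cmod z \<le> M" unfolding M_def by auto
  have "L * (m / 2) = 1 + (1 + M * (2 / m))" unfolding L_def distrib_right using m by simp
  then have L: "2 / m \<le> L" "1 + M * (2 / m) \<le> L * (m / 2)" unfolding L_def using m M by auto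
  have fe: "cmod (f l * e z l) \<le> 2 / m * exp (- (m / 2 * cmod (f l)))" if l: "l \<in> sector \<theta>2" for l
  proof -
    have "cmod (f l * e z l) \<le> cmod (f l) * exp (- (m * cmod (f l)))"
      unfolding norm_mult by (intro mult_left_mono e_le[OF zb l]) auto
    also have "\<dots> \<le> 2 / m * exp (- (m / 2 * cmod (f l)))" by (rule mult_exp_minus_le(1)[OF m norm_ge_zero])
    finally show ?thesis .
  qed
  have fe1: "cmod (f l * e z l) \<le> 2 / m" if l: "l \<in> sector \<theta>2" for l
  proof -
    have "2 / m * exp (- (m / 2 * cmod (f l))) \<le> 2 / m * 1" using m by (intro mult_left_mono) auto
    with fe[OF l] show ?thesis by linarith
  qed
  have "\<exists>S\<in>bounded_ops. S o\<^sub>L tauA = Psi w (\<lambda>l. - (f l * exp (- (z * f l))) * tau l) \<and> norm S \<le> K * L"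
  proof (rule calc[where \<phi> = "\<lambda>v. - (v * exp (- (z * v)))" and \<phi>' = "\<lambda>v. - ((1 - z * v) * exp (- (z * v)))" and \<delta> = "m / 2"])
    show "m / 2 > 0" using m by simp
    fix l assume l: "l \<in> sector \<theta>2"
    show "((\<lambda>v. - (v * exp (- (z * v)))) has_field_derivative - ((1 - z * f l) * exp (- (z * f l)))) (at (f l))"
      by (auto intro!: derivative_eq_intros simp: algebra_simps)
    show "cmod (- (f l * exp (- (z * f l)))) \<le> L" using fe1[OF l] L(1) unfolding e_def norm_minus_cancel by linarith
    have ml: "exp (- (m * cmod (f l))) \<le> exp (- (m / 2 * cmod (f l)))" using m by simp
    have "cmod (- ((1 - z * f l) * exp (- (z * f l)))) = cmod (e z l - z * (f l * e z l))" unfolding e_def norm_minus_cancel by (simp add: algebra_simps)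
    also have "\<dots> \<le> cmod (e z l) + cmod z * cmod (f l * e z l)" by (metis norm_mult norm_triangle_ineq4)
    also have "\<dots> \<le> exp (- (m / 2 * cmod (f l))) + M * (2 / m * exp (- (m / 2 * cmod (f l))))"
      using M by (intro add_mono mult_mono fe[OF l] order_trans[OF e_le[OF zb l] ml]) auto
    also have "\<dots> = (1 + M * (2 / m)) * exp (- (m / 2 * cmod (f l)))" by (simp add: algebra_simps)
    also have "\<dots> \<le> L * (m / 2) * exp (- (m / 2 * cmod (f l)))" by (intro mult_right_mono L) auto
    finally show "cmod (- ((1 - z * f l) * exp (- (z * f l)))) \<le> L * (m / 2) * exp (- (m / 2 * cmod (f l)))" .
  qed
  then obtain D where D: "D o\<^sub>L tauA = Psi w (\<lambda>l. - (f l * e z l) * tau l)" unfolding e_def by blast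
  have dtau: "decaying \<theta>2 tau" using w0 by (intro decaying_tau)
  have de: "decaying \<theta>2 (\<lambda>l. e \<zeta> l * tau l)" if "\<zeta> \<in> ball z r" for \<zeta>
  proof (rule decaying_mult_bounded(1)[OF dtau, where B = 1])
    show "e \<zeta> holomorphic_on sector \<theta>2" unfolding e_def using w0 K by (intro exp_minus_holomorphic)
    have "exp (- (m * cmod (f l))) \<le> 1" for l using m by simp
    then show "cmod (e \<zeta> l) \<le> 1" if "l \<in> sector \<theta>2" for l using e_le[OF \<open>\<zeta> \<in> _\<close> that] order_trans by blast
  qed
  have dfe: "decaying \<theta>2 (\<lambda>l. - (f l * e z l) * tau l)"
  proof (rule decaying_mult_bounded(1)[OF dtau, where B = "2 / m"])
    have "e z holomorphic_on sector \<theta>2" unfolding e_def using w0 K by (intro exp_minus_holomorphic)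
    then show "(\<lambda>l. - (f l * e z l)) holomorphic_on sector \<theta>2" using hol2 by (intro holomorphic_intros)
    show "cmod (- (f l * e z l)) \<le> 2 / m" if "l \<in> sector \<theta>2" for l using fe1[OF that] by (simp only: norm_minus_cancel)
  qed
  show ?thesis
  proof (intro exI, rule quadratic_remainder_has_derivative[OF _ r(1)])
    show "bounded_linear (\<lambda>h. h *\<^sub>C D)" by (rule scaleC.bounded_linear_left)
    fix \<zeta> assume "norm (\<zeta> - z) < r"
    then have \<zeta>: "\<zeta> \<in> ball z r" by (simp add: dist_norm norm_minus_commute)
    define h where "h = \<zeta> - z"
    have "\<exists>S\<in>bounded_ops. S o\<^sub>L tauA = Psi w (\<lambda>l. (exp (- (\<zeta> * f l)) - exp (- (z * f l)) + h * (f l * exp (- (z * f l)))) * tau l)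
       \<and> norm S \<le> K * (Q * (cmod h)\<^sup>2)"
    proof (rule calc[where \<phi> = "\<lambda>v. exp (- (\<zeta> * v)) - exp (- (z * v)) + h * (v * exp (- (z * v)))" and \<delta> = "m / 2" and
          \<phi>' = "\<lambda>v. - \<zeta> * exp (- (\<zeta> * v)) + z * exp (- (z * v)) + h * ((1 - z * v) * exp (- (z * v)))"])
      show "m / 2 > 0" using m by simp
      fix l assume l: "l \<in> sector \<theta>2"
      show "((\<lambda>v. exp (- (\<zeta> * v)) - exp (- (z * v)) + h * (v * exp (- (z * v)))) has_field_derivative
         - \<zeta> * exp (- (\<zeta> * f l)) + z * exp (- (z * f l)) + h * ((1 - z * f l) * exp (- (z * f l)))) (at (f l))"
        by (auto intro!: derivative_eq_intros simp: algebra_simps)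
      show "cmod (exp (- (\<zeta> * f l)) - exp (- (z * f l)) + h * (f l * exp (- (z * f l)))) \<le> Q * (cmod h)\<^sup>2"
        unfolding h_def by (rule par(1)[OF _ l \<zeta>])
      show "cmod (- \<zeta> * exp (- (\<zeta> * f l)) + z * exp (- (z * f l)) + h * ((1 - z * f l) * exp (- (z * f l))))
          \<le> Q * (cmod h)\<^sup>2 * (m / 2) * exp (- (m / 2 * cmod (f l)))"
        unfolding h_def by (rule par(2)[OF _ l \<zeta>])
    qed
    then obtain S where S: "S o\<^sub>L tauA = Psi w (\<lambda>l. (e \<zeta> l - e z l + h * (f l * e z l)) * tau l)" "norm S \<le> K * (Q * (cmod h)\<^sup>2)"
      unfolding e_def by blast
    note ws = w(1) K(3) less_imp_le[OF w0(3)]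
    have "(U \<zeta> - U z - h *\<^sub>C D) o\<^sub>L tauA = (Psi w (\<lambda>l. e \<zeta> l * tau l) + (-1) *\<^sub>C Psi w (\<lambda>l. e z l * tau l)) + (- h) *\<^sub>C Psi w (\<lambda>l. - (f l * e z l) * tau l)"
      using U[OF in_ball(1,2)[OF \<zeta>]] U[OF in_ball(1,2)[OF zb]] D
      by (simp add: compose.diff_left scaleC_compose_left scaleC.minus_left e_def)
    also have "\<dots> = Psi w (\<lambda>l. (e \<zeta> l * tau l + (-1) * (e z l * tau l)) + (- h) * (- (f l * e z l) * tau l))"
      using Psi_lin[OF ws decaying_add[OF de[OF \<zeta>] decaying_mult_const[OF de[OF zb]]] dfe, of "-1" "- h"]
        Psi_lin[OF ws de[OF \<zeta>] de[OF zb], of "-1"] by simp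
    also have "\<dots> = S o\<^sub>L tauA" unfolding S(1) by (simp add: algebra_simps)
    finally have "U \<zeta> - U z - h *\<^sub>C D = S" by (rule blinfun_compose_dense_cancel[OF _ tauA_dense])
    with S(2) show "norm (U \<zeta> - U z - (\<zeta> - z) *\<^sub>C D) \<le> K * Q * (norm (\<zeta> - z))\<^sup>2" unfolding h_def by simp
  qed
qed

end

section \<open>Strong continuity and the generator\<close>

lemma greaterThan_subset_atLeast: "{x<..} \<subseteq> {x::'a::preorder..}"
  by (auto intro: less_imp_le)

lemma has_vector_derivative_right_quotient:
  fixes g :: "real \<Rightarrow> 'a::real_normed_vector"
  assumes "(g has_vector_derivative d) (at_right 0)"
  shows "((\<lambda>h. (1 / h) *\<^sub>R (g h - g 0)) \<longlongrightarrow> d) (at_right 0)"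
proof -
  have "((\<lambda>h. (1 / norm (h - 0)) *\<^sub>R (g h - (g 0 + (h - 0) *\<^sub>R d))) \<longlongrightarrow> 0) (at_right 0)"
    using assms unfolding has_vector_derivative_def has_derivative_within by blast
  then have "((\<lambda>h. (1 / norm (h - 0)) *\<^sub>R (g h - (g 0 + (h - 0) *\<^sub>R d)) + d) \<longlongrightarrow> 0 + d) (at_right 0)"
    by (intro tendsto_add tendsto_const)
  then have "((\<lambda>h. (1 / norm (h - 0)) *\<^sub>R (g h - (g 0 + (h - 0) *\<^sub>R d)) + d) \<longlongrightarrow> d) (at_right 0)"
    by (simp only: add_0_left)
  then show ?thesis
  proof (rule Lim_transform_eventually)
    have "(1 / norm (h - 0)) *\<^sub>R (g h - (g 0 + (h - 0) *\<^sub>R d)) + d = (1 / h) *\<^sub>R (g h - g 0)" if "h > 0" for h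
      using that by (simp add: scaleR_diff_right scaleR_add_right)
    then show "\<forall>\<^sub>F h in at_right 0. (1 / norm (h - 0)) *\<^sub>R (g h - (g 0 + (h - 0) *\<^sub>R d)) + d = (1 / h) *\<^sub>R (g h - g 0)"
      by (intro eventually_at_rightI[of 0 1]) auto
  qed
qed

lemma strongly_continuous_dense:
  fixes T :: "real \<Rightarrow> 'a::real_normed_vector \<Rightarrow>\<^sub>L 'b::real_normed_vector"
  assumes bound: "\<And>t. t \<in> S \<Longrightarrow> norm (T t) \<le> M" and D: "closure D = UNIV"
    and cont: "\<And>x. x \<in> D \<Longrightarrow> continuous_on S (\<lambda>t. blinfun_apply (T t) x)"
  shows "continuous_on S (\<lambda>t. blinfun_apply (T t) x)"
proof -
  have "x \<in> closure D" using D by simp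
  then obtain y where y: "\<And>n::nat. y n \<in> D" "y \<longlonglongrightarrow> x" by (auto simp: closure_sequential)
  have "uniform_limit S (\<lambda>n t. blinfun_apply (T t) (y n)) (\<lambda>t. blinfun_apply (T t) x) sequentially"
  proof (rule uniform_limitI)
    fix e :: real assume e: "e > 0"
    define d where "d = e / (\<bar>M\<bar> + 1)"
    have d: "d > 0" "(\<bar>M\<bar> + 1) * d = e" unfolding d_def using e by auto
    have "\<forall>\<^sub>F n in sequentially. dist (y n) x < d" using y(2) d(1) by (rule tendstoD)
    then show "\<forall>\<^sub>F n in sequentially. \<forall>t\<in>S. dist (blinfun_apply (T t) (y n)) (blinfun_apply (T t) x) < e"
    proof eventually_elim
      case (elim n)
      show ?case
      proof
        fix t assume t: "t \<in> S"
        have "dist (blinfun_apply (T t) (y n)) (blinfun_apply (T t) x) = norm (blinfun_apply (T t) (y n - x))"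
          by (simp add: dist_norm blinfun.diff_right)
        also have "\<dots> \<le> norm (T t) * norm (y n - x)" by (rule norm_blinfun)
        also have "\<dots> \<le> (\<bar>M\<bar> + 1) * norm (y n - x)" using bound[OF t] by (intro mult_right_mono) auto
        also have "\<dots> < (\<bar>M\<bar> + 1) * d" using elim by (intro mult_strict_left_mono) (auto simp: dist_norm)
        finally show "dist (blinfun_apply (T t) (y n)) (blinfun_apply (T t) x) < e" unfolding d(2) .
      qed
    qed
  qed
  then show ?thesis
    by (rule uniform_limit_theorem[rotated]) (auto intro: cont[OF y(1)] always_eventually)
qed

context sectorial_symbol
begin

definition T :: "real \<Rightarrow> 'a \<Rightarrow>\<^sub>L 'a" where
  "T t = (if t = 0 then id_blinfun else U (of_real t))"

lemma exp_minus_real_bounded: "t \<ge> 0 \<Longrightarrow> z \<in> sector \<theta> \<Longrightarrow> cmod (exp (- (of_real t * f z))) \<le> 1"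
  and Re_real_nonneg: "t \<ge> 0 \<Longrightarrow> z \<in> sector \<theta> \<Longrightarrow> 0 \<le> Re (of_real t * f z)"
proof -
  assume t: "t \<ge> 0" and z: "z \<in> sector \<theta>"
  have "\<bar>Arg (complex_of_real t)\<bar> \<le> 0" using t by simp
  then show "cmod (exp (- (of_real t * f z))) \<le> 1" "0 \<le> Re (of_real t * f z)"
    using exp_minus_bounded[of 0 \<theta> z "of_real t"] Re_mult_nonneg[of 0 \<theta> z "of_real t"] a\<theta> theta_pos z t by auto
qed

lemma decaying_exp_minus_real:
  assumes "t \<ge> 0" "0 < \<theta>1" "\<theta>1 \<le> \<theta>" "decaying \<theta>1 g"
  shows "decaying \<theta>1 (\<lambda>z. exp (- (of_real t * f z)) * g z)"
proof (rule decaying_mult_bounded(1)[OF assms(4) exp_minus_holomorphic[OF assms(3,2)]])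
  show "cmod (exp (- (of_real t * f z))) \<le> 1" if "z \<in> sector \<theta>1" for z
    using exp_minus_real_bounded[OF assms(1)] that sector_mono[OF assms(2,3)] by blast
qed

lemma T_bounded: obtains K where "K \<ge> 0" "\<And>t. t \<ge> 0 \<Longrightarrow> norm (T t) \<le> K"
proof -
  have "(0::real) < pi / 2 - a * \<omega>" using semigroup_angle by simp
  then obtain w where w: "\<omega> < w" "a * w + 0 < pi / 2" by (rule intermediate_angle)
  obtain K where K: "K \<ge> 0" "\<And>\<zeta>. \<zeta> \<noteq> 0 \<Longrightarrow> \<bar>Arg \<zeta>\<bar> \<le> 0 \<Longrightarrow>
    U \<zeta> \<in> bounded_ops \<and> U \<zeta> o\<^sub>L tauA = Psi w (\<lambda>z. exp (- (\<zeta> * f z)) * tau z) \<and> norm (U \<zeta>) \<le> K"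
    by (rule U_bounded[OF w(1) order_refl w(2)]) blast
  show ?thesis
  proof (rule that)
    show "K + 1 \<ge> 0" using K by simp
    fix t :: real assume t: "t \<ge> 0"
    show "norm (T t) \<le> K + 1"
    proof (cases "t = 0")
      case True
      then show ?thesis using K norm_blinfun_id_le[where 'a = 'a] by (simp add: T_def)
    next
      case False
      then show ?thesis using K(2)[of "of_real t"] t by (simp add: T_def)
    qed
  qed
qed

lemma T_tau:
  assumes t: "t \<ge> 0" and w: "\<omega> < w" "w < \<theta>"
  shows "T t \<in> bounded_ops" "T t o\<^sub>L tauA = Psi w (\<lambda>z. exp (- (of_real t * f z)) * tau z)"
proof -
  have aw: "a * w + 0 < pi / 2" using w a unfolding a\<theta>[symmetric] by simp
  obtain K where K: "K \<ge> 0" "\<And>\<zeta>. \<zeta> \<noteq> 0 \<Longrightarrow> \<bar>Arg \<zeta>\<bar> \<le> 0 \<Longrightarrow>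
    U \<zeta> \<in> bounded_ops \<and> U \<zeta> o\<^sub>L tauA = Psi w (\<lambda>z. exp (- (\<zeta> * f z)) * tau z) \<and> norm (U \<zeta>) \<le> K"
    by (rule U_bounded[OF w(1) order_refl aw]) blast
  have "T t \<in> bounded_ops \<and> T t o\<^sub>L tauA = Psi w (\<lambda>z. exp (- (of_real t * f z)) * tau z)"
  proof (cases "t = 0")
    case True
    have "id_blinfun o\<^sub>L tauA = tauA" by (intro blinfun_eqI) simp
    then show ?thesis using True Psi_tau[of w] w \<theta> by (simp add: T_def bounded_ops_def)
  next
    case False
    then show ?thesis using K(2)[of "of_real t"] t by (simp add: T_def)
  qed
  then show "T t \<in> bounded_ops" "T t o\<^sub>L tauA = Psi w (\<lambda>z. exp (- (of_real t * f z)) * tau z)" by auto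
qed

text \<open>Multiplicativity and commutativity of the calculus give the identities after composition
  with \<tau>(A), which is then cancelled by density of its range.\<close>

lemma T_Psi:
  assumes t: "t \<ge> 0" and w: "\<omega> < w" "w < \<theta>1" "\<theta>1 \<le> \<theta>" and g: "decaying \<theta>1 g"
  shows "T t o\<^sub>L Psi w g = Psi w (\<lambda>z. exp (- (of_real t * f z)) * g z)"
    and "Psi w g o\<^sub>L T t = Psi w (\<lambda>z. exp (- (of_real t * f z)) * g z)"
proof -
  have \<theta>1: "0 < \<theta>1" "\<theta>1 < pi" "\<theta>1 \<le> pi" "w < pi" "w < \<theta>" using w \<theta> angle by auto
  note ws = w(1,2) \<theta>1(3)
  have dt: "decaying \<theta>1 tau" by (rule decaying_tau[OF \<theta>1(1,2)])
  let ?e = "\<lambda>z. exp (- (of_real t * f z))"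
  have de: "decaying \<theta>1 (\<lambda>z. ?e z * h z)" if "decaying \<theta>1 h" for h
    by (rule decaying_exp_minus_real[OF t \<theta>1(1) w(3) that])
  note Tt = T_tau(2)[OF t w(1) \<theta>1(5)] and Pt = Psi_tau[OF w(1) \<theta>1(4)]
  have r: "Psi w (\<lambda>z. ?e z * g z) o\<^sub>L tauA = Psi w (\<lambda>z. ?e z * g z * tau z)"
    unfolding Pt[symmetric] by (rule Psi_mult[OF ws de[OF g] dt])
  have "(T t o\<^sub>L Psi w g) o\<^sub>L tauA = T t o\<^sub>L (tauA o\<^sub>L Psi w g)"
    unfolding blinfun_compose_assoc Pt[symmetric] Psi_mult[OF ws g dt] Psi_mult[OF ws dt g] by (simp add: mult.commute)
  also have "\<dots> = Psi w (\<lambda>z. ?e z * tau z) o\<^sub>L Psi w g" unfolding blinfun_compose_assoc[symmetric] Tt ..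
  also have "\<dots> = Psi w (\<lambda>z. ?e z * g z * tau z)" unfolding Psi_mult[OF ws de[OF dt] g] by (simp add: mult_ac)
  finally show "T t o\<^sub>L Psi w g = Psi w (\<lambda>z. ?e z * g z)"
    unfolding r[symmetric] by (rule blinfun_compose_dense_cancel[OF _ tauA_dense])
  have "(Psi w g o\<^sub>L T t) o\<^sub>L tauA = Psi w (\<lambda>z. ?e z * g z * tau z)"
    unfolding blinfun_compose_assoc Tt Psi_mult[OF ws g de[OF dt]] by (simp add: mult_ac)
  then show "Psi w g o\<^sub>L T t = Psi w (\<lambda>z. ?e z * g z)"
    unfolding r[symmetric] by (rule blinfun_compose_dense_cancel[OF _ tauA_dense])
qed

lemma T_add:
  assumes "s \<ge> 0" "t \<ge> 0"
  shows "T (s + t) = T s o\<^sub>L T t"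
proof -
  obtain w where w: "\<omega> < w" "w < \<theta>" using dense[OF \<theta>(1)] by blast
  have d: "decaying \<theta> (\<lambda>z. exp (- (of_real t * f z)) * tau z)"
    by (rule decaying_exp_minus_real[OF assms(2) theta_pos order_refl decaying_tau[OF theta_pos \<theta>(2)]])
  have "(T s o\<^sub>L T t) o\<^sub>L tauA = Psi w (\<lambda>z. exp (- (of_real s * f z)) * (exp (- (of_real t * f z)) * tau z))"
    unfolding blinfun_compose_assoc T_tau(2)[OF assms(2) w] by (rule T_Psi(1)[OF assms(1) w order_refl d])
  also have "\<dots> = Psi w (\<lambda>z. exp (- (of_real (s + t) * f z)) * tau z)"
    by (simp add: algebra_simps exp_add exp_diff exp_minus divide_inverse)
  also have "\<dots> = T (s + t) o\<^sub>L tauA" using assms by (intro T_tau(2)[OF _ w, symmetric]) simp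
  finally show ?thesis using blinfun_compose_dense_cancel[OF _ tauA_dense] by metis
qed

text \<open>
  On the range of \<open>g(A)\<^sup>2\<close>, with \<open>g\<close> and \<open>f g\<close> decaying, orbits are differentiable up to \<open>t = 0\<close>: the remainder
  \<open>exp (- t f) - exp (- s f) + (t - s) f exp (- s f)\<close> is bounded by \<open>(t - s)\<^sup>2 |f|\<^sup>2\<close>, and \<open>(f g)\<^sup>2\<close> is integrable.
\<close>

lemma T_derivative:
  assumes w: "\<omega> < w" "w < \<theta>1" "\<theta>1 \<le> \<theta>" and g: "decaying \<theta>1 g" and fg: "decaying \<theta>1 (\<lambda>z. f z * g z)" and s: "s \<ge> 0"
  shows "((\<lambda>t. T t o\<^sub>L (Psi w g o\<^sub>L Psi w g)) has_vector_derivative - (T s o\<^sub>L (Psi w (\<lambda>z. f z * g z) o\<^sub>L Psi w g))) (at s within {0..})"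
proof -
  have \<theta>1: "0 < \<theta>1" "\<theta>1 \<le> pi" "w < pi" using w \<theta> angle by auto
  have sub: "sector \<theta>1 \<subseteq> sector \<theta>" by (rule sector_mono[OF \<theta>1(1) w(3)])
  note ws = w(1,2) \<theta>1(2)
  let ?e = "\<lambda>t z. exp (- (of_real t * f z))"
  have dgg: "decaying \<theta>1 (\<lambda>z. g z * g z)" and dfgg: "decaying \<theta>1 (\<lambda>z. f z * g z * g z)"
    and dff: "decaying \<theta>1 (\<lambda>z. (f z * g z) * (f z * g z))"
    by (rule decaying_mult[OF g g] decaying_mult[OF fg g] decaying_mult[OF fg fg])+
  obtain \<sigma> C where C: "\<sigma> > 0" "C \<ge> 0" "\<And>z. z \<in> sector \<theta>1 \<Longrightarrow> cmod ((f z * g z) * (f z * g z)) \<le> C * dk \<sigma> (cmod z)"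
    by (rule decayingE[OF dff]) blast
  obtain K where K: "K \<ge> 0" "\<And>\<theta> g C. w < \<theta> \<Longrightarrow> \<theta> \<le> pi \<Longrightarrow> g holomorphic_on sector \<theta> \<Longrightarrow> C \<ge> 0 \<Longrightarrow>
       (\<And>z. z \<in> sector \<theta> \<Longrightarrow> cmod (g z) \<le> C * dk \<sigma> (cmod z)) \<Longrightarrow> norm (Psi w g) \<le> K * C"
    by (rule Psi_bound[OF w(1) \<theta>1(3) C(1)]) blast
  have P: "T t o\<^sub>L (Psi w g o\<^sub>L Psi w g) = Psi w (\<lambda>z. ?e t z * (g z * g z))" if "t \<ge> 0" for t
    unfolding Psi_mult[OF ws g g] by (rule T_Psi(1)[OF that w dgg])
  have P1: "T s o\<^sub>L (Psi w (\<lambda>z. f z * g z) o\<^sub>L Psi w g) = Psi w (\<lambda>z. ?e s z * (f z * g z * g z))"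
    unfolding Psi_mult[OF ws fg g] by (rule T_Psi(1)[OF s w dfgg])
  have de: "decaying \<theta>1 (\<lambda>z. ?e t z * h z)" if "t \<ge> 0" "decaying \<theta>1 h" for t h
    by (rule decaying_exp_minus_real[OF that(1) \<theta>1(1) w(3) that(2)])
  show ?thesis
    unfolding has_vector_derivative_def
  proof (rule quadratic_remainder_has_derivative[where r = 1])
    fix t assume "t \<in> {0::real..}"
    then have t: "t \<ge> 0" by simp
    let ?h = "complex_of_real (t - s)"
    have "(T t o\<^sub>L (Psi w g o\<^sub>L Psi w g)) - (T s o\<^sub>L (Psi w g o\<^sub>L Psi w g)) - (t - s) *\<^sub>R - (T s o\<^sub>L (Psi w (\<lambda>z. f z * g z) o\<^sub>L Psi w g))
       = (Psi w (\<lambda>z. ?e t z * (g z * g z)) + (- 1) *\<^sub>C Psi w (\<lambda>z. ?e s z * (g z * g z))) + ?h *\<^sub>C Psi w (\<lambda>z. ?e s z * (f z * g z * g z))"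
      unfolding P[OF t] P[OF s] P1 by (simp only: scaleC_of_real) (simp add: scaleC.minus_left)
    also have "\<dots> = Psi w (\<lambda>z. ?e t z * (g z * g z) + (- 1) * (?e s z * (g z * g z)) + ?h * (?e s z * (f z * g z * g z)))"
      using Psi_lin[OF ws decaying_add[OF de[OF t dgg] decaying_mult_const[OF de[OF s dgg]]] de[OF s dfgg], of "-1" ?h]
        Psi_lin[OF ws de[OF t dgg] de[OF s dgg], of "-1"] by simp
    also have "norm \<dots> \<le> K * (C * (t - s)\<^sup>2)"
    proof (rule K(2)[OF w(2) \<theta>1(2)])
      show "C * (t - s)\<^sup>2 \<ge> 0" using C by simp
      show "(\<lambda>z. ?e t z * (g z * g z) + (- 1) * (?e s z * (g z * g z)) + ?h * (?e s z * (f z * g z * g z))) holomorphic_on sector \<theta>1"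
        using decaying_add[OF decaying_add[OF de[OF t dgg] decaying_mult_const[OF de[OF s dgg]]] decaying_mult_const[OF de[OF s dfgg]], of "-1" ?h]
        by (simp add: decaying_def)
      fix z assume z: "z \<in> sector \<theta>1"
      then have z': "z \<in> sector \<theta>" using sub by blast
      have "of_real t * f z - of_real s * f z = ?h * f z" by (simp add: algebra_simps)
      then have "cmod (?e t z - ?e s z + ?h * f z * ?e s z) \<le> (cmod (?h * f z))\<^sup>2"
        using exp_minus_Taylor(2)[OF Re_real_nonneg[OF t z'] Re_real_nonneg[OF s z']] by simp
      also have "\<dots> = (t - s)\<^sup>2 * (cmod (f z))\<^sup>2" by (simp only: norm_mult norm_of_real power_mult_distrib power2_abs)
      finally have 1: "cmod (?e t z - ?e s z + ?h * f z * ?e s z) \<le> (t - s)\<^sup>2 * (cmod (f z))\<^sup>2" .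
      have "cmod (?e t z * (g z * g z) + (- 1) * (?e s z * (g z * g z)) + ?h * (?e s z * (f z * g z * g z)))
         = cmod (?e t z - ?e s z + ?h * f z * ?e s z) * cmod (g z * g z)"
        by (simp only: norm_mult[symmetric]) (simp add: algebra_simps)
      also have "\<dots> \<le> (t - s)\<^sup>2 * (cmod (f z))\<^sup>2 * cmod (g z * g z)" by (intro mult_right_mono 1) simp
      also have "\<dots> = (t - s)\<^sup>2 * cmod ((f z * g z) * (f z * g z))" by (simp add: norm_mult power2_eq_square)
      also have "\<dots> \<le> (t - s)\<^sup>2 * (C * dk \<sigma> (cmod z))" by (intro mult_left_mono C(3) z) simp
      finally show "cmod (?e t z * (g z * g z) + (- 1) * (?e s z * (g z * g z)) + ?h * (?e s z * (f z * g z * g z)))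
         \<le> C * (t - s)\<^sup>2 * dk \<sigma> (cmod z)" by (simp add: mult_ac)
    qed
    finally show "norm ((T t o\<^sub>L (Psi w g o\<^sub>L Psi w g)) - (T s o\<^sub>L (Psi w g o\<^sub>L Psi w g)) - (t - s) *\<^sub>R - (T s o\<^sub>L (Psi w (\<lambda>z. f z * g z) o\<^sub>L Psi w g)))
        \<le> K * C * (norm (t - s))\<^sup>2" by simp
  qed (auto intro: bounded_linear_minus bounded_linear_scaleR_left)
qed

text \<open>The growth bound max (t^k) (t^-k) is \<open>dk (- k) t\<close>, and the exponents of
  \<open>dk\<close> add up, so n factors \<tau> leave the positive exponent n - k.\<close>

lemma f_tau_pow_decaying:
  assumes \<theta>1: "0 < \<theta>1" "\<theta>1 < \<theta>" and k: "0 \<le> k" "k < real n"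
    and le: "\<And>z. z \<in> sector \<theta>1 \<Longrightarrow> cmod (f z) \<le> C * max (cmod z powr k) (cmod z powr - k)"
  shows "decaying \<theta>1 (\<lambda>z. f z * tau z ^ n)"
proof -
  have p: "0 < \<theta>1" "\<theta>1 < pi" "\<theta>1 \<le> pi" using \<theta>1 \<theta> by auto
  obtain K where K: "K > 0" "\<And>z. z \<in> sector \<theta>1 \<Longrightarrow> cmod (tau z) \<le> K * dk 1 (cmod z)"
    by (rule tau_bound[OF p(1,2)]) blast
  have max: "max (t powr k) (t powr - k) = dk (- k) t" if t: "t > 0" for t :: real
  proof (cases "t \<ge> 1")
    case True
    have "t powr - k \<le> t powr k" using True k by (intro powr_mono) auto
    then show ?thesis using True t by (simp add: dk_def powr_def max_def mult.commute)
  next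
    case False
    have "t powr k \<le> t powr - k" using False t k by (intro powr_mono') auto
    then show ?thesis using False t by (simp add: dk_def powr_def max_def mult.commute)
  qed
  have pw: "dk 1 t ^ n = dk (real n) t" for t by (simp add: dk_def exp_of_nat_mult[symmetric])
  show ?thesis unfolding decaying_def
  proof (intro conjI exI ballI)
    show "(\<lambda>z. f z * tau z ^ n) holomorphic_on sector \<theta>1"
      using holomorphic_on_subset[OF hol sector_mono[OF p(1)]] tau_holomorphic[OF p(1,3)] \<theta>1 by (intro holomorphic_intros) auto
    show "real n - k > 0" "\<bar>C\<bar> * K ^ n \<ge> 0" using k K by auto
    fix z assume z: "z \<in> sector \<theta>1"
    then have z0: "cmod z > 0" using p by (auto simp: sector_def)
    have "cmod (f z) \<le> C * dk (- k) (cmod z)" using le[OF z] max[OF z0] by simp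
    also have "\<dots> \<le> \<bar>C\<bar> * dk (- k) (cmod z)" by (intro mult_right_mono) (auto simp: dk_def)
    finally have 1: "cmod (f z) \<le> \<bar>C\<bar> * dk (- k) (cmod z)" .
    have 2: "cmod (tau z) ^ n \<le> (K * dk 1 (cmod z)) ^ n" by (intro power_mono K z) simp
    have "cmod (f z * tau z ^ n) \<le> (\<bar>C\<bar> * dk (- k) (cmod z)) * (K * dk 1 (cmod z)) ^ n"
      unfolding norm_mult norm_power by (intro mult_mono 1 2) (auto simp: dk_def)
    also have "\<dots> = \<bar>C\<bar> * K ^ n * dk (real n - k) (cmod z)"
      unfolding power_mult_distrib pw using dk_add[of "- k" "real n" "cmod z"] by simp
    finally show "cmod (f z * tau z ^ n) \<le> \<bar>C\<bar> * K ^ n * dk (real n - k) (cmod z)" .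
  qed
qed

text \<open>\<open>hol_calculus\<close> takes n and w from a choice operator, so nothing but their
  admissibility may be used. Membership in its graph is recast as the equation (f \<tau>^n)(A) x =
  \<tau>^n(A) y between bounded operators.\<close>

lemma hol_calculus_regularised:
  obtains n w \<theta>1 where "\<omega> < w" "w < \<theta>1" "\<theta>1 \<le> \<theta>" "decaying \<theta>1 (\<lambda>z. tau z ^ n)" "decaying \<theta>1 (\<lambda>z. f z * tau z ^ n)"
    "Psi w (\<lambda>z. tau z ^ n) = tauA_pow n"
    "\<And>x y. (x, y) \<in> hol_calculus \<omega> \<theta> f A \<longleftrightarrow> blinfun_apply (Psi w (\<lambda>z. f z * tau z ^ n)) x = blinfun_apply (Psi w (\<lambda>z. tau z ^ n)) y"
proof -
  define nw where "nw = (SOME (n, w). calculus_admissible \<omega> \<theta> f n w)"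
  obtain n w where nw: "nw = (n, w)" by force
  \<comment> \<open>Some admissible pair must exist for the choice to be meaningful; growth of order
    1 allows n = 2.\<close>
  have "calculus_admissible \<omega> \<theta> f 2 ((\<omega> + \<theta>) / 2)"
    unfolding calculus_admissible_def
  proof (intro conjI)
    show "\<exists>k::real. 0 \<le> k \<and> k < real 2 \<and> (\<forall>\<theta>'. \<omega> < \<theta>' \<and> \<theta>' < \<theta> \<longrightarrow>
        (\<exists>C. \<forall>z\<in>sector \<theta>'. cmod (f z) \<le> C * max (cmod z powr k) (cmod z powr - k)))"
    proof (rule exI[of _ 1], intro conjI allI impI)
      fix \<theta>' assume "\<omega> < \<theta>' \<and> \<theta>' < \<theta>"
      then show "\<exists>C. \<forall>z\<in>sector \<theta>'. cmod (f z) \<le> C * max (cmod z powr 1) (cmod z powr - 1)"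
        using angle by (intro growth) auto
    qed auto
  qed (use \<theta> hol in auto)
  then have "(\<lambda>(n, w). calculus_admissible \<omega> \<theta> f n w) nw"
    unfolding nw_def by (intro someI_ex[of "\<lambda>(n, w). calculus_admissible \<omega> \<theta> f n w"] exI[of _ "(2, (\<omega> + \<theta>) / 2)"]) simp
  then have adm: "calculus_admissible \<omega> \<theta> f n w" by (simp add: nw)
  then have w: "\<omega> < w" "w < \<theta>" by (auto simp: calculus_admissible_def)
  define \<theta>1 where "\<theta>1 = (w + \<theta>) / 2"
  have \<theta>1: "w < \<theta>1" "\<theta>1 < \<theta>" "0 < \<theta>1" "\<omega> < \<theta>1" "\<theta>1 < pi" using w angle \<theta> unfolding \<theta>1_def by auto
  obtain k C where k: "0 \<le> k" "k < real n" and C: "\<And>z. z \<in> sector \<theta>1 \<Longrightarrow> cmod (f z) \<le> C * max (cmod z powr k) (cmod z powr - k)"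
    using adm \<theta>1 unfolding calculus_admissible_def by blast
  have "n \<noteq> 0" using k by auto
  then obtain n' where n': "n = Suc n'" by (cases n) auto
  note tp = tauA_pow_Psi[OF w(1) \<theta>1(1,5), of n', folded n']
  show ?thesis
  proof (rule that[OF w(1) \<theta>1(1) less_imp_le[OF \<theta>1(2)] tp(2) f_tau_pow_decaying[OF \<theta>1(3,2) k C] tp(1)])
    fix x y
    have "hol_calculus \<omega> \<theta> f A = op_graph (Psi w (\<lambda>z. f z * tau z ^ n)) O (op_graph (tauA_pow n))\<inverse>"
      unfolding hol_calculus_def nw_def[symmetric] nw by (simp add: regularised_calculus_eq tau_op_pow_eq)
    then show "(x, y) \<in> hol_calculus \<omega> \<theta> f A \<longleftrightarrow> blinfun_apply (Psi w (\<lambda>z. f z * tau z ^ n)) x = blinfun_apply (Psi w (\<lambda>z. tau z ^ n)) y"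
      unfolding tp(1) by (auto simp: op_graph_def)
  qed
qed

text \<open>Orbits that start in the dense range of \<tau>(A)^(2n) are differentiable up to 0, and
  the uniform bound for \<open>T\<close> carries continuity over to all vectors.\<close>

lemma T_strongly_continuous: "continuous_on {0..} (\<lambda>t. blinfun_apply (T t) x)"
proof -
  obtain n w \<theta>1 where w: "\<omega> < w" "w < \<theta>1" "\<theta>1 \<le> \<theta>" and d: "decaying \<theta>1 (\<lambda>z. tau z ^ n)" "decaying \<theta>1 (\<lambda>z. f z * tau z ^ n)"
    and N: "Psi w (\<lambda>z. tau z ^ n) = tauA_pow n"
    by (rule hol_calculus_regularised) blast
  obtain K where K: "\<And>t. t \<ge> 0 \<Longrightarrow> norm (T t) \<le> K" by (rule T_bounded) blast
  note vd = T_derivative[OF w d, unfolded N]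
  show ?thesis
  proof (rule strongly_continuous_dense)
    show "norm (T t) \<le> K" if "t \<in> {0..}" for t using K that by simp
    show "closure (range (blinfun_apply (tauA_pow n o\<^sub>L tauA_pow n))) = UNIV"
      by (intro dense_range_compose tauA_pow_dense)
    fix y assume "y \<in> range (blinfun_apply (tauA_pow n o\<^sub>L tauA_pow n))"
    then obtain x where y: "y = blinfun_apply (tauA_pow n o\<^sub>L tauA_pow n) x" by blast
    have "continuous_on {0..} (\<lambda>t. T t o\<^sub>L (tauA_pow n o\<^sub>L tauA_pow n))"
      unfolding continuous_on_eq_continuous_within using vd by (auto intro: has_vector_derivative_continuous)
    then have "continuous_on {0..} (\<lambda>t. blinfun_apply (T t o\<^sub>L (tauA_pow n o\<^sub>L tauA_pow n)) x)"
      by (rule bounded_linear.continuous_on[OF blinfun.bounded_linear_left])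
    then show "continuous_on {0..} (\<lambda>t. blinfun_apply (T t) y)" unfolding y by simp
  qed
qed

text \<open>With N = \<tau>^n(A) and G = (f \<tau>^n)(A), a pair (x, y) lies in - f(A) iff G x = - N
  y. For every x, N^2 T(t) x has derivative - N T(t) G x. If y is the derivative of T(t) x at 0,
  this gives N^2 y = - N G x, and N is injective. Conversely, if G x = - N y, integration gives N^2
  (T(t) x - x) = N^2 I(t), where I(t) is the integral of T(s) y over [0, t]; cancelling N^2 and
  differentiating at 0 gives y.\<close>

lemma generator_T: "generator T = affine_op 0 (- 1) (hol_calculus \<omega> \<theta> f A)"
proof -
  obtain n w \<theta>1 where w: "\<omega> < w" "w < \<theta>1" "\<theta>1 \<le> \<theta>" and d: "decaying \<theta>1 (\<lambda>z. tau z ^ n)" "decaying \<theta>1 (\<lambda>z. f z * tau z ^ n)"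
    and N: "Psi w (\<lambda>z. tau z ^ n) = tauA_pow n"
    and graph: "\<And>x y. (x, y) \<in> hol_calculus \<omega> \<theta> f A \<longleftrightarrow> blinfun_apply (Psi w (\<lambda>z. f z * tau z ^ n)) x = blinfun_apply (Psi w (\<lambda>z. tau z ^ n)) y"
    by (rule hol_calculus_regularised) blast
  have \<theta>1: "\<theta>1 \<le> pi" using w \<theta> by simp
  define N where "N = tauA_pow n"
  define G where "G = Psi w (\<lambda>z. f z * tau z ^ n)"
  note N' = \<open>Psi w (\<lambda>z. tau z ^ n) = tauA_pow n\<close>[folded N_def]
  note graph' = graph[folded G_def, unfolded N']
  have inj: "u = 0" if "blinfun_apply N u = 0" for u using tauA_pow_injective that unfolding N_def by blast
  have comm: "N o\<^sub>L G = G o\<^sub>L N" unfolding N'[symmetric] G_def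
    unfolding Psi_mult[OF w(1,2) \<theta>1 d] Psi_mult[OF w(1,2) \<theta>1 d(2,1)] by (simp add: mult.commute)
  have commN: "N o\<^sub>L T t = T t o\<^sub>L N" if "t \<ge> 0" for t
    unfolding N'[symmetric] T_Psi(1)[OF that w d(1)] T_Psi(2)[OF that w d(1)] ..
  note vd = T_derivative[OF w d, folded G_def, unfolded N']
  have ap: "blinfun_apply (S o\<^sub>L S') x = blinfun_apply S (blinfun_apply S' x)" for S S' :: "'a \<Rightarrow>\<^sub>L 'a" and x by simp
  \<comment> \<open>Moving N to the left of T and G makes the statement available for every x, and
    puts the regularisation where injectivity can cancel it.\<close>
  have orbit: "((\<lambda>t. blinfun_apply (N o\<^sub>L N) (blinfun_apply (T t) x)) has_vector_derivative
      - blinfun_apply N (blinfun_apply (T s) (blinfun_apply G x))) (at s within {0..})" if s: "s \<ge> 0" for s x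
  proof -
    have 1: "blinfun_apply (T t o\<^sub>L (N o\<^sub>L N)) x = blinfun_apply (N o\<^sub>L N) (blinfun_apply (T t) x)" if "t \<ge> 0" for t
    proof -
      have "T t o\<^sub>L (N o\<^sub>L N) = (N o\<^sub>L N) o\<^sub>L T t" using commN[OF that] by (metis blinfun_compose_assoc)
      then show ?thesis by (simp only: ap)
    qed
    have 2: "T s o\<^sub>L (G o\<^sub>L N) = N o\<^sub>L (T s o\<^sub>L G)" using commN[OF s] comm by (metis blinfun_compose_assoc)
    have "((\<lambda>t. blinfun_apply (T t o\<^sub>L (N o\<^sub>L N)) x) has_vector_derivative blinfun_apply (- (T s o\<^sub>L (G o\<^sub>L N))) x) (at s within {0..})"
      by (rule bounded_linear.has_vector_derivative[OF blinfun.bounded_linear_left vd[OF s]])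
    then have "((\<lambda>t. blinfun_apply (T t o\<^sub>L (N o\<^sub>L N)) x) has_vector_derivative - blinfun_apply N (blinfun_apply (T s) (blinfun_apply G x))) (at s within {0..})"
      unfolding 2 by (simp add: blinfun.minus_left)
    then show ?thesis
      by (rule has_vector_derivative_transform[rotated 2]) (use 1 s in auto)
  qed
  have T0: "T 0 = id_blinfun" by (simp add: T_def)
  have aff: "(x, y) \<in> affine_op 0 (- 1) H \<longleftrightarrow> (x, - y) \<in> H" for x y and H :: "'a rel"
  proof -
    have "0 *\<^sub>C x + (- 1) *\<^sub>C v = - v" for x v :: 'a using scaleC_of_real[of 0 x] by (simp add: scaleC.minus_left)
    then show ?thesis unfolding affine_op_def by (auto intro: exI[of _ "- y"])
  qed
  have "(x, y) \<in> generator T \<longleftrightarrow> blinfun_apply G x = blinfun_apply N (- y)" for x y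
  proof
    assume "(x, y) \<in> generator T"
    then have lim: "((\<lambda>h. (1 / h) *\<^sub>R (blinfun_apply (T h) x - x)) \<longlongrightarrow> y) (at_right 0)" by (simp add: generator_def)
    have "((\<lambda>h. blinfun_apply (N o\<^sub>L N) ((1 / h) *\<^sub>R (blinfun_apply (T h) x - x))) \<longlongrightarrow> blinfun_apply (N o\<^sub>L N) y) (at_right 0)"
      by (intro tendsto_intros lim)
    moreover have "((\<lambda>h. blinfun_apply (N o\<^sub>L N) ((1 / h) *\<^sub>R (blinfun_apply (T h) x - x))) \<longlongrightarrow> - blinfun_apply N (blinfun_apply G x)) (at_right 0)"
    proof -
      have "((\<lambda>t. blinfun_apply (N o\<^sub>L N) (blinfun_apply (T t) x)) has_vector_derivative - blinfun_apply N (blinfun_apply G x)) (at 0 within {0<..})"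
        using has_vector_derivative_within_subset[OF orbit[OF order_refl], of "{0<..}" x] by (simp add: T0 greaterThan_subset_atLeast)
      from has_vector_derivative_right_quotient[OF this] show ?thesis
        by (simp add: T0 blinfun.scaleR_right blinfun.diff_right)
    qed
    ultimately have "blinfun_apply (N o\<^sub>L N) y = - blinfun_apply N (blinfun_apply G x)"
      by (rule tendsto_unique[rotated]) simp
    then have "blinfun_apply N (blinfun_apply N y + blinfun_apply G x) = 0" by (simp add: blinfun.add_right)
    then have "blinfun_apply N y + blinfun_apply G x = 0" by (rule inj)
    then show "blinfun_apply G x = blinfun_apply N (- y)" by (simp add: blinfun.minus_right add_eq_0_iff)
  next
    assume Gx: "blinfun_apply G x = blinfun_apply N (- y)"
    define I where "I t = integral {0..t} (\<lambda>s. blinfun_apply (T s) y)" for t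
    have cont: "continuous_on {0..t} (\<lambda>s. blinfun_apply (T s) y)" for t
      by (rule continuous_on_subset[OF T_strongly_continuous]) auto
    have eq: "blinfun_apply (T t) x - x = I t" if t: "t \<ge> 0" for t
    proof -
      have "((\<lambda>s. blinfun_apply (N o\<^sub>L N) (blinfun_apply (T s) y)) has_integral
          blinfun_apply (N o\<^sub>L N) (blinfun_apply (T t) x) - blinfun_apply (N o\<^sub>L N) (blinfun_apply (T 0) x)) {0..t}"
      proof (rule fundamental_theorem_of_calculus[OF t])
        fix s assume s: "s \<in> {0..t}"
        then have s0: "s \<ge> 0" by simp
        have "- blinfun_apply N (blinfun_apply (T s) (blinfun_apply G x)) = blinfun_apply (N o\<^sub>L N) (blinfun_apply (T s) y)"
          unfolding Gx using arg_cong[OF commN[OF s0], of "\<lambda>S. blinfun_apply S y"] by (simp add: blinfun.minus_right)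
        then show "((\<lambda>s. blinfun_apply (N o\<^sub>L N) (blinfun_apply (T s) x)) has_vector_derivative blinfun_apply (N o\<^sub>L N) (blinfun_apply (T s) y)) (at s within {0..t})"
          using has_vector_derivative_within_subset[OF orbit[OF s0, of x], of "{0..t}"] by auto
      qed
      moreover have "((\<lambda>s. blinfun_apply (N o\<^sub>L N) (blinfun_apply (T s) y)) has_integral blinfun_apply (N o\<^sub>L N) (I t)) {0..t}"
        unfolding I_def
        using has_integral_linear[OF integrable_integral[OF integrable_continuous_real[OF cont[of t]]] blinfun.bounded_linear_right[of "N o\<^sub>L N"]]
        by (simp add: o_def)
      ultimately have "blinfun_apply (N o\<^sub>L N) (blinfun_apply (T t) x) - blinfun_apply (N o\<^sub>L N) (blinfun_apply (T 0) x) = blinfun_apply (N o\<^sub>L N) (I t)"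
        by (rule has_integral_unique)
      then have "blinfun_apply N (blinfun_apply N (blinfun_apply (T t) x - x - I t)) = 0"
        by (simp add: blinfun.diff_right T0)
      then have "blinfun_apply (T t) x - x - I t = 0" using inj by blast
      then show ?thesis by simp
    qed
    have "(I has_vector_derivative blinfun_apply (T 0) y) (at 0 within {0..1})"
      unfolding I_def by (rule integral_has_vector_derivative[OF cont]) simp
    then have "((\<lambda>h. (1 / h) *\<^sub>R (I h - I 0)) \<longlongrightarrow> y) (at_right 0)"
      unfolding at_within_Icc_at_right[OF zero_less_one] T0 using has_vector_derivative_right_quotient[of I y] by simp
    then have "((\<lambda>h. (1 / h) *\<^sub>R (blinfun_apply (T h) x - x)) \<longlongrightarrow> y) (at_right 0)"
    proof (rule Lim_transform_eventually)
      show "\<forall>\<^sub>F h in at_right 0. (1 / h) *\<^sub>R (I h - I 0) = (1 / h) *\<^sub>R (blinfun_apply (T h) x - x)"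
        using eq by (intro eventually_at_rightI[of 0 1]) (auto simp: I_def[of 0])
    qed
    then show "(x, y) \<in> generator T" by (simp add: generator_def)
  qed
  then show ?thesis unfolding set_eq_iff split_paired_All aff graph' by simp
qed

theorem generates_semigroup:
  "generates_sectorially_bounded_holomorphic_semigroup (pi / 2 - a * \<omega>) (affine_op 0 (- 1) (hol_calculus \<omega> \<theta> f A))"
  unfolding generates_sectorially_bounded_holomorphic_semigroup_def sectorially_bounded_holomorphic_semigroup_def C0_semigroup_def
proof (intro exI[of _ T] exI[of _ U] conjI allI impI ballI)
  obtain w where w: "\<omega> < w" "w < \<theta>" using dense[OF \<theta>(1)] by blast
  show "T t \<in> bounded_ops" if "0 \<le> t" for t by (rule T_tau(1)[OF that w])
  show "generator T = affine_op 0 (- 1) (hol_calculus \<omega> \<theta> f A)" by (rule generator_T)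
  show "0 < pi / 2 - a * \<omega>" "pi / 2 - a * \<omega> \<le> pi / 2" by (rule semigroup_angle)+
  show "T (s + t) = T s o\<^sub>L T t" if "0 \<le> s" "0 \<le> t" for s t by (rule T_add[OF that])
  show "continuous_on {0..} (\<lambda>t. blinfun_apply (T t) x)" for x by (rule T_strongly_continuous)
  show "T 0 = id_blinfun" by (simp add: T_def)
  show "U (of_real t) = T t" if "0 < t" for t using that by (simp add: T_def)
  show "norm_holomorphic_on U (sector (pi / 2 - a * \<omega>))"
    unfolding norm_holomorphic_on_def using U_has_derivative by blast
next
  fix z assume "z \<in> sector (pi / 2 - a * \<omega>)"
  then have z: "z \<noteq> 0" "\<bar>Arg z\<bar> < pi / 2 - a * \<omega>" using semigroup_angle by (auto simp: sector_def)
  obtain w where w: "\<omega> < w" "a * w + \<bar>Arg z\<bar> < pi / 2" by (rule intermediate_angle[OF z(2)])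
  show "U z \<in> bounded_ops" by (rule U_bounded[OF w(1) abs_ge_zero w(2)]) (use z in blast)
next
  fix \<psi> assume \<psi>: "0 < \<psi> \<and> \<psi> < pi / 2 - a * \<omega>"
  then obtain w where w: "\<omega> < w" "a * w + \<psi> < pi / 2" using intermediate_angle by blast
  obtain K where K: "\<And>\<zeta>. \<zeta> \<noteq> 0 \<Longrightarrow> \<bar>Arg \<zeta>\<bar> \<le> \<psi> \<Longrightarrow>
    U \<zeta> \<in> bounded_ops \<and> U \<zeta> o\<^sub>L tauA = Psi w (\<lambda>z. exp (- (\<zeta> * f z)) * tau z) \<and> norm (U \<zeta>) \<le> K"
    by (rule U_bounded[OF w(1) _ w(2)]) (use \<psi> in auto)
  show "bdd_above ((\<lambda>z. norm (U z)) ` sector \<psi>)"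
    by (rule bdd_aboveI2[of _ _ K]) (use K \<psi> in \<open>auto simp: sector_def\<close>)
qed

end

section \<open>Bernstein functions\<close>

lemma levy_space: "levy_measure \<mu> \<Longrightarrow> space \<mu> = {0<..}"
  unfolding levy_measure_def using sets_eq_imp_space_eq[of \<mu> "restrict_space borel {0<..}"] by (simp add: space_restrict_space)

lemma levy_measurable:
  assumes "levy_measure \<mu>" "h \<in> borel_measurable borel"
  shows "h \<in> borel_measurable \<mu>"
proof -
  have eq: "sets \<mu> = sets (restrict_space borel {0<..})" using assms by (simp add: levy_measure_def)
  from measurable_restrict_space1[OF assms(2)] show ?thesis unfolding measurable_cong_sets[OF eq refl] .
qed

lemma levy_integrable:
  fixes h :: "real \<Rightarrow> 'b::{banach, second_countable_topology}"
  assumes "levy_measure \<mu>" "h \<in> borel_measurable borel" "\<And>s. s > 0 \<Longrightarrow> norm (h s) \<le> C * (s / (1 + s))"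
  shows "integrable \<mu> h"
proof -
  have "integrable \<mu> (\<lambda>s. s / (1 + s))"
  proof (rule integrableI_nonneg)
    show "(\<lambda>s. s / (1 + s)) \<in> borel_measurable \<mu>" by (rule levy_measurable[OF assms(1)]) measurable
    show "AE s in \<mu>. 0 \<le> s / (1 + s)" by (rule AE_I2) (simp add: levy_space[OF assms(1)])
    show "(\<integral>\<^sup>+ s. ennreal (s / (1 + s)) \<partial>\<mu>) < \<infinity>" using assms by (simp add: levy_measure_def)
  qed
  then have "integrable \<mu> (\<lambda>s. C * (s / (1 + s)))" by (rule integrable_mult_right)
  then show ?thesis
  proof (rule Bochner_Integration.integrable_bound)
    show "h \<in> borel_measurable \<mu>" by (rule levy_measurable[OF assms(1,2)])
    show "AE s in \<mu>. norm (h s) \<le> norm (C * (s / (1 + s)))"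
    proof (rule AE_I2)
      fix s assume "s \<in> space \<mu>"
      then have "norm (h s) \<le> C * (s / (1 + s))" using levy_space[OF assms(1)] assms(3) by auto
      then show "norm (h s) \<le> norm (C * (s / (1 + s)))" unfolding real_norm_def by linarith
    qed
  qed
qed

lemma norm_le_levy_weight:
  assumes "s > (0::real)" "x * (1 + s) \<le> C * s"
  shows "x \<le> C * (s / (1 + s))"
  using assms by (simp add: pos_le_divide_eq)

text \<open>The bound |z| s, useful for small s, and the bound 2, useful for large s, combine to a
  multiple of s/(1 + s), the weight that the measure integrates.\<close>

lemma levy_exp_integrable:
  assumes "levy_measure \<mu>" "Re z > 0"
  shows "integrable \<mu> (\<lambda>s. 1 - exp (- (z * of_real s)))"
proof (rule levy_integrable[OF assms(1)])
  show "(\<lambda>s. 1 - exp (- (z * complex_of_real s))) \<in> borel_measurable borel"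
    by (intro borel_measurable_continuous_onI continuous_intros)
  fix s :: real assume s: "s > 0"
  have z: "0 \<le> Re (z * of_real s)" using assms s by simp
  have "cmod (1 - exp (- (z * of_real s))) \<le> cmod z * s"
    using exp_minus_Taylor(1)[of 0 "z * of_real s"] z s by (simp add: norm_mult)
  moreover have "cmod (1 - exp (- (z * of_real s))) * s \<le> 2 * s"
  proof (rule mult_right_mono)
    have "cmod (exp (- (z * of_real s))) \<le> 1" using z by simp
    then show "cmod (1 - exp (- (z * of_real s))) \<le> 2"
      using norm_triangle_ineq4[of 1 "exp (- (z * of_real s))"] unfolding norm_one by linarith
  qed (use s in simp)
  ultimately have "cmod (1 - exp (- (z * of_real s))) * (1 + s) \<le> (cmod z + 2) * s" by (simp add: algebra_simps)
  with s show "cmod (1 - exp (- (z * of_real s))) \<le> (cmod z + 2) * (s / (1 + s))" by (rule norm_le_levy_weight)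
qed

text \<open>The remainder of the integrand is at most s^2 exp(- m s) |y - z|^2, and s^2 exp(- m s)
  is at most a multiple of the weight s/(1 + s). So the integral too has a quadratic
  remainder.\<close>

lemma levy_exp_has_derivative:
  assumes \<mu>: "levy_measure \<mu>" and z: "Re z > 0"
  shows "((\<lambda>z. \<integral>s. 1 - exp (- (z * of_real s)) \<partial>\<mu>) has_field_derivative (\<integral>s. of_real s * exp (- (z * of_real s)) \<partial>\<mu>)) (at z)"
  unfolding has_field_derivative_def
proof (rule quadratic_remainder_has_derivative[OF bounded_linear_mult_right])
  \<comment> \<open>Within distance m of z the real parts stay at least m, so exp(- m s) can be
    split off while the exponents left over keep nonnegative real part.\<close>
  define m where "m = Re z / 2"
  show m: "m > 0" unfolding m_def using z by simp
  have iD: "integrable \<mu> (\<lambda>s. of_real s * exp (- (z * of_real s)))"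
  proof (rule levy_integrable[OF \<mu>])
    show "(\<lambda>s. complex_of_real s * exp (- (z * complex_of_real s))) \<in> borel_measurable borel"
      by (intro borel_measurable_continuous_onI continuous_intros)
    fix s :: real assume s: "s > 0"
    define E where "E = exp (- (Re z * s))"
    have "s * E \<le> 2 / Re z * exp (- (Re z / 2 * s))" unfolding E_def by (rule mult_exp_minus_le(1)[OF z]) (use s in simp)
    also have "\<dots> \<le> 2 / Re z * 1" using z s by (intro mult_left_mono) auto
    finally have "s * E * s \<le> 2 / Re z * s" using s by (intro mult_right_mono) auto
    moreover have "s * E \<le> 1 * s" using s z unfolding E_def by simp
    ultimately have "s * E * (1 + s) \<le> (1 + 2 / Re z) * s" by (simp add: algebra_simps)
    then have "cmod (of_real s * exp (- (z * of_real s))) * (1 + s) \<le> (1 + 2 / Re z) * s"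
      using s by (simp add: norm_mult E_def)
    with s show "cmod (of_real s * exp (- (z * of_real s))) \<le> (1 + 2 / Re z) * (s / (1 + s))" by (rule norm_le_levy_weight)
  qed
  define C where "C = 2 / m + 8 / m\<^sup>2"
  have iC: "integrable \<mu> (\<lambda>s. C * (s / (1 + s)))"
    by (rule levy_integrable[OF \<mu>, where C = C]) (use m in \<open>auto simp: C_def\<close>)
  fix y assume "cmod (y - z) < m"
  then have ym: "Re y \<ge> m" using abs_Re_le_cmod[of "y - z"] unfolding m_def by auto
  have iy: "integrable \<mu> (\<lambda>s. 1 - exp (- (y * of_real s)))" by (rule levy_exp_integrable[OF \<mu>]) (use ym m in linarith)
  have iz: "integrable \<mu> (\<lambda>s. 1 - exp (- (z * of_real s)))" by (rule levy_exp_integrable[OF \<mu> z])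
  have le: "cmod ((1 - exp (- (y * of_real s))) - (1 - exp (- (z * of_real s))) - (y - z) * (of_real s * exp (- (z * of_real s))))
      \<le> (C * (s / (1 + s))) * (cmod (y - z))\<^sup>2" if s: "s > 0" for s :: real
  proof -
    let ?m = "complex_of_real (m * s)"
    define E where "E = exp (- (m * s))"
    have E: "E \<ge> 0" unfolding E_def by simp
    define p q where "p = y * of_real s - ?m" and "q = z * of_real s - ?m"
    have pq: "Re p \<ge> 0" "Re q \<ge> 0"
      unfolding p_def q_def using ym s z by (auto simp: m_def left_diff_distrib[symmetric])
    have "s * E \<le> 2 / m * exp (- (m / 2 * s))" unfolding E_def by (rule mult_exp_minus_le(1)[OF m]) (use s in simp)
    also have "\<dots> \<le> 2 / m * 1" using m s by (intro mult_left_mono) auto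
    finally have 1: "s * E \<le> 2 / m" by simp
    have "s\<^sup>2 * E \<le> 8 / m\<^sup>2 * exp (- (m / 2 * s))" unfolding E_def by (rule mult_exp_minus_le(2)[OF m]) (use s in simp)
    also have "\<dots> \<le> 8 / m\<^sup>2 * 1" using m s by (intro mult_left_mono) auto
    finally have "s\<^sup>2 * E \<le> 8 / m\<^sup>2" by simp
    with 1 have "(s * E + s\<^sup>2 * E) * s \<le> C * s" unfolding C_def using s by (intro mult_right_mono) auto
    then have "s\<^sup>2 * E * (1 + s) \<le> C * s" by (simp add: algebra_simps power2_eq_square)
    with s have w: "s\<^sup>2 * E \<le> C * (s / (1 + s))" by (rule norm_le_levy_weight)
    have ex: "exp (- (y * of_real s)) = exp (- ?m) * exp (- p)" "exp (- (z * of_real s)) = exp (- ?m) * exp (- q)"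
      unfolding p_def q_def by (simp_all add: exp_add[symmetric])
    have d: "p - q = (y - z) * of_real s" unfolding p_def q_def by (simp add: algebra_simps)
    have "cmod ((1 - exp (- (y * of_real s))) - (1 - exp (- (z * of_real s))) - (y - z) * (of_real s * exp (- (z * of_real s))))
      = cmod (exp (- ?m) * (exp (- p) - exp (- q) + (p - q) * exp (- q)))"
      unfolding ex d by (subst norm_minus_commute) (simp add: algebra_simps)
    also have "\<dots> = E * cmod (exp (- p) - exp (- q) + (p - q) * exp (- q))" by (simp add: norm_mult E_def)
    also have "\<dots> \<le> E * (cmod (p - q))\<^sup>2" by (intro mult_left_mono exp_minus_Taylor(2) pq E)
    also have "\<dots> = (s\<^sup>2 * E) * (cmod (y - z))\<^sup>2" unfolding d by (simp add: norm_mult power_mult_distrib)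
    also have "\<dots> \<le> (C * (s / (1 + s))) * (cmod (y - z))\<^sup>2" by (intro mult_right_mono w) simp
    finally show ?thesis .
  qed
  have "(\<integral>s. 1 - exp (- (y * of_real s)) \<partial>\<mu>) - (\<integral>s. 1 - exp (- (z * of_real s)) \<partial>\<mu>) - (\<integral>s. of_real s * exp (- (z * of_real s)) \<partial>\<mu>) * (y - z)
     = (\<integral>s. (1 - exp (- (y * of_real s))) - (1 - exp (- (z * of_real s))) - (y - z) * (of_real s * exp (- (z * of_real s))) \<partial>\<mu>)"
    using Bochner_Integration.integral_diff[OF Bochner_Integration.integrable_diff[OF iy iz] integrable_mult_right[OF iD, of "y - z"]]
      Bochner_Integration.integral_diff[OF iy iz] Bochner_Integration.integral_mult_right_zero[of \<mu> "y - z" "\<lambda>s. of_real s * exp (- (z * of_real s))"] by (simp add: mult.commute)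
  also have "cmod \<dots> \<le> (\<integral>s. (C * (s / (1 + s))) * (cmod (y - z))\<^sup>2 \<partial>\<mu>)"
  proof (rule Bochner_Integration.integral_norm_bound_integral)
    show "integrable \<mu> (\<lambda>s. (1 - exp (- (y * of_real s))) - (1 - exp (- (z * of_real s))) - (y - z) * (of_real s * exp (- (z * of_real s))))"
      by (intro Bochner_Integration.integrable_diff iy iz integrable_mult_right iD)
    show "integrable \<mu> (\<lambda>s. (C * (s / (1 + s))) * (cmod (y - z))\<^sup>2)" by (intro integrable_mult_left iC)
  qed (use le levy_space[OF \<mu>] in auto)
  also have "\<dots> = (\<integral>s. C * (s / (1 + s)) \<partial>\<mu>) * (cmod (y - z))\<^sup>2" by (rule Bochner_Integration.integral_mult_left_zero)
  finally show "cmod ((\<integral>s. 1 - exp (- (y * of_real s)) \<partial>\<mu>) - (\<integral>s. 1 - exp (- (z * of_real s)) \<partial>\<mu>) - (\<integral>s. of_real s * exp (- (z * of_real s)) \<partial>\<mu>) * (y - z))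
      \<le> (\<integral>s. C * (s / (1 + s)) \<partial>\<mu>) * (cmod (y - z))\<^sup>2" .
qed

text \<open>Since |sin (y s)| \<le> |y| s and x s \<le> exp (x s) - cos (y s), multiplying by exp (-
  x s) suffices. Integrated against the Levy measure this becomes Re z |Im F(z)| \<le> |Im z| Re
  F(z), that is, |arg F(z)| \<le> |arg z|.\<close>

lemma exp_sin_le:
  fixes s x y :: real
  assumes "s > 0" "x > 0"
  shows "x * \<bar>exp (- (x * s)) * sin (y * s)\<bar> \<le> \<bar>y\<bar> * (1 - exp (- (x * s)) * cos (y * s))"
proof -
  have "x * \<bar>sin (y * s)\<bar> \<le> x * \<bar>y * s\<bar>" using assms by (intro mult_left_mono abs_sin_x_le_abs_x) auto
  also have "\<dots> = \<bar>y\<bar> * (x * s)" using assms by (simp add: abs_mult)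
  also have "\<dots> \<le> \<bar>y\<bar> * (exp (x * s) - cos (y * s))"
    using exp_ge_add_one_self[of "x * s"] cos_le_one[of "y * s"] by (intro mult_left_mono) linarith+
  finally have "exp (- (x * s)) * (x * \<bar>sin (y * s)\<bar>) \<le> exp (- (x * s)) * (\<bar>y\<bar> * (exp (x * s) - cos (y * s)))"
    by (intro mult_left_mono) auto
  also have "\<dots> = \<bar>y\<bar> * (exp (- (x * s)) * exp (x * s) - exp (- (x * s)) * cos (y * s))" by (simp add: algebra_simps)
  also have "exp (- (x * s)) * exp (x * s) = 1" by (simp add: exp_minus)
  finally show ?thesis by (simp add: abs_mult mult_ac)
qed

text \<open>Monotonicity and concavity come from the real function in the definition, the complex
  estimates from the integral formula; the two are linked by their agreement on the positive
  axis.\<close>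

lemma bernstein_functionE:
  assumes "bernstein_function F"
  obtains g g' where
    "\<And>x. x > 0 \<Longrightarrow> g x > 0" "\<And>x. x > 0 \<Longrightarrow> (g has_real_derivative g' x) (at x)"
    "\<And>x. x > 0 \<Longrightarrow> g' x \<ge> 0" "\<And>x y. 0 < x \<Longrightarrow> x \<le> y \<Longrightarrow> g' y \<le> g' x"
    "\<And>x. x > 0 \<Longrightarrow> F (of_real x) = of_real (g x)"
    "F holomorphic_on {z. Re z > 0}" "\<And>z. Re z > 0 \<Longrightarrow> cmod (deriv F z) \<le> g' (Re z)"
    "\<And>z. Re z > 0 \<Longrightarrow> g (Re z) \<le> Re (F z)" "\<And>z. Re z > 0 \<Longrightarrow> Re z * \<bar>Im (F z)\<bar> \<le> \<bar>Im z\<bar> * Re (F z)"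
proof -
  obtain g where g: "real_bernstein g" and Fg: "\<And>x. x > 0 \<Longrightarrow> F (of_real x) = of_real (g x)"
    using assms unfolding bernstein_function_def by blast
  obtain c b \<mu> where cb: "c \<ge> 0" "b \<ge> 0" and \<mu>: "levy_measure \<mu>"
    and F: "\<And>z. Re z > 0 \<Longrightarrow> F z = of_real c + of_real b * z + (\<integral>s. 1 - exp (- (z * of_real s)) \<partial>\<mu>)"
    using assms unfolding bernstein_function_def by blast
  define I where "I z = (\<integral>s. 1 - exp (- (z * of_real s)) \<partial>\<mu>)" for z :: complex
  note int = levy_exp_integrable[OF \<mu>]
  have F': "F z = of_real c + of_real b * z + I z" if "Re z > 0" for z unfolding I_def by (rule F[OF that])
  have diff: "(deriv ^^ k) g differentiable (at t)" if "t > 0" for k t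
    using g that unfolding real_bernstein_def by blast
  have sgn: "(- 1) ^ (k - 1) * (deriv ^^ k) g t \<ge> 0" if "k \<ge> 1" "t > 0" for k t
    using g that unfolding real_bernstein_def by blast
  have gpos: "g x > 0" if "x > 0" for x using g that unfolding real_bernstein_def by blast
  have g1: "(g has_real_derivative deriv g x) (at x)" if "x > 0" for x
    using diff[OF that, of 0] by (simp add: DERIV_deriv_iff_real_differentiable)
  have g2: "(deriv g has_real_derivative deriv (deriv g) x) (at x)" if "x > 0" for x
    using diff[OF that, of 1] by (simp add: DERIV_deriv_iff_real_differentiable)
  have op: "open {z. Re z > 0}" by (rule open_halfspace_Re_gt)
  have hol: "F holomorphic_on {z. Re z > 0}"
  proof -
    have "I holomorphic_on {z. Re z > 0}"
      unfolding I_def holomorphic_on_open[OF op] using levy_exp_has_derivative[OF \<mu>] by blast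
    then have "(\<lambda>z. of_real c + of_real b * z + I z) holomorphic_on {z. Re z > 0}" by (intro holomorphic_intros)
    then show ?thesis by (rule holomorphic_transform) (simp add: F')
  qed
  have ReI: "Re (I z) = (\<integral>s. 1 - exp (- (Re z * s)) * cos (Im z * s) \<partial>\<mu>)" 
    and ImI: "Im (I z) = (\<integral>s. exp (- (Re z * s)) * sin (Im z * s) \<partial>\<mu>)" 
    and iRe: "integrable \<mu> (\<lambda>s. 1 - exp (- (Re z * s)) * cos (Im z * s))"
    and iIm: "integrable \<mu> (\<lambda>s. exp (- (Re z * s)) * sin (Im z * s))" if "Re z > 0" for z
    using integral_Re[OF int[OF that]] integral_Im[OF int[OF that]] integrable_Re[OF int[OF that]] integrable_Im[OF int[OF that]]
    unfolding I_def by (simp_all add: Re_exp Im_exp)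
  have Re_ge: "g (Re z) \<le> Re (F z)" if z: "Re z > 0" for z
  proof -
    let ?x = "complex_of_real (Re z)"
    have x: "Re ?x > 0" using z by simp
    have "Re (I ?x) \<le> Re (I z)"
      unfolding ReI[OF z] ReI[OF x]
    proof (rule integral_mono)
      show "integrable \<mu> (\<lambda>s. 1 - exp (- (Re ?x * s)) * cos (Im ?x * s))" by (rule iRe[OF x])
      show "integrable \<mu> (\<lambda>s. 1 - exp (- (Re z * s)) * cos (Im z * s))" by (rule iRe[OF z])
      show "1 - exp (- (Re ?x * s)) * cos (Im ?x * s) \<le> 1 - exp (- (Re z * s)) * cos (Im z * s)" for s
        using mult_left_mono[OF cos_le_one, of "exp (- (Re z * s))" "Im z * s"] by simp
    qed
    then have "Re (F ?x) \<le> Re (F z)" unfolding F'[OF z] F'[OF x] by simp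
    then show ?thesis using Fg[OF z] by simp
  qed
  have Im_le: "Re z * \<bar>Im (F z)\<bar> \<le> \<bar>Im z\<bar> * Re (F z)" if z: "Re z > 0" for z
  proof -
    have "Re z * \<bar>Im (I z)\<bar> \<le> Re z * (\<integral>s. \<bar>exp (- (Re z * s)) * sin (Im z * s)\<bar> \<partial>\<mu>)"
      unfolding ImI[OF z] using integral_norm_bound[of \<mu> "\<lambda>s. exp (- (Re z * s)) * sin (Im z * s)"] z
      by (intro mult_left_mono) (simp_all del: integral_norm_bound)
    also have "\<dots> = (\<integral>s. Re z * \<bar>exp (- (Re z * s)) * sin (Im z * s)\<bar> \<partial>\<mu>)" by simp
    also have "\<dots> \<le> (\<integral>s. \<bar>Im z\<bar> * (1 - exp (- (Re z * s)) * cos (Im z * s)) \<partial>\<mu>)"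
    proof (rule integral_mono)
      show "integrable \<mu> (\<lambda>s. Re z * \<bar>exp (- (Re z * s)) * sin (Im z * s)\<bar>)"
        by (intro integrable_mult_right integrable_abs iIm[OF z])
      show "integrable \<mu> (\<lambda>s. \<bar>Im z\<bar> * (1 - exp (- (Re z * s)) * cos (Im z * s)))"
        by (intro integrable_mult_right iRe[OF z])
      fix s assume "s \<in> space \<mu>"
      then show "Re z * \<bar>exp (- (Re z * s)) * sin (Im z * s)\<bar> \<le> \<bar>Im z\<bar> * (1 - exp (- (Re z * s)) * cos (Im z * s))"
        using exp_sin_le[OF _ z] levy_space[OF \<mu>] by simp
    qed
    also have "\<dots> = \<bar>Im z\<bar> * Re (I z)" unfolding ReI[OF z] by simp
    finally have 1: "Re z * \<bar>Im (I z)\<bar> \<le> \<bar>Im z\<bar> * Re (I z)" .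
    have "Re z * \<bar>Im (F z)\<bar> \<le> Re z * (b * \<bar>Im z\<bar> + \<bar>Im (I z)\<bar>)"
      unfolding F'[OF z] using z cb abs_triangle_ineq[of "b * Im z" "Im (I z)"] by (intro mult_left_mono) (auto simp: abs_mult)
    also have "\<dots> \<le> \<bar>Im z\<bar> * (b * Re z) + \<bar>Im z\<bar> * Re (I z)" using 1 by (simp add: algebra_simps)
    also have "\<dots> \<le> \<bar>Im z\<bar> * (c + b * Re z + Re (I z))" using cb by (simp add: algebra_simps)
    finally show ?thesis unfolding F'[OF z] by simp
  qed
  have deriv_le: "cmod (deriv F z) \<le> deriv g (Re z)" if z: "Re z > 0" for z
  proof -
    define x where "x = Re z"
    have x: "x > 0" unfolding x_def using z .
    \<comment> \<open>In the real direction the kernel exp(- z s) (1 - exp(- h s)) has the kernel at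
      x = Re z as its modulus, so increments of F are dominated by those of g. Letting h tend to 0
      bounds the derivative by g'(x) without an integral formula for g'.\<close>
    have le: "cmod ((F (z + of_real h) - F z) / of_real h) \<le> (g (x + h) - g x) / h" if h: "h > 0" for h :: real
    proof -
      have zh: "Re (z + of_real h) > 0" "Re (of_real (x + h)) > 0" "Re (complex_of_real x) > 0" using z h x by auto
      have d1: "I (z + of_real h) - I z = (\<integral>s. exp (- (z * of_real s)) * (1 - exp (- of_real (h * s))) \<partial>\<mu>)"
        unfolding I_def Bochner_Integration.integral_diff[OF int[OF zh(1)] int[OF z], symmetric]
        by (rule Bochner_Integration.integral_cong) (auto simp: algebra_simps exp_add[symmetric])
      have i1: "integrable \<mu> (\<lambda>s. exp (- (z * of_real s)) * (1 - exp (- of_real (h * s))))"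
        using Bochner_Integration.integrable_diff[OF int[OF zh(1)] int[OF z]]
        by (simp add: algebra_simps exp_add[symmetric])
      have d2: "I (of_real (x + h)) - I (of_real x) = of_real (\<integral>s. exp (- (x * s)) * (1 - exp (- (h * s))) \<partial>\<mu>)"
        unfolding I_def Bochner_Integration.integral_diff[OF int[OF zh(2)] int[OF zh(3)], symmetric] integral_complex_of_real[symmetric]
        by (rule Bochner_Integration.integral_cong) (auto simp: algebra_simps exp_add[symmetric] exp_of_real[symmetric])
      have i2: "integrable \<mu> (\<lambda>s. exp (- (x * s)) * (1 - exp (- (h * s))))"
        using Bochner_Integration.integrable_diff[OF iRe[OF zh(2)] iRe[OF zh(3)]]
        by (simp add: algebra_simps exp_add[symmetric])
      have "cmod (I (z + of_real h) - I z) \<le> (\<integral>s. exp (- (x * s)) * (1 - exp (- (h * s))) \<partial>\<mu>)"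
        unfolding d1
      proof (rule Bochner_Integration.integral_norm_bound_integral[OF i1 i2])
        fix s assume "s \<in> space \<mu>"
        then have s: "s > 0" using levy_space[OF \<mu>] by simp
        have "1 - exp (- complex_of_real (h * s)) = of_real (1 - exp (- (h * s)))" by (simp add: exp_of_real[symmetric])
        then have "cmod (1 - exp (- complex_of_real (h * s))) = 1 - exp (- (h * s))" using s h by (simp only: norm_of_real) simp
        then show "cmod (exp (- (z * of_real s)) * (1 - exp (- of_real (h * s)))) \<le> exp (- (x * s)) * (1 - exp (- (h * s)))"
          by (simp add: norm_mult x_def)
      qed
      then have "cmod (F (z + of_real h) - F z) \<le> b * h + (\<integral>s. exp (- (x * s)) * (1 - exp (- (h * s))) \<partial>\<mu>)"
        using norm_triangle_ineq[of "of_real b * of_real h" "I (z + of_real h) - I z"] cb h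
        unfolding F'[OF zh(1)] F'[OF z] by (simp add: algebra_simps norm_mult)
      also have "\<dots> = g (x + h) - g x"
      proof -
        have "complex_of_real (g (x + h) - g x) = F (of_real (x + h)) - F (of_real x)" using Fg[of x] Fg[of "x + h"] x h by simp
        also have "\<dots> = of_real (b * h + (\<integral>s. exp (- (x * s)) * (1 - exp (- (h * s))) \<partial>\<mu>))"
          unfolding F'[OF zh(2)] F'[OF zh(3)] using d2 by (simp add: algebra_simps)
        finally show ?thesis by (simp only: of_real_eq_iff)
      qed
      finally show ?thesis using h by (simp add: norm_divide divide_right_mono)
    qed
    have "(F has_field_derivative deriv F z) (at z)" by (rule holomorphic_derivI[OF hol op]) (use z in simp)
    then have "((\<lambda>h. (F (z + h) - F z) / h) \<longlongrightarrow> deriv F z) (at 0)" by (simp add: DERIV_def)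
    moreover have "filterlim complex_of_real (at 0) (at_right 0)"
      unfolding filterlim_at by (auto intro!: eventually_at_rightI[of 0 1] tendsto_eq_intros)
    ultimately have "((\<lambda>h. (F (z + of_real h) - F z) / of_real h) \<longlongrightarrow> deriv F z) (at_right 0)"
      by (rule filterlim_compose)
    then have L: "((\<lambda>h. cmod ((F (z + of_real h) - F z) / of_real h)) \<longlongrightarrow> cmod (deriv F z)) (at_right 0)" by (rule tendsto_norm)
    have "((\<lambda>h. (g (x + h) - g x) / h) \<longlongrightarrow> deriv g x) (at_right 0)"
      using g1[OF x] unfolding DERIV_def by (rule filterlim_mono[OF _ order_refl at_le]) simp
    then show ?thesis unfolding x_def[symmetric]
      by (rule tendsto_le[OF trivial_limit_at_right_real _ L]) (intro eventually_at_rightI[of 0 1] le, auto)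
  qed
  show ?thesis
  proof (rule that[of g "deriv g", OF gpos g1 _ _ Fg hol deriv_le Re_ge Im_le])
    show "deriv g x \<ge> 0" if "x > 0" for x using sgn[OF order_refl that] by simp
    show "deriv g y \<le> deriv g x" if "0 < x" "x \<le> y" for x y
    proof (rule DERIV_nonpos_imp_nonincreasing[OF that(2)])
      fix u assume "x \<le> u" "u \<le> y"
      then have u: "u > 0" using that by simp
      have "deriv (deriv g) u \<le> 0" using sgn[OF one_le_numeral[of "num.Bit0 num.One"] u] by (simp add: numeral_2_eq_2)
      then show "\<exists>d. (deriv g has_real_derivative d) (at u) \<and> d \<le> 0" using g2[OF u] by blast
    qed
  qed
qed

section \<open>Arguments of real powers, and symbols through their logarithms\<close>

lemma polar_form: "z \<noteq> 0 \<Longrightarrow> of_real (cmod z) * cis (Arg z) = z"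
  using rcis_cmod_Arg[of z] by (simp add: rcis_def)

lemma powr_polar:
  assumes "z \<noteq> 0"
  shows "z powr of_real \<gamma> = of_real (cmod z powr \<gamma>) * cis (\<gamma> * Arg z)"
proof -
  have "Ln z = of_real (ln (cmod z)) + \<i> * of_real (Arg z)"
    using assms by (intro complex_eqI) (auto simp: Arg_eq_Im_Ln)
  then have "z powr of_real \<gamma> = exp (of_real (\<gamma> * ln (cmod z)) + \<i> * of_real (\<gamma> * Arg z))"
    using assms by (simp add: powr_def algebra_simps)
  also have "\<dots> = of_real (exp (\<gamma> * ln (cmod z))) * cis (\<gamma> * Arg z)"
    by (simp only: exp_add exp_of_real cis_conv_exp)
  finally show ?thesis using assms by (simp add: powr_def)
qed

lemma Arg_polar:
  assumes "r > 0" "\<bar>v\<bar> < pi"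
  shows "Arg (of_real r * cis v) = v" "cmod (of_real r * cis v) = r"
  using assms Arg_cis[of v] by (auto simp: norm_mult abs_less_iff)

lemma Arg_powr:
  assumes "z \<noteq> 0" "\<bar>\<gamma> * Arg z\<bar> < pi"
  shows "Arg (z powr of_real \<gamma>) = \<gamma> * Arg z"
  unfolding powr_polar[OF assms(1)] using assms by (intro Arg_polar) auto

text \<open>The hypothesis compares tangents: in the right half-plane |arg u| is arctan (|Im u| / Re
  u).\<close>

lemma abs_Arg_le:
  assumes "Re z > 0" "Re w > 0" "Re z * \<bar>Im w\<bar> \<le> \<bar>Im z\<bar> * Re w"
  shows "\<bar>Arg w\<bar> \<le> \<bar>Arg z\<bar>"
proof -
  have arg: "\<bar>Arg u\<bar> = arctan (\<bar>Im u\<bar> / Re u)" if u: "Re u > 0" for u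
  proof -
    have "\<bar>arctan x\<bar> = arctan \<bar>x\<bar>" for x by (cases "x \<ge> 0") (auto simp: arctan_minus)
    then show ?thesis using arg_conv_arctan[OF u] u by (simp add: abs_divide)
  qed
  show ?thesis
    unfolding arg[OF assms(1)] arg[OF assms(2)] arctan_le_iff using assms by (simp add: field_simps)
qed

text \<open>
  Logarithms \<open>L\<close> of symbols are easier to combine than the symbols: the properties that make \<open>exp \<circ> L\<close> a
  \<^locale>\<open>sectorial_symbol\<close> are preserved by nonnegative linear combinations of \<open>L\<close>.
\<close>

definition log_bounds :: "real \<Rightarrow> (complex \<Rightarrow> complex) \<Rightarrow> real \<Rightarrow> real \<Rightarrow> (real \<Rightarrow> real) \<Rightarrow> (real \<Rightarrow> real) \<Rightarrow> bool" where
  "log_bounds \<gamma> L w C q q' \<longleftrightarrow> 0 \<le> C \<and> (\<forall>t>0. (q has_real_derivative q' t) (at t) \<and> 0 \<le> q' t \<and>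
     q t \<le> C + \<gamma> * max 0 (ln t) \<and>
     (\<forall>v. \<bar>v\<bar> \<le> w \<longrightarrow> q t \<le> Re (L (of_real t * cis v)) \<and> Re (L (of_real t * cis v)) \<le> q t + C \<and>
        cmod (deriv L (of_real t * cis v)) \<le> C * q' t))"

definition log_symbol :: "real \<Rightarrow> real \<Rightarrow> (complex \<Rightarrow> complex) \<Rightarrow> bool" where
  "log_symbol \<theta> \<gamma> L \<longleftrightarrow> L holomorphic_on sector \<theta> \<and> (\<forall>z\<in>sector \<theta>. \<bar>Im (L z)\<bar> \<le> \<gamma> * \<bar>Arg z\<bar>) \<and>
     (\<forall>w. 0 < w \<and> w < \<theta> \<longrightarrow> (\<exists>C q q'. log_bounds \<gamma> L w C q q'))"

lemma log_boundsD:
  assumes "log_bounds \<gamma> L w C q q'"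
  shows "C \<ge> 0"
    "\<And>t. t > 0 \<Longrightarrow> (q has_real_derivative q' t) (at t)" "\<And>t. t > 0 \<Longrightarrow> 0 \<le> q' t"
    "\<And>t. t > 0 \<Longrightarrow> q t \<le> C + \<gamma> * max 0 (ln t)"
    "\<And>t v. t > 0 \<Longrightarrow> \<bar>v\<bar> \<le> w \<Longrightarrow> q t \<le> Re (L (of_real t * cis v))"
    "\<And>t v. t > 0 \<Longrightarrow> \<bar>v\<bar> \<le> w \<Longrightarrow> Re (L (of_real t * cis v)) \<le> q t + C"
    "\<And>t v. t > 0 \<Longrightarrow> \<bar>v\<bar> \<le> w \<Longrightarrow> cmod (deriv L (of_real t * cis v)) \<le> C * q' t"
  using assms unfolding log_bounds_def by blast+

lemma log_symbolE:
  assumes "log_symbol \<theta> \<gamma> L" "0 < w" "w < \<theta>"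
  obtains C q q' where "log_bounds \<gamma> L w C q q'"
  using assms unfolding log_symbol_def by blast

lemma log_symbolI:
  assumes "L holomorphic_on sector \<theta>" "\<And>z. z \<in> sector \<theta> \<Longrightarrow> \<bar>Im (L z)\<bar> \<le> \<gamma> * \<bar>Arg z\<bar>"
    and "\<And>w. 0 < w \<Longrightarrow> w < \<theta> \<Longrightarrow> \<exists>C q q'. log_bounds \<gamma> L w C q q'"
  shows "log_symbol \<theta> \<gamma> L"
  using assms unfolding log_symbol_def by blast

lemma log_symbol_zero: "log_symbol \<theta> 0 (\<lambda>_. 0)"
proof (rule log_symbolI)
  have "log_bounds 0 (\<lambda>_. 0) w 0 (\<lambda>_. 0) (\<lambda>_. 0)" for w by (simp add: log_bounds_def)
  then show "\<exists>C q q'. log_bounds 0 (\<lambda>_. 0) w C q q'" for w by blast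
qed auto

lemma log_symbol_mult:
  assumes L: "log_symbol \<theta> \<gamma> L" and b: "b \<ge> 0" and \<theta>: "0 < \<theta>" "\<theta> \<le> pi"
  shows "log_symbol \<theta> (b * \<gamma>) (\<lambda>z. of_real b * L z)"
proof (rule log_symbolI)
  have hol: "L holomorphic_on sector \<theta>" using L by (simp add: log_symbol_def)
  then show "(\<lambda>z. of_real b * L z) holomorphic_on sector \<theta>" by (intro holomorphic_intros)
  show "\<bar>Im (of_real b * L z)\<bar> \<le> b * \<gamma> * \<bar>Arg z\<bar>" if "z \<in> sector \<theta>" for z
  proof -
    have "b * \<bar>Im (L z)\<bar> \<le> b * (\<gamma> * \<bar>Arg z\<bar>)" using L that b by (intro mult_left_mono) (auto simp: log_symbol_def)
    then show ?thesis using b by (simp add: abs_mult mult.assoc)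
  qed
  fix w assume w: "0 < w" "w < \<theta>"
  obtain C q q' where bd: "log_bounds \<gamma> L w C q q'"
    by (rule log_symbolE[OF L w]) blast
  note C = log_boundsD[OF bd]
  \<comment> \<open>Scaling turns the additive constants into b C, while the factor in front of the
    scaled q' remains C; the sum covers both.\<close>
  have "log_bounds (b * \<gamma>) (\<lambda>z. of_real b * L z) w (C + b * C) (\<lambda>t. b * q t) (\<lambda>t. b * q' t)"
    unfolding log_bounds_def
  proof (intro conjI allI impI)
    show "0 \<le> C + b * C" using C b by simp
    fix t :: real assume t: "t > 0"
    show "((\<lambda>t. b * q t) has_real_derivative b * q' t) (at t)" by (intro DERIV_cmult C t)
    show "0 \<le> b * q' t" using C(3)[OF t] b by simp
    have "b * q t \<le> b * (C + \<gamma> * max 0 (ln t))" by (intro mult_left_mono C t b)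
    then show "b * q t \<le> C + b * C + b * \<gamma> * max 0 (ln t)" using C(1) by (simp add: distrib_left mult.assoc)
    fix v assume v: "\<bar>v\<bar> \<le> w"
    let ?z = "of_real t * cis v"
    have z: "?z \<in> sector \<theta>" using t v w \<theta> by (intro cis_in_sector) auto
    have "b * q t \<le> b * Re (L ?z)" by (intro mult_left_mono C t v b)
    then show "b * q t \<le> Re (of_real b * L ?z)" by simp
    have "b * Re (L ?z) \<le> b * (q t + C)" by (intro mult_left_mono C t v b)
    then show "Re (of_real b * L ?z) \<le> b * q t + (C + b * C)" using C(1) by (simp add: distrib_left)
    have "deriv (\<lambda>z. of_real b * L z) ?z = of_real b * deriv L ?z"
      by (rule DERIV_imp_deriv, rule DERIV_cmult, rule holomorphic_derivI[OF hol open_sector[OF \<theta>] z])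
    then have "cmod (deriv (\<lambda>z. of_real b * L z) ?z) = b * cmod (deriv L ?z)" using b by (simp add: norm_mult)
    also have "\<dots> \<le> b * (C * q' t)" by (intro mult_left_mono C t v b)
    also have "\<dots> \<le> (C + b * C) * (b * q' t)"
      using C(1) C(3)[OF t] b by (simp add: algebra_simps)
    finally show "cmod (deriv (\<lambda>z. of_real b * L z) ?z) \<le> (C + b * C) * (b * q' t)" .
  qed
  then show "\<exists>C q q'. log_bounds (b * \<gamma>) (\<lambda>z. of_real b * L z) w C q q'" by blast
qed

lemma log_symbol_add:
  assumes L: "log_symbol \<theta> \<gamma> L" and M: "log_symbol \<theta> \<delta> M" and \<theta>: "0 < \<theta>" "\<theta> \<le> pi"
  shows "log_symbol \<theta> (\<gamma> + \<delta>) (\<lambda>z. L z + M z)"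
proof (rule log_symbolI)
  have hol: "L holomorphic_on sector \<theta>" "M holomorphic_on sector \<theta>" using L M by (auto simp: log_symbol_def)
  then show "(\<lambda>z. L z + M z) holomorphic_on sector \<theta>" by (intro holomorphic_intros)
  show "\<bar>Im (L z + M z)\<bar> \<le> (\<gamma> + \<delta>) * \<bar>Arg z\<bar>" if "z \<in> sector \<theta>" for z
  proof -
    have "\<bar>Im (L z)\<bar> \<le> \<gamma> * \<bar>Arg z\<bar>" "\<bar>Im (M z)\<bar> \<le> \<delta> * \<bar>Arg z\<bar>" using L M that by (auto simp: log_symbol_def)
    then show ?thesis using abs_triangle_ineq[of "Im (L z)" "Im (M z)"] by (simp add: distrib_right)
  qed
  fix w assume w: "0 < w" "w < \<theta>"
  obtain C q q' where bd: "log_bounds \<gamma> L w C q q'"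
    by (rule log_symbolE[OF L w]) blast
  note C = log_boundsD[OF bd]
  obtain D r r' where bd: "log_bounds \<delta> M w D r r'"
    by (rule log_symbolE[OF M w]) blast
  note D = log_boundsD[OF bd]
  have "log_bounds (\<gamma> + \<delta>) (\<lambda>z. L z + M z) w (C + D) (\<lambda>t. q t + r t) (\<lambda>t. q' t + r' t)"
    unfolding log_bounds_def
  proof (intro conjI allI impI)
    show "0 \<le> C + D" using C D by simp
    fix t :: real assume t: "t > 0"
    show "((\<lambda>t. q t + r t) has_real_derivative q' t + r' t) (at t)" by (intro DERIV_add C D t)
    show "0 \<le> q' t + r' t" using C(3)[OF t] D(3)[OF t] by simp
    show "q t + r t \<le> C + D + (\<gamma> + \<delta>) * max 0 (ln t)" using C(4)[OF t] D(4)[OF t] by (simp add: distrib_right)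
    fix v assume v: "\<bar>v\<bar> \<le> w"
    let ?z = "of_real t * cis v"
    have z: "?z \<in> sector \<theta>" using t v w \<theta> by (intro cis_in_sector) auto
    show "q t + r t \<le> Re (L ?z + M ?z)" using C(5)[OF t v] D(5)[OF t v] by simp
    show "Re (L ?z + M ?z) \<le> q t + r t + (C + D)" using C(6)[OF t v] D(6)[OF t v] by simp
    have "deriv (\<lambda>z. L z + M z) ?z = deriv L ?z + deriv M ?z"
      by (rule DERIV_imp_deriv, rule DERIV_add) (rule holomorphic_derivI[OF _ open_sector[OF \<theta>] z], rule hol)+
    then have "cmod (deriv (\<lambda>z. L z + M z) ?z) \<le> C * q' t + D * r' t"
      using norm_triangle_ineq[of "deriv L ?z" "deriv M ?z"] C(7)[OF t v] D(7)[OF t v] by simp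
    also have "\<dots> \<le> (C + D) * (q' t + r' t)"
      using mult_nonneg_nonneg[OF C(1) D(3)[OF t]] mult_nonneg_nonneg[OF D(1) C(3)[OF t]] by (simp add: algebra_simps)
    finally show "cmod (deriv (\<lambda>z. L z + M z) ?z) \<le> (C + D) * (q' t + r' t)" .
  qed
  then show "\<exists>C q q'. log_bounds (\<gamma> + \<delta>) (\<lambda>z. L z + M z) w C q q'" by blast
qed

lemma log_symbol_sum:
  assumes "finite J" "\<And>j. j \<in> J \<Longrightarrow> log_symbol \<theta> (\<gamma> j) (L j)" "\<And>j. j \<in> J \<Longrightarrow> b j \<ge> 0" and \<theta>: "0 < \<theta>" "\<theta> \<le> pi"
  shows "log_symbol \<theta> (\<Sum>j\<in>J. b j * \<gamma> j) (\<lambda>z. \<Sum>j\<in>J. of_real (b j) * L j z)"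
  using assms(1-3)
proof (induction J)
  case empty
  show ?case using log_symbol_zero by simp
next
  case (insert j J)
  have "log_symbol \<theta> (b j * \<gamma> j) (\<lambda>z. of_real (b j) * L j z)" by (rule log_symbol_mult[OF _ _ \<theta>]) (use insert.prems in auto)
  moreover have "log_symbol \<theta> (\<Sum>j\<in>J. b j * \<gamma> j) (\<lambda>z. \<Sum>j\<in>J. of_real (b j) * L j z)" by (rule insert.IH) (use insert.prems in auto)
  ultimately show ?case using log_symbol_add[OF _ _ \<theta>] insert.hyps by simp
qed

text \<open>For |v| \<le> w the real part of p = z^\<gamma> is at least X(t) = cos (\<gamma> w)
  t^\<gamma>, so q(t) = ln g(X(t)) is a lower bound for ln |\<phi>(p)|. As g' decreases,
  |\<phi>'(p)| \<le> g'(Re p) \<le> g'(X(t)), which bounds the logarithmic derivative by a multiple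
  of q'. Concavity shows that |\<phi>(p)| exceeds g(X(t)) by a bounded factor only.\<close>

lemma log_symbol_bernstein:
  assumes \<phi>: "bernstein_function \<phi>" and \<gamma>: "0 < \<gamma>" "\<gamma> * \<theta> \<le> pi / 2" and \<theta>: "0 < \<theta>" "\<theta> \<le> pi"
  shows "log_symbol \<theta> \<gamma> (\<lambda>z. Ln (\<phi> (z powr of_real \<gamma>)))"
    and "z \<in> sector \<theta> \<Longrightarrow> \<phi> (z powr of_real \<gamma>) \<noteq> 0"
proof -
  obtain g g' where g: "\<And>x. x > 0 \<Longrightarrow> g x > 0" "\<And>x. x > 0 \<Longrightarrow> (g has_real_derivative g' x) (at x)"
    "\<And>x. x > 0 \<Longrightarrow> g' x \<ge> 0" "\<And>x y. 0 < x \<Longrightarrow> x \<le> y \<Longrightarrow> g' y \<le> g' x"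
    and \<phi>g: "\<And>x. x > 0 \<Longrightarrow> \<phi> (of_real x) = of_real (g x)"
    and hol: "\<phi> holomorphic_on {z. Re z > 0}" and d\<phi>: "\<And>z. Re z > 0 \<Longrightarrow> cmod (deriv \<phi> z) \<le> g' (Re z)"
    and Re\<phi>: "\<And>z. Re z > 0 \<Longrightarrow> g (Re z) \<le> Re (\<phi> z)"
    and Im\<phi>: "\<And>z. Re z > 0 \<Longrightarrow> Re z * \<bar>Im (\<phi> z)\<bar> \<le> \<bar>Im z\<bar> * Re (\<phi> z)"
    by (rule bernstein_functionE[OF \<phi>]) blast
  have op: "open {z. Re z > 0}" by (rule open_halfspace_Re_gt)
  have Repos: "Re (\<phi> z) > 0" if "Re z > 0" for z using Re\<phi>[OF that] g(1)[OF that] by linarith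
  \<comment> \<open>Concavity: the slope of a chord lies between the derivatives at its
    ends.\<close>
  have mvt: "g y - g x \<le> (y - x) * g' x" "(y - x) * g' y \<le> g y - g x" if xy: "0 < x" "x < y" for x y
  proof -
    have "\<exists>z>x. z < y \<and> g y - g x = (y - x) * g' z" by (rule MVT2[OF xy(2)]) (use g(2) xy in auto)
    then obtain z where z: "x < z" "z < y" "g y - g x = (y - x) * g' z" by blast
    have "g' z \<le> g' x" "g' y \<le> g' z" using g(4) xy z by auto
    then show "g y - g x \<le> (y - x) * g' x" "(y - x) * g' y \<le> g y - g x"
      unfolding z(3) using xy by (auto intro!: mult_left_mono)
  qed
  have mono: "g x \<le> g y" if "0 < x" "x \<le> y" for x y
  proof (cases "x = y")
    case False
    then have "0 \<le> (y - x) * g' y" using g(3)[of y] that by simp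
    with mvt(2)[of x y] that False show ?thesis by simp
  qed simp
  \<comment> \<open>From the chord over [x/2, x]: (x/2) g'(x) \<le> g(x) - g(x/2) \<le>
    g(x).\<close>
  have slope: "x * g' x \<le> 2 * g x" if "x > 0" for x
    using mvt(2)[of "x / 2" x] g(1)[of "x / 2"] that by simp
  have linear: "g x \<le> 3 * g 1 * max 1 x" if "x > 0" for x
  proof (cases "x \<le> 1")
    case True
    then show ?thesis using mono[of x 1] g(1)[of 1] that by simp
  next
    case False
    then have "g x \<le> g 1 + (x - 1) * g' 1" using mvt(1)[of 1 x] by simp
    also have "(x - 1) * g' 1 \<le> x * (2 * g 1)" using slope[of 1] g(3)[of 1] False by (intro mult_mono) auto
    also have "g 1 + x * (2 * g 1) \<le> 3 * g 1 * x" using g(1)[of 1] False by (simp add: algebra_simps)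
    finally show ?thesis using False by simp
  qed
  define P where "P z = z powr of_real \<gamma>" for z :: complex
  have P: "P z = of_real (cmod z powr \<gamma>) * cis (\<gamma> * Arg z)" "z \<noteq> 0" "\<gamma> * \<bar>Arg z\<bar> < pi / 2" "Re (P z) > 0" "\<bar>Arg (P z)\<bar> = \<gamma> * \<bar>Arg z\<bar>"
    "z \<notin> \<real>\<^sub>\<le>\<^sub>0" if z: "z \<in> sector \<theta>" for z
  proof -
    show z0: "z \<noteq> 0" using z \<theta> by (auto simp: sector_def)
    have A: "\<bar>Arg z\<bar> < \<theta>" using z \<theta> by (auto simp: sector_def)
    have "\<gamma> * \<bar>Arg z\<bar> < \<gamma> * \<theta>" using A \<gamma> by simp
    then show lt: "\<gamma> * \<bar>Arg z\<bar> < pi / 2" using \<gamma> by linarith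
    then have lt': "\<bar>\<gamma> * Arg z\<bar> < pi / 2" using \<gamma> by (simp add: abs_mult)
    show p: "P z = of_real (cmod z powr \<gamma>) * cis (\<gamma> * Arg z)" unfolding P_def by (rule powr_polar[OF z0])
    have "cos (\<gamma> * Arg z) > 0" using lt' by (intro cos_gt_zero_pi) auto
    then show "Re (P z) > 0" unfolding p using z0 by simp
    have "\<bar>\<gamma> * Arg z\<bar> < pi" using lt' pi_gt_zero by linarith
    then show "\<bar>Arg (P z)\<bar> = \<gamma> * \<bar>Arg z\<bar>" unfolding P_def using Arg_powr[OF z0, of \<gamma>] \<gamma> by (simp add: abs_mult)
    show "z \<notin> \<real>\<^sub>\<le>\<^sub>0"
    proof
      assume "z \<in> \<real>\<^sub>\<le>\<^sub>0"
      then have "Arg z = pi" using z0 by (auto simp: complex_nonpos_Reals_iff Arg_eq_pi complex_eq_iff)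
      then show False using A \<theta> by simp
    qed
  qed
  show nz: "\<phi> (z powr of_real \<gamma>) \<noteq> 0" if "z \<in> sector \<theta>" for z
    using Repos[OF P(4)[OF that]] unfolding P_def by auto
  define L where "L z = Ln (\<phi> (P z))" for z
  have dL: "(L has_field_derivative inverse (\<phi> (P z)) * (deriv \<phi> (P z) * (of_real \<gamma> * z powr (of_real \<gamma> - 1)))) (at z)" if z: "z \<in> sector \<theta>" for z
    unfolding L_def
  proof (rule DERIV_chain2[OF has_field_derivative_Ln DERIV_chain2[OF holomorphic_derivI[OF hol op]]])
    show "\<phi> (P z) \<notin> \<real>\<^sub>\<le>\<^sub>0" using Repos[OF P(4)[OF z]] by (auto simp: complex_nonpos_Reals_iff)
    show "P z \<in> {z. Re z > 0}" using P(4)[OF z] by simp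
    show "(P has_field_derivative of_real \<gamma> * z powr (of_real \<gamma> - 1)) (at z)"
      unfolding P_def by (rule has_field_derivative_powr[OF P(6)[OF z]])
  qed
  have "log_symbol \<theta> \<gamma> L"
  proof (rule log_symbolI)
    show "L holomorphic_on sector \<theta>" unfolding holomorphic_on_open[OF open_sector[OF \<theta>]] using dL by blast
    show "\<bar>Im (L z)\<bar> \<le> \<gamma> * \<bar>Arg z\<bar>" if z: "z \<in> sector \<theta>" for z
    proof -
      have "\<phi> (P z) \<noteq> 0" using nz[OF z] by (simp add: P_def)
      then have "\<bar>Im (L z)\<bar> = \<bar>Arg (\<phi> (P z))\<bar>" by (simp add: L_def Arg_eq_Im_Ln)
      also have "\<dots> \<le> \<bar>Arg (P z)\<bar>" by (rule abs_Arg_le[OF P(4)[OF z] Repos[OF P(4)[OF z]] Im\<phi>[OF P(4)[OF z]]])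
      finally show ?thesis unfolding P(5)[OF z] .
    qed
    fix w assume w: "0 < w" "w < \<theta>"
    define \<kappa> where "\<kappa> = cos (\<gamma> * w)"
    have "\<gamma> * w < \<gamma> * \<theta>" using w \<gamma> by simp
    then have gw: "0 < \<gamma> * w" "\<gamma> * w < pi / 2" using w \<gamma> by (simp, linarith)
    have \<kappa>: "0 < \<kappa>" "\<kappa> \<le> 1" unfolding \<kappa>_def using gw by (auto intro!: cos_gt_zero_pi)
    \<comment> \<open>The factor lost in passing from p to Re p, and once more from Re p to X(t);
      hence \<open>B * B\<close> in the constant \<open>C\<close>.\<close>
    define B where "B = 1 + 2 / \<kappa>"
    have B: "B \<ge> 1" unfolding B_def using \<kappa> by simp
    define X where "X t = \<kappa> * t powr \<gamma>" for t
    have X: "X t > 0" if "t > 0" for t unfolding X_def using \<kappa> that by simp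
    have dX: "(X has_real_derivative \<kappa> * (\<gamma> * t powr (\<gamma> - 1))) (at t)" if "t > 0" for t
      unfolding X_def using has_real_derivative_powr[OF that, of \<gamma>] by (rule DERIV_cmult)
    define q where "q t = ln (g (X t))" for t
    define q' where "q' t = inverse (g (X t)) * (g' (X t) * (\<kappa> * (\<gamma> * t powr (\<gamma> - 1))))" for t
    have polar: "P (of_real t * cis v) = of_real (t powr \<gamma>) * cis (\<gamma> * v)" "X t \<le> Re (P (of_real t * cis v))"
      "\<kappa> * cmod (P (of_real t * cis v)) = X t" "of_real t * cis v \<in> sector \<theta>" "Re (P (of_real t * cis v)) \<le> cmod (P (of_real t * cis v))"
      if t: "t > 0" and v: "\<bar>v\<bar> \<le> w" for t v
    proof -
      show z: "of_real t * cis v \<in> sector \<theta>" using t v w \<theta> by (intro cis_in_sector) auto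
      have "\<bar>v\<bar> < pi" using v w \<theta> by linarith
      then show p: "P (of_real t * cis v) = of_real (t powr \<gamma>) * cis (\<gamma> * v)"
        unfolding P(1)[OF z] by (simp only: Arg_polar[OF t])
      have "\<gamma> * \<bar>v\<bar> \<le> \<gamma> * w" using v \<gamma> by simp
      then have "cos (\<gamma> * w) \<le> cos \<bar>\<gamma> * v\<bar>" using gw \<gamma> by (intro cos_monotone_0_pi_le) (auto simp: abs_mult)
      then have "\<kappa> \<le> cos (\<gamma> * v)" unfolding \<kappa>_def by simp
      then show "X t \<le> Re (P (of_real t * cis v))" unfolding p X_def using t by (simp add: mult.commute mult_left_mono)
      show "\<kappa> * cmod (P (of_real t * cis v)) = X t" unfolding p X_def using t by (simp add: norm_mult)
      show "Re (P (of_real t * cis v)) \<le> cmod (P (of_real t * cis v))" by (rule complex_Re_le_cmod)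
    qed
    define C where "C = ln (B * B) + \<bar>ln (3 * g 1)\<bar> + 1 / \<kappa>"
    have BB: "ln (B * B) \<ge> 0" using B mult_mono[OF B B] by (intro ln_ge_zero) auto
    have "log_bounds \<gamma> L w C q q'"
      unfolding log_bounds_def
    proof (intro conjI allI impI)
      show "C \<ge> 0" unfolding C_def using BB \<kappa> by simp
      fix t :: real assume t: "t > 0"
      note Xt = X[OF t] and gX = g(1)[OF X[OF t]]
      show "(q has_real_derivative q' t) (at t)"
        unfolding q_def q'_def
        by (rule DERIV_chain2[where f = ln and g = "\<lambda>t. g (X t)", OF DERIV_ln[OF gX] DERIV_chain2[where f = g and g = X, OF g(2)[OF Xt] dX[OF t]]])
      show q'0: "0 \<le> q' t" unfolding q'_def using gX g(3)[OF Xt] \<kappa> \<gamma> by (intro mult_nonneg_nonneg) auto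
      show "q t \<le> C + \<gamma> * max 0 (ln t)"
      proof -
        have "X t \<le> t powr \<gamma>" unfolding X_def using \<kappa> t by (simp add: mult_left_le_one_le)
        also have tp: "t powr \<gamma> \<le> exp (\<gamma> * max 0 (ln t))" using t \<gamma> by (simp add: powr_def mult_left_mono)
        finally have "max 1 (X t) \<le> exp (\<gamma> * max 0 (ln t))" using \<gamma> by simp
        then have "g (X t) \<le> 3 * g 1 * exp (\<gamma> * max 0 (ln t))"
          using linear[OF Xt] mult_left_mono[of "max 1 (X t)" "exp (\<gamma> * max 0 (ln t))" "3 * g 1"] g(1)[of 1] by linarith
        then have "q t \<le> ln (3 * g 1 * exp (\<gamma> * max 0 (ln t)))" unfolding q_def using gX g(1)[of 1] by (intro ln_mono) auto
        also have "\<dots> = ln (3 * g 1) + \<gamma> * max 0 (ln t)" using g(1)[of 1] by (subst ln_mult) auto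
        also have "\<dots> \<le> C + \<gamma> * max 0 (ln t)" unfolding C_def using BB \<kappa> by (simp add: add_increasing add_increasing2)
        finally show ?thesis .
      qed
      fix v assume v: "\<bar>v\<bar> \<le> w"
      let ?z = "of_real t * cis v"
      define p where "p = P ?z"
      note pol = polar(2,3,5)[OF t v, folded p_def] and z = polar(4)[OF t v]
      have p0: "Re p > 0" using pol Xt by linarith
      have \<phi>ge: "g (X t) \<le> cmod (\<phi> p)" using mono[OF Xt pol(1)] Re\<phi>[OF p0] complex_Re_le_cmod[of "\<phi> p"] by linarith
      then have \<phi>0: "\<phi> p \<noteq> 0" using gX by auto
      have ReL: "Re (L ?z) = ln (cmod (\<phi> p))" unfolding L_def p_def[symmetric] using \<phi>0 by simp
      show "q t \<le> Re (L ?z)" unfolding ReL q_def using \<phi>ge gX by (intro ln_mono) auto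
      show "Re (L ?z) \<le> q t + C"
      proof -
        \<comment> \<open>On the vertical segment from Re p to p the derivative is at most g'(Re p),
          and the segment has length at most Re p / \<kappa>, so \<open>slope\<close> turns the
          increment into a multiple of g(Re p).\<close>
        have "cmod (\<phi> p - \<phi> (of_real (Re p))) \<le> g' (Re p) * cmod (p - of_real (Re p))"
        proof (rule field_differentiable_bound[where S = "{u. Re u = Re p}" and f' = "deriv \<phi>"])
          show "convex {u. Re u = Re p}" by (auto simp: convex_def distrib_right[symmetric])
          fix u assume "u \<in> {u. Re u = Re p}"
          then have u: "Re u = Re p" "Re u > 0" using p0 by auto
          show "(\<phi> has_field_derivative deriv \<phi> u) (at u within {u. Re u = Re p})"
            by (rule has_field_derivative_at_within, rule holomorphic_derivI[OF hol op]) (use u in simp)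
          show "cmod (deriv \<phi> u) \<le> g' (Re p)" using d\<phi>[OF u(2)] u(1) by simp
        qed auto
        also have "p - of_real (Re p) = \<i> * of_real (Im p)" by (simp add: complex_eq_iff)
        also have "g' (Re p) * cmod (\<i> * of_real (Im p)) \<le> g' (Re p) * (Re p / \<kappa>)"
        proof (rule mult_left_mono[OF _ g(3)[OF p0]])
          have "\<kappa> * \<bar>Im p\<bar> \<le> \<kappa> * cmod p" using abs_Im_le_cmod \<kappa> by (intro mult_left_mono) auto
          then show "cmod (\<i> * of_real (Im p)) \<le> Re p / \<kappa>" using pol \<kappa> by (simp add: norm_mult pos_le_divide_eq mult.commute)
        qed
        also have "\<dots> = (Re p * g' (Re p)) / \<kappa>" by simp
        also have "\<dots> \<le> 2 * g (Re p) / \<kappa>" using slope[OF p0] \<kappa> by (intro divide_right_mono) auto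
        finally have "cmod (\<phi> p) \<le> cmod (\<phi> (of_real (Re p))) + 2 * g (Re p) / \<kappa>"
          using norm_triangle_ineq2[of "\<phi> p" "\<phi> (of_real (Re p))"] by linarith
        also have "\<dots> = g (Re p) + 2 * g (Re p) / \<kappa>" unfolding \<phi>g[OF p0] using g(1)[OF p0] by simp
        also have "\<dots> = B * g (Re p)" unfolding B_def by (simp add: algebra_simps)
        finally have 1: "cmod (\<phi> p) \<le> B * g (Re p)" .
        have 2: "g (Re p) \<le> B * g (X t)"
        proof (cases "X t = Re p")
          case True
          then show ?thesis using B g(1)[OF p0] by simp
        next
          case False
          then have "g (Re p) - g (X t) \<le> (Re p - X t) * g' (X t)" using mvt(1)[OF Xt] pol by simp
          also have "\<dots> \<le> (X t / \<kappa>) * g' (X t)"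
          proof (rule mult_right_mono[OF _ g(3)[OF Xt]])
            have "X t / \<kappa> = cmod p" unfolding pol(2)[symmetric] using \<kappa> by simp
            then have "Re p \<le> X t / \<kappa>" using pol(3) by linarith
            then show "Re p - X t \<le> X t / \<kappa>" using Xt by linarith
          qed
          also have "\<dots> = (X t * g' (X t)) / \<kappa>" by simp
          also have "\<dots> \<le> 2 * g (X t) / \<kappa>" using slope[OF Xt] \<kappa> by (intro divide_right_mono) auto
          finally show ?thesis unfolding B_def by (simp add: algebra_simps)
        qed
        have "cmod (\<phi> p) \<le> B * (B * g (X t))" using 1 mult_left_mono[OF 2, of B] B by linarith
        then have "ln (cmod (\<phi> p)) \<le> ln ((B * B) * g (X t))" using \<phi>0 by (intro ln_mono) (auto simp: mult.assoc)
        also have "\<dots> = ln (B * B) + q t" unfolding q_def using B gX by (subst ln_mult) auto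
        also have "\<dots> \<le> q t + C" unfolding C_def using \<kappa> by simp
        finally show ?thesis unfolding ReL .
      qed
      have "complex_of_real \<gamma> - 1 = of_real (\<gamma> - 1)" by simp
      then have np: "cmod (?z powr (of_real \<gamma> - 1)) = t powr (\<gamma> - 1)"
        using t by (simp only: norm_powr_real_powr'[OF Reals_of_real]) (simp add: norm_mult)
      have "cmod (deriv L ?z) = inverse (cmod (\<phi> p)) * (cmod (deriv \<phi> p) * (\<gamma> * t powr (\<gamma> - 1)))"
        unfolding DERIV_imp_deriv[OF dL[OF z]] p_def[symmetric] norm_mult norm_inverse np using \<gamma> by simp
      also have "\<dots> \<le> inverse (g (X t)) * (g' (X t) * (\<gamma> * t powr (\<gamma> - 1)))"
      proof (intro mult_mono)
        show "inverse (cmod (\<phi> p)) \<le> inverse (g (X t))" by (rule le_imp_inverse_le[OF \<phi>ge gX])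
        show "cmod (deriv \<phi> p) \<le> g' (X t)" using d\<phi>[OF p0] g(4)[OF Xt pol(1)] by linarith
      qed (use gX g(3)[OF Xt] \<gamma> in auto)
      also have "\<dots> = 1 / \<kappa> * q' t" unfolding q'_def using \<kappa> by simp
      also have "\<dots> \<le> C * q' t" unfolding C_def using BB q'0 by (intro mult_right_mono) auto
      finally show "cmod (deriv L ?z) \<le> C * q' t" .
    qed
    then show "\<exists>C q q'. log_bounds \<gamma> L w C q q'" by blast
  qed
  then show "log_symbol \<theta> \<gamma> (\<lambda>z. Ln (\<phi> (z powr of_real \<gamma>)))" unfolding L_def P_def .
qed

section \<open>From logarithms of symbols to generators\<close>

lemma (in sectorial_operator) log_symbol_generates:
  assumes a: "0 < a" "a \<le> 1" "a * \<theta> = pi / 2" and \<theta>: "\<omega> < \<theta>" "\<theta> < pi"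
    and L: "log_symbol \<theta> \<gamma> L" "\<gamma> \<le> a" and f: "\<And>z. z \<in> sector \<theta> \<Longrightarrow> f z = exp (L z)"
  shows "generates_sectorially_bounded_holomorphic_semigroup (pi / 2 - a * \<omega>) (affine_op 0 (- 1) (hol_calculus \<omega> \<theta> f A))"
proof -
  have \<theta>0: "0 < \<theta>" "\<theta> \<le> pi" using \<theta> angle by auto
  have holL: "L holomorphic_on sector \<theta>" and ImL: "\<And>z. z \<in> sector \<theta> \<Longrightarrow> \<bar>Im (L z)\<bar> \<le> \<gamma> * \<bar>Arg z\<bar>"
    using L by (auto simp: log_symbol_def)
  have cf: "cmod (f z) = exp (Re (L z))" if "z \<in> sector \<theta>" for z using f[OF that] by simp
  have df: "deriv f z = exp (L z) * deriv L z" if z: "z \<in> sector \<theta>" for z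
  proof (rule DERIV_imp_deriv, rule has_field_derivative_transform_within_open[OF _ open_sector[OF \<theta>0] z])
    show "((\<lambda>z. exp (L z)) has_field_derivative exp (L z) * deriv L z) (at z)"
      by (rule DERIV_chain2[OF DERIV_exp holomorphic_derivI[OF holL open_sector[OF \<theta>0] z]])
  qed (simp add: f)
  have "sectorial_symbol A \<omega> f a \<theta>"
  proof unfold_locales
    show "0 < a" "a * \<theta> = pi / 2" "\<omega> < \<theta>" "\<theta> < pi" by (rule a \<theta>)+
    have "(\<lambda>z. exp (L z)) holomorphic_on sector \<theta>" using holL by (intro holomorphic_intros)
    then show "f holomorphic_on sector \<theta>" by (rule holomorphic_transform) (simp add: f)
  next
    fix \<theta>' assume \<theta>': "0 < \<theta>'" "\<theta>' < \<theta>"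
    obtain C q q' where bd: "log_bounds \<gamma> L \<theta>' C q q'"
      by (rule log_symbolE[OF L(1) \<theta>']) blast
    note C = log_boundsD[OF bd]
    show "\<exists>C. \<forall>z\<in>sector \<theta>'. cmod (f z) \<le> C * max (cmod z powr 1) (cmod z powr - 1)"
    proof (intro exI ballI)
      fix z assume z: "z \<in> sector \<theta>'"
      then have z0: "z \<noteq> 0" "\<bar>Arg z\<bar> \<le> \<theta>'" using \<theta>' by (auto simp: sector_def)
      define t where "t = cmod z"
      have t: "t > 0" using z0 by (simp add: t_def)
      have zz: "of_real t * cis (Arg z) = z" unfolding t_def by (rule polar_form[OF z0(1)])
      have "z \<in> sector \<theta>" using z sector_mono[OF \<theta>'(1), of \<theta>] \<theta>' by auto
      then have "cmod (f z) = exp (Re (L z))" by (rule cf)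
      \<comment> \<open>The bounds Re L \<le> q + C and q \<le> C + \<gamma> max 0 (ln t) give the
        constant 2 C, and \<gamma> \<le> a \<le> 1 makes the growth at infinity of order 1.\<close>
      also have "\<dots> \<le> exp (2 * C + max 0 (ln t))"
      proof -
        have "\<gamma> * max 0 (ln t) \<le> 1 * max 0 (ln t)" using L(2) a by (intro mult_right_mono) auto
        then show ?thesis using C(6)[OF t z0(2), unfolded zz] C(4)[OF t] by simp
      qed
      also have "\<dots> = exp (2 * C) * exp (max 0 (ln t))" by (rule exp_add)
      also have "exp (max 0 (ln t)) \<le> max (t powr 1) (t powr - 1)"
      proof (cases "t \<ge> 1")
        case True
        then show ?thesis using t by (simp add: le_max_iff_disj)
      next
        case False
        then have "exp (max 0 (ln t)) = 1" using t by (simp add: max_def)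
        also have "1 \<le> t powr - 1" using powr_mono'[of "- 1" 0 t] False t by simp
        finally show ?thesis by (simp add: le_max_iff_disj)
      qed
      finally show "cmod (f z) \<le> exp (2 * C) * max (cmod z powr 1) (cmod z powr - 1)" by (simp add: t_def)
    qed
  next
    fix w \<psi> z \<zeta>
    assume w: "0 \<le> w" "0 \<le> \<psi>" "a * w + \<psi> < pi / 2" and z: "z \<in> sector \<theta>" "\<bar>Arg z\<bar> \<le> w" and \<zeta>: "\<bar>Arg \<zeta>\<bar> \<le> \<psi>"
    show "cos (a * w + \<psi>) * (cmod \<zeta> * cmod (f z)) \<le> Re (\<zeta> * f z)"
    proof (cases "\<zeta> = 0")
      case False
      have "\<bar>Im (L z)\<bar> \<le> \<gamma> * \<bar>Arg z\<bar>" by (rule ImL[OF z(1)])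
      also have "\<dots> \<le> a * w" using z(2) L(2) a by (intro mult_mono) auto
      finally have "\<bar>Arg \<zeta> + Im (L z)\<bar> \<le> a * w + \<psi>" using \<zeta> by linarith
      then have "cos (a * w + \<psi>) \<le> cos \<bar>Arg \<zeta> + Im (L z)\<bar>" using w by (intro cos_monotone_0_pi_le) auto
      then have "cos (a * w + \<psi>) * (cmod \<zeta> * cmod (f z)) \<le> cos (Arg \<zeta> + Im (L z)) * (cmod \<zeta> * cmod (f z))"
        by (intro mult_right_mono) auto
      also have "\<dots> = Re (\<zeta> * f z)"
      proof -
        have "f z = of_real (exp (Re (L z))) * cis (Im (L z))" unfolding f[OF z(1)] by (simp add: exp_eq_polar)
        then have "\<zeta> * f z = of_real (cmod \<zeta> * exp (Re (L z))) * (cis (Arg \<zeta>) * cis (Im (L z)))"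
          by (subst polar_form[OF False, symmetric]) (simp add: mult_ac)
        then show ?thesis unfolding cf[OF z(1)] cis_mult by simp
      qed
      finally show ?thesis .
    qed simp
  next
    fix w assume w: "0 < w" "w < \<theta>"
    obtain C q q' where bd: "log_bounds \<gamma> L w C q q'"
      by (rule log_symbolE[OF L(1) w]) blast
    note C = log_boundsD[OF bd]
    show "\<exists>C>0. \<exists>p p'. \<forall>t>0. (p has_real_derivative p' t) (at t) \<and> 0 \<le> p t \<and>
       (\<forall>v. \<bar>v\<bar> \<le> w \<longrightarrow> p t \<le> cmod (f (of_real t * cis v)) \<and> cmod (deriv f (of_real t * cis v)) \<le> C * p' t)"
    \<comment> \<open>Here p = exp q. As |f'| = |f| |L'|, the factor exp C comes from |f| \<le> exp
      (q + C) and the factor C from |L'| \<le> C q'; the summand 1 makes the constant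
      positive.\<close>
    proof (rule exI[of _ "exp C * C + 1"], rule conjI[rotated], rule exI[of _ "\<lambda>t. exp (q t)"], rule exI[of _ "\<lambda>t. exp (q t) * q' t"], intro conjI allI impI)
      show "0 < exp C * C + 1" using C(1) by (simp add: add_nonneg_pos)
    next
      fix t :: real assume t: "t > 0"
      show "((\<lambda>t. exp (q t)) has_real_derivative exp (q t) * q' t) (at t)"
        by (rule DERIV_chain2[where f = exp and g = q, OF DERIV_exp C(2)[OF t]])
      show "0 \<le> exp (q t)" by simp
      fix v assume v: "\<bar>v\<bar> \<le> w"
      let ?z = "of_real t * cis v"
      have z: "?z \<in> sector \<theta>" using t v w \<theta>0 by (intro cis_in_sector) auto
      show "exp (q t) \<le> cmod (f ?z)" unfolding cf[OF z] using C(5)[OF t v] by simp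
      have "cmod (deriv f ?z) = exp (Re (L ?z)) * cmod (deriv L ?z)" unfolding df[OF z] by (simp add: norm_mult)
      also have "\<dots> \<le> exp (q t + C) * (C * q' t)" using C(6)[OF t v] by (intro mult_mono C(7) t v) auto
      also have "\<dots> = exp C * C * (exp (q t) * q' t)" by (simp add: exp_add mult_ac)
      also have "\<dots> \<le> (exp C * C + 1) * (exp (q t) * q' t)" using C(3)[OF t] by (intro mult_right_mono) auto
      finally show "cmod (deriv f ?z) \<le> (exp C * C + 1) * (exp (q t) * q' t)" .
    qed
  qed
  then show ?thesis by (rule sectorial_symbol.generates_semigroup)
qed

text \<open>Both parts of the theorem are instances, the first with a = 1. On the sector |a Arg z| <
  pi/2, so the principal power of z^a with exponent \<alpha>_j is that of z with exponent a
  \<alpha>_j. The angle constants of the factors then add up to a times the sum of the \<alpha>_j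
  \<beta>_j, which is at most a.\<close>

lemma bernstein_product_generates:
  fixes n :: nat and \<alpha> \<beta> :: "nat \<Rightarrow> real" and F f :: "complex \<Rightarrow> complex"
  assumes Fs: "\<And>j. j \<in> {1..n} \<Longrightarrow> bernstein_function (Fs j)"
    and \<alpha>: "\<And>j. j \<in> {1..n} \<Longrightarrow> 0 < \<alpha> j \<and> \<alpha> j \<le> 1"
    and \<beta>: "\<And>j. j \<in> {1..n} \<Longrightarrow> 0 < \<beta> j \<and> \<beta> j \<le> 1"
    and sum: "(\<Sum>j = 1..n. \<alpha> j * \<beta> j) \<le> 1"
    and F: "\<And>z. 0 < Re z \<Longrightarrow> F z = (\<Prod>j = 1..n. Fs j (z powr of_real (\<alpha> j)) powr of_real (\<beta> j))"
    and A: "sectorial \<omega> A" "closure (Range A) = UNIV"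
    and a: "1 / 2 < a" "a \<le> 1" and \<omega>: "\<omega> < pi / (2 * a)"
    and f: "\<And>z. z \<in> sector (pi / (2 * a)) \<Longrightarrow> f z = F (z powr of_real a)"
  shows "generates_sectorially_bounded_holomorphic_semigroup (pi / 2 - a * \<omega>)
    (affine_op 0 (- 1) (hol_calculus \<omega> (pi / (2 * a)) f A))"
proof -
  interpret sectorial_operator A \<omega> by unfold_locales (rule A)+
  define \<theta> where "\<theta> = pi / (2 * a)"
  have \<theta>: "0 < \<theta>" "\<theta> < pi" "a * \<theta> = pi / 2" unfolding \<theta>_def using a by (simp_all add: pos_divide_less_eq)
  then have \<theta>_le: "\<theta> \<le> pi" by simp
  have le: "a * \<alpha> j * \<theta> \<le> pi / 2" "0 < a * \<alpha> j" if j: "j \<in> {1..n}" for j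
  proof -
    have "a * \<alpha> j * \<theta> = \<alpha> j * (a * \<theta>)" by simp
    also have "\<dots> \<le> 1 * (a * \<theta>)" using \<alpha>[OF j] \<theta> by (intro mult_right_mono) auto
    finally show "a * \<alpha> j * \<theta> \<le> pi / 2" unfolding \<theta>(3) by (simp only: mult_1)
    show "0 < a * \<alpha> j" using a \<alpha>[OF j] by simp
  qed
  define L where "L z = (\<Sum>j = 1..n. of_real (\<beta> j) * Ln (Fs j (z powr of_real (a * \<alpha> j))))" for z
  have "log_symbol \<theta> (\<Sum>j = 1..n. \<beta> j * (a * \<alpha> j)) L"
    unfolding L_def
  proof (rule log_symbol_sum[OF _ _ _ \<theta>(1) \<theta>_le])
    show "log_symbol \<theta> (a * \<alpha> j) (\<lambda>z. Ln (Fs j (z powr of_real (a * \<alpha> j))))" if "j \<in> {1..n}" for j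
      by (rule log_symbol_bernstein(1)[OF Fs[OF that] le(2,1)[OF that] \<theta>(1) \<theta>_le])
    show "0 \<le> \<beta> j" if "j \<in> {1..n}" for j using \<beta>[OF that] by simp
  qed simp
  moreover have "(\<Sum>j = 1..n. \<beta> j * (a * \<alpha> j)) \<le> a"
  proof -
    have "(\<Sum>j = 1..n. \<beta> j * (a * \<alpha> j)) = a * (\<Sum>j = 1..n. \<alpha> j * \<beta> j)" by (simp add: sum_distrib_left mult_ac)
    also have "\<dots> \<le> a * 1" using sum a by (intro mult_left_mono) auto
    finally show ?thesis by simp
  qed
  moreover have "f z = exp (L z)" if z: "z \<in> sector \<theta>" for z
  proof -
    have z0: "z \<noteq> 0" "\<bar>Arg z\<bar> < \<theta>" using z \<theta> by (auto simp: sector_def)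
    have "a * \<bar>Arg z\<bar> < a * \<theta>" using z0 a by simp
    then have lt: "\<bar>a * Arg z\<bar> < pi / 2" using a unfolding \<theta>(3) by (simp add: abs_mult)
    let ?y = "z powr of_real a"
    have y: "?y \<noteq> 0" "cmod ?y = cmod z powr a" "Arg ?y = a * Arg z"
      using z0 Arg_powr[OF z0(1), of a] lt by (auto simp: norm_powr_real_powr')
    have "cos (a * Arg z) > 0" using lt by (intro cos_gt_zero_pi) auto
    then have Re: "0 < Re ?y" unfolding powr_polar[OF z0(1)] using z0 by simp
    have "?y powr of_real (\<alpha> j) = z powr of_real (a * \<alpha> j)" for j
    proof -
      have "?y powr of_real (\<alpha> j) = of_real ((cmod z powr a) powr \<alpha> j) * cis (\<alpha> j * (a * Arg z))"
        unfolding y(2,3)[symmetric] by (rule powr_polar[OF y(1)])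
      also have "\<dots> = z powr of_real (a * \<alpha> j)" unfolding powr_polar[OF z0(1)] by (simp add: powr_powr mult_ac)
      finally show ?thesis .
    qed
    then have "f z = (\<Prod>j = 1..n. Fs j (z powr of_real (a * \<alpha> j)) powr of_real (\<beta> j))"
      using f[folded \<theta>_def, OF z] F[OF Re] by simp
    also have "\<dots> = (\<Prod>j = 1..n. exp (of_real (\<beta> j) * Ln (Fs j (z powr of_real (a * \<alpha> j)))))"
    proof (rule prod.cong[OF refl])
      fix j assume j: "j \<in> {1..n}"
      show "Fs j (z powr of_real (a * \<alpha> j)) powr of_real (\<beta> j) = exp (of_real (\<beta> j) * Ln (Fs j (z powr of_real (a * \<alpha> j))))"
        using log_symbol_bernstein(2)[OF Fs[OF j] le(2,1)[OF j] \<theta>(1) \<theta>_le z] by (simp add: powr_def)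
    qed
    also have "\<dots> = exp (L z)" unfolding L_def by (simp add: exp_sum)
    finally show ?thesis .
  qed
  ultimately show ?thesis
    unfolding \<theta>_def[symmetric] using a \<theta> \<omega>[folded \<theta>_def] by (intro log_symbol_generates) auto
qed

theorem theorem1p2:
  fixes n :: nat
    and Fs :: "nat \<Rightarrow> complex \<Rightarrow> complex"
    and \<alpha> \<beta> :: "nat \<Rightarrow> real"
    and F :: "complex \<Rightarrow> complex"
    and A :: "('a :: complex_banach) rel"
    and \<omega> :: real
  assumes "1 \<le> n"
    and "\<And>j. j \<in> {1..n} \<Longrightarrow> bernstein_function (Fs j)"
    and "\<And>j. j \<in> {1..n} \<Longrightarrow> 0 < \<alpha> j \<and> \<alpha> j \<le> 1"
    and "\<And>j. j \<in> {1..n} \<Longrightarrow> 0 < \<beta> j \<and> \<beta> j \<le> 1"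
    and "(\<Sum>j = 1..n. \<alpha> j * \<beta> j) \<le> 1"
    and "\<And>z. 0 < Re z \<Longrightarrow>
           F z = (\<Prod>j = 1..n. Fs j (z powr of_real (\<alpha> j)) powr of_real (\<beta> j))"
    and "sectorial \<omega> A"
    and "closure (Range A) = UNIV"
  shows "(\<omega> < pi / 2 \<longrightarrow>
            generates_sectorially_bounded_holomorphic_semigroup (pi / 2 - \<omega>)
              (affine_op 0 (- 1) (hol_calculus \<omega> (pi / 2) F A))) \<and>
         (\<forall>a G. 1 / 2 < a \<and> a < 1 \<and> 0 < \<omega> \<and> \<omega> < pi / (2 * a) \<and>
            (\<forall>z \<in> sector (pi / (2 * a)). G z = F (z powr of_real a)) \<longrightarrow>
            generates_sectorially_bounded_holomorphic_semigroup (pi / 2 - a * \<omega>)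
              (affine_op 0 (- 1) (hol_calculus \<omega> (pi / (2 * a)) G A)))"
proof (intro conjI impI allI)
  assume "\<omega> < pi / 2"
  have "generates_sectorially_bounded_holomorphic_semigroup (pi / 2 - 1 * \<omega>)
      (affine_op 0 (- 1) (hol_calculus \<omega> (pi / (2 * 1)) F A))"
  proof (rule bernstein_product_generates[OF assms(2-8)])
    show "F z = F (z powr of_real 1)" if "z \<in> sector (pi / (2 * 1))" for z
      using that powr_to_1[of z] by (auto simp: sector_def split: if_splits)
  qed (use \<open>\<omega> < pi / 2\<close> in auto)
  then show "generates_sectorially_bounded_holomorphic_semigroup (pi / 2 - \<omega>)
      (affine_op 0 (- 1) (hol_calculus \<omega> (pi / 2) F A))" by simp
next
  fix a G
  assume "1 / 2 < a \<and> a < 1 \<and> 0 < \<omega> \<and> \<omega> < pi / (2 * a) \<and> (\<forall>z\<in>sector (pi / (2 * a)). G z = F (z powr of_real a))"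
  then show "generates_sectorially_bounded_holomorphic_semigroup (pi / 2 - a * \<omega>)
      (affine_op 0 (- 1) (hol_calculus \<omega> (pi / (2 * a)) G A))"
    by (intro bernstein_product_generates[OF assms(2-8)]) auto
qed

end
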